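(* Let $G$ be a finite group, $H\le Z(G)$, and $X$ a faithful central $H$-modular operator space. Then the subalgebra $\mathcal{G}^\ell$ of $CB(X_G)$ is completely isometrically isomorphic to $D_G$. Indeed $\mathcal{G}^\ell$ with its natural involution (and norm inherited from $B(X_G)$) is a $C^*$-algebra which is $*$-isomorphic to $D_G$. Similarly, $\mathcal{G}^r$ with its natural involution (and with the norm inherited from $B(X_G)$ and the reversed product from $B(X_G)$) is a $C^*$-algebra $*$-isomorphic to $D_G$, so that $\mathcal{G}^r\cong\mathcal{G}^\ell$ $*$-isomorphically and completely isometrically with respect to the operator space structure inherited from $CB(X_G)$.
   Context: Everything is over a fixed field $\mathbb{F}\in\{\mathbb{R},\mathbb{C}\}$. Central $H$-modular operator space: an operator space $X$ with a left action of $H$ by linear complete isometries for which there are a Hilbert space $\mathcal{H}$, a linear complete isometry $\rho:X\to B(\mathcal{H})$ and a unitary representation $\theta:H\to B(\mathcal{H})$ with $\rho(hx)=\theta(h)\rho(x)=\rho(x)\theta(h)$ for all $h\in H$, $x\in X$ (a central representation). Faithful: the $H$-action on $X$ is faithful. For a vector space $X$ with linear $H$-action: $X_G=\{\varphi:G\to X\mid \varphi(gh)=h^{-1}\varphi(g)\ \forall g\in G,h\in H\}$. Left and right translations: $(\pi_X(g)\varphi)(k)=\varphi(g^{-1}k)$ and $(\pi_X^r(g)\varphi)(k)=\varphi(kg)$. $\mathcal{G}^\ell=\mathrm{span}\{\pi_X(g):g\in G\}$ and $\mathcal{G}^r=\mathrm{span}\{\pi^r_X(g):g\in G\}$, as spaces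 of operators on $X_G$; their natural involutions are the (conjugate-)linear extensions of $\pi_X(g)\mapsto\pi_X(g^{-1})$ and $\pi_X^r(g)\mapsto\pi_X^r(g^{-1})$ respectively. Operator space structure on $X_G$: for a central representation $(\theta,\rho,\mathcal{H})$ let $\mathcal{C}=\theta(H)'\subset B(\mathcal{H})$ with $H$-action $h\cdot T=\theta(h)T$, and $\mathcal{H}_G$ (with $H$-action $h\xi=\theta(h)\xi$) with the Hilbert space structure inherited from $\ell^2(G,\mathcal{H})$. For $\Psi\in\mathcal{C}_G$ define $\mathfrak{I}(\Psi)\in B(\mathcal{H}_G)$ by $[\mathfrak{I}(\Psi)\xi](g)=\frac1{|H|}\sum_{k\in G}\Psi(k)(\xi(k^{-1}g))$. The operator space structure of $X_G$ is the one making $\varphi\mapsto\mathfrak{I}(\rho\circ\varphi)$ a complete isometry; it does not depend on the choice of $(\theta,\rho,\mathcal{H})$. The algebra $D$ and the acting $C^*$-algebra $D_G$: let $\mathcal{A}_\ell(X)$ (resp. $\mathcal{A}_r(X)$) be the operator space left (resp. right) adjointable multiplier $C^*$-algebra of $X$ (e.g. $\mathcal{A}_\ell(X)$ consists of the maps $T:X\to X$ for which there are a complete isometry $\sigma:X\to B(\mathcal{K})$ and $a\in B(\mathcal{K})$ with $\sigma(Tx)=a\sigma(x)$ for all $x$ and $a^*\sigma(X)\subset\sigma(X)$), and let $Z(X)=\mathcal{A}_\ell(X)\cap\mathcal{A}_r(X)$ be the centralizer algebra, a commutative $C^*$-algebra isometrically contained in $CB(X)$. The maps $x\mapsto hx$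 ($h\in H$) are unitaries in $Z(X)$, so $H$ is regarded as a subgroup of the unitary group of $Z(X)$, and $D=\mathrm{span}(H)\subset Z(X)$ is the $C^*$-algebra it generates. $H$ acts on $D$ by multiplication, making $D$ a central $H$-modular operator space, and $D_G=\{\varphi:G\to D\mid\varphi(gh)=h^{-1}\varphi(g)\ \forall g\in G,h\in H\}$ is a $C^*$-algebra with product $(\varphi*\psi)(g)=\frac1{|H|}\sum_{k\in G}\varphi(k)\psi(k^{-1}g)$, involution $\varphi^*(g)=\varphi(g^{-1})^*$, and the norm (and matrix norms) making $\varphi\mapsto\mathfrak{I}(\rho_D\circ\varphi)\in B((\mathcal{H}_D)_G)$, $[\mathfrak{I}(\rho_D\circ\varphi)\xi](g)=\frac1{|H|}\sum_{k\in G}\rho_D(\varphi(k))(\xi(k^{-1}g))$, a complete isometry, where $(\theta_D,\rho_D,\mathcal{H}_D)$ is any central representation of $D$ and $(\mathcal{H}_D)_G$ (with $H$-action $h\xi=\theta_D(h)\xi$ on $\mathcal{H}_D$) has the Hilbert space structure inherited from $\ell^2(G,\mathcal{H}_D)$. *)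

theory Defs
  imports Complex_Main "HOL-Library.Function_Algebras" "HOL-Algebra.Group"
begin

section \<open>The scalar field\<close>

text \<open>
  The class of the two scalar fields, the reals and the complex numbers. The identities
  \<open>z * fconj z = |z|\<^sup>2\<close> and \<open>(1 + z) * fconj (1 + z) = |1 + z|\<^sup>2\<close> show that \<open>z + fconj z\<close>
  is real, so every \<open>z\<close> is a root of a real quadratic polynomial; hence a field in this class is
  an algebraic extension of the reals, i.e. it is the real field (with \<open>fconj = id\<close>) or the
  complex field (with \<open>fconj = cnj\<close>).
\<close>

class rc_field = real_normed_field + banach +
  fixes fconj :: "'a \<Rightarrow> 'a"
  assumes fconj_add: "fconj (x + y) = fconj x + fconj y"
    and mult_fconj: "x * fconj x = (norm x)\<^sup>2 *\<^sub>R 1"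

instantiation real :: rc_field
begin
definition fconj_real :: "real \<Rightarrow> real" where "fconj_real x = x"
instance by standard (simp_all add: fconj_real_def power2_eq_square)
end

instantiation complex :: rc_field
begin
definition fconj_complex :: "complex \<Rightarrow> complex" where "fconj_complex = cnj"
instance by standard (simp_all add: fconj_complex_def complex_norm_square [symmetric] scaleR_conv_of_real)
end


section \<open>Linear maps between subspaces\<close>

text \<open>
  Vector spaces are linear subspaces \<open>V\<close> of an ambient vector space, given by a type in
  \<open>ab_group_add\<close> and a scalar multiplication. A map defined on \<open>V\<close> is represented by the total
  function that is \<open>0\<close> outside \<open>V\<close>, so that maps on \<open>V\<close> are equal iff they agree on \<open>V\<close>.
  Likewise, an \<open>n\<close> by \<open>n\<close> matrix is a function on pairs of natural numbers that is \<open>0\<close> outside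
  the index range.
\<close>

definition on_zero :: "'a set \<Rightarrow> ('a \<Rightarrow> 'b::zero) \<Rightarrow> 'a \<Rightarrow> 'b" where
  "on_zero V f = (\<lambda>v. if v \<in> V then f v else 0)"

definition lin_on :: "('f \<Rightarrow> 'v::ab_group_add \<Rightarrow> 'v) \<Rightarrow> 'v set \<Rightarrow>
    ('f \<Rightarrow> 'w::ab_group_add \<Rightarrow> 'w) \<Rightarrow> 'w set \<Rightarrow> ('v \<Rightarrow> 'w) \<Rightarrow> bool" where
  "lin_on s V t W T \<longleftrightarrow> (\<forall>v\<in>V. T v \<in> W) \<and> (\<forall>v\<in>V. \<forall>w\<in>V. T (v + w) = T v + T w)
     \<and> (\<forall>c. \<forall>v\<in>V. T (s c v) = t c (T v))"

definition pscl :: "('f \<Rightarrow> 'v \<Rightarrow> 'v) \<Rightarrow> 'f \<Rightarrow> ('a \<Rightarrow> 'v) \<Rightarrow> 'a \<Rightarrow> 'v" where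
  "pscl s c \<phi> = (\<lambda>a. s c (\<phi> a))"

definition mats :: "nat \<Rightarrow> 'v::zero set \<Rightarrow> (nat \<Rightarrow> nat \<Rightarrow> 'v) set" where
  "mats n V = {A. \<forall>i j. if i < n \<and> j < n then A i j \<in> V else A i j = 0}"

definition mtrunc :: "nat \<Rightarrow> (nat \<Rightarrow> nat \<Rightarrow> 'v::zero) \<Rightarrow> nat \<Rightarrow> nat \<Rightarrow> 'v" where
  "mtrunc n A = (\<lambda>i j. if i < n \<and> j < n then A i j else 0)"


section \<open>Hilbert spaces\<close>

record ('f, 'v) hilb =
  hcar :: "'v set"
  hscl :: "'f \<Rightarrow> 'v \<Rightarrow> 'v"
  hinner :: "'v \<Rightarrow> 'v \<Rightarrow> 'f"

definition hnorm :: "('f::rc_field, 'v) hilb \<Rightarrow> 'v \<Rightarrow> real" where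
  "hnorm K v = sqrt (norm (hinner K v v))"

locale hilbert_space =
  fixes K :: "('f::rc_field, 'v::ab_group_add) hilb"
  assumes vector_space: "vector_space (hscl K)"
    and subspace: "module.subspace (hscl K) (hcar K)"
    and inner_add: "\<lbrakk>u \<in> hcar K; v \<in> hcar K; w \<in> hcar K\<rbrakk> \<Longrightarrow>
          hinner K (u + v) w = hinner K u w + hinner K v w"
    and inner_scale: "\<lbrakk>v \<in> hcar K; w \<in> hcar K\<rbrakk> \<Longrightarrow> hinner K (hscl K c v) w = c * hinner K v w"
    and inner_conj: "\<lbrakk>v \<in> hcar K; w \<in> hcar K\<rbrakk> \<Longrightarrow> hinner K w v = fconj (hinner K v w)"
    and inner_nonneg: "v \<in> hcar K \<Longrightarrow> \<exists>r\<ge>0. hinner K v v = of_real r"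
    and inner_definite: "\<lbrakk>v \<in> hcar K; hinner K v v = 0\<rbrakk> \<Longrightarrow> v = 0"
    and complete: "\<lbrakk>\<And>n::nat. s n \<in> hcar K;
          \<And>e. e > 0 \<Longrightarrow> \<exists>N. \<forall>m\<ge>N. \<forall>n\<ge>N. hnorm K (s m - s n) < e\<rbrakk> \<Longrightarrow>
          \<exists>l\<in>hcar K. (\<lambda>n. hnorm K (s n - l)) \<longlonglongrightarrow> 0"

definition bops :: "('f::rc_field, 'v::ab_group_add) hilb \<Rightarrow> ('v \<Rightarrow> 'v) set" where
  "bops K = {T. lin_on (hscl K) (hcar K) (hscl K) (hcar K) T \<and> (\<forall>v. v \<notin> hcar K \<longrightarrow> T v = 0)
     \<and> (\<exists>B. \<forall>v\<in>hcar K. hnorm K (T v) \<le> B * hnorm K v)}"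

definition adjoint_pair ::
    "('f::rc_field, 'v::ab_group_add) hilb \<Rightarrow> ('v \<Rightarrow> 'v) \<Rightarrow> ('v \<Rightarrow> 'v) \<Rightarrow> bool" where
  "adjoint_pair K a b \<longleftrightarrow> a \<in> bops K \<and> b \<in> bops K
     \<and> (\<forall>v\<in>hcar K. \<forall>w\<in>hcar K. hinner K (a v) w = hinner K v (b w))"

text \<open>The norm of an \<open>n\<close> by \<open>n\<close> operator matrix acting on the \<open>n\<close>-fold direct sum of \<open>K\<close>.\<close>

definition opmat_norm ::
    "('f::rc_field, 'v::ab_group_add) hilb \<Rightarrow> nat \<Rightarrow> (nat \<Rightarrow> nat \<Rightarrow> 'v \<Rightarrow> 'v) \<Rightarrow> real" where
  "opmat_norm K n T = Sup {sqrt (\<Sum>i<n. (hnorm K (\<Sum>j<n. T i j (v j)))\<^sup>2) | v.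
     (\<forall>j<n. v j \<in> hcar K) \<and> (\<Sum>j<n. (hnorm K (v j))\<^sup>2) \<le> 1}"


section \<open>Operator spaces\<close>

text \<open>
  \<open>omnorm X n\<close> is the norm on the \<open>n\<close> by \<open>n\<close> matrices over \<open>X\<close>. Such a structure is an
  operator space iff it admits a linear complete isometry into some \<open>B(K)\<close>. Injectivity of
  complete isometries is stated explicitly because \<open>omnorm\<close> is not required to be a norm
  beforehand.
\<close>

record ('f, 'v) opspace =
  ocar :: "'v set"
  oscl :: "'f \<Rightarrow> 'v \<Rightarrow> 'v"
  omnorm :: "nat \<Rightarrow> (nat \<Rightarrow> nat \<Rightarrow> 'v) \<Rightarrow> real"

definition complete_isometry :: "('f::rc_field, 'x::ab_group_add) opspace \<Rightarrow>
    ('f, 'v::ab_group_add) hilb \<Rightarrow> ('x \<Rightarrow> 'v \<Rightarrow> 'v) \<Rightarrow> bool" where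
  "complete_isometry X K \<sigma> \<longleftrightarrow> lin_on (oscl X) (ocar X) (pscl (hscl K)) (bops K) \<sigma>
     \<and> inj_on \<sigma> (ocar X)
     \<and> (\<forall>n>0. \<forall>A\<in>mats n (ocar X). opmat_norm K n (\<lambda>i j. \<sigma> (A i j)) = omnorm X n A)"

definition mat1 :: "'v::zero \<Rightarrow> nat \<Rightarrow> nat \<Rightarrow> 'v" where
  "mat1 x = mtrunc 1 (\<lambda>i j. x)"

definition op_norm :: "('f, 'x::ab_group_add) opspace \<Rightarrow> ('x \<Rightarrow> 'x) \<Rightarrow> real" where
  "op_norm X T = Sup {omnorm X 1 (mat1 (T x)) | x. x \<in> ocar X \<and> omnorm X 1 (mat1 x) \<le> 1}"

text \<open>
  The amplification of an \<open>n\<close> by \<open>n\<close> matrix \<open>T\<close> of maps to an \<open>m\<close> by \<open>m\<close> matrix \<open>x\<close>, as an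
  \<open>m\<close> by \<open>m\<close> matrix of \<open>n\<close> by \<open>n\<close> blocks. The norm \<open>cb_mnorm\<close> is that of
  \<open>M\<^sub>n(CB(X)) = CB(X, M\<^sub>n(X))\<close>.
\<close>

definition amplify :: "nat \<Rightarrow> nat \<Rightarrow> (nat \<Rightarrow> nat \<Rightarrow> 'x \<Rightarrow> 'x::zero) \<Rightarrow> (nat \<Rightarrow> nat \<Rightarrow> 'x) \<Rightarrow>
    nat \<Rightarrow> nat \<Rightarrow> 'x" where
  "amplify n m T x = mtrunc (m * n) (\<lambda>p q. T (p mod n) (q mod n) (x (p div n) (q div n)))"

definition cb_values :: "('f, 'x::ab_group_add) opspace \<Rightarrow> nat \<Rightarrow>
    (nat \<Rightarrow> nat \<Rightarrow> 'x \<Rightarrow> 'x) \<Rightarrow> real set" where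
  "cb_values X n T = {omnorm X (m * n) (amplify n m T x) | m x.
     m > 0 \<and> x \<in> mats m (ocar X) \<and> omnorm X m x \<le> 1}"

definition cb_mnorm :: "('f, 'x::ab_group_add) opspace \<Rightarrow> nat \<Rightarrow>
    (nat \<Rightarrow> nat \<Rightarrow> 'x \<Rightarrow> 'x) \<Rightarrow> real" where
  "cb_mnorm X n T = Sup (cb_values X n T)"

definition CB :: "('f, 'x::ab_group_add) opspace \<Rightarrow> ('x \<Rightarrow> 'x) set" where
  "CB X = {T. lin_on (oscl X) (ocar X) (oscl X) (ocar X) T \<and> (\<forall>x. x \<notin> ocar X \<longrightarrow> T x = 0)
     \<and> bdd_above (cb_values X 1 (mat1 T))}"


section \<open>\<open>C\<^sup>*\<close>-algebras\<close>

record ('f, 'a) staralg =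
  acar :: "'a set"
  ascl :: "'f \<Rightarrow> 'a \<Rightarrow> 'a"
  amul :: "'a \<Rightarrow> 'a \<Rightarrow> 'a"
  astar :: "'a \<Rightarrow> 'a"

text \<open>
  The assumption \<open>positive\<close> says that \<open>1 + x\<^sup>* x\<close> is invertible in the unitization, with inverse
  \<open>1 + y\<close>. It belongs to the definition of a real \<open>C\<^sup>*\<close>-algebra and is redundant over the complex
  numbers.
\<close>

locale cstar_algebra =
  fixes A :: "('f::rc_field, 'a::ab_group_add) staralg" and N :: "'a \<Rightarrow> real"
  assumes vector_space: "vector_space (ascl A)"
    and subspace: "module.subspace (ascl A) (acar A)"
    and mul_closed: "\<lbrakk>x \<in> acar A; y \<in> acar A\<rbrakk> \<Longrightarrow> amul A x y \<in> acar A"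
    and mul_assoc: "\<lbrakk>x \<in> acar A; y \<in> acar A; z \<in> acar A\<rbrakk> \<Longrightarrow>
          amul A (amul A x y) z = amul A x (amul A y z)"
    and mul_add_left: "\<lbrakk>x \<in> acar A; y \<in> acar A; z \<in> acar A\<rbrakk> \<Longrightarrow>
          amul A (x + y) z = amul A x z + amul A y z"
    and mul_add_right: "\<lbrakk>x \<in> acar A; y \<in> acar A; z \<in> acar A\<rbrakk> \<Longrightarrow>
          amul A x (y + z) = amul A x y + amul A x z"
    and mul_scale_left: "\<lbrakk>x \<in> acar A; y \<in> acar A\<rbrakk> \<Longrightarrow>
          amul A (ascl A c x) y = ascl A c (amul A x y)"
    and mul_scale_right: "\<lbrakk>x \<in> acar A; y \<in> acar A\<rbrakk> \<Longrightarrow>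
          amul A x (ascl A c y) = ascl A c (amul A x y)"
    and star_closed: "x \<in> acar A \<Longrightarrow> astar A x \<in> acar A"
    and star_star: "x \<in> acar A \<Longrightarrow> astar A (astar A x) = x"
    and star_add: "\<lbrakk>x \<in> acar A; y \<in> acar A\<rbrakk> \<Longrightarrow> astar A (x + y) = astar A x + astar A y"
    and star_scale: "x \<in> acar A \<Longrightarrow> astar A (ascl A c x) = ascl A (fconj c) (astar A x)"
    and star_mul: "\<lbrakk>x \<in> acar A; y \<in> acar A\<rbrakk> \<Longrightarrow>
          astar A (amul A x y) = amul A (astar A y) (astar A x)"
    and norm_nonneg: "x \<in> acar A \<Longrightarrow> N x \<ge> 0"
    and norm_eq_0: "x \<in> acar A \<Longrightarrow> N x = 0 \<longleftrightarrow> x = 0"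
    and norm_triangle: "\<lbrakk>x \<in> acar A; y \<in> acar A\<rbrakk> \<Longrightarrow> N (x + y) \<le> N x + N y"
    and norm_scale: "x \<in> acar A \<Longrightarrow> N (ascl A c x) = norm c * N x"
    and norm_mul: "\<lbrakk>x \<in> acar A; y \<in> acar A\<rbrakk> \<Longrightarrow> N (amul A x y) \<le> N x * N y"
    and complete: "\<lbrakk>\<And>n::nat. s n \<in> acar A;
          \<And>e. e > 0 \<Longrightarrow> \<exists>M. \<forall>m\<ge>M. \<forall>n\<ge>M. N (s m - s n) < e\<rbrakk> \<Longrightarrow>
          \<exists>l\<in>acar A. (\<lambda>n. N (s n - l)) \<longlonglongrightarrow> 0"
    and cstar_identity: "x \<in> acar A \<Longrightarrow> N (amul A (astar A x) x) = (N x)\<^sup>2"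
    and positive: "x \<in> acar A \<Longrightarrow> \<exists>y\<in>acar A.
          amul A (astar A x) x + y + amul A (amul A (astar A x) x) y = 0 \<and>
          amul A (astar A x) x + y + amul A y (amul A (astar A x) x) = 0"

definition star_iso :: "('f, 'a::ab_group_add) staralg \<Rightarrow> ('f, 'b::ab_group_add) staralg \<Rightarrow>
    ('a \<Rightarrow> 'b) \<Rightarrow> bool" where
  "star_iso A B \<Phi> \<longleftrightarrow> bij_betw \<Phi> (acar A) (acar B)
     \<and> lin_on (ascl A) (acar A) (ascl B) (acar B) \<Phi>
     \<and> (\<forall>x\<in>acar A. \<forall>y\<in>acar A. \<Phi> (amul A x y) = amul B (\<Phi> x) (\<Phi> y))
     \<and> (\<forall>x\<in>acar A. \<Phi> (astar A x) = astar B (\<Phi> x))"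

definition completely_isometric :: "'a::zero set \<Rightarrow> (nat \<Rightarrow> (nat \<Rightarrow> nat \<Rightarrow> 'a) \<Rightarrow> real) \<Rightarrow>
    (nat \<Rightarrow> (nat \<Rightarrow> nat \<Rightarrow> 'b) \<Rightarrow> real) \<Rightarrow> ('a \<Rightarrow> 'b) \<Rightarrow> bool" where
  "completely_isometric V \<mu> \<nu> \<Phi> \<longleftrightarrow> (\<forall>n>0. \<forall>A\<in>mats n V. \<nu> n (\<lambda>i j. \<Phi> (A i j)) = \<mu> n A)"

definition mat_alg :: "nat \<Rightarrow> ('f, 'a::ab_group_add) staralg \<Rightarrow>
    ('f, nat \<Rightarrow> nat \<Rightarrow> 'a) staralg" where
  "mat_alg n A = \<lparr>acar = mats n (acar A),
     ascl = pscl (pscl (ascl A)),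
     amul = (\<lambda>M N. mtrunc n (\<lambda>i j. \<Sum>k<n. amul A (M i k) (N k j))),
     astar = (\<lambda>M. mtrunc n (\<lambda>i j. astar A (M j i)))\<rparr>"

text \<open>The canonical operator space structure of a \<open>C\<^sup>*\<close>-algebra: the norm on the \<open>n\<close> by \<open>n\<close>
  matrices is the unique one that makes them a \<open>C\<^sup>*\<close>-algebra.\<close>

definition cstar_mnorm :: "('f::rc_field, 'a::ab_group_add) staralg \<Rightarrow> nat \<Rightarrow>
    (nat \<Rightarrow> nat \<Rightarrow> 'a) \<Rightarrow> real" where
  "cstar_mnorm A n M = (THE r. \<exists>N. cstar_algebra (mat_alg n A) N \<and> r = N M)"


section \<open>Adjointable multipliers and the centralizer algebra\<close>

text \<open>
  \<open>left_adjoint U X T S\<close> says that \<open>T\<close> is a left adjointable multiplier of \<open>X\<close> with adjoint \<open>S\<close>: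
  \<open>\<sigma>(T x) = a \<sigma>(x)\<close> and \<open>\<sigma>(S x) = a\<^sup>* \<sigma>(x)\<close>. Requiring some such \<open>S : X \<rightarrow> X\<close> to exist is the
  requirement \<open>a\<^sup>* \<sigma>(X) \<subseteq> \<sigma>(X)\<close>. A type cannot be quantified inside a
  definition, so the Hilbert spaces \<open>K\<close> range over those carried by subgroups of one type, the
  universe \<open>U\<close>. Once \<open>U\<close> is large enough compared with \<open>X\<close> (e.g. functions from a sufficiently
  large index type to the scalars), this is no restriction.
\<close>

definition maps_on :: "'x::zero set \<Rightarrow> ('x \<Rightarrow> 'x) set" where
  "maps_on V = {T. (\<forall>x\<in>V. T x \<in> V) \<and> (\<forall>x. x \<notin> V \<longrightarrow> T x = 0)}"

definition left_adjoint :: "'u::ab_group_add itself \<Rightarrow>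
    ('f::rc_field, 'x::ab_group_add) opspace \<Rightarrow> ('x \<Rightarrow> 'x) \<Rightarrow> ('x \<Rightarrow> 'x) \<Rightarrow> bool" where
  "left_adjoint U X T S \<longleftrightarrow> T \<in> maps_on (ocar X) \<and> S \<in> maps_on (ocar X)
     \<and> (\<exists>(K :: ('f, 'u) hilb) \<sigma> a b. hilbert_space K \<and> complete_isometry X K \<sigma>
          \<and> adjoint_pair K a b
          \<and> (\<forall>x\<in>ocar X. \<sigma> (T x) = a \<circ> \<sigma> x \<and> \<sigma> (S x) = b \<circ> \<sigma> x))"

definition right_adjoint :: "'u::ab_group_add itself \<Rightarrow>
    ('f::rc_field, 'x::ab_group_add) opspace \<Rightarrow> ('x \<Rightarrow> 'x) \<Rightarrow> ('x \<Rightarrow> 'x) \<Rightarrow> bool" where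
  "right_adjoint U X T S \<longleftrightarrow> T \<in> maps_on (ocar X) \<and> S \<in> maps_on (ocar X)
     \<and> (\<exists>(K :: ('f, 'u) hilb) \<sigma> a b. hilbert_space K \<and> complete_isometry X K \<sigma>
          \<and> adjoint_pair K a b
          \<and> (\<forall>x\<in>ocar X. \<sigma> (T x) = \<sigma> x \<circ> a \<and> \<sigma> (S x) = \<sigma> x \<circ> b))"

definition left_multipliers :: "'u::ab_group_add itself \<Rightarrow>
    ('f::rc_field, 'x::ab_group_add) opspace \<Rightarrow> ('x \<Rightarrow> 'x) set" where
  "left_multipliers U X = {T. \<exists>S. left_adjoint U X T S}"

definition right_multipliers :: "'u::ab_group_add itself \<Rightarrow>
    ('f::rc_field, 'x::ab_group_add) opspace \<Rightarrow> ('x \<Rightarrow> 'x) set" where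
  "right_multipliers U X = {T. \<exists>S. right_adjoint U X T S}"

definition centralizer :: "'u::ab_group_add itself \<Rightarrow>
    ('f::rc_field, 'x::ab_group_add) opspace \<Rightarrow> ('x \<Rightarrow> 'x) set" where
  "centralizer U X = left_multipliers U X \<inter> right_multipliers U X"

definition centralizer_star :: "'u::ab_group_add itself \<Rightarrow>
    ('f::rc_field, 'x::ab_group_add) opspace \<Rightarrow> ('x \<Rightarrow> 'x) \<Rightarrow> 'x \<Rightarrow> 'x" where
  "centralizer_star U X T =
     (THE S. S \<in> centralizer U X \<and> left_adjoint U X T S \<and> right_adjoint U X T S)"


section \<open>Central modular operator spaces and induced spaces\<close>

definition central_subgroup :: "'g set \<Rightarrow> ('g, 'z) monoid_scheme \<Rightarrow> bool" where
  "central_subgroup H G \<longleftrightarrow>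
     subgroup H G \<and> (\<forall>h\<in>H. \<forall>g\<in>carrier G. h \<otimes>\<^bsub>G\<^esub> g = g \<otimes>\<^bsub>G\<^esub> h)"

definition modular_action :: "('g, 'z) monoid_scheme \<Rightarrow> 'g set \<Rightarrow>
    ('f::rc_field, 'x::ab_group_add) opspace \<Rightarrow> ('g \<Rightarrow> 'x \<Rightarrow> 'x) \<Rightarrow> bool" where
  "modular_action G H X act \<longleftrightarrow>
     (\<forall>h\<in>H. lin_on (oscl X) (ocar X) (oscl X) (ocar X) (act h)
        \<and> completely_isometric (ocar X) (omnorm X) (omnorm X) (act h))
     \<and> (\<forall>x\<in>ocar X. act \<one>\<^bsub>G\<^esub> x = x)
     \<and> (\<forall>h\<in>H. \<forall>k\<in>H. \<forall>x\<in>ocar X. act (h \<otimes>\<^bsub>G\<^esub> k) x = act h (act k x))"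

definition faithful_action :: "('g, 'z) monoid_scheme \<Rightarrow> 'g set \<Rightarrow>
    ('f, 'x) opspace \<Rightarrow> ('g \<Rightarrow> 'x \<Rightarrow> 'x) \<Rightarrow> bool" where
  "faithful_action G H X act \<longleftrightarrow> (\<forall>h\<in>H. (\<forall>x\<in>ocar X. act h x = x) \<longrightarrow> h = \<one>\<^bsub>G\<^esub>)"

definition unitary_rep :: "('g, 'z) monoid_scheme \<Rightarrow> 'g set \<Rightarrow>
    ('f::rc_field, 'v::ab_group_add) hilb \<Rightarrow> ('g \<Rightarrow> 'v \<Rightarrow> 'v) \<Rightarrow> bool" where
  "unitary_rep G H K \<theta> \<longleftrightarrow>
     (\<forall>h\<in>H. \<theta> h \<in> bops K
        \<and> (\<forall>v\<in>hcar K. \<forall>w\<in>hcar K. hinner K (\<theta> h v) (\<theta> h w) = hinner K v w))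
     \<and> (\<forall>v\<in>hcar K. \<theta> \<one>\<^bsub>G\<^esub> v = v)
     \<and> (\<forall>h\<in>H. \<forall>k\<in>H. \<theta> (h \<otimes>\<^bsub>G\<^esub> k) = \<theta> h \<circ> \<theta> k)"

definition central_rep :: "('g, 'z) monoid_scheme \<Rightarrow> 'g set \<Rightarrow>
    ('f::rc_field, 'x::ab_group_add) opspace \<Rightarrow> ('g \<Rightarrow> 'x \<Rightarrow> 'x) \<Rightarrow>
    ('f, 'v::ab_group_add) hilb \<Rightarrow> ('g \<Rightarrow> 'v \<Rightarrow> 'v) \<Rightarrow> ('x \<Rightarrow> 'v \<Rightarrow> 'v) \<Rightarrow> bool" where
  "central_rep G H X act K \<theta> \<rho> \<longleftrightarrow>
     hilbert_space K \<and> unitary_rep G H K \<theta> \<and> complete_isometry X K \<rho>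
     \<and> (\<forall>h\<in>H. \<forall>x\<in>ocar X. \<rho> (act h x) = \<theta> h \<circ> \<rho> x \<and> \<rho> (act h x) = \<rho> x \<circ> \<theta> h)"

text \<open>The space \<open>V\<^sub>G\<close>; functions on \<open>G\<close> are extended by \<open>0\<close> outside the carrier of \<open>G\<close>.\<close>

definition ind_car :: "('g, 'z) monoid_scheme \<Rightarrow> 'g set \<Rightarrow> ('g \<Rightarrow> 'v \<Rightarrow> 'v) \<Rightarrow> 'v::zero set \<Rightarrow>
    ('g \<Rightarrow> 'v) set" where
  "ind_car G H act V = {\<phi>. (\<forall>g. g \<notin> carrier G \<longrightarrow> \<phi> g = 0) \<and> (\<forall>g\<in>carrier G. \<phi> g \<in> V)
     \<and> (\<forall>g\<in>carrier G. \<forall>h\<in>H. \<phi> (g \<otimes>\<^bsub>G\<^esub> h) = act (inv\<^bsub>G\<^esub> h) (\<phi> g))}"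

definition ind_hilb :: "('g, 'z) monoid_scheme \<Rightarrow> 'g set \<Rightarrow>
    ('f::rc_field, 'v::ab_group_add) hilb \<Rightarrow> ('g \<Rightarrow> 'v \<Rightarrow> 'v) \<Rightarrow> ('f, 'g \<Rightarrow> 'v) hilb" where
  "ind_hilb G H K \<theta> = \<lparr>hcar = ind_car G H \<theta> (hcar K), hscl = pscl (hscl K),
     hinner = (\<lambda>\<xi> \<eta>. \<Sum>g\<in>carrier G. hinner K (\<xi> g) (\<eta> g))\<rparr>"

definition ind_op :: "('g, 'z) monoid_scheme \<Rightarrow> 'g set \<Rightarrow>
    ('f::rc_field, 'v::ab_group_add) hilb \<Rightarrow> ('g \<Rightarrow> 'v \<Rightarrow> 'v) \<Rightarrow> ('g \<Rightarrow> 'v \<Rightarrow> 'v) \<Rightarrow>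
    ('g \<Rightarrow> 'v) \<Rightarrow> 'g \<Rightarrow> 'v" where
  "ind_op G H K \<theta> \<Psi> = on_zero (hcar (ind_hilb G H K \<theta>)) (\<lambda>\<xi>. on_zero (carrier G)
     (\<lambda>g. hscl K (1 / of_nat (card H)) (\<Sum>k\<in>carrier G. \<Psi> k (\<xi> (inv\<^bsub>G\<^esub> k \<otimes>\<^bsub>G\<^esub> g)))))"

definition ind_opspace :: "('g, 'z) monoid_scheme \<Rightarrow> 'g set \<Rightarrow>
    ('f::rc_field, 'x::ab_group_add) opspace \<Rightarrow> ('g \<Rightarrow> 'x \<Rightarrow> 'x) \<Rightarrow>
    ('f, 'v::ab_group_add) hilb \<Rightarrow> ('g \<Rightarrow> 'v \<Rightarrow> 'v) \<Rightarrow> ('x \<Rightarrow> 'v \<Rightarrow> 'v) \<Rightarrow>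
    ('f, 'g \<Rightarrow> 'x) opspace" where
  "ind_opspace G H X act K \<theta> \<rho> = \<lparr>ocar = ind_car G H act (ocar X), oscl = pscl (oscl X),
     omnorm = (\<lambda>n \<Phi>. opmat_norm (ind_hilb G H K \<theta>) n
                 (\<lambda>i j. ind_op G H K \<theta> (\<lambda>g. \<rho> (\<Phi> i j g))))\<rparr>"


section \<open>The algebras \<open>D\<close> and \<open>D\<^sub>G\<close>\<close>

definition D_alg :: "'u::ab_group_add itself \<Rightarrow> 'g set \<Rightarrow>
    ('f::rc_field, 'x::ab_group_add) opspace \<Rightarrow> ('g \<Rightarrow> 'x \<Rightarrow> 'x) \<Rightarrow> ('f, 'x \<Rightarrow> 'x) staralg" where
  "D_alg U H X act = \<lparr>acar = module.span (pscl (oscl X)) ((\<lambda>h. on_zero (ocar X) (act h)) ` H),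
     ascl = pscl (oscl X), amul = (\<circ>), astar = centralizer_star U X\<rparr>"

definition D_opspace :: "'u::ab_group_add itself \<Rightarrow> 'g set \<Rightarrow>
    ('f::rc_field, 'x::ab_group_add) opspace \<Rightarrow> ('g \<Rightarrow> 'x \<Rightarrow> 'x) \<Rightarrow> ('f, 'x \<Rightarrow> 'x) opspace" where
  "D_opspace U H X act = \<lparr>ocar = acar (D_alg U H X act), oscl = pscl (oscl X),
     omnorm = cstar_mnorm (D_alg U H X act)\<rparr>"

definition D_act :: "('f, 'x::ab_group_add) opspace \<Rightarrow> ('g \<Rightarrow> 'x \<Rightarrow> 'x) \<Rightarrow>
    'g \<Rightarrow> ('x \<Rightarrow> 'x) \<Rightarrow> 'x \<Rightarrow> 'x" where
  "D_act X act h d = on_zero (ocar X) (act h) \<circ> d"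

definition DG_alg :: "'u::ab_group_add itself \<Rightarrow> ('g, 'z) monoid_scheme \<Rightarrow> 'g set \<Rightarrow>
    ('f::rc_field, 'x::ab_group_add) opspace \<Rightarrow> ('g \<Rightarrow> 'x \<Rightarrow> 'x) \<Rightarrow>
    ('f, 'g \<Rightarrow> 'x \<Rightarrow> 'x) staralg" where
  "DG_alg U G H X act = \<lparr>acar = ind_car G H (D_act X act) (acar (D_alg U H X act)),
     ascl = pscl (pscl (oscl X)),
     amul = (\<lambda>\<phi> \<psi>. on_zero (carrier G) (\<lambda>g. pscl (oscl X) (1 / of_nat (card H))
               (\<Sum>k\<in>carrier G. \<phi> k \<circ> \<psi> (inv\<^bsub>G\<^esub> k \<otimes>\<^bsub>G\<^esub> g)))),
     astar = (\<lambda>\<phi>. on_zero (carrier G) (\<lambda>g. centralizer_star U X (\<phi> (inv\<^bsub>G\<^esub> g))))\<rparr>"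


section \<open>Translations\<close>

definition ltrans :: "('g, 'z) monoid_scheme \<Rightarrow> 'g set \<Rightarrow> ('f, 'x::ab_group_add) opspace \<Rightarrow>
    ('g \<Rightarrow> 'x \<Rightarrow> 'x) \<Rightarrow> 'g \<Rightarrow> ('g \<Rightarrow> 'x) \<Rightarrow> 'g \<Rightarrow> 'x" where
  "ltrans G H X act g = on_zero (ind_car G H act (ocar X))
     (\<lambda>\<phi>. on_zero (carrier G) (\<lambda>k. \<phi> (inv\<^bsub>G\<^esub> g \<otimes>\<^bsub>G\<^esub> k)))"

definition rtrans :: "('g, 'z) monoid_scheme \<Rightarrow> 'g set \<Rightarrow> ('f, 'x::ab_group_add) opspace \<Rightarrow>
    ('g \<Rightarrow> 'x \<Rightarrow> 'x) \<Rightarrow> 'g \<Rightarrow> ('g \<Rightarrow> 'x) \<Rightarrow> 'g \<Rightarrow> 'x" where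
  "rtrans G H X act g = on_zero (ind_car G H act (ocar X))
     (\<lambda>\<phi>. on_zero (carrier G) (\<lambda>k. \<phi> (k \<otimes>\<^bsub>G\<^esub> g)))"

definition trans_span :: "('g, 'z) monoid_scheme \<Rightarrow> ('f::rc_field, 'x::ab_group_add) opspace \<Rightarrow>
    ('g \<Rightarrow> ('g \<Rightarrow> 'x) \<Rightarrow> 'g \<Rightarrow> 'x) \<Rightarrow> (('g \<Rightarrow> 'x) \<Rightarrow> 'g \<Rightarrow> 'x) set" where
  "trans_span G X P = module.span (pscl (pscl (oscl X))) (P ` carrier G)"

text \<open>\<open>s\<close> is the (conjugate-)linear extension of \<open>P g \<mapsto> P (g\<^sup>-\<^sup>1)\<close>. The operators \<open>P g\<close> need not
  be linearly independent, so the existence of \<open>s\<close> is not automatic; its values on the span are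
  determined.\<close>

definition natural_involution :: "('g, 'z) monoid_scheme \<Rightarrow>
    ('f::rc_field, 'x::ab_group_add) opspace \<Rightarrow> ('g \<Rightarrow> ('g \<Rightarrow> 'x) \<Rightarrow> 'g \<Rightarrow> 'x) \<Rightarrow>
    ((('g \<Rightarrow> 'x) \<Rightarrow> 'g \<Rightarrow> 'x) \<Rightarrow> ('g \<Rightarrow> 'x) \<Rightarrow> 'g \<Rightarrow> 'x) \<Rightarrow> bool" where
  "natural_involution G X P s \<longleftrightarrow>
     (\<forall>S\<in>trans_span G X P. \<forall>T\<in>trans_span G X P. s (S + T) = s S + s T)
     \<and> (\<forall>c. \<forall>T\<in>trans_span G X P.
          s (pscl (pscl (oscl X)) c T) = pscl (pscl (oscl X)) (fconj c) (s T))
     \<and> (\<forall>g\<in>carrier G. s (P g) = P (inv\<^bsub>G\<^esub> g))"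

definition Gl_alg :: "('g, 'z) monoid_scheme \<Rightarrow> 'g set \<Rightarrow>
    ('f::rc_field, 'x::ab_group_add) opspace \<Rightarrow> ('g \<Rightarrow> 'x \<Rightarrow> 'x) \<Rightarrow>
    ((('g \<Rightarrow> 'x) \<Rightarrow> 'g \<Rightarrow> 'x) \<Rightarrow> ('g \<Rightarrow> 'x) \<Rightarrow> 'g \<Rightarrow> 'x) \<Rightarrow>
    ('f, ('g \<Rightarrow> 'x) \<Rightarrow> 'g \<Rightarrow> 'x) staralg" where
  "Gl_alg G H X act s = \<lparr>acar = trans_span G X (ltrans G H X act),
     ascl = pscl (pscl (oscl X)), amul = (\<circ>), astar = s\<rparr>"

definition Gr_alg :: "('g, 'z) monoid_scheme \<Rightarrow> 'g set \<Rightarrow>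
    ('f::rc_field, 'x::ab_group_add) opspace \<Rightarrow> ('g \<Rightarrow> 'x \<Rightarrow> 'x) \<Rightarrow>
    ((('g \<Rightarrow> 'x) \<Rightarrow> 'g \<Rightarrow> 'x) \<Rightarrow> ('g \<Rightarrow> 'x) \<Rightarrow> 'g \<Rightarrow> 'x) \<Rightarrow>
    ('f, ('g \<Rightarrow> 'x) \<Rightarrow> 'g \<Rightarrow> 'x) staralg" where
  "Gr_alg G H X act s = \<lparr>acar = trans_span G X (rtrans G H X act),
     ascl = pscl (pscl (oscl X)), amul = (\<lambda>S T. T \<circ> S), astar = s\<rparr>"

end

theory Submission
  imports Defs
begin

text \<open>
  Adjoints of left multipliers are unique, so the involution of \<open>D = span H\<close> can be computed in the
  given central representation \<open>\<rho>\<close>. The span \<open>B\<close> of the unitaries \<open>\<theta> h\<close> acts on \<open>\<rho>(X) K\<close>; cutting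
  it down by the projection onto the part that acts faithfully gives a faithful representation \<open>\<pi>\<close> of
  \<open>D\<close> on \<open>K\<close> with \<open>\<rho>(d x) = \<pi>(d) \<rho>(x) = \<rho>(x) \<pi>(d)\<close>. It induces a faithful representation \<open>W\<close> of
  \<open>D\<^sub>G\<close>, whose matrix norms are those of \<open>D\<^sub>G\<close> because the norms on matrices over a finite-dimensional
  \<open>C\<^sup>*\<close>-algebra are unique. If \<open>j\<close> is the defining complete isometry of \<open>X\<^sub>G\<close>, left and right
  convolution by \<open>\<phi> \<in> D\<^sub>G\<close> correspond under \<open>j\<close> to multiplication by \<open>W \<phi>\<close> from the left and from
  the right. These convolutions are spanned by the translations, and their completely bounded norms
  are at most the norm of \<open>W \<phi>\<close>. Equality is seen on functions \<open>x\<close> supported on \<open>H\<close>: for these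
  \<open>j x\<close> commutes with \<open>W \<phi>\<close>, and \<open>\<rho>(x)\<close> almost attains its norm, for suitable \<open>x\<close>, on
  the part of \<open>K\<close> where \<open>W \<phi>\<close> attains its norm.
\<close>

subsection \<open>Scalars\<close>

text \<open>\<open>X\<close> need not contain a unit, so the norm of a convolution operator cannot
  be read off at a distinguished element, and a careless choice of \<open>x\<close> may be small
  exactly where \<open>W \<phi>\<close> is large. The top eigenvalue of
  \<open>\<phi>* \<phi>\<close> is therefore localized inside \<open>D\<close>: its eigenvector
  yields a positive element of \<open>D\<close>, an eigenvector of that element in \<open>D\<close>
  takes the place of a spectral projection, and \<open>x\<close> is chosen where this eigenvector
  acts with its full norm. These eigenvectors exist because all algebras involved are
  finite-dimensional, so that injective multiplications are surjective; this replaces functional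
  calculus and treats real and complex scalars alike. A second obstacle is that \<open>D_G\<close>
  is normed through an arbitrary representation of \<open>D\<close>. An induced operator is an
  operator matrix indexed by \<open>G / H\<close> with entries from the represented
  \<open>D\<close>, so its norm depends only on the matrix norms of \<open>D\<close>. Left and right
  convolution can share one proof of the norm formula because on functions supported on
  \<open>H\<close> they give the same operator.\<close>

lemma fconj_0 [simp]: "fconj (0 :: 'f::rc_field) = 0"
  using fconj_add [of 0 "0 :: 'f"] by simp

text \<open>The class provides only additivity and the value of \<open>x * fconj x\<close>. Dividing
  by \<open>x\<close> gives a closed formula from which multiplicativity, involutivity and norm
  preservation are computed; at 0 it agrees with \<open>fconj 0 = 0\<close> by the convention on
  division.\<close>

lemma fconj_eq: "fconj (x :: 'f::rc_field) = of_real ((norm x)\<^sup>2) / x"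
  using mult_fconj [of x] by (cases "x = 0") (auto simp: field_simps of_real_def)

lemma fconj_mult: "fconj (x * y :: 'f::rc_field) = fconj x * fconj y"
  by (simp add: fconj_eq norm_mult power_mult_distrib)

lemma norm_fconj [simp]: "norm (fconj x :: 'f::rc_field) = norm x"
  by (cases "x = 0") (simp_all add: fconj_eq norm_divide norm_mult power2_eq_square)

lemma fconj_fconj [simp]: "fconj (fconj x :: 'f::rc_field) = x"
proof (cases "x = 0")
  case False
  have "fconj (fconj x) = of_real ((norm x)\<^sup>2) / fconj x"
    by (simp add: fconj_eq [of "fconj x"])
  then show ?thesis using False by (simp add: fconj_eq [of x])
qed simp

lemma fconj_of_real [simp]: "fconj (of_real r :: 'f::rc_field) = of_real r"
  by (cases "r = 0") (simp_all add: fconj_eq power2_eq_square)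

lemma fconj_1 [simp]: "fconj (1 :: 'f::rc_field) = 1"
  using fconj_of_real [of 1] by simp

lemma fconj_of_nat [simp]: "fconj (of_nat n :: 'f::rc_field) = of_nat n"
  using fconj_of_real [of "real n"] by simp

lemma fconj_minus: "fconj (- x :: 'f::rc_field) = - fconj x"
  using fconj_add [of x "- x"] by (simp add: eq_neg_iff_add_eq_0 add.commute)

lemma fconj_sum: "fconj (\<Sum>i\<in>I. f i :: 'f::rc_field) = (\<Sum>i\<in>I. fconj (f i))"
  by (induction I rule: infinite_finite_induct) (simp_all add: fconj_add)

lemma fconj_divide: "fconj (x / y :: 'f::rc_field) = fconj x / fconj y"
  by (simp add: fconj_eq norm_divide power_divide)

lemma mult_fconj': "x * fconj x = (of_real ((norm x)\<^sup>2) :: 'f::rc_field)"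
  by (simp add: mult_fconj of_real_def)

text \<open>The class has no real part; this recovers it by polarization from |1 + z|^2 = 1 + 2 Re z
  + |z|^2.\<close>

definition re :: "'f::rc_field \<Rightarrow> real" where
  "re z = ((norm (1 + z))\<^sup>2 - 1 - (norm z)\<^sup>2) / 2"

lemma add_fconj: "z + fconj z = (of_real (2 * re z) :: 'f::rc_field)"
proof -
  have "(1 + z) * fconj (1 + z) = 1 + (z + fconj z) + z * fconj z"
    by (simp add: fconj_add algebra_simps)
  then show ?thesis
    by (simp add: mult_fconj' re_def algebra_simps)
qed

lemma re_fconj [simp]: "re (fconj z) = re (z :: 'f::rc_field)"
proof -
  have "of_real (2 * re (fconj z)) = (of_real (2 * re z) :: 'f)"
    using add_fconj [of z] add_fconj [of "fconj z"] by (simp add: add.commute)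
  then show ?thesis unfolding of_real_eq_iff by simp
qed

lemma re_of_real_mult: "re (of_real r * z) = r * re (z :: 'f::rc_field)"
proof -
  have "of_real (2 * re (of_real r * z)) = (of_real (2 * (r * re z)) :: 'f)"
    using add_fconj [of z] add_fconj [of "of_real r * z"]
    by (simp add: fconj_mult ring_distribs [symmetric] mult.left_commute)
  then show ?thesis unfolding of_real_eq_iff by simp
qed

lemma re_of_real [simp]: "re (of_real r :: 'f::rc_field) = r"
proof -
  have "of_real (2 * re (of_real r :: 'f)) = (of_real (2 * r) :: 'f)"
    using add_fconj [of "of_real r :: 'f"] by simp
  then show ?thesis unfolding of_real_eq_iff by simp
qed

lemma abs_re_le: "\<bar>re z\<bar> \<le> norm (z :: 'f::rc_field)"
proof -
  have "2 * \<bar>re z\<bar> = norm (z + fconj z)"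
    unfolding add_fconj norm_of_real by simp
  also have "\<dots> \<le> 2 * norm z"
    using norm_triangle_ineq [of z "fconj z"] by simp
  finally show ?thesis by simp
qed

subsection \<open>Finite-dimensional spaces\<close>

lemma vector_space_pscl: "vector_space s \<Longrightarrow> vector_space (pscl s)"
  by (auto simp: vector_space_def pscl_def fun_eq_iff)

context vector_space
begin

lemma finite_basis_of_subspace:
  assumes "subspace V" "finite S" "V \<subseteq> span S"
  obtains B where "finite B" "B \<subseteq> V" "independent B" "span B = V"
proof -
  obtain B where B: "B \<subseteq> V" "independent B" "V \<subseteq> span B"
    using maximal_independent_subset [of V] by metis
  have "finite B"
    using independent_span_bound [OF assms(2) B(2)] B(1) assms(3) by blast
  moreover have "span B = V"
    using B assms(1) span_minimal by blast
  ultimately show ?thesis using that B by blast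
qed

lemma lin_on_zero:
  assumes "subspace V" "lin_on scale V t W T" "vector_space t"
  shows "T 0 = 0"
proof -
  interpret t: vector_space t by fact
  have "T (scale 0 0) = t 0 (T 0)"
    using assms(2) subspace_0 [OF assms(1)] unfolding lin_on_def by blast
  then show ?thesis by simp
qed

lemma lin_on_sum:
  assumes "subspace V" "lin_on scale V t W T" "vector_space t" "\<And>i. i \<in> I \<Longrightarrow> f i \<in> V"
  shows "T (\<Sum>i\<in>I. f i) = (\<Sum>i\<in>I. T (f i))"
  using assms(4)
proof (induction I rule: infinite_finite_induct)
  case (insert i I)
  have "(\<Sum>i\<in>I. f i) \<in> V"
    using insert.prems by (intro subspace_sum [OF assms(1)]) auto
  then have "T (f i + (\<Sum>i\<in>I. f i)) = T (f i) + T (\<Sum>i\<in>I. f i)"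
    using assms(2) insert.prems unfolding lin_on_def by blast
  then show ?case using insert by simp
qed (simp_all add: lin_on_zero [OF assms(1-3)])

lemma lin_on_diff:
  assumes "subspace V" "lin_on scale V t W T" "vector_space t" "v \<in> V" "w \<in> V"
  shows "T (v - w) = T v - T w"
proof -
  have "T ((v - w) + w) = T (v - w) + T w"
    using assms unfolding lin_on_def by (metis subspace_diff)
  then show ?thesis by simp
qed

text \<open>Every inverse below comes from here: an injective multiplication map on a
  finite-dimensional algebra or ideal hits the element that is to be inverted or reproduced.\<close>

lemma lin_on_inj_imp_surj:
  assumes V: "subspace V" "finite S" "V \<subseteq> span S"
    and L: "lin_on scale V scale V L" "\<And>v. v \<in> V \<Longrightarrow> L v = 0 \<Longrightarrow> v = 0"
    and y: "y \<in> V"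
  shows "\<exists>x\<in>V. L x = y"
proof -
  obtain B where B: "finite B" "B \<subseteq> V" "independent B" "span B = V"
    using finite_basis_of_subspace [OF V] .
  have sp: "\<exists>x\<in>V. L x = z" if "z \<in> span (L ` B)" for z
    using that
  proof (induction rule: span_induct_alt)
    case base
    then show ?case using lin_on_zero [OF V(1) L(1) vector_space_axioms] subspace_0 [OF V(1)] by blast
  next
    case (step c x y)
    then obtain b u where "b \<in> B" "x = L b" "u \<in> V" "y = L u" by auto
    then have "L (scale c b + u) = scale c x + y"
      using L(1) B(2) V(1) by (auto simp: lin_on_def subspace_scale subsetD)
    moreover have "scale c b + u \<in> V"
      using \<open>b \<in> B\<close> \<open>u \<in> V\<close> B(2) V(1) by (auto intro!: subspace_add subspace_scale)
    ultimately show ?case by blast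
  qed
  have inj: "inj_on L V"
  proof (rule inj_onI)
    fix u v assume uv: "u \<in> V" "v \<in> V" "L u = L v"
    then have "L (u - v) = 0"
      using lin_on_diff [OF V(1) L(1) vector_space_axioms] by simp
    then show "u = v" using L(2) uv subspace_diff [OF V(1)] by fastforce
  qed
  have injB: "inj_on L B" using inj B(2) by (rule inj_on_subset)
  have ind: "independent (L ` B)"
  proof (rule independent_if_scalars_zero)
    show "finite (L ` B)" using B by simp
    fix f x assume f: "(\<Sum>x\<in>L ` B. scale (f x) x) = 0" and x: "x \<in> L ` B"
    have "L (\<Sum>b\<in>B. scale (f (L b)) b) = (\<Sum>b\<in>B. L (scale (f (L b)) b))"
      using B(2) V(1) by (intro lin_on_sum [OF V(1) L(1) vector_space_axioms] subspace_scale) auto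
    also have "\<dots> = (\<Sum>b\<in>B. scale (f (L b)) (L b))"
      using B(2) L(1) by (intro sum.cong) (auto simp: lin_on_def)
    also have "\<dots> = 0" using f by (simp add: sum.reindex [OF injB])
    finally have "L (\<Sum>b\<in>B. scale (f (L b)) b) = 0" .
    moreover have "(\<Sum>b\<in>B. scale (f (L b)) b) \<in> V"
      using B(2) V(1) by (auto intro!: subspace_sum subspace_scale)
    ultimately have "(\<Sum>b\<in>B. scale (f (L b)) b) = 0" by (rule L(2) [rotated])
    then have "\<forall>b\<in>B. f (L b) = 0"
      using B(1,3) independentD by (metis order_refl)
    then show "f x = 0" using x by auto
  qed
  have "y \<in> span (L ` B)"
  proof (rule ccontr)
    assume ny: "y \<notin> span (L ` B)"
    \<comment> \<open>Otherwise \<open>y\<close> and the image of \<open>B\<close> would be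
      \<open>card B + 1\<close> independent vectors in the span of \<open>B\<close>.\<close>
    then have "independent (insert y (L ` B))"
      using ind by (simp add: independent_insert)
    moreover have "insert y (L ` B) \<subseteq> span B"
      using y B L(1) by (auto simp: lin_on_def)
    ultimately have "card (insert y (L ` B)) \<le> card B"
      using independent_span_bound [OF B(1)] by blast
    moreover have "y \<notin> L ` B" using ny span_base by blast
    ultimately show False using B(1) card_image [OF injB] by simp
  qed
  then show ?thesis by (rule sp)
qed

end

section \<open>Norms on finite-dimensional subspaces: completeness and equivalence\<close>

definition normed_on :: "('f::rc_field \<Rightarrow> 'v \<Rightarrow> 'v) \<Rightarrow> 'v::ab_group_add set \<Rightarrow> ('v \<Rightarrow> real) \<Rightarrow> bool" where
  "normed_on s V N \<longleftrightarrow> (\<forall>x\<in>V. 0 \<le> N x) \<and> (\<forall>x\<in>V. N x = 0 \<longrightarrow> x = 0)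
     \<and> (\<forall>x\<in>V. \<forall>y\<in>V. N (x + y) \<le> N x + N y) \<and> (\<forall>c. \<forall>x\<in>V. N (s c x) = norm c * N x)"

locale rc_vector_space = vector_space scale for scale :: "'f::rc_field \<Rightarrow> 'v::ab_group_add \<Rightarrow> 'v"
begin

lemma normed_on_0:
  assumes "subspace V" "normed_on scale V N"
  shows "N 0 = 0"
proof -
  have "N (scale 0 0) = 0"
    using assms subspace_0 [OF assms(1)] unfolding normed_on_def by (metis mult_zero_left norm_zero)
  then show ?thesis by simp
qed

lemma normed_on_diff:
  assumes "subspace V" "normed_on scale V N" "x \<in> V" "y \<in> V"
  shows "N (x - y) \<le> N x + N y" "N (x - y) = N (y - x)"
proof -
  have *: "N (- z) = N z" if "z \<in> V" for z
  proof -
    have "N (scale (- 1) z) = norm (- 1 :: 'f) * N z"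
      using assms that unfolding normed_on_def by blast
    then show ?thesis by simp
  qed
  have "- y \<in> V" using subspace_neg [OF assms(1,4)] .
  then have "N (x + - y) \<le> N x + N (- y)"
    using assms unfolding normed_on_def by blast
  then show "N (x - y) \<le> N x + N y" using * [OF assms(4)] by simp
  show "N (x - y) = N (y - x)"
    using * [of "y - x"] subspace_diff [OF assms(1) assms(4,3)] by simp
qed

lemma normed_on_subset: "normed_on scale V N \<Longrightarrow> W \<subseteq> V \<Longrightarrow> normed_on scale W N"
  unfolding normed_on_def by blast

definition complete_on :: "'v set \<Rightarrow> ('v \<Rightarrow> real) \<Rightarrow> bool" where
  "complete_on V N \<longleftrightarrow> (\<forall>s :: nat \<Rightarrow> 'v. (\<forall>n. s n \<in> V) \<longrightarrow>
     (\<forall>e>0. \<exists>M. \<forall>m\<ge>M. \<forall>n\<ge>M. N (s m - s n) < e) \<longrightarrow> (\<exists>l\<in>V. (\<lambda>n. N (s n - l)) \<longlonglongrightarrow> 0))"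

text \<open>A complete subspace is closed, so \<open>b\<close> has a positive distance
  \<open>d\<close> from \<open>V\<close>; rescaling turns this distance into a bound on the
  coordinate along \<open>b\<close>.\<close>

lemma coordinate_bounded:
  assumes V: "subspace V" "complete_on V N" and b: "b \<notin> V"
    and N: "subspace W" "normed_on scale W N" "V \<subseteq> W" "b \<in> W"
  shows "\<exists>d>0. \<forall>w\<in>V. \<forall>c. norm c * d \<le> N (w + scale c b)"
proof -
  have "\<exists>d>0. \<forall>w\<in>V. d \<le> N (b - w)"
  proof (rule ccontr)
    assume "\<not> ?thesis"
    then have "\<forall>n. \<exists>w\<in>V. N (b - w) < 1 / real (Suc n)"
      by (metis not_le of_nat_0_less_iff zero_less_Suc zero_less_divide_1_iff)
    \<comment> \<open>At distance 0 the approximants of \<open>b\<close> form a Cauchy sequence in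
      \<open>V\<close>, whose limit in \<open>V\<close> would have to be \<open>b\<close>.\<close>
    then obtain s where s: "\<And>n. s n \<in> V" "\<And>n. N (b - s n) < 1 / real (Suc n)"
      by metis
    have sW: "s n \<in> W" "b - s n \<in> W" for n
      using s(1) [of n] N by (auto intro: subspace_diff)
    have "\<exists>M. \<forall>m\<ge>M. \<forall>n\<ge>M. N (s m - s n) < e" if "e > 0" for e
    proof -
      obtain M where M: "1 / real (Suc M) < e / 2"
        using nat_approx_posE [OF half_gt_zero [OF \<open>e > 0\<close>]] .
      have "N (s m - s n) < e" if "m \<ge> M" "n \<ge> M" for m n
      proof -
        have "N (s m - s n) = N ((b - s n) - (b - s m))" by simp
        also have "\<dots> \<le> N (b - s n) + N (b - s m)"
          using sW N by (intro normed_on_diff(1)) auto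
        also have "\<dots> < 1 / real (Suc n) + 1 / real (Suc m)"
          using s(2) [of n] s(2) [of m] by simp
        also have "\<dots> \<le> 1 / real (Suc M) + 1 / real (Suc M)"
          using that by (intro add_mono divide_left_mono) auto
        finally show ?thesis using M by simp
      qed
      then show ?thesis by blast
    qed
    then obtain l where l: "l \<in> V" "(\<lambda>n. N (s n - l)) \<longlonglongrightarrow> 0"
      using V(2) s(1) unfolding complete_on_def by blast
    have lim: "(\<lambda>n. 1 / real (Suc n) + N (s n - l)) \<longlonglongrightarrow> 0"
      using tendsto_add [OF LIMSEQ_inverse_real_of_nat l(2)] by (simp add: inverse_eq_divide)
    have "N (b - l) \<le> 1 / real (Suc n) + N (s n - l)" for n
    proof -
      have "N (b - l) = N ((b - s n) + (s n - l))" by simp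
      also have "\<dots> \<le> N (b - s n) + N (s n - l)"
        using N(2) sW l(1) N(1,3) unfolding normed_on_def by (meson subsetD subspace_diff)
      finally show ?thesis using s(2) [of n] by simp
    qed
    then have "N (b - l) \<le> 0"
      by (intro LIMSEQ_le_const [OF lim]) auto
    moreover have bl: "b - l \<in> W" using N l(1) by (auto intro: subspace_diff)
    ultimately have "b - l = 0" using N(2) unfolding normed_on_def
      by (meson dual_order.antisym)
    then show False using b l(1) by simp
  qed
  then obtain d where d: "d > 0" "\<And>w. w \<in> V \<Longrightarrow> d \<le> N (b - w)" by blast
  have "norm c * d \<le> N (w + scale c b)" if w: "w \<in> V" for w c
  proof (cases "c = 0")
    case True
    then show ?thesis using N w unfolding normed_on_def by auto
  next
    case False
    \<comment> \<open>Since w + c b = c (b - u), the claim is the distance estimate at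
      \<open>u\<close>, scaled by \<open>c\<close>.\<close>
    let ?u = "scale (- 1 / c) w"
    have u: "?u \<in> V" using V(1) w by (rule subspace_scale)
    have "scale c (b - ?u) = w + scale c b"
      using False by (simp add: scale_right_diff_distrib scale_right_distrib add.commute)
    moreover have "N (scale c (b - ?u)) = norm c * N (b - ?u)"
      using N u unfolding normed_on_def by (meson subsetD subspace_diff)
    ultimately show ?thesis using d(2) [OF u] by (simp add: mult_left_mono)
  qed
  then show ?thesis using d(1) by blast
qed

text \<open>Induction on the spanning set: by \<open>coordinate_bounded\<close> the coordinates
  along the new vector are Cauchy in the complete scalar field, and what remains is Cauchy in the
  smaller span.\<close>

lemma finite_span_complete:
  assumes "finite S" "normed_on scale (span S) N"
  shows "complete_on (span S) N"
  using assms
proof (induction S)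
  case empty
  have "N 0 = 0" using normed_on_0 [OF subspace_span empty] .
  then show ?case unfolding complete_on_def by auto
next
  case (insert b S)
  show ?case
  proof (cases "b \<in> span S")
    case True
    then show ?thesis using insert span_redundant [OF True] by simp
  next
    case False
    let ?W = "span (insert b S)"
    have sub: "span S \<subseteq> ?W" by (rule span_mono) auto
    have bW: "b \<in> ?W" by (rule span_base) simp
    have cS: "complete_on (span S) N"
      using insert normed_on_subset [OF _ sub] by blast
    obtain d where d: "d > 0" "\<And>w c. w \<in> span S \<Longrightarrow> norm c * d \<le> N (w + scale c b)"
      using coordinate_bounded [OF subspace_span cS False subspace_span insert.prems sub bW] by blast
    show ?thesis
      unfolding complete_on_def
    proof (intro allI impI)
      fix s :: "nat \<Rightarrow> 'v"
      assume sW: "\<forall>n. s n \<in> ?W" and cau: "\<forall>e>0. \<exists>M. \<forall>m\<ge>M. \<forall>n\<ge>M. N (s m - s n) < e"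
      have "\<forall>n. \<exists>k. s n - scale k b \<in> span S"
        using sW by (simp add: span_insert)
      then obtain c where c: "\<And>n. s n - scale (c n) b \<in> span S" by metis
      define w where "w = (\<lambda>n. s n - scale (c n) b)"
      have wS: "w n \<in> span S" for n using c by (simp add: w_def)
      have dif: "s m - s n = (w m - w n) + scale (c m - c n) b" for m n
        by (simp add: w_def scale_left_diff_distrib)
      have cb: "norm (c m - c n) * d \<le> N (s m - s n)" for m n
        unfolding dif by (rule d(2)) (simp add: span_diff wS)
      have "Cauchy c"
      proof (rule CauchyI)
        fix e :: real assume "e > 0"
        then obtain M where M: "\<forall>m\<ge>M. \<forall>n\<ge>M. N (s m - s n) < e * d"
          using cau d(1) by (meson mult_pos_pos)
        have "norm (c m - c n) < e" if "m \<ge> M" "n \<ge> M" for m n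
        proof -
          have "norm (c m - c n) * d < e * d" using M cb [of m n] that by fastforce
          then show ?thesis using d(1) by simp
        qed
        then show "\<exists>M. \<forall>m\<ge>M. \<forall>n\<ge>M. norm (c m - c n) < e" by blast
      qed
      then obtain k where k: "c \<longlonglongrightarrow> k" using Cauchy_convergent convergent_def by blast
      have tri: "N (x + y) \<le> N x + N y" if "x \<in> ?W" "y \<in> ?W" for x y
        using insert.prems that unfolding normed_on_def by blast
      have sc: "N (scale a b) = norm a * N b" for a
        using insert.prems bW unfolding normed_on_def by blast
      have scb: "scale a b \<in> ?W" for a using bW by (rule span_scale)
      have wW: "w m \<in> ?W" for m using wS sub by blast
      have Nb: "0 \<le> N b" using insert.prems bW unfolding normed_on_def by blast
      have "\<exists>M. \<forall>m\<ge>M. \<forall>n\<ge>M. N (w m - w n) < e" if e: "e > 0" for e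
      proof -
        obtain M1 where M1: "\<And>m n. m \<ge> M1 \<Longrightarrow> n \<ge> M1 \<Longrightarrow> N (s m - s n) < e / 2"
          using cau e by (meson half_gt_zero)
        \<comment> \<open>Adding 1 keeps the divisor positive without a discussion of
          \<open>N b\<close>.\<close>
        have "0 < e / 2 / (N b + 1)" using e Nb by simp
        then obtain M2 where M2: "\<And>m n. m \<ge> M2 \<Longrightarrow> n \<ge> M2 \<Longrightarrow> norm (c m - c n) < e / 2 / (N b + 1)"
          using CauchyD [OF \<open>Cauchy c\<close>] by blast
        have "N (w m - w n) < e" if "m \<ge> max M1 M2" "n \<ge> max M1 M2" for m n
        proof -
          have "N (w m - w n) = N ((s m - s n) - scale (c m - c n) b)"
            using dif [of m n] by simp
          also have "\<dots> \<le> N (s m - s n) + N (scale (c m - c n) b)"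
            using sW scb by (intro normed_on_diff [OF subspace_span insert.prems] span_diff) auto
          also have "\<dots> = N (s m - s n) + norm (c m - c n) * N b" using sc by simp
          also have "norm (c m - c n) * N b \<le> norm (c m - c n) * (N b + 1)"
            by (simp add: mult_left_mono)
          also have "\<dots> < e / 2"
            using M2 [of m n] that Nb by (simp add: field_simps)
          finally show ?thesis using M1 [of m n] that by simp
        qed
        then show ?thesis by blast
      qed
      then obtain l where l: "l \<in> span S" "(\<lambda>n. N (w n - l)) \<longlonglongrightarrow> 0"
        using cS wS unfolding complete_on_def by blast
      have lW: "l + scale k b \<in> ?W" using l(1) sub scb by (auto intro: span_add)
      have lim: "(\<lambda>n. N (w n - l) + norm (c n - k) * N b) \<longlonglongrightarrow> 0 + 0 * N b"
        using k by (intro tendsto_intros l(2)) (simp add: LIM_zero tendsto_norm_zero)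
      have bnd: "0 \<le> N (s n - (l + scale k b)) \<and>
          N (s n - (l + scale k b)) \<le> N (w n - l) + norm (c n - k) * N b" for n
      proof
        show "0 \<le> N (s n - (l + scale k b))"
          using insert.prems sW lW span_diff unfolding normed_on_def by blast
        have "s n - (l + scale k b) = (w n - l) + scale (c n - k) b"
          by (simp add: w_def scale_left_diff_distrib)
        then show "N (s n - (l + scale k b)) \<le> N (w n - l) + norm (c n - k) * N b"
          using tri [of "w n - l" "scale (c n - k) b"] scb wW l(1) sub sc
          by (metis span_diff subsetD)
      qed
      have "(\<lambda>n. N (s n - (l + scale k b))) \<longlonglongrightarrow> 0"
      proof (rule tendsto_sandwich)
        show "\<forall>\<^sub>F n in sequentially. 0 \<le> N (s n - (l + scale k b))"
          using bnd by (intro always_eventually) blast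
        show "\<forall>\<^sub>F n in sequentially. N (s n - (l + scale k b)) \<le> N (w n - l) + norm (c n - k) * N b"
          using bnd by (intro always_eventually) blast
      qed (use lim in simp_all)
      then show "\<exists>l\<in>?W. (\<lambda>n. N (s n - l)) \<longlonglongrightarrow> 0" using lW by blast
    qed
  qed
qed

text \<open>The same induction: in x = w + c b both \<open>w\<close> and \<open>c\<close> are
  controlled by \<open>N x\<close>, again because \<open>b\<close> has positive distance from the
  smaller span.\<close>

lemma finite_span_norms_equivalent:
  assumes "finite S" "normed_on scale (span S) N" "normed_on scale (span S) N'"
  shows "\<exists>C>0. \<forall>x\<in>span S. N' x \<le> C * N x"
  using assms
proof (induction S)
  case empty
  have "N 0 = 0" "N' 0 = 0"
    using normed_on_0 [OF subspace_span] empty by blast+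
  then show ?case by (intro exI [of _ 1]) auto
next
  case (insert b S)
  show ?case
  proof (cases "b \<in> span S")
    case True
    then show ?thesis using insert span_redundant [OF True] by simp
  next
    case False
    let ?W = "span (insert b S)"
    have sub: "span S \<subseteq> ?W" by (rule span_mono) auto
    have bW: "b \<in> ?W" by (rule span_base) simp
    have cS: "complete_on (span S) N"
      using finite_span_complete insert normed_on_subset [OF _ sub] by blast
    obtain d where d: "d > 0" "\<And>w c. w \<in> span S \<Longrightarrow> norm c * d \<le> N (w + scale c b)"
      using coordinate_bounded [OF subspace_span cS False subspace_span insert.prems(1) sub bW] by blast
    obtain C where C: "C > 0" "\<And>x. x \<in> span S \<Longrightarrow> N' x \<le> C * N x"
      using insert normed_on_subset [OF _ sub] by meson
    have Nb: "0 \<le> N b" "0 \<le> N' b" using insert.prems bW unfolding normed_on_def by blast+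
    \<comment> \<open>The constant collects \<open>N' w \<le> C * N w\<close>,
      \<open>N w \<le> N x + norm c * N b\<close> and \<open>norm c \<le> N x / d\<close>.\<close>
    have "N' x \<le> (C + (C * N b + N' b) / d) * N x" if xW: "x \<in> ?W" for x
    proof -
      obtain c where c: "x - scale c b \<in> span S" using xW by (auto simp: span_insert)
      define w where "w = x - scale c b"
      have w: "w \<in> span S" "x = w + scale c b" using c by (auto simp: w_def)
      have scb: "scale c b \<in> ?W" using bW by (rule span_scale)
      have "N' x \<le> N' w + N' (scale c b)"
        unfolding w(2) using insert.prems(2) w(1) sub scb unfolding normed_on_def by blast
      also have "N' (scale c b) = norm c * N' b"
        using insert.prems(2) bW unfolding normed_on_def by blast
      also have "N' w \<le> C * N w" using C w by blast
      also have "N w = N (x - scale c b)" by (simp add: w_def)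
      also have "\<dots> \<le> N x + N (scale c b)"
        using normed_on_diff [OF subspace_span insert.prems(1)] xW scb by blast
      also have "N (scale c b) = norm c * N b"
        using insert.prems(1) bW unfolding normed_on_def by blast
      finally have "N' x \<le> C * N x + norm c * (C * N b + N' b)"
        using C(1) by (simp add: algebra_simps)
      also have "norm c * (C * N b + N' b) \<le> N x / d * (C * N b + N' b)"
        using d(2) [OF w(1), of c] d(1) w(2) C(1) Nb
        by (intro mult_right_mono) (simp_all add: field_simps)
      finally show ?thesis by (simp add: algebra_simps add_divide_distrib)
    qed
    moreover have "C + (C * N b + N' b) / d > 0" using C(1) Nb d(1) by (simp add: add_pos_nonneg)
    ultimately show ?thesis by blast
  qed
qed

end

subsection \<open>Inner product spaces and bounded operators\<close>

text \<open>Leaving completeness out makes direct sums and induced spaces instances without a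
  completeness argument. Adjoints are always exhibited explicitly, never obtained from a
  representation theorem.\<close>

locale prehilbert =
  fixes K :: "('f::rc_field, 'v::ab_group_add) hilb"
  assumes vector_space: "vector_space (hscl K)"
    and subspace: "module.subspace (hscl K) (hcar K)"
    and inner_add: "\<lbrakk>u \<in> hcar K; v \<in> hcar K; w \<in> hcar K\<rbrakk> \<Longrightarrow>
          hinner K (u + v) w = hinner K u w + hinner K v w"
    and inner_scale: "\<lbrakk>v \<in> hcar K; w \<in> hcar K\<rbrakk> \<Longrightarrow> hinner K (hscl K c v) w = c * hinner K v w"
    and inner_conj: "\<lbrakk>v \<in> hcar K; w \<in> hcar K\<rbrakk> \<Longrightarrow> hinner K w v = fconj (hinner K v w)"
    and inner_nonneg: "v \<in> hcar K \<Longrightarrow> \<exists>r\<ge>0. hinner K v v = of_real r"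
    and inner_definite: "\<lbrakk>v \<in> hcar K; hinner K v v = 0\<rbrakk> \<Longrightarrow> v = 0"

lemma hilbert_space_prehilbert: "hilbert_space K \<Longrightarrow> prehilbert K"
  unfolding hilbert_space_def prehilbert_def by blast

definition opn :: "('f::rc_field, 'v::ab_group_add) hilb \<Rightarrow> ('v \<Rightarrow> 'v) \<Rightarrow> real" where
  "opn K T = Sup {hnorm K (T v) | v. v \<in> hcar K \<and> hnorm K v \<le> 1}"

context prehilbert
begin

sublocale vs: rc_vector_space "hscl K"
  unfolding rc_vector_space_def by (rule vector_space)

sublocale vso: rc_vector_space "pscl (hscl K)"
  unfolding rc_vector_space_def by (rule vector_space_pscl [OF vector_space])

lemmas car_simps [simp] = vs.subspace_0 [OF subspace] vs.subspace_add [OF subspace]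
  vs.subspace_scale [OF subspace] vs.subspace_diff [OF subspace] vs.subspace_neg [OF subspace]

lemma car_sum [simp]: "(\<And>i. i \<in> I \<Longrightarrow> f i \<in> hcar K) \<Longrightarrow> (\<Sum>i\<in>I. f i) \<in> hcar K"
  by (rule vs.subspace_sum [OF subspace])

lemma inner_add_right: "\<lbrakk>u \<in> hcar K; v \<in> hcar K; w \<in> hcar K\<rbrakk> \<Longrightarrow>
    hinner K w (u + v) = hinner K w u + hinner K w v"
  using inner_conj [of "u + v" w] inner_conj [of u w] inner_conj [of v w]
  by (simp add: inner_add fconj_add)

lemma inner_scale_right: "\<lbrakk>v \<in> hcar K; w \<in> hcar K\<rbrakk> \<Longrightarrow>
    hinner K w (hscl K c v) = fconj c * hinner K w v"
  using inner_conj [of "hscl K c v" w] inner_conj [of v w]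
  by (simp add: inner_scale fconj_mult)

lemma inner_zero [simp]: "v \<in> hcar K \<Longrightarrow> hinner K 0 v = 0" "v \<in> hcar K \<Longrightarrow> hinner K v 0 = 0"
  using inner_scale [of 0 v 0] inner_scale_right [of 0 v 0] by simp_all

lemma inner_sum: "\<lbrakk>\<And>i. i \<in> I \<Longrightarrow> f i \<in> hcar K; w \<in> hcar K\<rbrakk> \<Longrightarrow>
    hinner K (\<Sum>i\<in>I. f i) w = (\<Sum>i\<in>I. hinner K (f i) w)"
  by (induction I rule: infinite_finite_induct) (simp_all add: inner_add)

lemma inner_sum_right: "\<lbrakk>\<And>i. i \<in> I \<Longrightarrow> f i \<in> hcar K; w \<in> hcar K\<rbrakk> \<Longrightarrow>
    hinner K w (\<Sum>i\<in>I. f i) = (\<Sum>i\<in>I. hinner K w (f i))"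
  by (induction I rule: infinite_finite_induct) (simp_all add: inner_add_right)

lemma hnorm_nonneg [simp]: "0 \<le> hnorm K v"
  by (simp add: hnorm_def)

lemma inner_self: "v \<in> hcar K \<Longrightarrow> hinner K v v = of_real ((hnorm K v)\<^sup>2)"
  using inner_nonneg [of v] by (auto simp: hnorm_def)

lemma hnorm_0 [simp]: "hnorm K 0 = 0"
  by (simp add: hnorm_def)

lemma hnorm_eq_0: "v \<in> hcar K \<Longrightarrow> hnorm K v = 0 \<longleftrightarrow> v = 0"
  using inner_self [of v] inner_definite [of v] by auto

lemma hnorm_scale: "v \<in> hcar K \<Longrightarrow> hnorm K (hscl K c v) = norm c * hnorm K v"
  by (simp add: hnorm_def inner_scale inner_scale_right norm_mult real_sqrt_mult)

lemma hnorm_add_sq: "\<lbrakk>v \<in> hcar K; w \<in> hcar K\<rbrakk> \<Longrightarrow>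
    (hnorm K (v + w))\<^sup>2 = (hnorm K v)\<^sup>2 + 2 * re (hinner K v w) + (hnorm K w)\<^sup>2"
proof -
  assume vw: "v \<in> hcar K" "w \<in> hcar K"
  have "of_real ((hnorm K (v + w))\<^sup>2) = hinner K (v + w) (v + w)"
    using vw by (simp add: inner_self)
  also have "\<dots> = hinner K v v + (hinner K v w + fconj (hinner K v w)) + hinner K w w"
    using vw by (simp add: inner_add inner_add_right inner_conj [of v w])
  also have "\<dots> = of_real ((hnorm K v)\<^sup>2 + 2 * re (hinner K v w) + (hnorm K w)\<^sup>2)"
    unfolding add_fconj using vw by (simp add: inner_self)
  finally show ?thesis unfolding of_real_eq_iff .
qed

lemma cauchy_schwarz: "\<lbrakk>v \<in> hcar K; w \<in> hcar K\<rbrakk> \<Longrightarrow> norm (hinner K v w) \<le> hnorm K v * hnorm K w"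
proof (cases "w = 0")
  case False
  assume vw: "v \<in> hcar K" "w \<in> hcar K"
  define b where "b = (hnorm K w)\<^sup>2"
  define z where "z = hinner K v w"
  have b: "b > 0" using False vw hnorm_eq_0 [of w] by (simp add: b_def)
  \<comment> \<open>This \<open>c\<close> minimizes the norm of v + c w; that the minimum is
    nonnegative is the inequality.\<close>
  define c where "c = - z / of_real b"
  have "hinner K v (hscl K c w) = fconj c * z"
    using vw by (simp add: inner_scale_right z_def)
  also have "\<dots> = of_real (- 1 / b) * (fconj z * z)"
    by (simp add: c_def fconj_divide fconj_minus)
  finally have "re (hinner K v (hscl K c w)) = re (of_real (- 1 / b) * (fconj z * z))"
    by simp
  also have "\<dots> = - (norm z)\<^sup>2 / b"
    unfolding mult.commute [of "fconj z"] mult_fconj' re_of_real_mult re_of_real by simp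
  finally have "(hnorm K (v + hscl K c w))\<^sup>2 = (hnorm K v)\<^sup>2 + 2 * (- (norm z)\<^sup>2 / b) + (norm c)\<^sup>2 * b"
    using vw by (simp add: hnorm_add_sq hnorm_scale power_mult_distrib b_def)
  also have "(norm c)\<^sup>2 * b = (norm z)\<^sup>2 / b"
    using b by (simp add: c_def norm_divide power_divide power2_eq_square)
  finally have "(norm z)\<^sup>2 / b \<le> (hnorm K v)\<^sup>2"
    using zero_le_power2 [of "hnorm K (v + hscl K c w)"] by linarith
  then have "(norm z)\<^sup>2 \<le> (hnorm K v * hnorm K w)\<^sup>2"
    using b by (simp add: field_simps b_def power_mult_distrib)
  then show ?thesis unfolding z_def by (rule power2_le_imp_le) simp
qed simp

lemma hnorm_triangle: "\<lbrakk>v \<in> hcar K; w \<in> hcar K\<rbrakk> \<Longrightarrow> hnorm K (v + w) \<le> hnorm K v + hnorm K w"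
proof (rule power2_le_imp_le)
  assume vw: "v \<in> hcar K" "w \<in> hcar K"
  have "re (hinner K v w) \<le> hnorm K v * hnorm K w"
    using abs_re_le [of "hinner K v w"] cauchy_schwarz [OF vw] by linarith
  then show "(hnorm K (v + w))\<^sup>2 \<le> (hnorm K v + hnorm K w)\<^sup>2"
    using vw by (simp add: hnorm_add_sq power2_sum)
qed simp

lemma hnorm_sum: "(\<And>i. i \<in> I \<Longrightarrow> f i \<in> hcar K) \<Longrightarrow> hnorm K (\<Sum>i\<in>I. f i) \<le> (\<Sum>i\<in>I. hnorm K (f i))"
proof (induction I rule: infinite_finite_induct)
  case (insert i I)
  then have "hnorm K (f i + (\<Sum>i\<in>I. f i)) \<le> hnorm K (f i) + hnorm K (\<Sum>i\<in>I. f i)"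
    by (intro hnorm_triangle) auto
  then show ?case using insert.IH insert.prems insert.hyps by (simp add: order_trans)
qed simp_all

section \<open>Bounded operators that vanish outside the carrier\<close>

lemma bops_car [simp]: "T \<in> bops K \<Longrightarrow> v \<in> hcar K \<Longrightarrow> T v \<in> hcar K"
  unfolding bops_def lin_on_def by blast

lemma bops_add: "T \<in> bops K \<Longrightarrow> v \<in> hcar K \<Longrightarrow> w \<in> hcar K \<Longrightarrow> T (v + w) = T v + T w"
  unfolding bops_def lin_on_def by blast

lemma bops_scale: "T \<in> bops K \<Longrightarrow> v \<in> hcar K \<Longrightarrow> T (hscl K c v) = hscl K c (T v)"
  unfolding bops_def lin_on_def by blast

lemma bops_outside: "T \<in> bops K \<Longrightarrow> v \<notin> hcar K \<Longrightarrow> T v = 0"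
  unfolding bops_def by blast

lemma bops_0 [simp]: "T \<in> bops K \<Longrightarrow> T 0 = 0"
  using bops_scale [of T 0 0] by simp

lemma bops_diff: "T \<in> bops K \<Longrightarrow> v \<in> hcar K \<Longrightarrow> w \<in> hcar K \<Longrightarrow> T (v - w) = T v - T w"
  using bops_add [of T "v - w" w] by simp

lemma bops_sum: "T \<in> bops K \<Longrightarrow> (\<And>i. i \<in> I \<Longrightarrow> f i \<in> hcar K) \<Longrightarrow> T (\<Sum>i\<in>I. f i) = (\<Sum>i\<in>I. T (f i))"
  by (induction I rule: infinite_finite_induct) (simp_all add: bops_add)

lemma bops_eqI: "\<lbrakk>S \<in> bops K; T \<in> bops K; \<And>v. v \<in> hcar K \<Longrightarrow> S v = T v\<rbrakk> \<Longrightarrow> S = T"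
  by (rule ext) (metis bops_outside)

lemma bops_bound:
  assumes "T \<in> bops K"
  obtains B where "B \<ge> 0" "\<And>v. v \<in> hcar K \<Longrightarrow> hnorm K (T v) \<le> B * hnorm K v"
proof -
  obtain B where B: "\<And>v. v \<in> hcar K \<Longrightarrow> hnorm K (T v) \<le> B * hnorm K v"
    using assms by (auto simp: bops_def)
  have "hnorm K (T v) \<le> max B 0 * hnorm K v" if "v \<in> hcar K" for v
    using B [OF that] mult_right_mono [of B "max B 0" "hnorm K v"] by simp
  then show ?thesis using that [of "max B 0"] by simp
qed

lemma bopsI:
  assumes "\<And>v. v \<in> hcar K \<Longrightarrow> T v \<in> hcar K"
    and "\<And>v w. v \<in> hcar K \<Longrightarrow> w \<in> hcar K \<Longrightarrow> T (v + w) = T v + T w"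
    and "\<And>c v. v \<in> hcar K \<Longrightarrow> T (hscl K c v) = hscl K c (T v)"
    and "\<And>v. v \<notin> hcar K \<Longrightarrow> T v = 0"
    and "\<And>v. v \<in> hcar K \<Longrightarrow> hnorm K (T v) \<le> B * hnorm K v"
  shows "T \<in> bops K"
  unfolding bops_def lin_on_def
  by (intro CollectI conjI ballI allI impI exI [of _ B]) (rule assms; assumption)+

lemma zero_bops [simp]: "0 \<in> bops K"
  by (rule bopsI [where B = 0]) simp_all

lemma comp_bops [simp]:
  assumes "S \<in> bops K" "T \<in> bops K"
  shows "S \<circ> T \<in> bops K"
proof -
  obtain B where B: "B \<ge> 0" "\<And>v. v \<in> hcar K \<Longrightarrow> hnorm K (S v) \<le> B * hnorm K v"
    using bops_bound [OF assms(1)] by blast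
  obtain C where C: "C \<ge> 0" "\<And>v. v \<in> hcar K \<Longrightarrow> hnorm K (T v) \<le> C * hnorm K v"
    using bops_bound [OF assms(2)] by blast
  show ?thesis
  proof (rule bopsI [where B = "B * C"])
    fix v assume v: "v \<in> hcar K"
    have "hnorm K (S (T v)) \<le> B * (C * hnorm K v)"
      using B(2) [of "T v"] mult_left_mono [OF C(2) [OF v] B(1)] assms v by simp
    then show "hnorm K ((S \<circ> T) v) \<le> B * C * hnorm K v" by simp
  qed (use assms in \<open>simp_all add: bops_add bops_scale bops_outside\<close>)
qed

lemma add_bops [simp]:
  assumes "S \<in> bops K" "T \<in> bops K"
  shows "S + T \<in> bops K"
proof -
  obtain B where B: "B \<ge> 0" "\<And>v. v \<in> hcar K \<Longrightarrow> hnorm K (S v) \<le> B * hnorm K v"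
    using bops_bound [OF assms(1)] by blast
  obtain C where C: "C \<ge> 0" "\<And>v. v \<in> hcar K \<Longrightarrow> hnorm K (T v) \<le> C * hnorm K v"
    using bops_bound [OF assms(2)] by blast
  show ?thesis
  proof (rule bopsI [where B = "B + C"])
    fix v assume v: "v \<in> hcar K"
    show "hnorm K ((S + T) v) \<le> (B + C) * hnorm K v"
      using B(2) [OF v] C(2) [OF v] hnorm_triangle [of "S v" "T v"] assms v
      by (simp add: distrib_right)
  qed (use assms in \<open>simp_all add: bops_add bops_scale bops_outside algebra_simps
      vs.scale_right_distrib\<close>)
qed

lemma scale_bops [simp]:
  assumes "T \<in> bops K"
  shows "pscl (hscl K) c T \<in> bops K"
proof -
  obtain B where B: "B \<ge> 0" "\<And>v. v \<in> hcar K \<Longrightarrow> hnorm K (T v) \<le> B * hnorm K v"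
    using bops_bound [OF assms] by blast
  show ?thesis
  proof (rule bopsI [where B = "norm c * B"])
    fix v assume v: "v \<in> hcar K"
    show "hnorm K (pscl (hscl K) c T v) \<le> norm c * B * hnorm K v"
      using mult_left_mono [OF B(2) [OF v], of "norm c"] assms v
      by (simp add: pscl_def hnorm_scale mult.assoc)
  qed (use assms in \<open>simp_all add: pscl_def bops_add bops_scale bops_outside
      vs.scale_right_distrib vs.scale_left_commute\<close>)
qed

lemma subspace_bops: "vso.subspace (bops K)"
  by (rule vso.subspaceI) simp_all

lemma sum_bops [simp]: "(\<And>i. i \<in> I \<Longrightarrow> T i \<in> bops K) \<Longrightarrow> (\<Sum>i\<in>I. T i) \<in> bops K"
  by (rule vso.subspace_sum [OF subspace_bops])

section \<open>The operator norm\<close>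

lemma opn_bdd:
  assumes "T \<in> bops K"
  shows "bdd_above {hnorm K (T v) | v. v \<in> hcar K \<and> hnorm K v \<le> 1}"
proof -
  obtain B where B: "B \<ge> 0" "\<And>v. v \<in> hcar K \<Longrightarrow> hnorm K (T v) \<le> B * hnorm K v"
    using bops_bound [OF assms] by blast
  have "hnorm K (T v) \<le> B" if "v \<in> hcar K" "hnorm K v \<le> 1" for v
    using B(2) [OF that(1)] mult_left_mono [OF that(2) B(1)] by simp
  then show ?thesis by (intro bdd_aboveI [where M = B]) auto
qed

lemma opn_nonneg: "T \<in> bops K \<Longrightarrow> 0 \<le> opn K T"
  unfolding opn_def by (intro cSup_upper2 [OF _ _ opn_bdd]) (auto intro!: exI [of _ 0])

lemma opn_ub:
  assumes "T \<in> bops K" "v \<in> hcar K"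
  shows "hnorm K (T v) \<le> opn K T * hnorm K v"
proof (cases "v = 0")
  case False
  then have p: "hnorm K v > 0" using hnorm_eq_0 [OF assms(2)] hnorm_nonneg [of v] by linarith
  define w where "w = hscl K (of_real (1 / hnorm K v)) v"
  have w: "w \<in> hcar K" "hnorm K w = 1"
    using assms p by (simp_all add: w_def hnorm_scale norm_divide)
  then have "hnorm K (T w) \<le> opn K T"
    unfolding opn_def by (intro cSup_upper opn_bdd assms) auto
  moreover have "hnorm K (T w) = hnorm K (T v) / hnorm K v"
    using assms p by (simp add: w_def bops_scale hnorm_scale norm_divide)
  ultimately show ?thesis using p by (simp add: pos_divide_le_eq)
qed (use assms in simp)

lemma opn_least:
  assumes "0 \<le> c" "\<And>v. v \<in> hcar K \<Longrightarrow> hnorm K (T v) \<le> c * hnorm K v"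
  shows "opn K T \<le> c"
  unfolding opn_def
proof (rule cSup_least)
  show "{hnorm K (T v) | v. v \<in> hcar K \<and> hnorm K v \<le> 1} \<noteq> {}"
    by (auto intro!: exI [of _ 0])
  fix x assume "x \<in> {hnorm K (T v) | v. v \<in> hcar K \<and> hnorm K v \<le> 1}"
  then obtain v where v: "x = hnorm K (T v)" "v \<in> hcar K" "hnorm K v \<le> 1" by blast
  then show "x \<le> c" using assms(2) [OF v(2)] mult_left_mono [OF v(3) assms(1)] by simp
qed

lemma opn_approx:
  assumes "T \<in> bops K" "c < opn K T"
  shows "\<exists>v\<in>hcar K. hnorm K v \<le> 1 \<and> c < hnorm K (T v)"
proof -
  have "{hnorm K (T v) | v. v \<in> hcar K \<and> hnorm K v \<le> 1} \<noteq> {}"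
    by (auto intro!: exI [of _ 0])
  then show ?thesis using assms unfolding opn_def by (auto simp: less_cSup_iff opn_bdd)
qed

lemma opn_0 [simp]: "opn K 0 = 0"
  using opn_least [of 0 0] opn_nonneg [of 0] by simp

lemma opn_eq_0: "T \<in> bops K \<Longrightarrow> opn K T = 0 \<longleftrightarrow> T = 0"
proof
  assume T: "T \<in> bops K" "opn K T = 0"
  have "T v = 0" if "v \<in> hcar K" for v
    using opn_ub [OF T(1) that] T that hnorm_eq_0 [of "T v"] hnorm_nonneg [of "T v"] by simp
  then show "T = 0" using T by (intro bops_eqI) simp_all
qed simp

lemma opn_triangle: "S \<in> bops K \<Longrightarrow> T \<in> bops K \<Longrightarrow> opn K (S + T) \<le> opn K S + opn K T"
proof (rule opn_least)
  assume ST: "S \<in> bops K" "T \<in> bops K"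
  then show "0 \<le> opn K S + opn K T" by (simp add: opn_nonneg)
  fix v assume v: "v \<in> hcar K"
  show "hnorm K ((S + T) v) \<le> (opn K S + opn K T) * hnorm K v"
    using opn_ub [OF ST(1) v] opn_ub [OF ST(2) v] hnorm_triangle [of "S v" "T v"] ST v
    by (simp add: distrib_right)
qed

lemma opn_comp: "S \<in> bops K \<Longrightarrow> T \<in> bops K \<Longrightarrow> opn K (S \<circ> T) \<le> opn K S * opn K T"
proof (rule opn_least)
  assume ST: "S \<in> bops K" "T \<in> bops K"
  then show "0 \<le> opn K S * opn K T" by (simp add: opn_nonneg)
  fix v assume v: "v \<in> hcar K"
  show "hnorm K ((S \<circ> T) v) \<le> opn K S * opn K T * hnorm K v"
    using opn_ub [OF ST(1), of "T v"] mult_left_mono [OF opn_ub [OF ST(2) v] opn_nonneg [OF ST(1)]] ST v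
    by simp
qed

lemma opn_scale_le: "T \<in> bops K \<Longrightarrow> opn K (pscl (hscl K) c T) \<le> norm c * opn K T"
proof (rule opn_least)
  assume T: "T \<in> bops K"
  then show "0 \<le> norm c * opn K T" by (simp add: opn_nonneg)
  fix v assume v: "v \<in> hcar K"
  show "hnorm K (pscl (hscl K) c T v) \<le> norm c * opn K T * hnorm K v"
    using mult_left_mono [OF opn_ub [OF T v], of "norm c"] T v by (simp add: pscl_def hnorm_scale)
qed

lemma opn_scale: "T \<in> bops K \<Longrightarrow> opn K (pscl (hscl K) c T) = norm c * opn K T"
proof (cases "c = 0")
  case True
  then have "pscl (hscl K) c T = 0" by (simp add: pscl_def fun_eq_iff)
  then show ?thesis using True by simp
next
  case False
  assume T: "T \<in> bops K"
  have "T = pscl (hscl K) (1 / c) (pscl (hscl K) c T)"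
    using False by (simp add: pscl_def)
  then have "opn K T \<le> norm (1 / c) * opn K (pscl (hscl K) c T)"
    using opn_scale_le [of "pscl (hscl K) c T" "1 / c"] T by simp
  then have "norm c * opn K T \<le> opn K (pscl (hscl K) c T)"
    using False by (simp add: norm_divide field_simps)
  then show ?thesis using opn_scale_le [OF T, of c] by simp
qed

section \<open>Adjoint pairs and the \<open>C*\<close>-identity\<close>

lemma adjoint_pairD:
  "adjoint_pair K a b \<Longrightarrow> v \<in> hcar K \<Longrightarrow> w \<in> hcar K \<Longrightarrow> hinner K (a v) w = hinner K v (b w)"
  "adjoint_pair K a b \<Longrightarrow> a \<in> bops K" "adjoint_pair K a b \<Longrightarrow> b \<in> bops K"
  by (simp_all add: adjoint_pair_def)

lemma adjoint_sym: "adjoint_pair K a b \<Longrightarrow> adjoint_pair K b a"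
  unfolding adjoint_pair_def by (metis bops_car inner_conj)

lemma adjoint_comp: "adjoint_pair K a a' \<Longrightarrow> adjoint_pair K b b' \<Longrightarrow> adjoint_pair K (a \<circ> b) (b' \<circ> a')"
  by (simp add: adjoint_pair_def)

lemma adjoint_add: "adjoint_pair K a a' \<Longrightarrow> adjoint_pair K b b' \<Longrightarrow> adjoint_pair K (a + b) (a' + b')"
  by (simp add: adjoint_pair_def inner_add inner_add_right)

lemma adjoint_scale: "adjoint_pair K a a' \<Longrightarrow>
    adjoint_pair K (pscl (hscl K) c a) (pscl (hscl K) (fconj c) a')"
  by (simp add: adjoint_pair_def) (simp add: pscl_def inner_scale inner_scale_right)

lemma adjoint_diff:
  assumes "adjoint_pair K a a'" "adjoint_pair K b b'"
  shows "adjoint_pair K (a - b) (a' - b')"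
proof -
  have "x - y = x + pscl (hscl K) (- 1) y" for x y :: "'v \<Rightarrow> 'v"
    by (simp add: pscl_def fun_eq_iff)
  then show ?thesis
    using adjoint_add [OF assms(1) adjoint_scale [OF assms(2), of "- 1"]] by (simp add: fconj_minus)
qed

lemma adjoint_0: "adjoint_pair K 0 0"
  by (simp add: adjoint_pair_def)

lemma adjoint_sum: "(\<And>i. i \<in> I \<Longrightarrow> adjoint_pair K (a i) (b i)) \<Longrightarrow>
    adjoint_pair K (\<Sum>i\<in>I. a i) (\<Sum>i\<in>I. b i)"
  by (induction I rule: infinite_finite_induct) (simp_all add: adjoint_0 adjoint_add)

lemma eq_of_inner:
  assumes "u \<in> hcar K" "v \<in> hcar K" "\<And>w. w \<in> hcar K \<Longrightarrow> hinner K w u = hinner K w v"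
  shows "u = v"
proof -
  have "hinner K (u - v) ((u - v) + v) = hinner K (u - v) (u - v) + hinner K (u - v) v"
    using assms by (intro inner_add_right) auto
  then have "hinner K (u - v) (u - v) = 0" using assms by simp
  then show ?thesis using inner_definite [of "u - v"] assms by simp
qed

lemma adjoint_unique: "adjoint_pair K a b \<Longrightarrow> adjoint_pair K a b' \<Longrightarrow> b = b'"
  by (rule bops_eqI) (auto simp: adjoint_pair_def intro!: eq_of_inner)

text \<open>From |a v|^2 = <v, b a v> one gets |a|^2 \<le> |b a| \<le> |b| |a|, hence |a| \<le> |b|.
  Adjoint pairs are symmetric, so equality holds throughout.\<close>

lemma opn_cstar:
  assumes "adjoint_pair K a b"
  shows "opn K (b \<circ> a) = (opn K a)\<^sup>2" "opn K b = opn K a"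
proof -
  have le: "(opn K a)\<^sup>2 \<le> opn K (b \<circ> a)" if ab: "adjoint_pair K a b" for a b
  proof -
    have ba: "b \<circ> a \<in> bops K" "a \<in> bops K" using ab by (auto simp: adjoint_pair_def)
    have "hnorm K (a v) \<le> sqrt (opn K (b \<circ> a)) * hnorm K v" if v: "v \<in> hcar K" for v
    proof (rule power2_le_imp_le)
      have "of_real ((hnorm K (a v))\<^sup>2) = hinner K v (b (a v))"
        using inner_self [of "a v"] adjoint_pairD(1) [OF ab v, of "a v"] ba v by simp
      then have "norm (of_real ((hnorm K (a v))\<^sup>2) :: 'f) \<le> hnorm K v * hnorm K (b (a v))"
        using cauchy_schwarz [of v "b (a v)"] bops_car [OF ba(1) v] v by simp
      then have "(hnorm K (a v))\<^sup>2 \<le> hnorm K v * hnorm K ((b \<circ> a) v)"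
        unfolding norm_of_real by simp
      also have "\<dots> \<le> hnorm K v * (opn K (b \<circ> a) * hnorm K v)"
        by (intro mult_left_mono opn_ub ba v) simp
      finally show "(hnorm K (a v))\<^sup>2 \<le> (sqrt (opn K (b \<circ> a)) * hnorm K v)\<^sup>2"
        using opn_nonneg [OF ba(1)] by (simp add: power_mult_distrib power2_eq_square mult_ac)
    qed (simp add: opn_nonneg ba)
    then have "opn K a \<le> sqrt (opn K (b \<circ> a))"
      using opn_nonneg [OF ba(1)] by (intro opn_least) auto
    then have "(opn K a)\<^sup>2 \<le> (sqrt (opn K (b \<circ> a)))\<^sup>2"
      using opn_nonneg [OF ba(2)] by (intro power_mono)
    then show ?thesis using opn_nonneg [OF ba(1)] by simp
  qed
  have le': "opn K a \<le> opn K b" if ab: "adjoint_pair K a b" for a b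
  proof -
    have ab': "a \<in> bops K" "b \<in> bops K" using ab by (auto simp: adjoint_pair_def)
    have "opn K a * opn K a \<le> opn K b * opn K a"
      using le [OF ab] opn_comp [OF ab'(2,1)] by (simp add: power2_eq_square)
    then show ?thesis using opn_nonneg [OF ab'(1)] opn_nonneg [OF ab'(2)]
      by (cases "opn K a = 0") auto
  qed
  show eq: "opn K b = opn K a"
    using le' [OF assms] le' [OF adjoint_sym [OF assms]] by simp
  show "opn K (b \<circ> a) = (opn K a)\<^sup>2"
    using le [OF assms] opn_comp [of b a] assms eq
    by (simp add: adjoint_pair_def power2_eq_square)
qed

end

subsection \<open>Finite-dimensional algebras with a faithful involutive representation\<close>

text \<open>The algebra axioms are not assumed: they are inherited from the operators \<open>\<pi> x\<close>.\<close>

locale star_rep = prehilbert K for K :: "('f::rc_field, 'v::ab_group_add) hilb" +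
  fixes A :: "('f, 'a::ab_group_add) staralg" and \<pi> :: "'a \<Rightarrow> 'v \<Rightarrow> 'v"
  assumes A_vector_space: "vector_space (ascl A)"
    and A_subspace: "module.subspace (ascl A) (acar A)"
    and A_finite: "\<exists>S. finite S \<and> acar A \<subseteq> module.span (ascl A) S"
    and A_mul: "\<lbrakk>x \<in> acar A; y \<in> acar A\<rbrakk> \<Longrightarrow> amul A x y \<in> acar A"
    and A_star: "x \<in> acar A \<Longrightarrow> astar A x \<in> acar A"
    and rep_lin: "lin_on (ascl A) (acar A) (pscl (hscl K)) (bops K) \<pi>"
    and rep_inj: "\<lbrakk>x \<in> acar A; \<pi> x = 0\<rbrakk> \<Longrightarrow> x = 0"
    and rep_mul: "\<lbrakk>x \<in> acar A; y \<in> acar A\<rbrakk> \<Longrightarrow> \<pi> (amul A x y) = \<pi> x \<circ> \<pi> y"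
    and rep_star: "x \<in> acar A \<Longrightarrow> adjoint_pair K (\<pi> x) (\<pi> (astar A x))"
begin

sublocale va: rc_vector_space "ascl A"
  unfolding rc_vector_space_def by (rule A_vector_space)

lemmas A_simps [simp] = va.subspace_0 [OF A_subspace] va.subspace_add [OF A_subspace]
  va.subspace_scale [OF A_subspace] va.subspace_diff [OF A_subspace]

lemma rep_bops [simp]: "x \<in> acar A \<Longrightarrow> \<pi> x \<in> bops K"
  using rep_lin unfolding lin_on_def by blast

lemma rep_add: "x \<in> acar A \<Longrightarrow> y \<in> acar A \<Longrightarrow> \<pi> (x + y) = \<pi> x + \<pi> y"
  using rep_lin unfolding lin_on_def by blast

lemma rep_scale: "x \<in> acar A \<Longrightarrow> \<pi> (ascl A c x) = pscl (hscl K) c (\<pi> x)"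
  using rep_lin unfolding lin_on_def by blast

lemma rep_diff: "x \<in> acar A \<Longrightarrow> y \<in> acar A \<Longrightarrow> \<pi> (x - y) = \<pi> x - \<pi> y"
  using va.lin_on_diff [OF A_subspace rep_lin vso.vector_space_axioms] .

lemma rep_0 [simp]: "\<pi> 0 = 0"
  using va.lin_on_zero [OF A_subspace rep_lin vso.vector_space_axioms] .

lemma rep_eqI: "x \<in> acar A \<Longrightarrow> y \<in> acar A \<Longrightarrow> \<pi> x = \<pi> y \<Longrightarrow> x = y"
  using rep_inj [of "x - y"] by (simp add: rep_diff)

text \<open>Because \<pi> is faithful and adjoints are unique, identities about the star reduce to
  exhibiting adjoint pairs.\<close>

lemma rep_star_eqI: "x \<in> acar A \<Longrightarrow> y \<in> acar A \<Longrightarrow> adjoint_pair K (\<pi> x) (\<pi> y) \<Longrightarrow> astar A x = y"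
  using adjoint_unique [OF rep_star] A_star rep_eqI by blast

lemma normed_A: "normed_on (ascl A) (acar A) (\<lambda>x. opn K (\<pi> x))"
  using rep_inj by (auto simp: normed_on_def opn_nonneg opn_eq_0 rep_add opn_triangle rep_scale opn_scale)

text \<open>If \<open>r = \<parallel>y\<^sup>* y\<parallel>\<close> were not an eigenvalue of left multiplication by \<open>y\<^sup>* y\<close>, then
  \<open>y\<^sup>* y - r\<close> would be invertible and hence bounded below on \<open>K\<close>.\<close>

lemma top_eigenvector:
  assumes y: "y \<in> acar A" and r: "opn K (\<pi> y) > 0"
  shows "\<exists>f\<in>acar A. f \<noteq> 0 \<and>
    amul A (amul A (astar A y) y) f = ascl A (of_real ((opn K (\<pi> y))\<^sup>2)) f"
proof (rule ccontr)
  assume no: "\<not> ?thesis"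
  define r where "r = (opn K (\<pi> y))\<^sup>2"
  define Q where "Q = amul A (astar A y) y"
  have Q: "Q \<in> acar A" using y by (simp add: Q_def A_mul A_star)
  have r0: "r > 0" using assms by (simp add: r_def)
  define L where "L = (\<lambda>f. amul A Q f - ascl A (of_real r) f)"
  have LA: "L f \<in> acar A" if "f \<in> acar A" for f using that Q by (simp add: L_def A_mul)
  have piL: "\<pi> (L f) = (\<pi> Q \<circ> \<pi> f) - pscl (hscl K) (of_real r) (\<pi> f)" if "f \<in> acar A" for f
    using that Q by (simp add: L_def A_mul rep_diff rep_mul rep_scale)
  have fK: "\<pi> f v \<in> hcar K" if "f \<in> acar A" for f v
    using that by (cases "v \<in> hcar K") (simp_all add: bops_outside)
  have QfD: "\<pi> Q (\<pi> f v + \<pi> g v) = \<pi> Q (\<pi> f v) + \<pi> Q (\<pi> g v)"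
    if "f \<in> acar A" "g \<in> acar A" for f g v
    using that Q by (intro bops_add) (simp_all add: fK)
  have lin: "lin_on (ascl A) (acar A) (ascl A) (acar A) L"
    unfolding lin_on_def
  proof (intro conjI ballI allI)
    fix f g assume fg: "f \<in> acar A" "g \<in> acar A"
    show "L (f + g) = L f + L g"
      using fg Q by (intro rep_eqI)
        (simp_all add: LA piL rep_add fun_eq_iff pscl_def vs.scale_right_distrib QfD)
  next
    fix c f assume f: "f \<in> acar A"
    show "L (ascl A c f) = ascl A c (L f)"
    proof (rule rep_eqI)
      have "\<pi> Q (hscl K c (\<pi> f v)) = hscl K c (\<pi> Q (\<pi> f v))" for v
        using f Q by (intro bops_scale) (simp_all add: fK)
      then show "\<pi> (L (ascl A c f)) = \<pi> (ascl A c (L f))"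
        using f Q by (simp add: LA piL rep_scale fun_eq_iff pscl_def vs.scale_right_diff_distrib mult.commute)
    qed (use f LA in simp_all)
  qed (use LA in simp)
  \<comment> \<open>By the assumption \<open>no\<close>, the kernel of \<open>L\<close> is trivial;
    so \<open>L\<close> is onto and reaches \<open>Q\<close>.\<close>
  have "f = 0" if "f \<in> acar A" "L f = 0" for f
    using no that unfolding L_def Q_def r_def by auto
  then obtain u where u: "u \<in> acar A" "L u = Q"
    using va.lin_on_inj_imp_surj [OF A_subspace _ _ lin _ Q] A_finite by blast
  define T where "T = \<pi> (astar A u)"
  have Tu: "adjoint_pair K (\<pi> u) T" using rep_star [OF u(1)] by (simp add: T_def)
  have QQ: "adjoint_pair K (\<pi> Q) (\<pi> Q)"
    using adjoint_comp [OF adjoint_sym [OF rep_star [OF y]] rep_star [OF y]] y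
    by (simp add: Q_def rep_mul A_star)
  \<comment> \<open>The adjoint of (Q - r) u = Q is T (Q - r) = Q. With w = (Q - r) v this gives r v
    = T w - w, which bounds Q - r from below.\<close>
  have "adjoint_pair K (\<pi> Q) ((T \<circ> \<pi> Q) - pscl (hscl K) (of_real r) T)"
    using adjoint_diff [OF adjoint_comp [OF QQ Tu] adjoint_scale [OF Tu, of "of_real r"]] piL [OF u(1)] u
    by simp
  then have eq: "(T \<circ> \<pi> Q) - pscl (hscl K) (of_real r) T = \<pi> Q"
    using QQ adjoint_unique by blast
  have Tb: "T \<in> bops K" using Tu by (simp add: adjoint_pair_def)
  define c where "c = opn K T + 1"
  have c: "c > 0" using opn_nonneg [OF Tb] by (simp add: c_def)
  have low: "r * hnorm K v \<le> c * hnorm K (\<pi> Q v - hscl K (of_real r) v)" if v: "v \<in> hcar K" for v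
  proof -
    let ?w = "\<pi> Q v - hscl K (of_real r) v"
    have w: "?w \<in> hcar K" using v Q by simp
    have "hscl K (of_real r) v = T ?w - ?w"
      using fun_cong [OF eq, of v] v Q Tb by (simp add: pscl_def bops_diff bops_scale)
    then have "r * hnorm K v = hnorm K (T ?w - ?w)"
      using v r0 hnorm_scale [OF v, of "of_real r"] by simp
    also have "T ?w - ?w = T ?w + hscl K (- 1) ?w" by simp
    also have "hnorm K \<dots> \<le> hnorm K (T ?w) + hnorm K (hscl K (- 1) ?w)"
      using w Tb v Q by (intro hnorm_triangle) simp_all
    also have "\<dots> \<le> c * hnorm K ?w"
      using opn_ub [OF Tb w] w unfolding hnorm_scale [OF w] by (simp add: c_def distrib_right)
    finally show ?thesis .
  qed
  \<comment> \<open>Chosen so that |w|^2 < 2 r e and r |v| \<le> c |w| together give r^2 |v|^2 \<le>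
    r^2 / 2, against |v|^2 > 1/2.\<close>
  define e where "e = r / (4 * c\<^sup>2)"
  have e: "e > 0" using r0 c by (simp add: e_def)
  \<comment> \<open>The margin \<open>e\<close> makes \<open>Q v\<close> close to
    \<open>r v\<close>; the margin \<open>r / 2\<close> keeps \<open>v\<close> away from 0.\<close>
  have "\<exists>v\<in>hcar K. hnorm K v \<le> 1 \<and> r - min e (r / 2) < (hnorm K (\<pi> y v))\<^sup>2"
  proof -
    have "r - min e (r / 2) < (opn K (\<pi> y))\<^sup>2" using e r0 by (simp add: r_def)
    then have "sqrt (r - min e (r / 2)) < opn K (\<pi> y)"
      using assms by (intro real_less_lsqrt) (auto simp: r_def)
    then obtain v where v: "v \<in> hcar K" "hnorm K v \<le> 1" "sqrt (r - min e (r / 2)) < hnorm K (\<pi> y v)"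
      using opn_approx y rep_bops by blast
    then have "(sqrt (r - min e (r / 2)))\<^sup>2 < (hnorm K (\<pi> y v))\<^sup>2"
      using r0 by (intro power_strict_mono) auto
    moreover have "(sqrt (r - min e (r / 2)))\<^sup>2 = r - min e (r / 2)" using r0 by simp
    ultimately show ?thesis using v by auto
  qed
  then obtain v where v: "v \<in> hcar K" "hnorm K v \<le> 1"
      and v2: "r - e < (hnorm K (\<pi> y v))\<^sup>2" "r / 2 < (hnorm K (\<pi> y v))\<^sup>2"
    by force
  have "(hnorm K (\<pi> y v))\<^sup>2 \<le> r * (hnorm K v)\<^sup>2"
    using power_mono [OF opn_ub [OF rep_bops [OF y] v(1)], of 2] by (simp add: r_def power_mult_distrib)
  then have nv: "1 / 2 < (hnorm K v)\<^sup>2" using v2(2) r0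
    by (metis less_le_trans mult.commute mult_less_cancel_left_pos times_divide_eq_right mult.right_neutral)
  have Qv: "hinner K (\<pi> Q v) v = of_real ((hnorm K (\<pi> y v))\<^sup>2)"
    using adjoint_pairD(1) [OF adjoint_sym [OF rep_star [OF y]], of "\<pi> y v" v] v y
    by (simp add: Q_def rep_mul A_star inner_self)
  have "opn K (\<pi> Q) = r"
    using opn_cstar [OF rep_star [OF y]] y by (simp add: Q_def rep_mul A_star r_def)
  then have nQ: "(hnorm K (\<pi> Q v))\<^sup>2 \<le> r\<^sup>2"
    using order_trans [OF opn_ub [OF rep_bops [OF Q] v(1)] mult_left_mono [OF v(2), of "opn K (\<pi> Q)"]] r0
    by (intro power_mono) auto
  let ?w = "\<pi> Q v - hscl K (of_real r) v"
  have "(hnorm K (\<pi> Q v + hscl K (of_real (- r)) v))\<^sup>2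
      = (hnorm K (\<pi> Q v))\<^sup>2 + 2 * re (of_real (- r) * hinner K (\<pi> Q v) v) + (r * hnorm K v)\<^sup>2"
    unfolding hnorm_add_sq [OF bops_car [OF rep_bops [OF Q] v(1)] car_simps(3) [OF v(1)]]
    using v Q r0 by (simp add: inner_scale_right hnorm_scale del: of_real_minus)
  then have "(hnorm K ?w)\<^sup>2 = (hnorm K (\<pi> Q v))\<^sup>2 - 2 * r * (hnorm K (\<pi> y v))\<^sup>2 + (r * hnorm K v)\<^sup>2"
    unfolding Qv re_of_real_mult re_of_real by simp
  moreover have "(r * hnorm K v)\<^sup>2 \<le> r\<^sup>2"
    using mult_left_mono [OF v(2), of r] r0 by (intro power_mono) auto
  moreover have "r * (r - e) < r * (hnorm K (\<pi> y v))\<^sup>2" using v2(1) r0 by simp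
  ultimately have "(hnorm K ?w)\<^sup>2 < 2 * r * e"
    using nQ by (simp add: algebra_simps power2_eq_square)
  moreover have "(r * hnorm K v)\<^sup>2 \<le> (c * hnorm K ?w)\<^sup>2"
    using low [OF v(1)] r0 by (intro power_mono) auto
  ultimately have "r\<^sup>2 * (hnorm K v)\<^sup>2 \<le> c\<^sup>2 * (2 * r * e)"
    using mult_left_mono [of "(hnorm K ?w)\<^sup>2" "2 * r * e" "c\<^sup>2"]
    by (simp add: power_mult_distrib)
  moreover have "c\<^sup>2 * (2 * r * e) = r\<^sup>2 * (1 / 2)"
    using c by (simp add: e_def field_simps power2_eq_square)
  moreover have "r\<^sup>2 * (1 / 2) < r\<^sup>2 * (hnorm K v)\<^sup>2"
    using nv r0 by (intro mult_strict_left_mono) auto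
  ultimately show False by simp
qed

lemma rep_car [simp]: "f \<in> acar A \<Longrightarrow> \<pi> f v \<in> hcar K"
  by (cases "v \<in> hcar K") (simp_all add: bops_outside)

lemma rep_comp_add: "\<lbrakk>f \<in> acar A; g \<in> acar A; h \<in> acar A\<rbrakk> \<Longrightarrow>
    \<pi> h (\<pi> f v + \<pi> g v) = \<pi> h (\<pi> f v) + \<pi> h (\<pi> g v)"
  by (intro bops_add) simp_all

lemma rep_comp_scale: "\<lbrakk>f \<in> acar A; h \<in> acar A\<rbrakk> \<Longrightarrow>
    \<pi> h (hscl K c (\<pi> f v)) = hscl K c (\<pi> h (\<pi> f v))"
  by (intro bops_scale) simp_all

text \<open>With P = x* x, left multiplication by 1 + P is injective since <(1 + P) u, u> = |u|^2 +
  |x u|^2. Solving (1 + P) y = - P gives a right inverse 1 + y in the unitization, which is then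
  shown to be two-sided.\<close>

lemma rep_invertible:
  assumes x: "x \<in> acar A"
  shows "\<exists>y\<in>acar A.
    amul A (astar A x) x + y + amul A (amul A (astar A x) x) y = 0 \<and>
    amul A (astar A x) x + y + amul A y (amul A (astar A x) x) = 0"
proof -
  define P where "P = amul A (astar A x) x"
  have P: "P \<in> acar A" using x by (simp add: P_def A_mul A_star)
  define L where "L = (\<lambda>y. y + amul A P y)"
  have LA: "L y \<in> acar A" if "y \<in> acar A" for y using that P by (simp add: L_def A_mul)
  have piL: "\<pi> (L y) = \<pi> y + (\<pi> P \<circ> \<pi> y)" if "y \<in> acar A" for y
    using that P by (simp add: L_def A_mul rep_add rep_mul)
  have lin: "lin_on (ascl A) (acar A) (ascl A) (acar A) L"
    unfolding lin_on_def
  proof (intro conjI ballI allI)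
    fix f g assume fg: "f \<in> acar A" "g \<in> acar A"
    then show "L (f + g) = L f + L g"
      using P by (intro rep_eqI) (simp_all add: LA piL rep_add fun_eq_iff rep_comp_add)
  next
    fix c f assume f: "f \<in> acar A"
    then show "L (ascl A c f) = ascl A c (L f)"
      using P by (intro rep_eqI)
        (simp_all add: LA piL rep_scale fun_eq_iff pscl_def rep_comp_scale vs.scale_right_distrib)
  qed (use LA in simp)
  have inj: "f = 0" if f: "f \<in> acar A" "L f = 0" for f
  proof -
    have "\<pi> f v = 0" if v: "v \<in> hcar K" for v
    proof -
      let ?u = "\<pi> f v"
      have u: "?u \<in> hcar K" using f v by simp
      have "?u + \<pi> P ?u = 0"
        using fun_cong [OF piL [OF f(1)], of v] f by simp
      then have "0 = hinner K (?u + \<pi> P ?u) ?u" using u by simp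
      also have "\<dots> = hinner K ?u ?u + hinner K (\<pi> P ?u) ?u"
        using u P by (simp add: inner_add)
      also have "hinner K (\<pi> P ?u) ?u = hinner K (\<pi> x ?u) (\<pi> x ?u)"
        using adjoint_pairD(1) [OF adjoint_sym [OF rep_star [OF x]], of "\<pi> x ?u" ?u] u x
        by (simp add: P_def rep_mul A_star)
      also have "hinner K ?u ?u + hinner K (\<pi> x ?u) (\<pi> x ?u)
          = of_real ((hnorm K ?u)\<^sup>2 + (hnorm K (\<pi> x ?u))\<^sup>2)"
        using u x by (simp add: inner_self)
      finally have "(hnorm K ?u)\<^sup>2 + (hnorm K (\<pi> x ?u))\<^sup>2 = 0"
        by (metis of_real_eq_0_iff)
      then show "?u = 0" using hnorm_eq_0 [OF u] by (simp add: add_nonneg_eq_0_iff)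
    qed
    then have "\<pi> f = 0" using f by (intro bops_eqI) simp_all
    then show "f = 0" using f rep_inj by blast
  qed
  obtain S where S: "finite S" "acar A \<subseteq> va.span S" using A_finite by blast
  have nP: "- P \<in> acar A" using A_simps(4) [OF A_simps(1) P] by simp
  obtain y where y: "y \<in> acar A" "L y = - P"
    using va.lin_on_inj_imp_surj [OF A_subspace S lin _ nP] inj by blast
  have PP: "adjoint_pair K (\<pi> P) (\<pi> P)"
    using adjoint_comp [OF adjoint_sym [OF rep_star [OF x]] rep_star [OF x]] x
    by (simp add: P_def rep_mul A_star)
  \<comment> \<open>The adjoint of (1 + P)(1 + y) = 1 is (1 + z)(1 + P) = 1. Evaluating z (y + P y)
    in both ways gives z P = P y, and hence z = y.\<close>
  define z where "z = astar A y"
  have z: "z \<in> acar A" using y by (simp add: z_def A_star)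
  have yz: "adjoint_pair K (\<pi> y) (\<pi> z)" unfolding z_def by (rule rep_star [OF y(1)])
  have e1: "\<pi> y + (\<pi> P \<circ> \<pi> y) = - \<pi> P"
    using piL [OF y(1)] y(2) rep_diff [OF A_simps(1) P] by simp
  have nadj: "adjoint_pair K (- \<pi> P) (- \<pi> P)"
    using adjoint_diff [OF adjoint_0 PP] by simp
  have "adjoint_pair K (\<pi> y + (\<pi> P \<circ> \<pi> y)) (\<pi> z + (\<pi> z \<circ> \<pi> P))"
    using adjoint_add [OF yz adjoint_comp [OF PP yz]] by simp
  then have e2: "\<pi> z + (\<pi> z \<circ> \<pi> P) = - \<pi> P"
    using nadj adjoint_unique unfolding e1 by blast
  have "\<pi> z v = \<pi> y v" for v
  proof -
    have a: "\<pi> y v + \<pi> P (\<pi> y v) = - \<pi> P v" using fun_cong [OF e1, of v] by simp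
    have b: "\<pi> z w + \<pi> z (\<pi> P w) = - \<pi> P w" for w using fun_cong [OF e2, of w] by simp
    have "\<pi> z (\<pi> y v + \<pi> P (\<pi> y v)) = - \<pi> P (\<pi> y v)"
      using b [of "\<pi> y v"] rep_comp_add [of y "amul A P y" z v] y P z by (simp add: A_mul rep_mul)
    moreover have "\<pi> z (- \<pi> P v) = - \<pi> z (\<pi> P v)"
      using rep_comp_scale [of P z "- 1" v] P z by simp
    ultimately have "\<pi> z (\<pi> P v) = \<pi> P (\<pi> y v)" using a by simp
    then show ?thesis using a b [of v] by (metis add_right_cancel)
  qed
  then have "\<pi> y + (\<pi> y \<circ> \<pi> P) = - \<pi> P" using e2 by (metis ext)
  then have "P + y + amul A P y = 0" "P + y + amul A y P = 0"
    using e1 P y by (auto intro!: rep_eqI simp: rep_add rep_mul A_mul add.assoc)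
  then show ?thesis using y(1) unfolding P_def by blast
qed

text \<open>The axioms are pulled back along \<pi>, and completeness comes from finite dimension.
  \<open>N\<close> is a parameter because the norm inherited from operators on \<open>X_G\<close> is
  later known merely to agree with the operator norm on the carrier.\<close>

theorem cstar_algebra_of_rep:
  assumes N: "\<And>x. x \<in> acar A \<Longrightarrow> N x = opn K (\<pi> x)"
  shows "cstar_algebra A N"
proof
  obtain S where S: "finite S" "acar A \<subseteq> va.span S" using A_finite by blast
  obtain B where B: "finite B" "va.span B = acar A"
    using va.finite_basis_of_subspace [OF A_subspace S] by metis
  have "normed_on (ascl A) (acar A) N"
    using normed_A N unfolding normed_on_def by simp
  then have cpl: "va.complete_on (acar A) N"
    using va.finite_span_complete [OF B(1), of N] B(2) by simp
  show "\<exists>l\<in>acar A. (\<lambda>n. N (s n - l)) \<longlonglongrightarrow> 0"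
    if s: "\<And>n::nat. s n \<in> acar A" "\<And>e. e > 0 \<Longrightarrow> \<exists>M. \<forall>m\<ge>M. \<forall>n\<ge>M. N (s m - s n) < e" for s
  proof -
    have 1: "\<forall>n. s n \<in> acar A" by (rule allI) (rule s(1))
    have 2: "\<forall>e>0. \<exists>M. \<forall>m\<ge>M. \<forall>n\<ge>M. N (s m - s n) < e"
      by (rule allI, rule impI) (rule s(2))
    show ?thesis by (rule cpl [unfolded va.complete_on_def, THEN spec, THEN mp, OF 1, THEN mp, OF 2])
  qed
  fix x y z c assume x: "x \<in> acar A"
  show "astar A (astar A x) = x"
    by (rule rep_star_eqI [OF A_star [OF x] x adjoint_sym [OF rep_star [OF x]]])
  show "astar A (ascl A c x) = ascl A (fconj c) (astar A x)"
    using x by (intro rep_star_eqI) (simp_all add: A_star rep_scale adjoint_scale rep_star)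
  show "N x \<ge> 0" "N x = 0 \<longleftrightarrow> x = 0" "N (ascl A c x) = norm c * N x"
    using x rep_inj by (auto simp: N opn_nonneg opn_eq_0 rep_scale opn_scale)
  show "N (amul A (astar A x) x) = (N x)\<^sup>2"
    using x by (simp add: N A_mul A_star rep_mul opn_cstar [OF rep_star])
  assume y: "y \<in> acar A"
  show "amul A (ascl A c x) y = ascl A c (amul A x y)" "amul A x (ascl A c y) = ascl A c (amul A x y)"
    using x y by (intro rep_eqI; simp add: A_mul rep_mul rep_scale pscl_def fun_eq_iff rep_comp_scale)+
  show "astar A (x + y) = astar A x + astar A y"
    using x y by (intro rep_star_eqI) (simp_all add: A_star rep_add adjoint_add rep_star)
  show "astar A (amul A x y) = amul A (astar A y) (astar A x)"
    using x y by (intro rep_star_eqI) (simp_all add: A_star A_mul rep_mul adjoint_comp rep_star)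
  show "N (x + y) \<le> N x + N y" "N (amul A x y) \<le> N x * N y"
    using x y by (simp_all add: N A_mul rep_add rep_mul opn_triangle opn_comp)
  assume z: "z \<in> acar A"
  show "amul A (amul A x y) z = amul A x (amul A y z)"
    using x y z by (intro rep_eqI) (simp_all add: A_mul rep_mul o_assoc)
  show "amul A (x + y) z = amul A x z + amul A y z" "amul A x (y + z) = amul A x y + amul A x z"
    using x y z by (intro rep_eqI; simp add: A_mul rep_mul rep_add fun_eq_iff rep_comp_add)+
qed (use A_vector_space A_subspace A_mul A_star rep_invertible in auto)

end

subsection \<open>Uniqueness of the \<open>C\<^sup>*\<close>-norm\<close>

text \<open>If b < a, the powers of b / a tend to 0 and eventually beat any constant. This is the
  spectral radius argument in the form needed for comparing norms.\<close>

lemma le_of_iterated_squares: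
  fixes a b C :: real
  assumes "0 \<le> a" "0 \<le> b" "\<And>k. a ^ (2 ^ k) \<le> C * b ^ (2 ^ k)"
  shows "a \<le> b"
proof (rule ccontr)
  assume "\<not> a \<le> b"
  then have ab: "b < a" "0 < a" using assms by auto
  define q where "q = b / a"
  have q: "0 \<le> q" "q < 1" using ab assms(2) by (simp_all add: q_def)
  have C: "1 \<le> C * q ^ (2 ^ k)" for k
    using assms(3) [of k] ab(2) by (simp add: q_def power_divide field_simps)
  have "(\<lambda>k. C * q ^ k) \<longlonglongrightarrow> C * 0"
    using q by (intro tendsto_mult LIMSEQ_power_zero tendsto_const) auto
  then have "eventually (\<lambda>k. C * q ^ k < 1) sequentially"
    by (intro order_tendstoD) auto
  then obtain m where m: "\<And>k. k \<ge> m \<Longrightarrow> C * q ^ k < 1"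
    unfolding eventually_sequentially by blast
  \<comment> \<open>Puts an exponent of the special form \<open>2 ^ m\<close> beyond the threshold
    \<open>m\<close>.\<close>
  have "m \<le> 2 ^ m" using less_exp [of m] by simp
  then show False using m [of "2 ^ m"] C [of m] by simp
qed

text \<open>For the self-adjoint y = x* x both norms are multiplicative along repeated squaring,
  while finite dimension makes them equivalent; the constant of equivalence disappears in the
  limit.\<close>

lemma cstar_norm_unique:
  assumes 1: "cstar_algebra A N1" and 2: "cstar_algebra A N2"
    and S: "finite S" "acar A \<subseteq> module.span (ascl A) S" and x: "x \<in> acar A"
  shows "N1 x = N2 x"
proof -
  have le: "N1 x \<le> N2 x" if 1: "cstar_algebra A N1" and 2: "cstar_algebra A N2" for N1 N2
  proof -
    interpret a1: cstar_algebra A N1 by fact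
    interpret a2: cstar_algebra A N2 by fact
    interpret va: rc_vector_space "ascl A"
      unfolding rc_vector_space_def by (rule a1.vector_space)
    obtain B where B: "finite B" "va.span B = acar A"
      using va.finite_basis_of_subspace [OF a1.subspace S] by metis
    have "normed_on (ascl A) (acar A) N1" "normed_on (ascl A) (acar A) N2"
      unfolding normed_on_def
      using a1.norm_nonneg a1.norm_eq_0 a1.norm_triangle a1.norm_scale
        a2.norm_nonneg a2.norm_eq_0 a2.norm_triangle a2.norm_scale by auto
    then obtain C where C: "\<And>z. z \<in> acar A \<Longrightarrow> N1 z \<le> C * N2 z"
      using va.finite_span_norms_equivalent [OF B(1), of N2 N1] B(2) by auto
    define y where "y = amul A (astar A x) x"
    \<comment> \<open>\<open>p k\<close> is the power of \<open>y\<close> with exponent 2^k; each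
      \<open>p k\<close> is self-adjoint, so the \<open>C*\<close>-identity squares its
      norm.\<close>
    define p where "p = rec_nat y (\<lambda>_ z. amul A z z)"
    have p: "p 0 = y" "p (Suc k) = amul A (p k) (p k)" for k by (simp_all add: p_def)
    have pA: "p k \<in> acar A \<and> astar A (p k) = p k" for k
      by (induction k) (simp_all add: p y_def x a1.mul_closed a1.star_closed a1.star_mul a1.star_star)
    have pow: "N1 (p k) = N1 y ^ (2 ^ k) \<and> N2 (p k) = N2 y ^ (2 ^ k)" for k
    proof (induction k)
      case (Suc k)
      have "N1 (p (Suc k)) = (N1 (p k))\<^sup>2" "N2 (p (Suc k)) = (N2 (p k))\<^sup>2"
        using a1.cstar_identity [of "p k"] a2.cstar_identity [of "p k"] pA [of k] by (simp_all add: p)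
      then show ?case using Suc by (simp add: power_mult [symmetric] mult.commute)
    qed (simp add: p)
    have yA: "y \<in> acar A" using pA [of 0] by (simp add: p)
    have "N1 y \<le> N2 y"
    proof (rule le_of_iterated_squares)
      show "N1 y ^ (2 ^ k) \<le> C * N2 y ^ (2 ^ k)" for k
        using C [of "p k"] pA [of k] pow [of k] by simp
    qed (use yA a1.norm_nonneg a2.norm_nonneg in auto)
    then have "(N1 x)\<^sup>2 \<le> (N2 x)\<^sup>2"
      using a1.cstar_identity [OF x] a2.cstar_identity [OF x] by (simp add: y_def)
    then show ?thesis using a2.norm_nonneg [OF x] by (rule power2_le_imp_le)
  qed
  show ?thesis using le [OF 1 2] le [OF 2 1] by simp
qed

subsection \<open>Finite direct sums and operator matrices\<close>

lemma sum_fun_app: "(\<Sum>i\<in>I. f i) x = (\<Sum>i\<in>I. f i x)"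
  by (induction I rule: infinite_finite_induct) simp_all

lemma sum_squares_le_square_sum:
  fixes f :: "'a \<Rightarrow> real"
  assumes "\<And>i. i \<in> I \<Longrightarrow> 0 \<le> f i"
  shows "(\<Sum>i\<in>I. (f i)\<^sup>2) \<le> (\<Sum>i\<in>I. f i)\<^sup>2"
  using assms
proof (induction I rule: infinite_finite_induct)
  case (insert i I)
  then have "0 \<le> f i * (\<Sum>i\<in>I. f i)" by (intro mult_nonneg_nonneg sum_nonneg) auto
  then show ?case using insert by (simp add: power2_sum)
qed simp_all

text \<open>A common frame for finite direct sums and for the induced space, which differ only in
  the index set and in the subspace \<open>W\<close> of functions.\<close>

definition fun_hilb :: "'i set \<Rightarrow> ('i \<Rightarrow> 'v) set \<Rightarrow> ('f::rc_field, 'v::ab_group_add) hilb \<Rightarrow>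
    ('f, 'i \<Rightarrow> 'v) hilb" where
  "fun_hilb I W K = \<lparr>hcar = W, hscl = pscl (hscl K), hinner = (\<lambda>v w. \<Sum>i\<in>I. hinner K (v i) (w i))\<rparr>"

lemma fun_hilb_simps [simp]:
  "hcar (fun_hilb I W K) = W" "hscl (fun_hilb I W K) = pscl (hscl K)"
  "hinner (fun_hilb I W K) v w = (\<Sum>i\<in>I. hinner K (v i) (w i))"
  by (simp_all add: fun_hilb_def)

context prehilbert
begin

lemma hnorm_fun_hilb:
  assumes "\<And>i. i \<in> I \<Longrightarrow> v i \<in> hcar K"
  shows "hnorm (fun_hilb I W K) v = sqrt (\<Sum>i\<in>I. (hnorm K (v i))\<^sup>2)"
proof -
  have "(\<Sum>i\<in>I. hinner K (v i) (v i)) = of_real (\<Sum>i\<in>I. (hnorm K (v i))\<^sup>2)"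
    unfolding of_real_sum by (intro sum.cong refl inner_self assms)
  then show ?thesis
    unfolding hnorm_def [of "fun_hilb I W K"] by (simp only: fun_hilb_simps norm_of_real) (simp add: sum_nonneg)
qed

lemma prehilbert_fun_hilb:
  assumes I: "finite I" and W: "vso.subspace W"
    and sub: "\<And>v i. v \<in> W \<Longrightarrow> i \<in> I \<Longrightarrow> v i \<in> hcar K" "\<And>v i. v \<in> W \<Longrightarrow> i \<notin> I \<Longrightarrow> v i = 0"
  shows "prehilbert (fun_hilb I W K)"
proof (rule prehilbert.intro)
  show "vector_space (hscl (fun_hilb I W K))" by (simp add: vso.vector_space_axioms)
  show "module.subspace (hscl (fun_hilb I W K)) (hcar (fun_hilb I W K))" using W by simp
  fix u v w c
  assume v: "v \<in> hcar (fun_hilb I W K)"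
  have self: "hinner (fun_hilb I W K) v v = of_real (\<Sum>i\<in>I. (hnorm K (v i))\<^sup>2)"
    using v sub(1) by (simp add: inner_self)
  show "\<exists>r\<ge>0. hinner (fun_hilb I W K) v v = of_real r"
    unfolding self by (intro exI [of _ "\<Sum>i\<in>I. (hnorm K (v i))\<^sup>2"]) (simp add: sum_nonneg)
  show "v = 0" if "hinner (fun_hilb I W K) v v = 0"
  proof -
    have "(\<Sum>i\<in>I. (hnorm K (v i))\<^sup>2) = 0" using that unfolding self by (simp only: of_real_eq_0_iff)
    then have "\<forall>i\<in>I. v i = 0"
      using I v sub(1) by (simp add: sum_nonneg_eq_0_iff hnorm_eq_0)
    then show ?thesis using v sub(2) by (force simp: fun_eq_iff)
  qed
  assume w: "w \<in> hcar (fun_hilb I W K)"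
  show "hinner (fun_hilb I W K) (hscl (fun_hilb I W K) c v) w = c * hinner (fun_hilb I W K) v w"
    using v w sub(1) by (simp add: pscl_def inner_scale sum_distrib_left)
  show "hinner (fun_hilb I W K) w v = fconj (hinner (fun_hilb I W K) v w)"
    using v w sub(1) by (simp add: fconj_sum inner_conj [symmetric])
  assume u: "u \<in> hcar (fun_hilb I W K)"
  show "hinner (fun_hilb I W K) (u + v) w = hinner (fun_hilb I W K) u w + hinner (fun_hilb I W K) v w"
    using u v w sub(1) by (simp add: inner_add sum.distrib)
qed

end

definition hsum :: "nat \<Rightarrow> ('f::rc_field, 'v::ab_group_add) hilb \<Rightarrow> ('f, nat \<Rightarrow> 'v) hilb" where
  "hsum n K = fun_hilb {..<n} {v. \<forall>i. if i < n then v i \<in> hcar K else v i = 0} K"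

definition opmat :: "('f::rc_field, 'v::ab_group_add) hilb \<Rightarrow> nat \<Rightarrow> (nat \<Rightarrow> nat \<Rightarrow> 'v \<Rightarrow> 'v) \<Rightarrow>
    (nat \<Rightarrow> 'v) \<Rightarrow> nat \<Rightarrow> 'v" where
  "opmat K n T = on_zero (hcar (hsum n K)) (\<lambda>v i. if i < n then \<Sum>j<n. T i j (v j) else 0)"

context prehilbert
begin

lemma hsum_scl [simp]: "hscl (hsum n K) = pscl (hscl K)"
  by (simp add: hsum_def)

lemma hsum_carI: "(\<And>i. i < n \<Longrightarrow> v i \<in> hcar K) \<Longrightarrow> (\<And>i. \<not> i < n \<Longrightarrow> v i = 0) \<Longrightarrow> v \<in> hcar (hsum n K)"
  by (simp add: hsum_def)

lemma hsum_carD: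
  assumes "v \<in> hcar (hsum n K)"
  shows "i < n \<Longrightarrow> v i \<in> hcar K" "\<not> i < n \<Longrightarrow> v i = 0"
  using spec [OF assms [unfolded hsum_def fun_hilb_simps mem_Collect_eq], of i] by simp_all

lemma prehilbert_hsum: "prehilbert (hsum n K)"
  unfolding hsum_def
proof (rule prehilbert_fun_hilb)
  show "vso.subspace {v. \<forall>i. if i < n then v i \<in> hcar K else v i = 0}"
    by (rule vso.subspaceI) (simp_all add: pscl_def)
  fix v :: "nat \<Rightarrow> 'v" and i
  assume v: "v \<in> {v. \<forall>i. if i < n then v i \<in> hcar K else v i = 0}"
  show "i \<in> {..<n} \<Longrightarrow> v i \<in> hcar K" "i \<notin> {..<n} \<Longrightarrow> v i = 0"
    using spec [OF v [unfolded mem_Collect_eq], of i] by simp_all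
qed simp

interpretation hs: prehilbert "hsum n K" for n by (rule prehilbert_hsum)

lemma hnorm_hsum: "(\<And>i. i < n \<Longrightarrow> v i \<in> hcar K) \<Longrightarrow> hnorm (hsum n K) v = sqrt (\<Sum>i<n. (hnorm K (v i))\<^sup>2)"
  unfolding hsum_def by (rule hnorm_fun_hilb) simp

lemma hnorm_hsum_sq: "(\<And>i. i < n \<Longrightarrow> v i \<in> hcar K) \<Longrightarrow> (hnorm (hsum n K) v)\<^sup>2 = (\<Sum>i<n. (hnorm K (v i))\<^sup>2)"
  by (simp add: hnorm_hsum sum_nonneg)

lemma inner_hsum: "hinner (hsum n K) v w = (\<Sum>i<n. hinner K (v i) (w i))"
  by (simp add: hsum_def)

lemma hnorm_component_le: "v \<in> hcar (hsum n K) \<Longrightarrow> i < n \<Longrightarrow> hnorm K (v i) \<le> hnorm (hsum n K) v"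
proof (rule power2_le_imp_le)
  assume v: "v \<in> hcar (hsum n K)" and i: "i < n"
  have "(hnorm K (v i))\<^sup>2 \<le> (\<Sum>i<n. (hnorm K (v i))\<^sup>2)"
    using i by (intro member_le_sum) auto
  then show "(hnorm K (v i))\<^sup>2 \<le> (hnorm (hsum n K) v)\<^sup>2"
    using v by (simp add: hnorm_hsum_sq hsum_carD)
qed simp

lemma opmat_apply: "v \<in> hcar (hsum n K) \<Longrightarrow> opmat K n T v = (\<lambda>i. if i < n then \<Sum>j<n. T i j (v j) else 0)"
  by (simp add: opmat_def on_zero_def)

lemma opmat_bops [simp]:
  assumes T: "\<And>i j. i < n \<Longrightarrow> j < n \<Longrightarrow> T i j \<in> bops K"
  shows "opmat K n T \<in> bops (hsum n K)"
proof (rule hs.bopsI)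
  show "opmat K n T v = 0" if "v \<notin> hcar (hsum n K)" for v
    using that by (simp add: opmat_def on_zero_def)
  fix v c assume v: "v \<in> hcar (hsum n K)"
  have vj: "v j \<in> hcar K" if "j < n" for j using v that by (rule hsum_carD)
  show car: "opmat K n T v \<in> hcar (hsum n K)"
    unfolding opmat_apply [OF v] using vj T by (intro hsum_carI) (auto intro!: car_sum)
  show "opmat K n T (hscl (hsum n K) c v) = hscl (hsum n K) c (opmat K n T v)"
    using v T hs.car_simps(3) [OF v, of c]
    by (auto simp: opmat_apply pscl_def bops_scale hsum_carD vs.scale_sum_right fun_eq_iff intro!: sum.cong)
  show "opmat K n T (v + w) = opmat K n T v + opmat K n T w" if w: "w \<in> hcar (hsum n K)" for w
    using v w T by (auto simp: opmat_apply bops_add hsum_carD sum.distrib fun_eq_iff)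
  \<comment> \<open>A crude constant suffices, as only boundedness is at stake.\<close>
  let ?B = "\<Sum>i<n. \<Sum>j<n. opn K (T i j)"
  show "hnorm (hsum n K) (opmat K n T v) \<le> ?B * hnorm (hsum n K) v"
  proof (rule power2_le_imp_le)
    have "hnorm K (\<Sum>j<n. T i j (v j)) \<le> (\<Sum>j<n. opn K (T i j) * hnorm (hsum n K) v)" if i: "i < n" for i
    proof -
      have "hnorm K (\<Sum>j<n. T i j (v j)) \<le> (\<Sum>j<n. hnorm K (T i j (v j)))"
        using v T i by (intro hnorm_sum) (auto simp: hsum_carD)
      also have "\<dots> \<le> (\<Sum>j<n. opn K (T i j) * hnorm K (v j))"
        using v T i by (intro sum_mono opn_ub) (auto simp: hsum_carD)
      also have "\<dots> \<le> (\<Sum>j<n. opn K (T i j) * hnorm (hsum n K) v)"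
        using v T i by (intro sum_mono mult_left_mono hnorm_component_le opn_nonneg) auto
      finally show ?thesis .
    qed
    then have "(\<Sum>i<n. hnorm K (opmat K n T v i)) \<le> ?B * hnorm (hsum n K) v"
      unfolding opmat_apply [OF v] sum_distrib_right by (intro sum_mono) simp
    then have "(\<Sum>i<n. hnorm K (opmat K n T v i))\<^sup>2 \<le> (?B * hnorm (hsum n K) v)\<^sup>2"
      by (intro power_mono sum_nonneg) auto
    then show "(hnorm (hsum n K) (opmat K n T v))\<^sup>2 \<le> (?B * hnorm (hsum n K) v)\<^sup>2"
      using sum_squares_le_square_sum [of "{..<n}" "\<lambda>i. hnorm K (opmat K n T v i)"] car
      by (simp add: hnorm_hsum_sq hsum_carD)
    show "0 \<le> ?B * hnorm (hsum n K) v"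
      using T by (intro mult_nonneg_nonneg sum_nonneg opn_nonneg) auto
  qed
qed

text \<open>The supremum in \<open>opmat_norm\<close> admits vectors with arbitrary values beyond
  index \<open>n\<close>. Truncating them puts them into \<open>hsum\<close>, so that everything
  known about \<open>opn\<close> becomes available for matrix norms.\<close>

lemma opmat_norm_eq_opn: "opmat_norm K n T = opn (hsum n K) (opmat K n T)"
  if T: "\<And>i j. i < n \<Longrightarrow> j < n \<Longrightarrow> T i j \<in> bops K"
proof -
  have *: "hnorm (hsum n K) (opmat K n T v) = sqrt (\<Sum>i<n. (hnorm K (\<Sum>j<n. T i j (v j)))\<^sup>2)"
    if "v \<in> hcar (hsum n K)" for v
    unfolding opmat_apply [OF that]
    using hsum_carD(1) [OF that] T by (subst hnorm_hsum) (auto intro!: car_sum)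
  have eq: "{sqrt (\<Sum>i<n. (hnorm K (\<Sum>j<n. T i j (v j)))\<^sup>2) | v.
      (\<forall>j<n. v j \<in> hcar K) \<and> (\<Sum>j<n. (hnorm K (v j))\<^sup>2) \<le> 1}
    = {hnorm (hsum n K) (opmat K n T v) | v. v \<in> hcar (hsum n K) \<and> hnorm (hsum n K) v \<le> 1}"
    (is "?L = ?R")
  proof (intro subset_antisym subsetI)
    fix x assume "x \<in> ?L"
    then obtain v where v: "x = sqrt (\<Sum>i<n. (hnorm K (\<Sum>j<n. T i j (v j)))\<^sup>2)"
        "\<forall>j<n. v j \<in> hcar K" "(\<Sum>j<n. (hnorm K (v j))\<^sup>2) \<le> 1" by blast
    define w where "w = (\<lambda>i. if i < n then v i else 0)"
    have w: "w \<in> hcar (hsum n K)" using v(2) by (intro hsum_carI) (auto simp: w_def)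
    have "hnorm (hsum n K) w \<le> 1" using v w by (subst hnorm_hsum) (auto simp: w_def)
    moreover have "x = hnorm (hsum n K) (opmat K n T w)"
      using * [OF w] v(1) by (simp add: w_def)
    ultimately show "x \<in> ?R" using w by blast
  next
    fix x assume "x \<in> ?R"
    then obtain v where v: "x = hnorm (hsum n K) (opmat K n T v)" "v \<in> hcar (hsum n K)"
        "hnorm (hsum n K) v \<le> 1" by blast
    have "(\<Sum>j<n. (hnorm K (v j))\<^sup>2) \<le> 1"
      using v(2,3) by (subst (asm) hnorm_hsum) (auto simp: hsum_carD)
    then show "x \<in> ?L" using * [OF v(2)] v(1,2) by (auto simp: hsum_carD)
  qed
  show ?thesis unfolding opmat_norm_def opn_def eq ..
qed

lemma opmat_norm_ub:
  assumes "\<And>i j. i < n \<Longrightarrow> j < n \<Longrightarrow> T i j \<in> bops K" "\<And>j. j < n \<Longrightarrow> v j \<in> hcar K"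
  shows "(\<Sum>i<n. (hnorm K (\<Sum>j<n. T i j (v j)))\<^sup>2) \<le> (opmat_norm K n T)\<^sup>2 * (\<Sum>j<n. (hnorm K (v j))\<^sup>2)"
proof -
  define w where "w = (\<lambda>i. if i < n then v i else 0)"
  have w: "w \<in> hcar (hsum n K)" using assms(2) by (intro hsum_carI) (auto simp: w_def)
  have "(hnorm (hsum n K) (opmat K n T w))\<^sup>2 \<le> (opmat_norm K n T * hnorm (hsum n K) w)\<^sup>2"
    using hs.opn_ub [OF opmat_bops [OF assms(1)] w] by (simp add: opmat_norm_eq_opn assms(1) power_mono)
  moreover have "(hnorm (hsum n K) (opmat K n T w))\<^sup>2 = (\<Sum>i<n. (hnorm K (\<Sum>j<n. T i j (v j)))\<^sup>2)"
    using w assms by (subst hnorm_hsum_sq) (auto simp: opmat_apply w_def intro!: car_sum)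
  moreover have "(hnorm (hsum n K) w)\<^sup>2 = (\<Sum>j<n. (hnorm K (v j))\<^sup>2)"
    using assms by (subst hnorm_hsum_sq) (auto simp: w_def)
  ultimately show ?thesis by (simp add: power_mult_distrib)
qed

lemma opmat_norm_least:
  assumes T: "\<And>i j. i < n \<Longrightarrow> j < n \<Longrightarrow> T i j \<in> bops K" and c: "0 \<le> c"
    and le: "\<And>v. (\<And>j. j < n \<Longrightarrow> v j \<in> hcar K) \<Longrightarrow> (\<And>j. \<not> j < n \<Longrightarrow> v j = 0) \<Longrightarrow>
      (\<Sum>i<n. (hnorm K (\<Sum>j<n. T i j (v j)))\<^sup>2) \<le> c\<^sup>2 * (\<Sum>j<n. (hnorm K (v j))\<^sup>2)"
  shows "opmat_norm K n T \<le> c"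
proof -
  have "opn (hsum n K) (opmat K n T) \<le> c"
  proof (rule hs.opn_least [OF c])
    fix v assume v: "v \<in> hcar (hsum n K)"
    have "(hnorm (hsum n K) (opmat K n T v))\<^sup>2 = (\<Sum>i<n. (hnorm K (\<Sum>j<n. T i j (v j)))\<^sup>2)"
      unfolding opmat_apply [OF v]
      using hsum_carD(1) [OF v] T by (subst hnorm_hsum_sq) (auto intro!: car_sum)
    also have "\<dots> \<le> c\<^sup>2 * (\<Sum>j<n. (hnorm K (v j))\<^sup>2)"
      using v by (intro le) (auto intro: hsum_carD)
    also have "\<dots> = (c * hnorm (hsum n K) v)\<^sup>2"
      using v by (subst power_mult_distrib, subst hnorm_hsum_sq) (auto intro: hsum_carD)
    finally show "hnorm (hsum n K) (opmat K n T v) \<le> c * hnorm (hsum n K) v"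
      by (rule power2_le_imp_le) (simp add: c)
  qed
  then show ?thesis using opmat_norm_eq_opn [of n T] T by simp
qed

lemma opmat_norm_nonneg:
  assumes "\<And>i j. i < n \<Longrightarrow> j < n \<Longrightarrow> T i j \<in> bops K"
  shows "0 \<le> opmat_norm K n T"
  using hs.opn_nonneg [OF opmat_bops, of n T] opmat_norm_eq_opn [of n T] assms by simp

lemma opmat_norm_1:
  assumes "T 0 0 \<in> bops K"
  shows "opmat_norm K 1 T = opn K (T 0 0)"
proof (rule antisym)
  show "opmat_norm K 1 T \<le> opn K (T 0 0)"
    using assms power_mono [OF opn_ub [OF assms], of _ 2]
    by (intro opmat_norm_least) (auto simp: opn_nonneg power_mult_distrib)
  show "opn K (T 0 0) \<le> opmat_norm K 1 T"
  proof (rule opn_least)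
    show nn: "0 \<le> opmat_norm K 1 T" using assms by (intro opmat_norm_nonneg) auto
    fix v assume v: "v \<in> hcar K"
    have "(hnorm K (T 0 0 v))\<^sup>2 \<le> (opmat_norm K 1 T * hnorm K v)\<^sup>2"
      using opmat_norm_ub [of 1 T "\<lambda>_. v"] assms v by (simp add: power_mult_distrib)
    then show "hnorm K (T 0 0 v) \<le> opmat_norm K 1 T * hnorm K v"
      by (rule power2_le_imp_le) (use nn in simp)
  qed
qed

lemma opmat_norm_cong:
  "(\<And>i j. i < n \<Longrightarrow> j < n \<Longrightarrow> S i j = T i j) \<Longrightarrow> opmat_norm K n S = opmat_norm K n T"
  unfolding opmat_norm_def by (intro arg_cong [of _ _ Sup] Collect_cong ex_cong) simp

lemma opmat_comp:
  assumes S: "\<And>i j. i < n \<Longrightarrow> j < n \<Longrightarrow> S i j \<in> bops K" and T: "\<And>i j. i < n \<Longrightarrow> j < n \<Longrightarrow> T i j \<in> bops K"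
  shows "opmat K n S \<circ> opmat K n T = opmat K n (\<lambda>i j. \<Sum>k<n. S i k \<circ> T k j)"
proof (rule hs.bops_eqI)
  show "opmat K n S \<circ> opmat K n T \<in> bops (hsum n K)"
    using S T by (intro hs.comp_bops opmat_bops) auto
  show "opmat K n (\<lambda>i j. \<Sum>k<n. S i k \<circ> T k j) \<in> bops (hsum n K)"
    using S T by (intro opmat_bops sum_bops comp_bops) auto
  fix v assume v: "v \<in> hcar (hsum n K)"
  have "opmat K n T v \<in> hcar (hsum n K)" using v T by (simp add: hs.bops_car)
  moreover have "(\<Sum>k<n. S i k (\<Sum>j<n. T k j (v j))) = (\<Sum>j<n. \<Sum>k<n. S i k (T k j (v j)))" if "i < n" for i
  proof -
    have "(\<Sum>k<n. S i k (\<Sum>j<n. T k j (v j))) = (\<Sum>k<n. \<Sum>j<n. S i k (T k j (v j)))"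
      using S T v that by (intro sum.cong refl bops_sum) (auto simp: hsum_carD)
    then show ?thesis by (subst sum.swap)
  qed
  ultimately show "(opmat K n S \<circ> opmat K n T) v = opmat K n (\<lambda>i j. \<Sum>k<n. S i k \<circ> T k j) v"
    using v by (auto simp: opmat_apply fun_eq_iff sum_fun_app)
qed

lemma opmat_adjoint:
  assumes T: "\<And>i j. i < n \<Longrightarrow> j < n \<Longrightarrow> adjoint_pair K (T i j) (T' j i)"
  shows "adjoint_pair (hsum n K) (opmat K n T) (opmat K n T')"
  unfolding adjoint_pair_def
proof (intro conjI ballI)
  have b: "T i j \<in> bops K" "T' i j \<in> bops K" if "i < n" "j < n" for i j
    using T that by (auto simp: adjoint_pair_def)
  show "opmat K n T \<in> bops (hsum n K)" "opmat K n T' \<in> bops (hsum n K)"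
    using b by auto
  fix v w assume v: "v \<in> hcar (hsum n K)" and w: "w \<in> hcar (hsum n K)"
  have "hinner (hsum n K) (opmat K n T v) w = (\<Sum>i<n. \<Sum>j<n. hinner K (T i j (v j)) (w i))"
    using v w b unfolding inner_hsum opmat_apply [OF v]
    by (intro sum.cong refl) (auto intro!: inner_sum simp: hsum_carD(1) [OF v] hsum_carD(1) [OF w])
  also have "\<dots> = (\<Sum>j<n. \<Sum>i<n. hinner K (v j) (T' j i (w i)))"
    using v w T by (subst sum.swap) (auto intro!: sum.cong adjoint_pairD(1) simp: hsum_carD)
  also have "\<dots> = hinner (hsum n K) v (opmat K n T' w)"
    using v w b unfolding inner_hsum opmat_apply [OF w]
    by (intro sum.cong refl) (auto intro!: inner_sum_right [symmetric] simp: hsum_carD(1) [OF v] hsum_carD(1) [OF w])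
  finally show "hinner (hsum n K) (opmat K n T v) w = hinner (hsum n K) v (opmat K n T' w)" .
qed

end

lemma mtrunc_apply [simp]: "i < n \<Longrightarrow> j < n \<Longrightarrow> mtrunc n A i j = A i j" "\<not> (i < n \<and> j < n) \<Longrightarrow> mtrunc n A i j = 0"
  by (auto simp: mtrunc_def)

lemma matsD: "A \<in> mats n V \<Longrightarrow> i < n \<Longrightarrow> j < n \<Longrightarrow> A i j \<in> V"
  "A \<in> mats n V \<Longrightarrow> \<not> (i < n \<and> j < n) \<Longrightarrow> A i j = 0"
  unfolding mats_def by (auto split: if_splits)

lemma matsI: "(\<And>i j. i < n \<Longrightarrow> j < n \<Longrightarrow> A i j \<in> V) \<Longrightarrow> (\<And>i j. \<not> (i < n \<and> j < n) \<Longrightarrow> A i j = 0) \<Longrightarrow> A \<in> mats n V"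
  unfolding mats_def by auto

lemma mtrunc_mats [simp]: "(\<And>i j. i < n \<Longrightarrow> j < n \<Longrightarrow> A i j \<in> V) \<Longrightarrow> mtrunc n A \<in> mats n V"
  by (rule matsI) auto

lemma mats_eqI:
  assumes "A \<in> mats n V" "B \<in> mats n V" "\<And>i j. i < n \<Longrightarrow> j < n \<Longrightarrow> A i j = B i j"
  shows "A = B"
proof (intro ext)
  show "A i j = B i j" for i j
    using assms(3) [of i j] matsD(2) [OF assms(1), of i j] matsD(2) [OF assms(2), of i j]
    by (cases "i < n \<and> j < n") auto
qed

context vector_space
begin

lemma subspace_mats:
  assumes "subspace V"
  shows "module.subspace (pscl (pscl scale)) (mats n V)"
proof -
  interpret m: vector_space "pscl (pscl scale)"
    by (intro vector_space_pscl vector_space_axioms)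
  show ?thesis
    by (rule m.subspaceI)
      (use assms in \<open>auto simp: mats_def pscl_def subspace_0 subspace_add subspace_scale\<close>)
qed

lemma finite_mats:
  assumes "finite S" "V \<subseteq> span S"
  shows "\<exists>S'. finite S' \<and> mats n V \<subseteq> module.span (pscl (pscl scale)) S'"
proof -
  interpret m: vector_space "pscl (pscl scale)"
    by (intro vector_space_pscl vector_space_axioms)
  \<comment> \<open>Matrix units with a coefficient: \<open>s\<close> in position (i, j).\<close>
  define E where "E = (\<lambda>(i::nat) (j::nat) s i' j'. if i' = i \<and> j' = j then s else (0 :: 'b))"
  define S' where "S' = (\<lambda>(i, j, s). E i j s) ` ({..<n} \<times> {..<n} \<times> S)"
  have E: "E i j s \<in> m.span S'" if "i < n" "j < n" "s \<in> span S" for i j :: nat and s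
    using that(3)
  proof (induction rule: span_induct_alt)
    case base
    have "E i j 0 = 0" by (simp add: E_def fun_eq_iff)
    then show ?case by (simp only: m.span_zero)
  next
    case (step c x y)
    have "E i j (scale c x + y) = pscl (pscl scale) c (E i j x) + E i j y"
      by (simp add: E_def fun_eq_iff pscl_def)
    moreover have "E i j x \<in> S'" using that step unfolding S'_def by force
    ultimately show ?case using step(2) by (metis m.span_add m.span_scale m.span_base)
  qed
  have "M \<in> m.span S'" if M: "M \<in> mats n V" for M
  proof -
    have "M = (\<Sum>i<n. \<Sum>j<n. E i j (M i j))"
    proof (intro ext)
      fix a b
      have "(\<Sum>i<n. \<Sum>j<n. E i j (M i j)) a b = (\<Sum>i<n. \<Sum>j<n. E i j (M i j) a b)"
        by (simp add: sum_fun_app)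
      also have "\<dots> = (\<Sum>i<n. if i = a then \<Sum>j<n. if j = b then M a b else 0 else 0)"
        by (intro sum.cong refl) (auto simp: E_def intro!: sum.cong)
      also have "\<dots> = M a b"
        using matsD(2) [OF M, of a b] by (cases "a < n"; cases "b < n") auto
      finally show "M a b = (\<Sum>i<n. \<Sum>j<n. E i j (M i j)) a b" by simp
    qed
    moreover have "(\<Sum>i<n. \<Sum>j<n. E i j (M i j)) \<in> m.span S'"
      using M assms(2) by (intro m.span_sum E) (auto dest: matsD(1))
    ultimately show ?thesis by simp
  qed
  moreover have "finite S'" using assms(1) by (simp add: S'_def)
  ultimately show ?thesis by blast
qed

end

text \<open>Matrix algebras stay within the same locale, so eigenvectors and uniqueness of the norm
  are available at every matrix level.\<close>

lemma (in star_rep) star_rep_mat: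
  "star_rep (hsum n K) (mat_alg n A) (\<lambda>M. opmat K n (\<lambda>i j. \<pi> (M i j)))"
proof -
  let ?A = "mat_alg n A" and ?P = "\<lambda>M. opmat K n (\<lambda>i j. \<pi> (M i j))"
  interpret hs: prehilbert "hsum n K" by (rule prehilbert_hsum)
  obtain S where S: "finite S" "acar A \<subseteq> va.span S" using A_finite by blast
  have car: "acar ?A = mats n (acar A)" and scl: "ascl ?A = pscl (pscl (ascl A))"
    by (simp_all add: mat_alg_def)
  have b: "?P M \<in> bops (hsum n K)" if "M \<in> mats n (acar A)" for M
    using matsD(1) [OF that] by simp
  have lin: "lin_on (ascl ?A) (acar ?A) (pscl (hscl (hsum n K))) (bops (hsum n K)) ?P"
    unfolding lin_on_def car scl hsum_scl
  proof (intro conjI ballI allI b)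
    fix M assume M: "M \<in> mats n (acar A)"
    show "?P (M + N) = ?P M + ?P N" if N: "N \<in> mats n (acar A)" for N
      using matsD(1) [OF M] matsD(1) [OF N]
      by (auto simp: opmat_def on_zero_def fun_eq_iff rep_add sum.distrib)
    show "?P (pscl (pscl (ascl A)) c M) = pscl (pscl (hscl K)) c (?P M)" for c
      using matsD(1) [OF M]
      by (auto simp: opmat_def on_zero_def fun_eq_iff rep_scale pscl_def vs.scale_sum_right)
  qed
  have star: "astar ?A M \<in> acar ?A" "adjoint_pair (hsum n K) (?P M) (?P (astar ?A M))"
    if M: "M \<in> acar ?A" for M
  proof -
    note Mij = matsD(1) [OF M [unfolded car]]
    show "astar ?A M \<in> acar ?A"
      unfolding car using Mij by (simp add: mat_alg_def A_star)
    show "adjoint_pair (hsum n K) (?P M) (?P (astar ?A M))"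
      by (rule opmat_adjoint) (use Mij in \<open>simp add: mat_alg_def rep_star\<close>)
  qed
  have inj: "M = 0" if M: "M \<in> acar ?A" and P: "?P M = 0" for M
  proof (rule mats_eqI)
    show "M \<in> mats n (acar A)" "0 \<in> mats n (acar A)" using M by (simp_all add: car mats_def)
    fix i j assume ij: "i < n" "j < n"
    note Mij = matsD(1) [OF M [unfolded car]]
    have "\<pi> (M i j) v = 0" if v: "v \<in> hcar K" for v
    proof -
      \<comment> \<open>Placing \<open>v\<close> in slot \<open>j\<close> isolates the entry in row
        \<open>i\<close> and column \<open>j\<close>.\<close>
      define w where "w = (\<lambda>k. if k = j then v else 0)"
      have w: "w \<in> hcar (hsum n K)" using v ij by (intro hsum_carI) (auto simp: w_def)
      have "(\<Sum>k<n. \<pi> (M i k) (w k)) = 0"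
        using fun_cong [OF fun_cong [OF P, of w], of i] ij w by (simp add: opmat_apply)
      moreover have "(\<Sum>k<n. \<pi> (M i k) (w k)) = (\<Sum>k<n. if k = j then \<pi> (M i j) v else 0)"
        using ij Mij by (intro sum.cong) (auto simp: w_def)
      ultimately show ?thesis using ij by simp
    qed
    then have "\<pi> (M i j) = 0" using Mij [OF ij] by (intro bops_eqI) simp_all
    then show "M i j = 0 i j" using rep_inj Mij [OF ij] by simp
  qed
  have mul: "amul ?A M N \<in> acar ?A" "?P (amul ?A M N) = ?P M \<circ> ?P N"
    if M: "M \<in> acar ?A" and N: "N \<in> acar ?A" for M N
  proof -
    note Mij = matsD(1) [OF M [unfolded car]] and Nij = matsD(1) [OF N [unfolded car]]
    have prod: "(\<Sum>k<n. amul A (M i k) (N k j)) \<in> acar A" if "i < n" "j < n" for i j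
      using that Mij Nij by (intro va.subspace_sum [OF A_subspace] A_mul) auto
    then show "amul ?A M N \<in> acar ?A"
      unfolding car by (simp add: mat_alg_def)
    have "?P M \<circ> ?P N = opmat K n (\<lambda>i j. \<Sum>k<n. \<pi> (M i k) \<circ> \<pi> (N k j))"
      using Mij Nij by (intro opmat_comp) auto
    also have "\<dots> = ?P (amul ?A M N)"
    proof (rule hs.bops_eqI)
      have "\<pi> (\<Sum>k<n. amul A (M i k) (N k j)) = (\<Sum>k<n. \<pi> (M i k) \<circ> \<pi> (N k j))"
        if "i < n" "j < n" for i j
        using that Mij Nij
        by (subst va.lin_on_sum [OF A_subspace rep_lin vso.vector_space_axioms])
          (auto simp: A_mul rep_mul)
      then show "opmat K n (\<lambda>i j. \<Sum>k<n. \<pi> (M i k) \<circ> \<pi> (N k j)) v = ?P (amul ?A M N) v"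
        if "v \<in> hcar (hsum n K)" for v
        using that by (auto simp: opmat_apply mat_alg_def fun_eq_iff)
      show "opmat K n (\<lambda>i j. \<Sum>k<n. \<pi> (M i k) \<circ> \<pi> (N k j)) \<in> bops (hsum n K)"
        using Mij Nij by (intro opmat_bops sum_bops comp_bops) auto
      show "?P (amul ?A M N) \<in> bops (hsum n K)"
        using prod by (intro opmat_bops) (simp add: mat_alg_def)
    qed
    finally show "?P (amul ?A M N) = ?P M \<circ> ?P N" by simp
  qed
  have vs: "vector_space (ascl ?A)" unfolding scl by (intro vector_space_pscl A_vector_space)
  have sub: "module.subspace (ascl ?A) (acar ?A)"
    unfolding scl car by (rule va.subspace_mats [OF A_subspace])
  have fin: "\<exists>S. finite S \<and> acar ?A \<subseteq> module.span (ascl ?A) S"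
    unfolding scl car by (rule va.finite_mats [OF S])
  show ?thesis
    by (rule star_rep.intro [OF prehilbert_hsum], rule star_rep_axioms.intro, rule vs, rule sub,
        rule fin, erule (1) mul(1), erule star(1), rule lin, erule (1) inj, erule (1) mul(2),
        erule star(2))
qed

text \<open>The operator norm on the direct sum is a \<open>C*\<close>-norm on the matrix algebra,
  and there is no other one; this resolves the description operator in
  \<open>cstar_mnorm\<close>.\<close>

theorem (in star_rep) cstar_mnorm_eq:
  assumes M: "M \<in> mats n (acar A)"
  shows "cstar_mnorm A n M = opmat_norm K n (\<lambda>i j. \<pi> (M i j))"
proof -
  interpret m: star_rep "hsum n K" "mat_alg n A" "\<lambda>M. opmat K n (\<lambda>i j. \<pi> (M i j))"
    by (rule star_rep_mat)
  define N where "N = (\<lambda>M. opn (hsum n K) (opmat K n (\<lambda>i j. \<pi> (M i j))))"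
  have N: "cstar_algebra (mat_alg n A) N" by (rule m.cstar_algebra_of_rep) (simp add: N_def)
  have MA: "M \<in> acar (mat_alg n A)" using M by (simp add: mat_alg_def)
  have "cstar_mnorm A n M = N M"
    unfolding cstar_mnorm_def
  proof (rule the_equality)
    show "\<exists>N'. cstar_algebra (mat_alg n A) N' \<and> N M = N' M" using N by blast
    show "r = N M" if "\<exists>N. cstar_algebra (mat_alg n A) N \<and> r = N M" for r
      using that cstar_norm_unique [OF _ N _ _ MA] m.A_finite by metis
  qed
  then show ?thesis
    using opmat_norm_eq_opn [of n "\<lambda>i j. \<pi> (M i j)"] matsD(1) [OF M] by (simp add: N_def)
qed

subsection \<open>Uniqueness of adjoints of left multipliers\<close>

text \<open>A column of height 2, padded by zeros because only square matrices carry norms.\<close>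

definition column :: "'x::zero \<Rightarrow> 'x \<Rightarrow> nat \<Rightarrow> nat \<Rightarrow> 'x" where
  "column x y = (\<lambda>i j. if i = 0 \<and> j = 0 then x else if i = 1 \<and> j = 0 then y else 0)"

text \<open>This norm is intrinsic to \<open>X\<close>, which allows estimates proved in two
  different complete isometries to be combined.\<close>

definition colnorm :: "('f, 'x::zero) opspace \<Rightarrow> 'x \<Rightarrow> 'x \<Rightarrow> real" where
  "colnorm X x y = omnorm X 2 (column x y)"

lemma sum_lessThan_2: "(\<Sum>i<2. f i) = f 0 + f (1 :: nat)"
  by (simp add: numeral_2_eq_2)

locale comp_isom = prehilbert K for K :: "('f::rc_field, 'u::ab_group_add) hilb" +
  fixes X :: "('f, 'x::ab_group_add) opspace" and \<sigma> :: "'x \<Rightarrow> 'u \<Rightarrow> 'u"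
  assumes x_vs: "vector_space (oscl X)"
    and x_subspace: "module.subspace (oscl X) (ocar X)"
    and isom: "complete_isometry X K \<sigma>"
begin

sublocale xs: rc_vector_space "oscl X"
  unfolding rc_vector_space_def by (rule x_vs)

lemmas ocar_simps [simp] = xs.subspace_0 [OF x_subspace] xs.subspace_add [OF x_subspace]
  xs.subspace_scale [OF x_subspace] xs.subspace_diff [OF x_subspace] xs.subspace_neg [OF x_subspace]

lemma isom_lin: "lin_on (oscl X) (ocar X) (pscl (hscl K)) (bops K) \<sigma>"
  using isom by (simp add: complete_isometry_def)

lemma isom_bops [simp]: "x \<in> ocar X \<Longrightarrow> \<sigma> x \<in> bops K"
  using isom_lin unfolding lin_on_def by blast

lemma isom_add: "x \<in> ocar X \<Longrightarrow> y \<in> ocar X \<Longrightarrow> \<sigma> (x + y) = \<sigma> x + \<sigma> y"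
  using isom_lin unfolding lin_on_def by blast

lemma isom_scale: "x \<in> ocar X \<Longrightarrow> \<sigma> (oscl X c x) = pscl (hscl K) c (\<sigma> x)"
  using isom_lin unfolding lin_on_def by blast

lemma isom_0 [simp]: "\<sigma> 0 = 0"
  using xs.lin_on_zero [OF x_subspace isom_lin vso.vector_space_axioms] .

lemma isom_diff: "x \<in> ocar X \<Longrightarrow> y \<in> ocar X \<Longrightarrow> \<sigma> (x - y) = \<sigma> x - \<sigma> y"
  using xs.lin_on_diff [OF x_subspace isom_lin vso.vector_space_axioms] .

lemma isom_sum: "(\<And>i. i \<in> I \<Longrightarrow> f i \<in> ocar X) \<Longrightarrow> \<sigma> (\<Sum>i\<in>I. f i) = (\<Sum>i\<in>I. \<sigma> (f i))"
  by (rule xs.lin_on_sum [OF x_subspace isom_lin vso.vector_space_axioms])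

lemma isom_eqI: "x \<in> ocar X \<Longrightarrow> y \<in> ocar X \<Longrightarrow> \<sigma> x = \<sigma> y \<Longrightarrow> x = y"
  using isom unfolding complete_isometry_def inj_on_def by blast

lemma isom_norm: "0 < n \<Longrightarrow> A \<in> mats n (ocar X) \<Longrightarrow> opmat_norm K n (\<lambda>i j. \<sigma> (A i j)) = omnorm X n A"
  using isom unfolding complete_isometry_def by blast

lemma mat1_mats [simp]: "0 \<in> V \<Longrightarrow> x \<in> V \<Longrightarrow> mat1 x \<in> mats 1 V"
  unfolding mat1_def by (rule mtrunc_mats) simp

lemma isom_norm_1: "x \<in> ocar X \<Longrightarrow> omnorm X 1 (mat1 x) = opn K (\<sigma> x)"
  using isom_norm [of 1 "mat1 x"] opmat_norm_1 [of "\<lambda>i j. \<sigma> (mat1 x i j)"] by (simp add: mat1_def)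

lemma column_mats: "x \<in> ocar X \<Longrightarrow> y \<in> ocar X \<Longrightarrow> column x y \<in> mats 2 (ocar X)"
  by (rule matsI) (auto simp: column_def)

lemma colnorm_eq: "x \<in> ocar X \<Longrightarrow> y \<in> ocar X \<Longrightarrow> colnorm X x y = opmat_norm K 2 (\<lambda>i j. \<sigma> (column x y i j))"
  unfolding colnorm_def by (rule isom_norm [symmetric]) (simp_all add: column_mats)

lemma column_bops: "x \<in> ocar X \<Longrightarrow> y \<in> ocar X \<Longrightarrow> \<sigma> (column x y i j) \<in> bops K"
  by (simp add: column_def)

lemma column_sum: "(\<Sum>i<2. (hnorm K (\<Sum>j<2. \<sigma> (column x y i j) (v j)))\<^sup>2) =
    (hnorm K (\<sigma> x (v 0)))\<^sup>2 + (hnorm K (\<sigma> y (v 0)))\<^sup>2"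
  by (simp add: column_def sum_lessThan_2)

lemma colnorm_nonneg: "x \<in> ocar X \<Longrightarrow> y \<in> ocar X \<Longrightarrow> 0 \<le> colnorm X x y"
  unfolding colnorm_eq by (rule opmat_norm_nonneg) (rule column_bops)

lemma colnorm_ub:
  assumes "x \<in> ocar X" "y \<in> ocar X" "v \<in> hcar K"
  shows "(hnorm K (\<sigma> x v))\<^sup>2 + (hnorm K (\<sigma> y v))\<^sup>2 \<le> (colnorm X x y * hnorm K v)\<^sup>2"
proof -
  define w where "w = (\<lambda>j::nat. if j = 0 then v else 0)"
  have "(\<Sum>i<2. (hnorm K (\<Sum>j<2. \<sigma> (column x y i j) (w j)))\<^sup>2) \<le>
      (opmat_norm K 2 (\<lambda>i j. \<sigma> (column x y i j)))\<^sup>2 * (\<Sum>j<2. (hnorm K (w j))\<^sup>2)"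
    using assms by (intro opmat_norm_ub column_bops) (auto simp: w_def)
  then show ?thesis
    unfolding column_sum colnorm_eq [OF assms(1,2)]
    by (simp add: w_def sum_lessThan_2 power_mult_distrib)
qed

lemma colnorm_least:
  assumes "x \<in> ocar X" "y \<in> ocar X" "0 \<le> c"
    and le: "\<And>v. v \<in> hcar K \<Longrightarrow> (hnorm K (\<sigma> x v))\<^sup>2 + (hnorm K (\<sigma> y v))\<^sup>2 \<le> (c * hnorm K v)\<^sup>2"
  shows "colnorm X x y \<le> c"
  unfolding colnorm_eq [OF assms(1,2)]
proof (rule opmat_norm_least)
  fix v :: "nat \<Rightarrow> 'u" assume v: "\<And>j. j < 2 \<Longrightarrow> v j \<in> hcar K"
  have "(c * hnorm K (v 0))\<^sup>2 \<le> c\<^sup>2 * (\<Sum>j<2. (hnorm K (v j))\<^sup>2)"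
    by (simp add: sum_lessThan_2 power_mult_distrib mult_left_mono)
  then show "(\<Sum>i<2. (hnorm K (\<Sum>j<2. \<sigma> (column x y i j) (v j)))\<^sup>2) \<le> c\<^sup>2 * (\<Sum>j<2. (hnorm K (v j))\<^sup>2)"
    using le [of "v 0"] v [of 0] unfolding column_sum by simp
qed (use assms column_bops in auto)

lemma colnorm_triangle:
  assumes "x \<in> ocar X" "y \<in> ocar X" "x' \<in> ocar X" "y' \<in> ocar X"
  shows "colnorm X (x + x') (y + y') \<le> colnorm X x y + colnorm X x' y'"
proof (rule colnorm_least)
  fix v assume v: "v \<in> hcar K"
  let ?h = "\<lambda>x. hnorm K (\<sigma> x v)" and ?c = "colnorm X x y" and ?d = "colnorm X x' y'"
  have nn: "0 \<le> ?c" "0 \<le> ?d" "0 \<le> hnorm K v" using assms colnorm_nonneg by auto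
  have 1: "(?h x)\<^sup>2 + (?h y)\<^sup>2 \<le> (?c * hnorm K v)\<^sup>2" "(?h x')\<^sup>2 + (?h y')\<^sup>2 \<le> (?d * hnorm K v)\<^sup>2"
    using assms v by (simp_all add: colnorm_ub)
  have tri: "?h (x + x') \<le> ?h x + ?h x'" "?h (y + y') \<le> ?h y + ?h y'"
    using assms v hnorm_triangle by (simp_all add: isom_add)
  have cs: "?h x * ?h x' + ?h y * ?h y' \<le> (?c * hnorm K v) * (?d * hnorm K v)"
  proof (rule power2_le_imp_le)
    \<comment> \<open>Lagrange's identity in the plane; it yields the Cauchy-Schwarz inequality for
      the mixed terms.\<close>
    have "(?h x * ?h x' + ?h y * ?h y')\<^sup>2 + (?h x * ?h y' - ?h y * ?h x')\<^sup>2
        = ((?h x)\<^sup>2 + (?h y)\<^sup>2) * ((?h x')\<^sup>2 + (?h y')\<^sup>2)"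
      by (simp add: power2_eq_square algebra_simps)
    then have "(?h x * ?h x' + ?h y * ?h y')\<^sup>2 \<le> ((?h x)\<^sup>2 + (?h y)\<^sup>2) * ((?h x')\<^sup>2 + (?h y')\<^sup>2)"
      using zero_le_power2 [of "?h x * ?h y' - ?h y * ?h x'"] by linarith
    also have "\<dots> \<le> (?c * hnorm K v)\<^sup>2 * (?d * hnorm K v)\<^sup>2"
      using 1 by (intro mult_mono) auto
    finally show "(?h x * ?h x' + ?h y * ?h y')\<^sup>2 \<le> ((?c * hnorm K v) * (?d * hnorm K v))\<^sup>2"
      by (simp add: power_mult_distrib)
  qed (use nn in auto)
  have "(?h (x + x'))\<^sup>2 + (?h (y + y'))\<^sup>2 \<le> (?h x + ?h x')\<^sup>2 + (?h y + ?h y')\<^sup>2"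
    using tri by (intro add_mono power_mono) auto
  also have "\<dots> = ((?h x)\<^sup>2 + (?h y)\<^sup>2) + ((?h x')\<^sup>2 + (?h y')\<^sup>2) + 2 * (?h x * ?h x' + ?h y * ?h y')"
    by (simp add: power2_sum)
  also have "\<dots> \<le> (?c * hnorm K v)\<^sup>2 + (?d * hnorm K v)\<^sup>2 + 2 * ((?c * hnorm K v) * (?d * hnorm K v))"
    by (rule add_mono [OF add_mono [OF 1] mult_left_mono [OF cs]]) simp
  also have "\<dots> = ((?c + ?d) * hnorm K v)\<^sup>2"
    by (simp add: power2_eq_square algebra_simps)
  finally show "(?h (x + x'))\<^sup>2 + (?h (y + y'))\<^sup>2 \<le> ((?c + ?d) * hnorm K v)\<^sup>2" .
qed (use assms colnorm_nonneg in auto)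

lemma colnorm_scale_le:
  assumes "x \<in> ocar X" "y \<in> ocar X"
  shows "colnorm X (oscl X c x) (oscl X c y) \<le> norm c * colnorm X x y"
proof (rule colnorm_least)
  fix v assume v: "v \<in> hcar K"
  have "(norm c)\<^sup>2 * ((hnorm K (\<sigma> x v))\<^sup>2 + (hnorm K (\<sigma> y v))\<^sup>2) \<le> (norm c)\<^sup>2 * (colnorm X x y * hnorm K v)\<^sup>2"
    using colnorm_ub [OF assms v] by (intro mult_left_mono) auto
  then show "(hnorm K (\<sigma> (oscl X c x) v))\<^sup>2 + (hnorm K (\<sigma> (oscl X c y) v))\<^sup>2 \<le> (norm c * colnorm X x y * hnorm K v)\<^sup>2"
    using assms v by (simp add: isom_scale pscl_def hnorm_scale power_mult_distrib algebra_simps)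
qed (use assms colnorm_nonneg in auto)

lemma colnorm_mono:
  assumes "x \<in> ocar X" "y \<in> ocar X"
  shows "colnorm X x 0 \<le> colnorm X x y"
proof (rule colnorm_least)
  fix v assume v: "v \<in> hcar K"
  have "(hnorm K (\<sigma> x v))\<^sup>2 + (hnorm K (\<sigma> 0 v))\<^sup>2 \<le> (hnorm K (\<sigma> x v))\<^sup>2 + (hnorm K (\<sigma> y v))\<^sup>2"
    by simp
  also have "\<dots> \<le> (colnorm X x y * hnorm K v)\<^sup>2" by (rule colnorm_ub [OF assms v])
  finally show "(hnorm K (\<sigma> x v))\<^sup>2 + (hnorm K (\<sigma> 0 v))\<^sup>2 \<le> (colnorm X x y * hnorm K v)\<^sup>2" .
qed (use assms colnorm_nonneg in auto)

lemma colnorm_eq_0: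
  assumes "x \<in> ocar X" "colnorm X x 0 \<le> 0"
  shows "x = 0"
proof (rule isom_eqI)
  have "colnorm X x 0 = 0" using assms colnorm_nonneg [of x 0] by simp
  then have "hnorm K (\<sigma> x v) = 0" if "v \<in> hcar K" for v
    using colnorm_ub [OF assms(1) _ that, of 0] by simp
  then show "\<sigma> x = \<sigma> 0" using assms(1) by (intro bops_eqI) (simp_all add: hnorm_eq_0)
qed (use assms in auto)

text \<open>On columns, \<open>Z = (0, - b; a, 0)\<close> is skew-adjoint, so the norm of \<open>1 + t Z\<close> is
  \<open>1 + O(t\<^sup>2)\<close>.\<close>

lemma colnorm_skew:
  assumes ab: "adjoint_pair K a b"
    and T: "\<And>x. x \<in> ocar X \<Longrightarrow> T x \<in> ocar X \<and> \<sigma> (T x) = a \<circ> \<sigma> x"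
    and S: "\<And>x. x \<in> ocar X \<Longrightarrow> S x \<in> ocar X \<and> \<sigma> (S x) = b \<circ> \<sigma> x"
  shows "\<exists>C\<ge>0. \<forall>x\<in>ocar X. \<forall>y\<in>ocar X. colnorm X (S y) (T x) \<le> C * colnorm X x y \<and>
    (\<forall>t. colnorm X (x - oscl X (of_real t) (S y)) (y + oscl X (of_real t) (T x)) \<le> (1 + C * t\<^sup>2) * colnorm X x y)"
proof -
  have bo: "a \<in> bops K" "b \<in> bops K" using ab by (auto simp: adjoint_pair_def)
  define D where "D = max (opn K a) (opn K b)"
  have D: "0 \<le> D" using opn_nonneg [OF bo(1)] by (simp add: D_def)
  have aD: "hnorm K (a v) \<le> D * hnorm K v" "hnorm K (b v) \<le> D * hnorm K v" if "v \<in> hcar K" for v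
    using opn_ub [OF bo(1) that] opn_ub [OF bo(2) that]
      mult_right_mono [of "opn K a" D "hnorm K v"] mult_right_mono [of "opn K b" D "hnorm K v"]
    by (simp_all add: D_def)
  \<comment> \<open>\<open>D\<close> bounds the column \<open>(S y, T x)\<close>, and its square
    bounds the coefficient of t^2.\<close>
  define C where "C = max D (D\<^sup>2)"
  have C: "0 \<le> C" "D \<le> C" "D\<^sup>2 \<le> C" using D by (simp_all add: C_def)
  have "colnorm X (S y) (T x) \<le> C * colnorm X x y \<and>
    (\<forall>t. colnorm X (x - oscl X (of_real t) (S y)) (y + oscl X (of_real t) (T x)) \<le> (1 + C * t\<^sup>2) * colnorm X x y)"
    if x: "x \<in> ocar X" and y: "y \<in> ocar X" for x y
  proof (intro conjI allI)
    have cn: "0 \<le> colnorm X x y" using x y by (rule colnorm_nonneg)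
    have key: "(hnorm K (b (\<sigma> y v)))\<^sup>2 + (hnorm K (a (\<sigma> x v)))\<^sup>2 \<le> D\<^sup>2 * ((hnorm K (\<sigma> x v))\<^sup>2 + (hnorm K (\<sigma> y v))\<^sup>2)"
      if v: "v \<in> hcar K" for v
    proof -
      have "(hnorm K (b (\<sigma> y v)))\<^sup>2 \<le> (D * hnorm K (\<sigma> y v))\<^sup>2" "(hnorm K (a (\<sigma> x v)))\<^sup>2 \<le> (D * hnorm K (\<sigma> x v))\<^sup>2"
        using aD x y v by (auto intro!: power_mono)
      then show ?thesis by (simp add: power_mult_distrib algebra_simps)
    qed
    show "colnorm X (S y) (T x) \<le> C * colnorm X x y"
    proof (rule colnorm_least)
      fix v assume v: "v \<in> hcar K"
      have "(hnorm K (\<sigma> (S y) v))\<^sup>2 + (hnorm K (\<sigma> (T x) v))\<^sup>2 \<le> D\<^sup>2 * ((hnorm K (\<sigma> x v))\<^sup>2 + (hnorm K (\<sigma> y v))\<^sup>2)"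
        using key [OF v] S [OF y] T [OF x] by simp
      also have "\<dots> \<le> C\<^sup>2 * (colnorm X x y * hnorm K v)\<^sup>2"
        using C D by (intro mult_mono colnorm_ub x y v power_mono) auto
      finally show "(hnorm K (\<sigma> (S y) v))\<^sup>2 + (hnorm K (\<sigma> (T x) v))\<^sup>2 \<le> (C * colnorm X x y * hnorm K v)\<^sup>2"
        by (simp add: power_mult_distrib)
    qed (use x y S T C cn in auto)
    fix t :: real
    show "colnorm X (x - oscl X (of_real t) (S y)) (y + oscl X (of_real t) (T x)) \<le> (1 + C * t\<^sup>2) * colnorm X x y"
    proof (rule colnorm_least)
      fix v assume v: "v \<in> hcar K"
      let ?u = "\<sigma> x v" and ?w = "\<sigma> y v"
      have uw: "?u \<in> hcar K" "?w \<in> hcar K" "a ?u \<in> hcar K" "b ?w \<in> hcar K" using x y v bo by auto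
      have e1: "\<sigma> (x - oscl X (of_real t) (S y)) v = ?u + hscl K (of_real (- t)) (b ?w)"
        using x y S [OF y] by (simp add: isom_diff isom_scale pscl_def)
      have e2: "\<sigma> (y + oscl X (of_real t) (T x)) v = ?w + hscl K (of_real t) (a ?u)"
        using x y T [OF x] by (simp add: isom_add isom_scale pscl_def)
      \<comment> \<open>The terms linear in \<open>t\<close> cancel because \<open>b\<close> is the
        adjoint of \<open>a\<close>; only the quadratic ones survive.\<close>
      have "re (hinner K ?w (a ?u)) = re (hinner K (a ?u) ?w)"
        using inner_conj [OF uw(3,2)] by simp
      also have "\<dots> = re (hinner K ?u (b ?w))" using adjoint_pairD(1) [OF ab uw(1,2)] by simp
      finally have cross: "re (hinner K ?w (a ?u)) = re (hinner K ?u (b ?w))" .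
      have "(hnorm K (?u + hscl K (of_real (- t)) (b ?w)))\<^sup>2 + (hnorm K (?w + hscl K (of_real t) (a ?u)))\<^sup>2
        = (hnorm K ?u)\<^sup>2 + (hnorm K ?w)\<^sup>2 + t\<^sup>2 * ((hnorm K (b ?w))\<^sup>2 + (hnorm K (a ?u))\<^sup>2)"
        using uw cross
        by (simp add: hnorm_add_sq inner_scale_right re_of_real_mult hnorm_scale power_mult_distrib
            algebra_simps del: of_real_minus)
      also have "\<dots> \<le> (hnorm K ?u)\<^sup>2 + (hnorm K ?w)\<^sup>2 + t\<^sup>2 * (D\<^sup>2 * ((hnorm K ?u)\<^sup>2 + (hnorm K ?w)\<^sup>2))"
        using key [OF v] by (intro add_left_mono mult_left_mono) auto
      also have "\<dots> = (1 + D\<^sup>2 * t\<^sup>2) * ((hnorm K ?u)\<^sup>2 + (hnorm K ?w)\<^sup>2)"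
        by (simp add: algebra_simps)
      also have "\<dots> \<le> (1 + C * t\<^sup>2)\<^sup>2 * (colnorm X x y * hnorm K v)\<^sup>2"
      proof (intro mult_mono colnorm_ub x y v)
        have "1 + D\<^sup>2 * t\<^sup>2 \<le> 1 + C * t\<^sup>2" using C by (simp add: mult_right_mono)
        also have "\<dots> \<le> (1 + C * t\<^sup>2)\<^sup>2"
          using C(1) by (intro self_le_power) auto
        finally show "1 + D\<^sup>2 * t\<^sup>2 \<le> (1 + C * t\<^sup>2)\<^sup>2" .
      qed auto
      finally show "(hnorm K (\<sigma> (x - oscl X (of_real t) (S y)) v))\<^sup>2 + (hnorm K (\<sigma> (y + oscl X (of_real t) (T x)) v))\<^sup>2
          \<le> ((1 + C * t\<^sup>2) * colnorm X x y * hnorm K v)\<^sup>2"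
        unfolding e1 e2 by (simp add: power_mult_distrib)
    qed (use x y S T C cn in auto)
  qed
  then show ?thesis using C(1) by blast
qed

text \<open>Multipliers are defined as mere maps. Linearity comes from composition with
  \<open>a\<close> on the left and the injectivity of \<sigma>.\<close>

lemma multiplier_linear:
  assumes T: "\<And>x. x \<in> ocar X \<Longrightarrow> T x \<in> ocar X \<and> \<sigma> (T x) = a \<circ> \<sigma> x" and a: "a \<in> bops K"
  shows "lin_on (oscl X) (ocar X) (oscl X) (ocar X) T"
  unfolding lin_on_def
proof (intro conjI ballI allI)
  have s: "\<sigma> z v \<in> hcar K" if "z \<in> ocar X" for z v
    using that bops_outside [OF isom_bops [OF that], of v] by (cases "v \<in> hcar K") simp_all
  fix x assume x: "x \<in> ocar X"
  show "T x \<in> ocar X" using T x by blast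
  show "T (x + y) = T x + T y" if y: "y \<in> ocar X" for y
    using x y T bops_add [OF a] s by (intro isom_eqI) (auto simp: isom_add fun_eq_iff)
  show "T (oscl X c x) = oscl X c (T x)" for c
    using x T bops_scale [OF a] s by (intro isom_eqI) (auto simp: isom_scale fun_eq_iff pscl_def)
qed

end

text \<open>If \<open>R = S - S'\<close>, then \<open>(1 + t Z) (1 - t Z') = 1 + t N + O(t\<^sup>2)\<close> with the nilpotent
  \<open>N = (0, - R; 0, 0)\<close>. Hence \<open>1 + n t N = (1 + t N)\<^sup>n\<close> stays bounded for \<open>t = 1 / \<surd>n\<close>,
  which forces \<open>R = 0\<close>.\<close>

theorem left_adjoint_unique:
  fixes U :: "'u::ab_group_add itself" and X :: "('f::rc_field, 'x::ab_group_add) opspace"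
  assumes vs: "vector_space (oscl X)" and sub: "module.subspace (oscl X) (ocar X)"
    and S: "left_adjoint U X T S" and S': "left_adjoint U X T S'"
  shows "S = S'"
proof -
  from S obtain K :: "('f, 'u) hilb" and \<sigma> a b where 1: "hilbert_space K" "complete_isometry X K \<sigma>" "adjoint_pair K a b"
      and 2: "\<And>x. x \<in> ocar X \<Longrightarrow> \<sigma> (T x) = a \<circ> \<sigma> x \<and> \<sigma> (S x) = b \<circ> \<sigma> x"
    unfolding left_adjoint_def by blast
  from S' obtain K' :: "('f, 'u) hilb" and \<sigma>' a' b' where q1: "hilbert_space K'" "complete_isometry X K' \<sigma>'" "adjoint_pair K' a' b'"
      and q2: "\<And>x. x \<in> ocar X \<Longrightarrow> \<sigma>' (T x) = a' \<circ> \<sigma>' x \<and> \<sigma>' (S' x) = b' \<circ> \<sigma>' x"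
    unfolding left_adjoint_def by blast
  have m: "T \<in> maps_on (ocar X)" "S \<in> maps_on (ocar X)" "S' \<in> maps_on (ocar X)"
    using S S' by (auto simp: left_adjoint_def)
  have mT [simp]: "T x \<in> ocar X" "S x \<in> ocar X" "S' x \<in> ocar X" if "x \<in> ocar X" for x
    using m that by (auto simp: maps_on_def)
  interpret p: comp_isom K X \<sigma>
    using hilbert_space_prehilbert [OF 1(1)] vs sub 1(2) by (intro comp_isom.intro comp_isom_axioms.intro)
  interpret q: comp_isom K' X \<sigma>'
    using hilbert_space_prehilbert [OF q1(1)] vs sub q1(2) by (intro comp_isom.intro comp_isom_axioms.intro)
  have ab: "a \<in> bops K" "b \<in> bops K" "a' \<in> bops K'" using 1(3) q1(3) by (auto simp: adjoint_pair_def)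
  obtain C where C: "0 \<le> C" "\<And>x y. x \<in> ocar X \<Longrightarrow> y \<in> ocar X \<Longrightarrow> colnorm X (S y) (T x) \<le> C * colnorm X x y"
      "\<And>x y t. x \<in> ocar X \<Longrightarrow> y \<in> ocar X \<Longrightarrow>
        colnorm X (x - oscl X (of_real t) (S y)) (y + oscl X (of_real t) (T x)) \<le> (1 + C * t\<^sup>2) * colnorm X x y"
    using p.colnorm_skew [OF 1(3), of T S] 2 mT by metis
  obtain C' where C': "0 \<le> C'" "\<And>x y. x \<in> ocar X \<Longrightarrow> y \<in> ocar X \<Longrightarrow> colnorm X (S' y) (T x) \<le> C' * colnorm X x y"
      "\<And>x y t. x \<in> ocar X \<Longrightarrow> y \<in> ocar X \<Longrightarrow>
        colnorm X (x - oscl X (of_real t) (S' y)) (y + oscl X (of_real t) (T x)) \<le> (1 + C' * t\<^sup>2) * colnorm X x y"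
    using q.colnorm_skew [OF q1(3), of T S'] q2 mT by metis
  have linT: "lin_on (oscl X) (ocar X) (oscl X) (ocar X) T" and linS: "lin_on (oscl X) (ocar X) (oscl X) (ocar X) S"
    using 2 ab by (auto intro!: p.multiplier_linear)
  have Tadd: "T (x + y) = T x + T y" and Sadd: "S (x + y) = S x + S y" if "x \<in> ocar X" "y \<in> ocar X" for x y
    using linT linS that unfolding lin_on_def by blast+
  have Tscl: "T (oscl X c x) = oscl X c (T x)" and Sscl: "S (oscl X c x) = oscl X c (S x)" if "x \<in> ocar X" for x c
    using linT linS that unfolding lin_on_def by blast+
  \<comment> \<open>Collects the t^2 terms of (1 + C t^2)(1 + C' t^2) and the correction C C' t^2,
    using t^2 \<le> 1 for the term of order 4.\<close>
  define M where "M = C + C' + 2 * C * C'"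
  have M: "0 \<le> M" using C(1) C'(1) by (simp add: M_def)
  define R where "R = (\<lambda>y. S y - S' y)"
  have RX [simp]: "R y \<in> ocar X" if "y \<in> ocar X" for y using that by (simp add: R_def)
  have step: "colnorm X (x - oscl X (of_real t) (R y)) y \<le> (1 + M * t\<^sup>2) * colnorm X x y"
    if x: "x \<in> ocar X" and y: "y \<in> ocar X" and t: "t\<^sup>2 \<le> 1" for x y t
  proof -
    let ?t = "of_real t :: 'f"
    \<comment> \<open>This column is (1 - t Z') applied to (x, y). The bound with \<open>C'\<close>
      applies at \<open>- t\<close> because it depends on t^2 alone.\<close>
    let ?x1 = "x + oscl X ?t (S' y)" and ?y1 = "y - oscl X ?t (T x)"
    have x1: "?x1 \<in> ocar X" "?y1 \<in> ocar X" using x y by simp_all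
    have cn: "0 \<le> colnorm X x y" using x y by (rule p.colnorm_nonneg)
    have "colnorm X ?x1 ?y1 \<le> (1 + C' * t\<^sup>2) * colnorm X x y"
      using C'(3) [OF x y, of "- t"] by simp
    then have "(1 + C * t\<^sup>2) * colnorm X ?x1 ?y1 \<le> (1 + C * t\<^sup>2) * ((1 + C' * t\<^sup>2) * colnorm X x y)"
      using C(1) by (intro mult_left_mono) auto
    then have b1: "colnorm X (?x1 - oscl X ?t (S ?y1)) (?y1 + oscl X ?t (T ?x1))
        \<le> (1 + C * t\<^sup>2) * ((1 + C' * t\<^sup>2) * colnorm X x y)"
      using C(3) [OF x1, of t] by simp
    \<comment> \<open>The product (1 + t Z)(1 - t Z') equals 1 + t N - t^2 Z Z'. Adding the column
      scaled by \<open>?c\<close> cancels the last term and leaves exactly 1 + t N.\<close>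
    let ?c = "- (?t * ?t)"
    have "colnorm X (oscl X ?c (S (T x))) (oscl X ?c (T (S' y))) \<le> norm ?c * colnorm X (S (T x)) (T (S' y))"
      using x y by (intro p.colnorm_scale_le) simp_all
    also have "\<dots> \<le> norm ?c * (C * (C' * colnorm X x y))"
      using C(2) [of "S' y" "T x"] mult_left_mono [OF C'(2) [OF x y] C(1)] x y
      by (intro mult_left_mono) auto
    also have "norm ?c = t\<^sup>2" by (simp add: norm_mult power2_eq_square)
    finally have b2: "colnorm X (oscl X ?c (S (T x))) (oscl X ?c (T (S' y))) \<le> t\<^sup>2 * (C * (C' * colnorm X x y))" .
    have n: "S (- oscl X ?t (T x)) = - oscl X ?t (S (T x))"
      using Sscl [of "T x" "- ?t"] x by simp
    have "S ?y1 = S y - oscl X ?t (S (T x))"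
      using Sadd [of y "- oscl X ?t (T x)"] n x y by simp
    then have e1: "x - oscl X ?t (R y) = (?x1 - oscl X ?t (S ?y1)) + oscl X ?c (S (T x))"
      by (simp add: R_def p.xs.scale_right_diff_distrib)
    have e2: "y = (?y1 + oscl X ?t (T ?x1)) + oscl X ?c (T (S' y))"
      using x y by (simp add: Tadd Tscl p.xs.scale_right_distrib)
    have "colnorm X (x - oscl X ?t (R y)) y \<le>
        colnorm X (?x1 - oscl X ?t (S ?y1)) (?y1 + oscl X ?t (T ?x1)) + colnorm X (oscl X ?c (S (T x))) (oscl X ?c (T (S' y)))"
      using p.colnorm_triangle [of "?x1 - oscl X ?t (S ?y1)" "?y1 + oscl X ?t (T ?x1)"
          "oscl X ?c (S (T x))" "oscl X ?c (T (S' y))"] x y x1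
      unfolding e1 [symmetric] e2 [symmetric] by simp
    also have "\<dots> \<le> (1 + C * t\<^sup>2) * ((1 + C' * t\<^sup>2) * colnorm X x y) + t\<^sup>2 * (C * (C' * colnorm X x y))"
      using b1 b2 by simp
    also have "\<dots> = (1 + (C + C' + C * C' * t\<^sup>2 + C * C') * t\<^sup>2) * colnorm X x y"
      by (simp add: algebra_simps)
    also have "\<dots> \<le> (1 + M * t\<^sup>2) * colnorm X x y"
    proof (intro mult_right_mono add_left_mono cn)
      show "C + C' + C * C' * t\<^sup>2 + C * C' \<le> M"
        using mult_left_mono [OF t, of "C * C'"] C(1) C'(1) by (simp add: M_def mult.commute)
    qed simp
    finally show ?thesis .
  qed
  have R0: "R y = 0" if y: "y \<in> ocar X" for y
  proof -
    \<comment> \<open>Since N is nilpotent of order 2, \<open>k\<close> steps starting at the column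
      (0, y) lead to (- k t R y, y).\<close>
    have it: "colnorm X (- oscl X (of_real (real k * t)) (R y)) y \<le> (1 + M * t\<^sup>2) ^ k * colnorm X 0 y"
      if t: "t\<^sup>2 \<le> 1" for k t
    proof (induction k)
      case (Suc k)
      have "- oscl X (of_real (real (Suc k) * t)) (R y)
          = - oscl X (of_real (real k * t)) (R y) - oscl X (of_real t) (R y)"
        by (simp add: distrib_right p.xs.scale_left_distrib)
      then have "colnorm X (- oscl X (of_real (real (Suc k) * t)) (R y)) y
          \<le> (1 + M * t\<^sup>2) * colnorm X (- oscl X (of_real (real k * t)) (R y)) y"
        using step [OF _ y t, of "- oscl X (of_real (real k * t)) (R y)"] y by simp
      also have "\<dots> \<le> (1 + M * t\<^sup>2) * ((1 + M * t\<^sup>2) ^ k * colnorm X 0 y)"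
        using M by (intro mult_left_mono Suc) auto
      finally show ?case by simp
    qed simp
    have bd: "sqrt (real n) * colnorm X (R y) 0 \<le> exp M * colnorm X 0 y" if n: "n > 0" for n :: nat
    proof -
      define t where "t = 1 / sqrt (real n)"
      have t2: "t\<^sup>2 = 1 / real n" by (simp add: t_def power_divide)
      have nt: "real n * t = sqrt (real n)" using n by (simp add: t_def real_div_sqrt)
      have c0: "0 \<le> colnorm X 0 y" using y by (intro p.colnorm_nonneg) auto
      have "colnorm X (R y) 0 = colnorm X (oscl X (of_real (- 1 / sqrt (real n))) (- oscl X (of_real (sqrt (real n))) (R y))) (oscl X (of_real (- 1 / sqrt (real n))) 0)"
        using n by simp
      also have "\<dots> \<le> norm (of_real (- 1 / sqrt (real n)) :: 'f) * colnorm X (- oscl X (of_real (sqrt (real n))) (R y)) 0"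
        using y by (intro p.colnorm_scale_le) auto
      also have "norm (of_real (- 1 / sqrt (real n)) :: 'f) = 1 / sqrt (real n)"
        unfolding norm_of_real by simp
      finally have "sqrt (real n) * colnorm X (R y) 0 \<le> colnorm X (- oscl X (of_real (sqrt (real n))) (R y)) 0"
        using n by (simp add: field_simps)
      also have "\<dots> \<le> colnorm X (- oscl X (of_real (sqrt (real n))) (R y)) y"
        using y by (intro p.colnorm_mono) auto
      also have "\<dots> \<le> (1 + M * t\<^sup>2) ^ n * colnorm X 0 y"
        using it [of t n] n by (simp add: t2 nt)
      also have "\<dots> \<le> exp M * colnorm X 0 y"
      proof (intro mult_right_mono c0)
        have "(1 + M * t\<^sup>2) ^ n \<le> exp (M / real n) ^ n"
          using M exp_ge_add_one_self [of "M / real n"] by (intro power_mono) (simp_all add: t2)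
        also have "\<dots> = exp M" using n by (simp add: exp_of_nat_mult [symmetric])
        finally show "(1 + M * t\<^sup>2) ^ n \<le> exp M" .
      qed
      finally show ?thesis .
    qed
    have "colnorm X (R y) 0 \<le> 0"
    proof (rule ccontr)
      assume "\<not> ?thesis"
      then have c: "0 < colnorm X (R y) 0" by simp
      obtain n :: nat where n: "(exp M * colnorm X 0 y / colnorm X (R y) 0)\<^sup>2 < real n"
        using reals_Archimedean2 by blast
      have n0: "n > 0" using n zero_le_power2 [of "exp M * colnorm X 0 y / colnorm X (R y) 0"] by (cases n) auto
      have "exp M * colnorm X 0 y / colnorm X (R y) 0 < sqrt (real n)"
        using n by (rule real_less_rsqrt)
      then show False using bd [OF n0] c by (simp add: field_simps)
    qed
    then show ?thesis using y by (intro p.colnorm_eq_0) auto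
  qed
  show ?thesis
  proof (rule ext)
    fix y show "S y = S' y"
      using R0 [of y] m by (cases "y \<in> ocar X") (auto simp: R_def maps_on_def)
  qed
qed

lemma left_adjoint_sym: "left_adjoint U X T S \<Longrightarrow> left_adjoint U X S T"
  unfolding left_adjoint_def
  using prehilbert.adjoint_sym [OF hilbert_space_prehilbert] by blast

lemma right_adjoint_sym: "right_adjoint U X T S \<Longrightarrow> right_adjoint U X S T"
  unfolding right_adjoint_def
  using prehilbert.adjoint_sym [OF hilbert_space_prehilbert] by blast

text \<open>Adjoints of left multipliers are unique, so a common adjoint for both sides is the only
  candidate for the description in \<open>centralizer_star\<close>.\<close>

lemma centralizer_star_eq:
  assumes "vector_space (oscl X)" "module.subspace (oscl X) (ocar X)"
    and "left_adjoint U X T S" "right_adjoint U X T S"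
  shows "centralizer_star U X T = S"
  unfolding centralizer_star_def
proof (rule the_equality)
  show "S \<in> centralizer U X \<and> left_adjoint U X T S \<and> right_adjoint U X T S"
    using assms left_adjoint_sym right_adjoint_sym
    unfolding centralizer_def left_multipliers_def right_multipliers_def by blast
  show "S' = S" if "S' \<in> centralizer U X \<and> left_adjoint U X T S' \<and> right_adjoint U X T S'" for S'
    using left_adjoint_unique [OF assms(1,2) assms(3)] that by blast
qed

subsection \<open>The algebra \<open>D\<close> and its faithful representation\<close>

text \<open>Kept free of \<open>X\<close> because it is instantiated twice: for the given
  representation of \<open>X\<close> and for the representation of \<open>D\<close> through which
  \<open>D_G\<close> is normed.\<close>

locale unitary_setting = prehilbert K + group G
  for K :: "('f::rc_field, 'u::ab_group_add) hilb" and G :: "('g, 'z) monoid_scheme" +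
  fixes H :: "'g set" and \<theta> :: "'g \<Rightarrow> 'u \<Rightarrow> 'u"
  assumes finite_G: "finite (carrier G)" and central_H: "central_subgroup H G"
    and unitary: "unitary_rep G H K \<theta>"
begin

lemma H_subgroup: "subgroup H G"
  using central_H by (simp add: central_subgroup_def)

lemma H_G [simp]: "h \<in> H \<Longrightarrow> h \<in> carrier G"
  using subgroup.mem_carrier [OF H_subgroup] .

lemma H_closed [simp]: "\<one>\<^bsub>G\<^esub> \<in> H" "h \<in> H \<Longrightarrow> inv\<^bsub>G\<^esub> h \<in> H" "h \<in> H \<Longrightarrow> k \<in> H \<Longrightarrow> h \<otimes>\<^bsub>G\<^esub> k \<in> H"
  using H_subgroup by (simp_all add: subgroup.one_closed subgroup.m_inv_closed subgroup.m_closed)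

lemma H_comm: "h \<in> H \<Longrightarrow> g \<in> carrier G \<Longrightarrow> h \<otimes>\<^bsub>G\<^esub> g = g \<otimes>\<^bsub>G\<^esub> h"
  using central_H by (simp add: central_subgroup_def)

lemma H_finite: "finite H"
  using finite_G H_subgroup finite_subset subgroup.subset by blast

lemma theta_bops [simp]: "h \<in> H \<Longrightarrow> \<theta> h \<in> bops K"
  using unitary by (simp add: unitary_rep_def)

lemma theta_inner: "h \<in> H \<Longrightarrow> v \<in> hcar K \<Longrightarrow> w \<in> hcar K \<Longrightarrow> hinner K (\<theta> h v) (\<theta> h w) = hinner K v w"
  using unitary by (simp add: unitary_rep_def)

lemma theta_one [simp]: "v \<in> hcar K \<Longrightarrow> \<theta> \<one>\<^bsub>G\<^esub> v = v"
  using unitary by (simp add: unitary_rep_def)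

lemma theta_mult: "h \<in> H \<Longrightarrow> k \<in> H \<Longrightarrow> \<theta> (h \<otimes>\<^bsub>G\<^esub> k) = \<theta> h \<circ> \<theta> k"
  using unitary by (simp add: unitary_rep_def)

lemma theta_adjoint: "h \<in> H \<Longrightarrow> adjoint_pair K (\<theta> h) (\<theta> (inv\<^bsub>G\<^esub> h))"
  unfolding adjoint_pair_def
proof (intro conjI ballI)
  fix v w assume h: "h \<in> H" and v: "v \<in> hcar K" and w: "w \<in> hcar K"
  have "\<theta> h (\<theta> (inv\<^bsub>G\<^esub> h) w) = \<theta> (h \<otimes>\<^bsub>G\<^esub> inv\<^bsub>G\<^esub> h) w"
    unfolding theta_mult [OF h H_closed(2) [OF h]] by simp
  then have "\<theta> h (\<theta> (inv\<^bsub>G\<^esub> h) w) = w" using h w by simp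
  then show "hinner K (\<theta> h v) w = hinner K v (\<theta> (inv\<^bsub>G\<^esub> h) w)"
    using theta_inner [OF h v, of "\<theta> (inv\<^bsub>G\<^esub> h) w"] h w by simp
qed simp_all

lemma theta_commute: "h \<in> H \<Longrightarrow> k \<in> H \<Longrightarrow> \<theta> h \<circ> \<theta> k = \<theta> k \<circ> \<theta> h"
  using theta_mult [of h k] theta_mult [of k h] H_comm [of h k] by simp

end

locale central_setting =
  fixes G :: "('g, 'z) monoid_scheme" and H :: "'g set"
    and X :: "('f::rc_field, 'x::ab_group_add) opspace" and act :: "'g \<Rightarrow> 'x \<Rightarrow> 'x"
    and K :: "('f, 'u::ab_group_add) hilb" and \<theta> :: "'g \<Rightarrow> 'u \<Rightarrow> 'u" and \<rho> :: "'x \<Rightarrow> 'u \<Rightarrow> 'u"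
  assumes G_group: "group G" and G_finite: "finite (carrier G)" and H_central: "central_subgroup H G"
    and X_vs: "vector_space (oscl X)" and X_subspace: "module.subspace (oscl X) (ocar X)"
    and modular: "modular_action G H X act"
    and rep: "central_rep G H X act K \<theta> \<rho>"
begin

sublocale unitary_setting K G H \<theta>
  using rep hilbert_space_prehilbert G_group G_finite H_central
  by (intro unitary_setting.intro unitary_setting_axioms.intro) (auto simp: central_rep_def)

sublocale comp_isom K X \<rho>
  using rep X_vs X_subspace hilbert_space_prehilbert
  by (intro comp_isom.intro comp_isom_axioms.intro) (auto simp: central_rep_def)

sublocale xso: rc_vector_space "pscl (oscl X)"
  unfolding rc_vector_space_def by (rule vector_space_pscl [OF X_vs])

lemma rho_act: "h \<in> H \<Longrightarrow> x \<in> ocar X \<Longrightarrow> \<rho> (act h x) = \<theta> h \<circ> \<rho> x"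
    "h \<in> H \<Longrightarrow> x \<in> ocar X \<Longrightarrow> \<rho> (act h x) = \<rho> x \<circ> \<theta> h"
  using rep unfolding central_rep_def by blast+

lemma act_ocar [simp]: "h \<in> H \<Longrightarrow> x \<in> ocar X \<Longrightarrow> act h x \<in> ocar X"
  using modular unfolding modular_action_def lin_on_def by blast

lemma act_one [simp]: "x \<in> ocar X \<Longrightarrow> act \<one>\<^bsub>G\<^esub> x = x"
  using modular unfolding modular_action_def by blast

lemma act_mult: "h \<in> H \<Longrightarrow> k \<in> H \<Longrightarrow> x \<in> ocar X \<Longrightarrow> act (h \<otimes>\<^bsub>G\<^esub> k) x = act h (act k x)"
  using modular unfolding modular_action_def by blast

lemma act_inv [simp]: "h \<in> H \<Longrightarrow> x \<in> ocar X \<Longrightarrow> act (inv\<^bsub>G\<^esub> h) (act h x) = x"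
    "h \<in> H \<Longrightarrow> x \<in> ocar X \<Longrightarrow> act h (act (inv\<^bsub>G\<^esub> h) x) = x"
  by (simp_all add: act_mult [symmetric])

lemma act_lin: "h \<in> H \<Longrightarrow> lin_on (oscl X) (ocar X) (oscl X) (ocar X) (act h)"
  using modular unfolding modular_action_def by blast

lemma rho_car [simp]: "x \<in> ocar X \<Longrightarrow> \<rho> x v \<in> hcar K"
  using bops_outside [OF isom_bops, of x v] by (cases "v \<in> hcar K") simp_all

section \<open>The span of the action on \<open>X\<close> and the span of the unitaries on
  \<open>K\<close>\<close>

definition hop :: "'g \<Rightarrow> 'x \<Rightarrow> 'x" where
  "hop h = on_zero (ocar X) (act h)"

definition D :: "('x \<Rightarrow> 'x) set" where
  "D = xso.span (hop ` H)"

text \<open>A commutative star-algebra on \<open>K\<close>. In general \<open>D\<close> is only a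
  quotient of it, since a combination of the unitaries \<theta> h may vanish on \<rho>(X) K.\<close>

definition B :: "('u \<Rightarrow> 'u) set" where
  "B = vso.span (\<theta> ` H)"

lemma D_alg_simps: "acar (D_alg TYPE('u) H X act) = D" "ascl (D_alg TYPE('u) H X act) = pscl (oscl X)"
    "amul (D_alg TYPE('u) H X act) = (\<circ>)" "astar (D_alg TYPE('u) H X act) = centralizer_star TYPE('u) X"
  by (simp_all add: D_alg_def D_def hop_def)

lemma D_subspace: "xso.subspace D" and B_subspace: "vso.subspace B"
  by (simp_all add: D_def B_def)

lemmas D_simps [simp] = xso.subspace_0 [OF D_subspace] xso.subspace_add [OF D_subspace]
  xso.subspace_scale [OF D_subspace] xso.subspace_diff [OF D_subspace]

lemmas B_simps [simp] = vso.subspace_0 [OF B_subspace] vso.subspace_add [OF B_subspace]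
  vso.subspace_scale [OF B_subspace] vso.subspace_diff [OF B_subspace]

lemma hop_D [simp]: "h \<in> H \<Longrightarrow> hop h \<in> D" and theta_B [simp]: "h \<in> H \<Longrightarrow> \<theta> h \<in> B"
  by (auto simp: D_def B_def intro: xso.span_base vso.span_base)

lemma hop_apply: "x \<in> ocar X \<Longrightarrow> hop h x = act h x" "x \<notin> ocar X \<Longrightarrow> hop h x = 0"
  by (simp_all add: hop_def on_zero_def)

lemma B_induct:
  assumes "b \<in> B" "P 0"
    and step: "\<And>c h b. h \<in> H \<Longrightarrow> b \<in> B \<Longrightarrow> P b \<Longrightarrow> P (pscl (hscl K) c (\<theta> h) + b)"
  shows "P b"
proof -
  have "b \<in> B \<and> P b"
  proof (rule vso.span_induct_alt [of b "\<theta> ` H" "\<lambda>b. b \<in> B \<and> P b"])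
    show "b \<in> vso.span (\<theta> ` H)" using assms(1) by (simp only: B_def)
    show "0 \<in> B \<and> P 0" using assms(2) by simp
    show "pscl (hscl K) c x + y \<in> B \<and> P (pscl (hscl K) c x + y)"
      if "x \<in> \<theta> ` H" "y \<in> B \<and> P y" for c x y
      using that step by auto
  qed
  then show ?thesis ..
qed

lemma D_induct:
  assumes "d \<in> D" "P 0"
    and step: "\<And>c h d. h \<in> H \<Longrightarrow> d \<in> D \<Longrightarrow> P d \<Longrightarrow> P (pscl (oscl X) c (hop h) + d)"
  shows "P d"
proof -
  have "d \<in> D \<and> P d"
  proof (rule xso.span_induct_alt [of d "hop ` H" "\<lambda>d. d \<in> D \<and> P d"])
    show "d \<in> xso.span (hop ` H)" using assms(1) by (simp only: D_def)
    show "0 \<in> D \<and> P 0" using assms(2) by simp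
    show "pscl (oscl X) c x + y \<in> D \<and> P (pscl (oscl X) c x + y)"
      if "x \<in> hop ` H" "y \<in> D \<and> P y" for c x y
      using that step by auto
  qed
  then show ?thesis ..
qed

lemma B_bops [simp]: "b \<in> B \<Longrightarrow> b \<in> bops K"
proof -
  have "\<theta> ` H \<subseteq> bops K" by auto
  then show "b \<in> B \<Longrightarrow> b \<in> bops K"
    using vso.span_minimal [OF _ subspace_bops] unfolding B_def by blast
qed

lemma B_car [simp]: "b \<in> B \<Longrightarrow> b v \<in> hcar K"
  using bops_outside [of b v] by (cases "v \<in> hcar K") simp_all

lemma B_comm_theta:
  assumes "b \<in> B" "h \<in> H"
  shows "b (\<theta> h v) = \<theta> h (b v)"
  using assms(1)
proof (rule B_induct)
  fix c k b assume k: "k \<in> H" and b: "b \<in> B" and IH: "b (\<theta> h v) = \<theta> h (b v)"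
  have hk: "\<theta> k (\<theta> h v) = \<theta> h (\<theta> k v)"
    using fun_cong [OF theta_commute [OF k assms(2)], of v] by simp
  have "\<theta> h (hscl K c (\<theta> k v) + b v) = hscl K c (\<theta> h (\<theta> k v)) + \<theta> h (b v)"
    using assms k b by (simp add: bops_add bops_scale B_car [OF theta_B])
  then show "(pscl (hscl K) c (\<theta> k) + b) (\<theta> h v) = \<theta> h ((pscl (hscl K) c (\<theta> k) + b) v)"
    by (simp add: pscl_def hk IH)
qed (use assms in simp)

lemma B_commute':
  assumes "b \<in> B" "b' \<in> B"
  shows "b (b' v) = b' (b v)"
  using assms(1)
proof (rule B_induct)
  fix c h b assume h: "h \<in> H" and b: "b \<in> B" and IH: "b (b' v) = b' (b v)"
  have "b' (hscl K c (\<theta> h v) + b v) = hscl K c (b' (\<theta> h v)) + b' (b v)"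
    using assms h b by (simp add: bops_add bops_scale B_car [OF theta_B])
  then show "(pscl (hscl K) c (\<theta> h) + b) (b' v) = b' ((pscl (hscl K) c (\<theta> h) + b) v)"
    by (simp add: pscl_def IH B_comm_theta [OF assms(2) h])
qed (use assms in simp)

lemma B_commute: "b \<in> B \<Longrightarrow> b' \<in> B \<Longrightarrow> b \<circ> b' = b' \<circ> b"
  by (simp add: fun_eq_iff B_commute')

lemma B_theta_comp:
  assumes "h \<in> H" "b \<in> B"
  shows "\<theta> h \<circ> b \<in> B"
  using assms(2)
proof (rule B_induct)
  have "\<theta> h \<circ> 0 = (0 :: 'u \<Rightarrow> 'u)" using assms by (auto simp: fun_eq_iff)
  then show "\<theta> h \<circ> 0 \<in> B" by simp
  fix c k b assume k: "k \<in> H" and b: "b \<in> B" and IH: "\<theta> h \<circ> b \<in> B"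
  have "\<theta> h \<circ> (pscl (hscl K) c (\<theta> k) + b) = pscl (hscl K) c (\<theta> (h \<otimes>\<^bsub>G\<^esub> k)) + (\<theta> h \<circ> b)"
    using assms k b by (simp add: fun_eq_iff pscl_def theta_mult bops_add bops_scale B_car [OF theta_B])
  then show "\<theta> h \<circ> (pscl (hscl K) c (\<theta> k) + b) \<in> B" using assms k IH by simp
qed

lemma B_comp [simp]:
  assumes "b \<in> B" "b' \<in> B"
  shows "b \<circ> b' \<in> B"
  using assms(1)
proof (rule B_induct)
  have "0 \<circ> b' = (0 :: 'u \<Rightarrow> 'u)" by (auto simp: fun_eq_iff)
  then show "0 \<circ> b' \<in> B" by simp
  fix c h b assume h: "h \<in> H" and IH: "b \<circ> b' \<in> B"
  have "(pscl (hscl K) c (\<theta> h) + b) \<circ> b' = pscl (hscl K) c (\<theta> h \<circ> b') + (b \<circ> b')"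
    by (simp add: fun_eq_iff pscl_def)
  then show "(pscl (hscl K) c (\<theta> h) + b) \<circ> b' \<in> B" using h IH B_theta_comp [OF h assms(2)] by simp
qed

lemma B_adjoint:
  assumes "b \<in> B"
  shows "\<exists>b'\<in>B. adjoint_pair K b b'"
  using assms
proof (rule B_induct)
  show "\<exists>b'\<in>B. adjoint_pair K 0 b'" using adjoint_0 B_simps(1) by blast
  fix c h b assume h: "h \<in> H" and "\<exists>b'\<in>B. adjoint_pair K b b'"
  then obtain b' where b': "b' \<in> B" "adjoint_pair K b b'" by blast
  have "adjoint_pair K (pscl (hscl K) c (\<theta> h) + b) (pscl (hscl K) (fconj c) (\<theta> (inv\<^bsub>G\<^esub> h)) + b')"
    by (intro adjoint_add adjoint_scale theta_adjoint b' h)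
  moreover have "pscl (hscl K) (fconj c) (\<theta> (inv\<^bsub>G\<^esub> h)) + b' \<in> B" using b' h by simp
  ultimately show "\<exists>b'\<in>B. adjoint_pair K (pscl (hscl K) c (\<theta> h) + b) b'" by blast
qed

lemma B_rho':
  assumes "b \<in> B" "x \<in> ocar X"
  shows "b (\<rho> x v) = \<rho> x (b v)"
  using assms(1)
proof (rule B_induct)
  fix c h b assume h: "h \<in> H" and b: "b \<in> B" and IH: "b (\<rho> x v) = \<rho> x (b v)"
  have hb: "\<theta> h (\<rho> x v) = \<rho> x (\<theta> h v)"
    using fun_cong [OF rho_act(1) [OF h assms(2)], of v] fun_cong [OF rho_act(2) [OF h assms(2)], of v] by simp
  have "\<rho> x (hscl K c (\<theta> h v) + b v) = hscl K c (\<rho> x (\<theta> h v)) + \<rho> x (b v)"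
    using assms h b by (simp add: bops_add bops_scale B_car [OF theta_B])
  then show "(pscl (hscl K) c (\<theta> h) + b) (\<rho> x v) = \<rho> x ((pscl (hscl K) c (\<theta> h) + b) v)"
    by (simp add: pscl_def hb IH)
qed (use assms in simp)

lemma B_rho: "b \<in> B \<Longrightarrow> x \<in> ocar X \<Longrightarrow> b \<circ> \<rho> x = \<rho> x \<circ> b"
  by (simp add: fun_eq_iff B_rho')

lemma D_ocar [simp]:
  assumes "d \<in> D"
  shows "d x \<in> ocar X"
  using assms
proof (rule D_induct)
  fix c h d assume h: "h \<in> H" and IH: "d x \<in> ocar X"
  have "hop h x \<in> ocar X" using h by (cases "x \<in> ocar X") (simp_all add: hop_apply)
  then show "(pscl (oscl X) c (hop h) + d) x \<in> ocar X" using IH by (simp add: pscl_def)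
qed simp

lemma D_outside: "d \<in> D \<Longrightarrow> x \<notin> ocar X \<Longrightarrow> d x = 0"
  by (erule D_induct) (simp_all add: pscl_def hop_apply)

text \<open>The inductive step shared by both directions of the correspondence between
  \<open>B\<close> and \<open>D\<close>, which is so far only a relation.\<close>

lemma lift_step:
  assumes "h \<in> H" "d \<in> D" "\<forall>x\<in>ocar X. \<rho> (d x) = b \<circ> \<rho> x"
  shows "\<forall>x\<in>ocar X. \<rho> ((pscl (oscl X) c (hop h) + d) x) = (pscl (hscl K) c (\<theta> h) + b) \<circ> \<rho> x"
proof
  fix x assume x: "x \<in> ocar X"
  have "\<rho> ((pscl (oscl X) c (hop h) + d) x) = pscl (hscl K) c (\<theta> h \<circ> \<rho> x) + (b \<circ> \<rho> x)"
    using assms x by (simp add: pscl_def [of "oscl X"] hop_apply isom_add isom_scale rho_act(1))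
  then show "\<rho> ((pscl (oscl X) c (hop h) + d) x) = (pscl (hscl K) c (\<theta> h) + b) \<circ> \<rho> x"
    by (simp add: fun_eq_iff pscl_def)
qed

lemma D_lift:
  assumes "d \<in> D"
  shows "\<exists>b\<in>B. \<forall>x\<in>ocar X. \<rho> (d x) = b \<circ> \<rho> x"
  using assms
proof (rule D_induct)
  show "\<exists>b\<in>B. \<forall>x\<in>ocar X. \<rho> (0 x) = b \<circ> \<rho> x"
    by (intro bexI [of _ 0]) (auto simp: fun_eq_iff)
  fix c h d assume h: "h \<in> H" and d: "d \<in> D" and "\<exists>b\<in>B. \<forall>x\<in>ocar X. \<rho> (d x) = b \<circ> \<rho> x"
  then obtain b where b: "b \<in> B" "\<forall>x\<in>ocar X. \<rho> (d x) = b \<circ> \<rho> x" by blast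
  have "pscl (hscl K) c (\<theta> h) + b \<in> B" using b h by simp
  then show "\<exists>b\<in>B. \<forall>x\<in>ocar X. \<rho> ((pscl (oscl X) c (hop h) + d) x) = b \<circ> \<rho> x"
    using lift_step [OF h d b(2)] by blast
qed

lemma B_descend:
  assumes "b \<in> B"
  shows "\<exists>d\<in>D. \<forall>x\<in>ocar X. \<rho> (d x) = b \<circ> \<rho> x"
  using assms
proof (rule B_induct)
  show "\<exists>d\<in>D. \<forall>x\<in>ocar X. \<rho> (d x) = 0 \<circ> \<rho> x"
    by (intro bexI [of _ 0]) (auto simp: fun_eq_iff)
  fix c h b assume h: "h \<in> H" and "\<exists>d\<in>D. \<forall>x\<in>ocar X. \<rho> (d x) = b \<circ> \<rho> x"
  then obtain d where d: "d \<in> D" "\<forall>x\<in>ocar X. \<rho> (d x) = b \<circ> \<rho> x" by blast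
  have "pscl (oscl X) c (hop h) + d \<in> D" using d h by simp
  then show "\<exists>d\<in>D. \<forall>x\<in>ocar X. \<rho> (d x) = (pscl (hscl K) c (\<theta> h) + b) \<circ> \<rho> x"
    using lift_step [OF h d] by blast
qed

text \<open>The kernel of the action of \<open>B\<close> on \<open>\<rho>(X) K\<close> is an ideal of \<open>B\<close>. It has a self-adjoint
  unit: multiplication by \<open>u = \<Sum> s\<^sup>* s\<close>, where \<open>s\<close> runs over a basis, is injective on it and hence
  bijective.\<close>

definition J :: "('u \<Rightarrow> 'u) set" where
  "J = {b \<in> B. \<forall>x\<in>ocar X. \<forall>v. b (\<rho> x v) = 0}"

lemma J_unit: "\<exists>f\<in>J. adjoint_pair K f f \<and> (\<forall>j\<in>J. f \<circ> j = j)"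
proof -
  have J_sub: "vso.subspace J"
  proof (rule vso.subspaceI)
    show "pscl (hscl K) c j \<in> J" if "j \<in> J" for c j
      using that B_simps(3) [of j c] by (simp add: J_def) (simp add: pscl_def)
  qed (simp_all add: J_def)
  have JB: "j \<in> B" if "j \<in> J" for j using that by (simp add: J_def)
  have ideal: "b \<circ> j \<in> J" if "b \<in> B" "j \<in> J" for b j
    using that by (auto simp: J_def)
  have adj: "\<exists>j'\<in>J. adjoint_pair K j j'" if j: "j \<in> J" for j
  proof -
    obtain j' where j': "j' \<in> B" "adjoint_pair K j j'" using B_adjoint JB j by blast
    have "j' (\<rho> x v) = 0" if x: "x \<in> ocar X" for x v
    proof -
      let ?w = "\<rho> x v"
      have w: "?w \<in> hcar K" "j' ?w \<in> hcar K" using x j' by simp_all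
      \<comment> \<open>The adjoint \<open>j'\<close> stays in \<open>J\<close>: |j' w|^2 = <j j' w,
        w>, and j j' kills \<rho>(X) K because j' commutes with \<rho> x.\<close>
      have "j (j' ?w) = j (\<rho> x (j' v))" using fun_cong [OF B_rho [OF j'(1) x], of v] by simp
      also have "\<dots> = 0" using j x by (simp add: J_def)
      finally have "hinner K (j' ?w) (j' ?w) = 0"
        using adjoint_pairD(1) [OF j'(2) w(2,1)] w by simp
      then show ?thesis using inner_definite w by blast
    qed
    then show ?thesis using j' by (auto simp: J_def)
  qed
  have "finite (\<theta> ` H)" "J \<subseteq> vso.span (\<theta> ` H)"
    using H_finite by (auto simp: J_def B_def)
  then obtain S where S: "finite S" "S \<subseteq> J" "vso.span S = J"
    using vso.finite_basis_of_subspace [OF J_sub] by metis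
  obtain st where st: "\<And>s. s \<in> S \<Longrightarrow> st s \<in> J \<and> adjoint_pair K s (st s)"
    using adj S(2) by (metis subsetD)
  define u where "u = (\<Sum>s\<in>S. st s \<circ> s)"
  have u: "u \<in> J" unfolding u_def
    using st S(2) by (intro vso.subspace_sum [OF J_sub] ideal) (auto simp: JB)
  define L where "L = (\<lambda>j :: 'u \<Rightarrow> 'u. u \<circ> j)"
  have lin: "lin_on (pscl (hscl K)) J (pscl (hscl K)) J L"
    unfolding lin_on_def
  proof (intro conjI ballI allI)
    fix j assume j: "j \<in> J"
    show "L j \<in> J" using j u by (simp add: L_def ideal JB)
    show "L (j + j') = L j + L j'" if "j' \<in> J" for j'
      using j that u by (simp add: L_def fun_eq_iff bops_add JB)
    show "L (pscl (hscl K) c j) = pscl (hscl K) c (L j)" for c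
      using j u by (simp add: L_def fun_eq_iff pscl_def bops_scale JB)
  qed
  have inj: "j = 0" if j: "j \<in> J" "L j = 0" for j
  proof -
    obtain j' where j': "j' \<in> J" "adjoint_pair K j j'" using adj j by blast
    \<comment> \<open>From u (j v) = 0 the sum of all |s (j v)|^2 vanishes. Each \<open>s\<close>,
      and then all of \<open>J\<close> including the adjoint of \<open>j\<close>, kills the range of
      \<open>j\<close>.\<close>
    have s0: "s (j v) = 0" if s: "s \<in> S" and v: "v \<in> hcar K" for s v
    proof -
      have jv: "j v \<in> hcar K" using j by (simp add: JB)
      have "0 = hinner K (u (j v)) (j v)"
        using fun_cong [OF j(2), of v] jv by (simp add: L_def)
      also have "\<dots> = (\<Sum>s\<in>S. hinner K (st s (s (j v))) (j v))"
        using st S(2) jv unfolding u_def sum_fun_app by (subst inner_sum) (auto simp: JB)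
      also have "\<dots> = (\<Sum>s\<in>S. of_real ((hnorm K (s (j v)))\<^sup>2))"
      proof (rule sum.cong [OF refl])
        fix s assume s: "s \<in> S"
        then have sj: "s (j v) \<in> hcar K" using S(2) JB by (metis B_car subsetD)
        then have "hinner K (st s (s (j v))) (j v) = hinner K (s (j v)) (s (j v))"
          using adjoint_pairD(1) [OF adjoint_sym, of s "st s"] st [OF s] jv by blast
        then show "hinner K (st s (s (j v))) (j v) = of_real ((hnorm K (s (j v)))\<^sup>2)"
          using sj by (simp add: inner_self)
      qed
      finally have "(\<Sum>s\<in>S. (hnorm K (s (j v)))\<^sup>2) = 0"
        unfolding of_real_sum [symmetric] by (metis of_real_eq_0_iff)
      then have "(hnorm K (s (j v)))\<^sup>2 = 0"
        using sum_nonneg_eq_0_iff [of S "\<lambda>s. (hnorm K (s (j v)))\<^sup>2"] S(1) s by simp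
      moreover have "s (j v) \<in> hcar K" using s S(2) JB by (metis B_car subsetD)
      ultimately show ?thesis by (simp add: hnorm_eq_0)
    qed
    have "i (j v) = 0" if "i \<in> J" and v: "v \<in> hcar K" for i v
      using \<open>i \<in> J\<close> unfolding S(3) [symmetric]
    proof (induction rule: vso.span_induct_alt)
      case (step c s i)
      then show ?case using s0 [OF _ v] by (simp add: pscl_def)
    qed simp
    then have "hinner K (j v) (j v) = 0" if v: "v \<in> hcar K" for v
      using adjoint_pairD(1) [OF j'(2) v, of "j v"] j(1) j'(1) v by (metis B_car JB inner_zero(2))
    then have "j v = 0" if "v \<in> hcar K" for v
      using inner_definite that j by (simp add: JB)
    then show ?thesis using j by (intro bops_eqI) (simp_all add: JB)
  qed
  \<comment> \<open>A solution of u f = u is a left unit of \<open>J\<close>, because u (f j - j) =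
    0 and multiplication by \<open>u\<close> is injective on \<open>J\<close>.\<close>
  obtain f where f: "f \<in> J" "L f = u"
    using vso.lin_on_inj_imp_surj [OF J_sub S(1) _ lin _ u] inj S(3) by blast
  have unit: "f \<circ> j = j" if j: "j \<in> J" for j
  proof -
    have fj: "f \<circ> j \<in> J" using f j by (simp add: ideal JB)
    have uf: "u (f v) = u v" for v using fun_cong [OF f(2), of v] by (simp add: L_def)
    have "L ((f \<circ> j) - j) = 0"
      using vso.lin_on_diff [OF J_sub lin vso.vector_space_axioms fj j] by (simp add: L_def fun_eq_iff uf)
    moreover have "(f \<circ> j) - j \<in> J" using fj j vso.subspace_diff [OF J_sub] by blast
    ultimately show ?thesis using inj by fastforce
  qed
  obtain f' where f': "f' \<in> J" "adjoint_pair K f f'" using adj f(1) by blast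
  \<comment> \<open>The unit property gives f' = f f', and f f' is self-adjoint when f' is the
    adjoint of f.\<close>
  have "adjoint_pair K f' f'"
    using adjoint_comp [OF f'(2) adjoint_sym [OF f'(2)]] unit [OF f'(1)] by simp
  then have "f = f'" using adjoint_unique [OF adjoint_sym [OF f'(2)]] by blast
  then show ?thesis using f(1) f'(2) unit by blast
qed

definition unit_of_J :: "('u \<Rightarrow> 'u) \<Rightarrow> bool" where
  "unit_of_J f \<longleftrightarrow> f \<in> J \<and> adjoint_pair K f f \<and> (\<forall>j\<in>J. f \<circ> j = j)"

definition f\<^sub>J :: "'u \<Rightarrow> 'u" where
  "f\<^sub>J = (SOME f. unit_of_J f)"

lemma fJ: "f\<^sub>J \<in> J" "adjoint_pair K f\<^sub>J f\<^sub>J" "j \<in> J \<Longrightarrow> f\<^sub>J \<circ> j = j"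
proof -
  have "\<exists>f. unit_of_J f" using J_unit unfolding unit_of_J_def by blast
  then have "unit_of_J f\<^sub>J" unfolding f\<^sub>J_def by (rule someI_ex)
  then show "f\<^sub>J \<in> J" "adjoint_pair K f\<^sub>J f\<^sub>J" "j \<in> J \<Longrightarrow> f\<^sub>J \<circ> j = j"
    by (auto simp: unit_of_J_def)
qed

lemma fJ_B [simp]: "f\<^sub>J \<in> B"
  using fJ(1) by (simp add: J_def)

text \<open>The projection complementary to the unit of \<open>J\<close>. It fixes the range of
  every \<rho> x. The identity is written \<open>\<theta> \<one>\<close> because operators vanish
  outside the carrier.\<close>

definition e :: "'u \<Rightarrow> 'u" where
  "e = \<theta> \<one>\<^bsub>G\<^esub> - f\<^sub>J"

lemma e_B [simp]: "e \<in> B"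
  unfolding e_def by simp

lemma e_fJ: "e \<circ> f\<^sub>J = 0"
proof (rule bops_eqI)
  show "(e \<circ> f\<^sub>J) v = 0 v" if "v \<in> hcar K" for v
    using fun_cong [OF fJ(3) [OF fJ(1)], of v] B_car [OF fJ_B, of v] by (simp add: e_def)
qed simp_all

lemma e_rho: "x \<in> ocar X \<Longrightarrow> e \<circ> \<rho> x = \<rho> x"
  using fJ(1) by (auto simp: e_def J_def fun_eq_iff)

text \<open>All operators in \<open>B\<close> that induce \<open>d\<close> form a coset of
  \<open>J\<close>; annihilation by the unit of \<open>J\<close> selects one of them.\<close>

definition lifts :: "('u \<Rightarrow> 'u) \<Rightarrow> ('x \<Rightarrow> 'x) \<Rightarrow> bool" where
  "lifts b d \<longleftrightarrow> b \<in> B \<and> b \<circ> f\<^sub>J = 0 \<and> (\<forall>x\<in>ocar X. \<rho> (d x) = b \<circ> \<rho> x)"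

text \<open>The difference lies in \<open>J\<close>, so multiplication by the unit of
  \<open>J\<close> both fixes and annihilates it.\<close>

lemma lifts_unique:
  assumes "lifts b d" "lifts b' d"
  shows "b = b'"
proof -
  have B: "b \<in> B" "b' \<in> B" and f: "b \<circ> f\<^sub>J = 0" "b' \<circ> f\<^sub>J = 0" using assms by (auto simp: lifts_def)
  have eq: "b (\<rho> x v) = b' (\<rho> x v)" if "x \<in> ocar X" for x v
    using assms that unfolding lifts_def by (metis comp_apply)
  have "b - b' \<in> J" using B eq by (simp add: J_def)
  then have "f\<^sub>J \<circ> (b - b') = b - b'" by (rule fJ(3))
  then have "(b - b') \<circ> f\<^sub>J = b - b'" using B_commute [of "b - b'" "f\<^sub>J"] B by simp
  moreover have "(b - b') \<circ> f\<^sub>J = 0"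
    using f by (simp add: fun_eq_iff)
  ultimately show ?thesis by simp
qed

lemma lifts_exists:
  assumes "d \<in> D"
  shows "\<exists>b. lifts b d"
proof -
  obtain b where b: "b \<in> B" "\<forall>x\<in>ocar X. \<rho> (d x) = b \<circ> \<rho> x" using D_lift assms by blast
  have "lifts (b \<circ> e) d"
    unfolding lifts_def
  proof (intro conjI ballI)
    show "b \<circ> e \<circ> f\<^sub>J = 0"
      using e_fJ b(1) by (simp add: o_assoc [symmetric] fun_eq_iff)
    show "\<rho> (d x) = b \<circ> e \<circ> \<rho> x" if "x \<in> ocar X" for x
      using b(2) e_rho that by (simp add: o_assoc [symmetric])
  qed (use b in simp)
  then show ?thesis by blast
qed

definition \<pi> :: "('x \<Rightarrow> 'x) \<Rightarrow> 'u \<Rightarrow> 'u" where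
  "\<pi> d = (THE b. lifts b d)"

lemma pi_eqI: "lifts b d \<Longrightarrow> \<pi> d = b"
  unfolding \<pi>_def using lifts_unique by blast

lemma pi_lifts: "d \<in> D \<Longrightarrow> lifts (\<pi> d) d"
  using lifts_exists pi_eqI by metis

lemma pi_B [simp]: "d \<in> D \<Longrightarrow> \<pi> d \<in> B"
  using pi_lifts by (simp add: lifts_def)

lemma rho_D: "d \<in> D \<Longrightarrow> x \<in> ocar X \<Longrightarrow> \<rho> (d x) = \<pi> d \<circ> \<rho> x"
  using pi_lifts by (simp add: lifts_def)

lemma rho_D': "d \<in> D \<Longrightarrow> x \<in> ocar X \<Longrightarrow> \<rho> (d x) = \<rho> x \<circ> \<pi> d"
  using rho_D B_rho by simp

lemma D_eqI:
  assumes "d \<in> D" "d' \<in> D" "\<And>x. x \<in> ocar X \<Longrightarrow> \<rho> (d x) = \<rho> (d' x)"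
  shows "d = d'"
proof (rule ext)
  show "d x = d' x" for x
    using assms isom_eqI [of "d x" "d' x"] by (cases "x \<in> ocar X") (simp_all add: D_outside)
qed

lemma pi_f: "d \<in> D \<Longrightarrow> \<pi> d (f\<^sub>J v) = 0"
  using pi_lifts by (simp add: lifts_def fun_eq_iff)

lemma hop_comp: "h \<in> H \<Longrightarrow> k \<in> H \<Longrightarrow> x \<in> ocar X \<Longrightarrow> hop h (hop k x) = hop (h \<otimes>\<^bsub>G\<^esub> k) x"
  by (simp add: hop_apply act_mult)

lemma D_add: "d \<in> D \<Longrightarrow> x \<in> ocar X \<Longrightarrow> y \<in> ocar X \<Longrightarrow> d (x + y) = d x + d y"
  by (rule isom_eqI) (simp_all add: rho_D' isom_add fun_eq_iff)

lemma D_scale: "d \<in> D \<Longrightarrow> x \<in> ocar X \<Longrightarrow> d (oscl X c x) = oscl X c (d x)"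
  by (rule isom_eqI) (simp_all add: rho_D' isom_scale fun_eq_iff pscl_def)

lemma D_0 [simp]: "d \<in> D \<Longrightarrow> d 0 = 0"
  using D_scale [of d 0 0] by simp

lemma D_sum: "d \<in> D \<Longrightarrow> (\<And>i. i \<in> I \<Longrightarrow> f i \<in> ocar X) \<Longrightarrow> d (\<Sum>i\<in>I. f i) = (\<Sum>i\<in>I. d (f i))"
proof (induction I rule: infinite_finite_induct)
  case (insert i I)
  then show ?case by (simp add: D_add xs.subspace_sum [OF x_subspace])
qed simp_all

lemma D_hop_comp:
  assumes "h \<in> H" "d \<in> D"
  shows "hop h \<circ> d \<in> D"
  using assms(2)
proof (rule D_induct)
  have "hop h \<circ> 0 = (0 :: 'x \<Rightarrow> 'x)" using assms by (auto simp: fun_eq_iff)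
  then show "hop h \<circ> 0 \<in> D" by simp
  fix c k d assume k: "k \<in> H" and d: "d \<in> D" and IH: "hop h \<circ> d \<in> D"
  have "hop h (oscl X c (hop k x) + d x) = oscl X c (hop h (hop k x)) + hop h (d x)" for x
    using assms k d by (simp add: D_add D_scale D_ocar [OF hop_D])
  moreover have "hop h (hop k x) = hop (h \<otimes>\<^bsub>G\<^esub> k) x" for x
    using assms k hop_comp [of h k x] by (cases "x \<in> ocar X") (simp_all add: D_outside [OF hop_D])
  ultimately have "hop h \<circ> (pscl (oscl X) c (hop k) + d) = pscl (oscl X) c (hop (h \<otimes>\<^bsub>G\<^esub> k)) + (hop h \<circ> d)"
    by (simp add: fun_eq_iff pscl_def)
  then show "hop h \<circ> (pscl (oscl X) c (hop k) + d) \<in> D" using assms k IH by simp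
qed

lemma D_comp [simp]:
  assumes "d \<in> D" "d' \<in> D"
  shows "d \<circ> d' \<in> D"
  using assms(1)
proof (rule D_induct)
  have "0 \<circ> d' = (0 :: 'x \<Rightarrow> 'x)" by (auto simp: fun_eq_iff)
  then show "0 \<circ> d' \<in> D" by simp
  fix c h d assume h: "h \<in> H" and IH: "d \<circ> d' \<in> D"
  have "(pscl (oscl X) c (hop h) + d) \<circ> d' = pscl (oscl X) c (hop h \<circ> d') + (d \<circ> d')"
    by (simp add: fun_eq_iff pscl_def)
  then show "(pscl (oscl X) c (hop h) + d) \<circ> d' \<in> D" using h IH D_hop_comp [OF h assms(2)] by simp
qed

lemma D_commute: "d \<in> D \<Longrightarrow> d' \<in> D \<Longrightarrow> d (d' x) = d' (d x)"
  using fun_cong [OF D_eqI [of "d \<circ> d'" "d' \<circ> d"], of x] B_commute' [of "\<pi> d" "\<pi> d'"]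
  by (simp add: rho_D fun_eq_iff)

lemma pi_add: "d \<in> D \<Longrightarrow> d' \<in> D \<Longrightarrow> \<pi> (d + d') = \<pi> d + \<pi> d'"
  by (rule pi_eqI) (auto simp: lifts_def fun_eq_iff pi_f isom_add rho_D)

lemma pi_scale: "d \<in> D \<Longrightarrow> \<pi> (pscl (oscl X) c d) = pscl (hscl K) c (\<pi> d)"
proof (rule pi_eqI)
  assume d: "d \<in> D"
  then have "pscl (hscl K) c (\<pi> d) \<in> B" by simp
  then show "lifts (pscl (hscl K) c (\<pi> d)) (pscl (oscl X) c d)"
    unfolding lifts_def using d by (simp add: fun_eq_iff pi_f isom_scale rho_D pscl_def)
qed

lemma pi_comp: "d \<in> D \<Longrightarrow> d' \<in> D \<Longrightarrow> \<pi> (d \<circ> d') = \<pi> d \<circ> \<pi> d'"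
  by (rule pi_eqI) (auto simp: lifts_def fun_eq_iff pi_f rho_D)

lemma pi_hop: "h \<in> H \<Longrightarrow> \<pi> (hop h) = \<theta> h \<circ> e"
proof (rule pi_eqI, unfold lifts_def, intro conjI ballI)
  assume h: "h \<in> H"
  show "\<theta> h \<circ> e \<circ> f\<^sub>J = 0"
    using e_fJ h by (simp add: o_assoc [symmetric] fun_eq_iff)
  show "\<rho> (hop h x) = \<theta> h \<circ> e \<circ> \<rho> x" if "x \<in> ocar X" for x
    using e_rho that h by (simp add: o_assoc [symmetric] hop_apply rho_act(1))
qed simp

lemma pi_hop_comp: "h \<in> H \<Longrightarrow> d \<in> D \<Longrightarrow> \<pi> (hop h \<circ> d) = \<theta> h \<circ> \<pi> d"
proof (rule pi_eqI, unfold lifts_def, intro conjI ballI)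
  assume h: "h \<in> H" and d: "d \<in> D"
  show "\<theta> h \<circ> \<pi> d \<circ> f\<^sub>J = 0"
    using pi_f [OF d] h by (simp add: fun_eq_iff)
  show "\<rho> ((hop h \<circ> d) x) = \<theta> h \<circ> \<pi> d \<circ> \<rho> x" if "x \<in> ocar X" for x
    using rho_D [OF d that] d h by (simp add: o_assoc [symmetric] hop_apply rho_act(1))
qed (simp add: B_theta_comp)

lemma e_adjoint: "adjoint_pair K e e"
  unfolding e_def using adjoint_diff [OF theta_adjoint fJ(2), of "\<one>\<^bsub>G\<^esub>"] by simp

text \<open>The adjoint of \<pi> d in \<open>B\<close> again kills the unit of \<open>J\<close>,
  hence it is \<pi> d' for some d'. As \<open>K\<close> lives in the type chosen as universe, (K,
  \<rho>, \<pi> d, \<pi> d') is itself a witness of adjointness on both sides, and uniqueness makes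
  d' the star of d.\<close>

lemma D_star:
  assumes d: "d \<in> D"
  shows "centralizer_star TYPE('u) X d \<in> D" "adjoint_pair K (\<pi> d) (\<pi> (centralizer_star TYPE('u) X d))"
proof -
  obtain b' where b': "b' \<in> B" "adjoint_pair K (\<pi> d) b'" using B_adjoint d by (meson pi_B)
  obtain d' where d': "d' \<in> D" "\<forall>x\<in>ocar X. \<rho> (d' x) = b' \<circ> \<rho> x" using B_descend b'(1) by blast
  have "adjoint_pair K (f\<^sub>J \<circ> \<pi> d) (b' \<circ> f\<^sub>J)"
    by (rule adjoint_comp [OF fJ(2) b'(2)])
  moreover have "f\<^sub>J \<circ> \<pi> d = 0"
    using B_commute' [of "f\<^sub>J" "\<pi> d"] d pi_f [OF d] by (simp add: fun_eq_iff)
  ultimately have "b' \<circ> f\<^sub>J = 0" using adjoint_unique adjoint_0 by metis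
  then have pd': "\<pi> d' = b'" using b' d' by (intro pi_eqI) (simp add: lifts_def)
  have ad: "adjoint_pair K (\<pi> d) (\<pi> d')" using b'(2) pd' by simp
  have maps: "d \<in> maps_on (ocar X)" "d' \<in> maps_on (ocar X)"
    using d d'(1) by (simp_all add: maps_on_def D_outside)
  have hs: "hilbert_space K" using rep by (simp add: central_rep_def)
  have "left_adjoint TYPE('u) X d d'"
    unfolding left_adjoint_def
    by (intro conjI maps exI [of _ K] exI [of _ \<rho>] exI [of _ "\<pi> d"] exI [of _ "\<pi> d'"] hs isom ad ballI)
      (simp_all add: rho_D d d'(1))
  moreover have "right_adjoint TYPE('u) X d d'"
    unfolding right_adjoint_def
    by (intro conjI maps exI [of _ K] exI [of _ \<rho>] exI [of _ "\<pi> d"] exI [of _ "\<pi> d'"] hs isom ad ballI)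
      (simp_all add: rho_D' d d'(1))
  ultimately have "centralizer_star TYPE('u) X d = d'"
    by (rule centralizer_star_eq [OF X_vs X_subspace])
  then show "centralizer_star TYPE('u) X d \<in> D" "adjoint_pair K (\<pi> d) (\<pi> (centralizer_star TYPE('u) X d))"
    using d'(1) ad by simp_all
qed

sublocale Drep: star_rep K "D_alg TYPE('u) H X act" \<pi>
proof (rule star_rep.intro [OF prehilbert_axioms], rule star_rep_axioms.intro, unfold D_alg_simps)
  show "vector_space (pscl (oscl X))" by (rule xso.vector_space_axioms)
  show "xso.subspace D" by (rule D_subspace)
  show "\<exists>S. finite S \<and> D \<subseteq> xso.span S" using H_finite by (auto simp: D_def)
  show "lin_on (pscl (oscl X)) D (pscl (hscl K)) (bops K) \<pi>"
    by (simp add: lin_on_def pi_add pi_scale)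
  fix d assume d: "d \<in> D"
  show "centralizer_star TYPE('u) X d \<in> D" "adjoint_pair K (\<pi> d) (\<pi> (centralizer_star TYPE('u) X d))"
    using D_star [OF d] by simp_all
  show "d = 0" if "\<pi> d = 0"
    using that d by (intro D_eqI) (simp_all add: rho_D fun_eq_iff)
  fix d' assume d': "d' \<in> D"
  show "d \<circ> d' \<in> D" "\<pi> (d \<circ> d') = \<pi> d \<circ> \<pi> d'" using d d' by (simp_all add: pi_comp)
qed

lemma star_hop: "h \<in> H \<Longrightarrow> centralizer_star TYPE('u) X (hop h) = hop (inv\<^bsub>G\<^esub> h)"
proof -
  assume h: "h \<in> H"
  have "adjoint_pair K (\<pi> (hop h)) (\<pi> (hop (inv\<^bsub>G\<^esub> h)))"
    using adjoint_comp [OF theta_adjoint [OF h] e_adjoint] B_commute [of e "\<theta> (inv\<^bsub>G\<^esub> h)"] h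
    by (simp add: pi_hop)
  then show ?thesis
    using Drep.rep_star_eqI [of "hop h" "hop (inv\<^bsub>G\<^esub> h)"] h by (simp add: D_alg_simps)
qed

end

subsection \<open>Induced Hilbert spaces and convolution operators\<close>

lemma sum_lessThan_mult:
  fixes f :: "nat \<Rightarrow> 'a::comm_monoid_add"
  shows "(\<Sum>s<n * q. f s) = (\<Sum>j<n. \<Sum>a<q. f (j * q + a))"
proof -
  have "(\<Sum>s<n * q. f s) = (\<Sum>j<n. sum f {j * q..<j * q + q})"
    by (rule sum.nat_group [symmetric])
  also have "\<dots> = (\<Sum>j<n. \<Sum>a<q. f (j * q + a))"
    using sum.shift_bounds_nat_ivl [of f 0 "_ * q" q]
    by (simp add: lessThan_atLeast0 add.commute)
  finally show ?thesis .
qed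

context unitary_setting
begin

section \<open>The induced Hilbert space and its operators\<close>

definition KG :: "('f, 'g \<Rightarrow> 'u) hilb" where
  "KG = ind_hilb G H K \<theta>"

lemma KG_eq: "KG = fun_hilb (carrier G) (ind_car G H \<theta> (hcar K)) K"
  by (simp add: KG_def ind_hilb_def fun_hilb_def)

lemma KG_scl [simp]: "hscl KG = pscl (hscl K)"
  by (simp add: KG_eq)

lemma KG_car: "hcar KG = ind_car G H \<theta> (hcar K)"
  by (simp add: KG_eq)

lemma KG_D:
  assumes "\<xi> \<in> hcar KG"
  shows "\<xi> g \<in> hcar K" "g \<notin> carrier G \<Longrightarrow> \<xi> g = 0"
    "g \<in> carrier G \<Longrightarrow> h \<in> H \<Longrightarrow> \<xi> (g \<otimes>\<^bsub>G\<^esub> h) = \<theta> (inv\<^bsub>G\<^esub> h) (\<xi> g)"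
  using assms unfolding KG_car ind_car_def by (cases "g \<in> carrier G"; simp)+

lemma KG_I:
  assumes "\<And>g. g \<in> carrier G \<Longrightarrow> \<xi> g \<in> hcar K" "\<And>g. g \<notin> carrier G \<Longrightarrow> \<xi> g = 0"
    "\<And>g h. g \<in> carrier G \<Longrightarrow> h \<in> H \<Longrightarrow> \<xi> (g \<otimes>\<^bsub>G\<^esub> h) = \<theta> (inv\<^bsub>G\<^esub> h) (\<xi> g)"
  shows "\<xi> \<in> hcar KG"
  unfolding KG_car ind_car_def using assms by simp

lemma prehilbert_KG: "prehilbert KG"
  unfolding KG_eq
proof (rule prehilbert_fun_hilb [OF finite_G])
  show "vso.subspace (ind_car G H \<theta> (hcar K))"
    unfolding KG_car [symmetric]
    by (rule vso.subspaceI; rule KG_I)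
      (simp_all add: KG_D pscl_def bops_add bops_scale)
qed (simp_all add: KG_car [symmetric] KG_D)

lemma hnorm_KG: "\<xi> \<in> hcar KG \<Longrightarrow> (hnorm KG \<xi>)\<^sup>2 = (\<Sum>g\<in>carrier G. (hnorm K (\<xi> g))\<^sup>2)"
  unfolding KG_eq by (subst hnorm_fun_hilb) (simp_all add: KG_car [symmetric] KG_D sum_nonneg)

interpretation kg: prehilbert KG by (rule prehilbert_KG)

lemma hnorm_KG_component: "\<xi> \<in> hcar KG \<Longrightarrow> hnorm K (\<xi> g) \<le> hnorm KG \<xi>"
proof (cases "g \<in> carrier G")
  case True
  assume x: "\<xi> \<in> hcar KG"
  show ?thesis
  proof (rule power2_le_imp_le)
    show "(hnorm K (\<xi> g))\<^sup>2 \<le> (hnorm KG \<xi>)\<^sup>2"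
      unfolding hnorm_KG [OF x] using True finite_G
      by (intro member_le_sum [of g "carrier G" "\<lambda>g. (hnorm K (\<xi> g))\<^sup>2"]) auto
  qed (rule kg.hnorm_nonneg)
qed (simp add: KG_D)

definition iop :: "('g \<Rightarrow> 'u \<Rightarrow> 'u) \<Rightarrow> ('g \<Rightarrow> 'u) \<Rightarrow> 'g \<Rightarrow> 'u" where
  "iop \<Psi> = ind_op G H K \<theta> \<Psi>"

abbreviation cH :: 'f where
  "cH \<equiv> 1 / of_nat (card H)"

lemma iop_apply: "\<xi> \<in> hcar KG \<Longrightarrow> g \<in> carrier G \<Longrightarrow>
    iop \<Psi> \<xi> g = hscl K cH (\<Sum>k\<in>carrier G. \<Psi> k (\<xi> (inv\<^bsub>G\<^esub> k \<otimes>\<^bsub>G\<^esub> g)))"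
  by (simp add: iop_def ind_op_def on_zero_def KG_def)

lemma iop_outside: "\<xi> \<notin> hcar KG \<Longrightarrow> iop \<Psi> \<xi> = 0" "g \<notin> carrier G \<Longrightarrow> iop \<Psi> \<xi> g = 0"
  by (simp_all add: iop_def ind_op_def on_zero_def KG_def)

lemma iop_cong: "(\<And>g. g \<in> carrier G \<Longrightarrow> \<Psi> g = \<Psi>' g) \<Longrightarrow> iop \<Psi> = iop \<Psi>'"
  by (simp add: iop_def ind_op_def on_zero_def fun_eq_iff)

lemma iop_add: "iop (\<lambda>g. \<Psi> g + \<Psi>' g) = iop \<Psi> + iop \<Psi>'"
  by (auto simp: iop_def ind_op_def on_zero_def fun_eq_iff sum.distrib vs.scale_right_distrib)

lemma iop_scale: "iop (\<lambda>g. pscl (hscl K) c (\<Psi> g)) = pscl (pscl (hscl K)) c (iop \<Psi>)"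
  by (auto simp: iop_def ind_op_def on_zero_def fun_eq_iff pscl_def vs.scale_sum_right mult.commute)

text \<open>Membership in \<open>C_G\<close> for the commutant C of \<theta>(H), written out
  pointwise; it is the condition under which \<open>iop\<close> preserves the induced space.\<close>

definition equi :: "('g \<Rightarrow> 'u \<Rightarrow> 'u) \<Rightarrow> bool" where
  "equi \<Psi> \<longleftrightarrow> (\<forall>g\<in>carrier G. \<Psi> g \<in> bops K \<and> (\<forall>h\<in>H. \<forall>v.
     \<Psi> (g \<otimes>\<^bsub>G\<^esub> h) v = \<theta> (inv\<^bsub>G\<^esub> h) (\<Psi> g v) \<and> \<theta> h (\<Psi> g v) = \<Psi> g (\<theta> h v)))"

lemma equiD:
  assumes "equi \<Psi>" "g \<in> carrier G"
  shows "\<Psi> g \<in> bops K" "h \<in> H \<Longrightarrow> \<Psi> (g \<otimes>\<^bsub>G\<^esub> h) v = \<theta> (inv\<^bsub>G\<^esub> h) (\<Psi> g v)"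
    "h \<in> H \<Longrightarrow> \<theta> h (\<Psi> g v) = \<Psi> g (\<theta> h v)"
  using assms unfolding equi_def by blast+

lemma cancel_simps [simp]:
  assumes "g \<in> carrier G" "k \<in> carrier G"
  shows "g \<otimes>\<^bsub>G\<^esub> (inv\<^bsub>G\<^esub> g \<otimes>\<^bsub>G\<^esub> k) = k" "inv\<^bsub>G\<^esub> g \<otimes>\<^bsub>G\<^esub> (g \<otimes>\<^bsub>G\<^esub> k) = k"
  using assms by (simp_all add: m_assoc [symmetric])

lemma sum_inv_mult:
  assumes "g \<in> carrier G"
  shows "(\<Sum>k\<in>carrier G. F k (inv\<^bsub>G\<^esub> k \<otimes>\<^bsub>G\<^esub> g)) = (\<Sum>k\<in>carrier G. F (g \<otimes>\<^bsub>G\<^esub> inv\<^bsub>G\<^esub> k) k)"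
  by (rule sum.reindex_bij_witness [of _ "\<lambda>k. g \<otimes>\<^bsub>G\<^esub> inv\<^bsub>G\<^esub> k" "\<lambda>k. inv\<^bsub>G\<^esub> k \<otimes>\<^bsub>G\<^esub> g"])
    (use assms in \<open>simp_all add: inv_mult_group m_assoc\<close>)

lemma card_H_pos: "card H > 0"
  using H_finite H_closed(1) by (metis card_gt_0_iff empty_iff)

text \<open>The reason for the factor 1/|H|: a function supported on one coset and constant there is
  summed to its value. The scalar multiplication is arbitrary because the lemma is applied in
  \<open>K\<close>, in \<open>X\<close> and in \<open>D\<close>.\<close>

lemma coset_average:
  assumes "vector_space s" and g: "g \<in> carrier G"
    and out: "\<And>k. k \<in> carrier G \<Longrightarrow> inv\<^bsub>G\<^esub> g \<otimes>\<^bsub>G\<^esub> k \<notin> H \<Longrightarrow> F k = 0"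
    and inside: "\<And>h. h \<in> H \<Longrightarrow> F (g \<otimes>\<^bsub>G\<^esub> h) = w"
  shows "s (cH :: 'f) (\<Sum>k\<in>carrier G. F k) = w"
proof -
  interpret v: vector_space s by fact
  have inj: "inj_on (\<lambda>h. g \<otimes>\<^bsub>G\<^esub> h) H"
    using g by (auto intro!: inj_onI)
  have sub: "(\<lambda>h. g \<otimes>\<^bsub>G\<^esub> h) ` H \<subseteq> carrier G" using g by auto
  have "F k = 0" if "k \<in> carrier G - (\<lambda>h. g \<otimes>\<^bsub>G\<^esub> h) ` H" for k
  proof (rule out)
    show "k \<in> carrier G" using that by simp
    show "inv\<^bsub>G\<^esub> g \<otimes>\<^bsub>G\<^esub> k \<notin> H"
    proof
      assume "inv\<^bsub>G\<^esub> g \<otimes>\<^bsub>G\<^esub> k \<in> H"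
      then have "g \<otimes>\<^bsub>G\<^esub> (inv\<^bsub>G\<^esub> g \<otimes>\<^bsub>G\<^esub> k) \<in> (\<lambda>h. g \<otimes>\<^bsub>G\<^esub> h) ` H" by blast
      then show False using that g by (simp add: m_assoc [symmetric])
    qed
  qed
  then have "(\<Sum>k\<in>carrier G. F k) = (\<Sum>k\<in>(\<lambda>h. g \<otimes>\<^bsub>G\<^esub> h) ` H. F k)"
    using finite_G sub by (intro sum.mono_neutral_right) auto
  also have "\<dots> = (\<Sum>h\<in>H. w)" unfolding sum.reindex [OF inj] using inside by simp
  finally have "s cH (\<Sum>k\<in>carrier G. F k) = (\<Sum>h\<in>H. s cH w)"
    by (simp only: v.scale_sum_right)
  also have "\<dots> = s (\<Sum>h\<in>H. cH) w" by (rule v.scale_sum_left [symmetric])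
  also have "(\<Sum>h\<in>H. cH) = 1" using card_H_pos by simp
  finally show ?thesis by simp
qed

lemma iop_bops [simp]:
  assumes e: "equi \<Psi>"
  shows "iop \<Psi> \<in> bops KG"
proof (rule kg.bopsI)
  have P: "\<Psi> k v \<in> hcar K" if "k \<in> carrier G" "v \<in> hcar K" for k v
    using equiD(1) [OF e that(1)] that(2) by simp
  fix \<xi> c assume x: "\<xi> \<in> hcar KG"
  show car: "iop \<Psi> \<xi> \<in> hcar KG"
  proof (rule KG_I)
    fix g h assume g: "g \<in> carrier G" and h: "h \<in> H"
    have "\<Psi> k (\<xi> (inv\<^bsub>G\<^esub> k \<otimes>\<^bsub>G\<^esub> (g \<otimes>\<^bsub>G\<^esub> h))) = \<theta> (inv\<^bsub>G\<^esub> h) (\<Psi> k (\<xi> (inv\<^bsub>G\<^esub> k \<otimes>\<^bsub>G\<^esub> g)))"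
      if k: "k \<in> carrier G" for k
      using KG_D(3) [OF x, of "inv\<^bsub>G\<^esub> k \<otimes>\<^bsub>G\<^esub> g" h] k g h equiD(3) [OF e k] by (simp add: m_assoc)
    then show "iop \<Psi> \<xi> (g \<otimes>\<^bsub>G\<^esub> h) = \<theta> (inv\<^bsub>G\<^esub> h) (iop \<Psi> \<xi> g)"
      using x g h P by (simp add: iop_apply KG_D bops_scale bops_sum)
  qed (use x P in \<open>simp_all add: iop_apply KG_D iop_outside\<close>)
  show "iop \<Psi> (hscl KG c \<xi>) = hscl KG c (iop \<Psi> \<xi>)"
  proof (rule ext)
    fix g show "iop \<Psi> (hscl KG c \<xi>) g = hscl KG c (iop \<Psi> \<xi>) g"
    proof (cases "g \<in> carrier G")
      case True
      have "\<Psi> k (hscl K c (\<xi> (inv\<^bsub>G\<^esub> k \<otimes>\<^bsub>G\<^esub> g))) = hscl K c (\<Psi> k (\<xi> (inv\<^bsub>G\<^esub> k \<otimes>\<^bsub>G\<^esub> g)))"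
        if "k \<in> carrier G" for k
        by (rule bops_scale [OF equiD(1) [OF e that] KG_D(1) [OF x]])
      then show ?thesis
        using x True kg.car_simps(3) [OF x, of c]
        by (simp add: iop_apply pscl_def vs.scale_sum_right [symmetric])
    qed (simp add: iop_outside pscl_def)
  qed
  show "iop \<Psi> (\<xi> + \<eta>) = iop \<Psi> \<xi> + iop \<Psi> \<eta>" if y: "\<eta> \<in> hcar KG" for \<eta>
  proof (rule ext)
    fix g show "iop \<Psi> (\<xi> + \<eta>) g = (iop \<Psi> \<xi> + iop \<Psi> \<eta>) g"
    proof (cases "g \<in> carrier G")
      case True
      have "\<Psi> k (\<xi> (inv\<^bsub>G\<^esub> k \<otimes>\<^bsub>G\<^esub> g) + \<eta> (inv\<^bsub>G\<^esub> k \<otimes>\<^bsub>G\<^esub> g)) = \<Psi> k (\<xi> (inv\<^bsub>G\<^esub> k \<otimes>\<^bsub>G\<^esub> g)) + \<Psi> k (\<eta> (inv\<^bsub>G\<^esub> k \<otimes>\<^bsub>G\<^esub> g))"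
        if "k \<in> carrier G" for k
        by (rule bops_add [OF equiD(1) [OF e that] KG_D(1) [OF x] KG_D(1) [OF y]])
      then show ?thesis
        using x y True kg.car_simps(2) [OF x y]
        by (simp add: iop_apply sum.distrib vs.scale_right_distrib)
    qed (simp add: iop_outside)
  qed
  let ?B = "\<Sum>g\<in>carrier G. \<Sum>k\<in>carrier G. norm cH * opn K (\<Psi> k)"
  have "hnorm K (iop \<Psi> \<xi> g) \<le> (\<Sum>k\<in>carrier G. norm cH * opn K (\<Psi> k) * hnorm KG \<xi>)" if g: "g \<in> carrier G" for g
  proof -
    have "hnorm K (iop \<Psi> \<xi> g) = norm cH * hnorm K (\<Sum>k\<in>carrier G. \<Psi> k (\<xi> (inv\<^bsub>G\<^esub> k \<otimes>\<^bsub>G\<^esub> g)))"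
      unfolding iop_apply [OF x g] using x P by (intro hnorm_scale car_sum) (simp add: KG_D)
    also have "\<dots> \<le> norm cH * (\<Sum>k\<in>carrier G. hnorm K (\<Psi> k (\<xi> (inv\<^bsub>G\<^esub> k \<otimes>\<^bsub>G\<^esub> g))))"
      using x P by (intro mult_left_mono hnorm_sum) (simp_all add: KG_D)
    also have "\<dots> \<le> norm cH * (\<Sum>k\<in>carrier G. opn K (\<Psi> k) * hnorm KG \<xi>)"
    proof (intro mult_left_mono sum_mono)
      fix k assume k: "k \<in> carrier G"
      have "hnorm K (\<Psi> k (\<xi> (inv\<^bsub>G\<^esub> k \<otimes>\<^bsub>G\<^esub> g))) \<le> opn K (\<Psi> k) * hnorm K (\<xi> (inv\<^bsub>G\<^esub> k \<otimes>\<^bsub>G\<^esub> g))"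
        by (rule opn_ub [OF equiD(1) [OF e k] KG_D(1) [OF x]])
      also have "\<dots> \<le> opn K (\<Psi> k) * hnorm KG \<xi>"
        by (intro mult_left_mono hnorm_KG_component x opn_nonneg equiD(1) [OF e k])
      finally show "hnorm K (\<Psi> k (\<xi> (inv\<^bsub>G\<^esub> k \<otimes>\<^bsub>G\<^esub> g))) \<le> opn K (\<Psi> k) * hnorm KG \<xi>" .
    qed simp
    finally show ?thesis by (simp only: sum_distrib_left mult.assoc)
  qed
  then have le: "(\<Sum>g\<in>carrier G. hnorm K (iop \<Psi> \<xi> g)) \<le> ?B * hnorm KG \<xi>"
    unfolding sum_distrib_right by (intro sum_mono) simp
  show "hnorm KG (iop \<Psi> \<xi>) \<le> ?B * hnorm KG \<xi>"
  proof (rule power2_le_imp_le)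
    have "(hnorm KG (iop \<Psi> \<xi>))\<^sup>2 \<le> (\<Sum>g\<in>carrier G. hnorm K (iop \<Psi> \<xi> g))\<^sup>2"
      unfolding hnorm_KG [OF car] by (rule sum_squares_le_square_sum) simp
    also have "\<dots> \<le> (?B * hnorm KG \<xi>)\<^sup>2" by (intro power_mono le sum_nonneg) simp
    finally show "(hnorm KG (iop \<Psi> \<xi>))\<^sup>2 \<le> (?B * hnorm KG \<xi>)\<^sup>2" .
    show "0 \<le> ?B * hnorm KG \<xi>" by (rule order_trans [OF sum_nonneg le]) simp
  qed
qed (simp add: iop_outside)

section \<open>Products and adjoints of induced operators\<close>

definition conv :: "('g \<Rightarrow> 'u \<Rightarrow> 'u) \<Rightarrow> ('g \<Rightarrow> 'u \<Rightarrow> 'u) \<Rightarrow> 'g \<Rightarrow> 'u \<Rightarrow> 'u" where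
  "conv \<Psi> \<Psi>' g = pscl (hscl K) cH (\<Sum>k\<in>carrier G. \<Psi> k \<circ> \<Psi>' (inv\<^bsub>G\<^esub> k \<otimes>\<^bsub>G\<^esub> g))"

text \<open>Formulated for arbitrary equivariant functions because it serves both for products in
  \<open>D_G\<close> and for the action of \<open>D_G\<close> on \<open>X_G\<close> from either
  side.\<close>

lemma iop_conv:
  assumes e: "equi \<Psi>" "equi \<Psi>'"
  shows "iop (conv \<Psi> \<Psi>') = iop \<Psi> \<circ> iop \<Psi>'"
proof -
  have "iop (conv \<Psi> \<Psi>') \<xi> g = (iop \<Psi> \<circ> iop \<Psi>') \<xi> g" for \<xi> g
  proof (cases "\<xi> \<in> hcar KG \<and> g \<in> carrier G")
    case True
    then have x: "\<xi> \<in> hcar KG" and g: "g \<in> carrier G" by auto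
    have y: "iop \<Psi>' \<xi> \<in> hcar KG" using e x by simp
    have P: "\<Psi>' k v \<in> hcar K" if "k \<in> carrier G" "v \<in> hcar K" for k v
      using equiD(1) [OF e(2) that(1)] that(2) by simp
    have "(iop \<Psi> \<circ> iop \<Psi>') \<xi> g = hscl K cH (\<Sum>k\<in>carrier G. \<Psi> k (hscl K cH (\<Sum>l\<in>carrier G. \<Psi>' l (\<xi> (inv\<^bsub>G\<^esub> l \<otimes>\<^bsub>G\<^esub> (inv\<^bsub>G\<^esub> k \<otimes>\<^bsub>G\<^esub> g))))))"
      using x g y by (simp add: iop_apply)
    also have "\<dots> = hscl K cH (\<Sum>k\<in>carrier G. hscl K cH (\<Sum>l\<in>carrier G. \<Psi> k (\<Psi>' l (\<xi> (inv\<^bsub>G\<^esub> l \<otimes>\<^bsub>G\<^esub> (inv\<^bsub>G\<^esub> k \<otimes>\<^bsub>G\<^esub> g))))))"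
      using x g P equiD(1) [OF e(1)]
      by (intro arg_cong [where f = "hscl K cH"] sum.cong refl) (simp add: bops_scale bops_sum KG_D)
    also have "\<dots> = hscl K cH (\<Sum>k\<in>carrier G. hscl K cH (\<Sum>m\<in>carrier G. \<Psi> k (\<Psi>' (inv\<^bsub>G\<^esub> k \<otimes>\<^bsub>G\<^esub> m) (\<xi> (inv\<^bsub>G\<^esub> m \<otimes>\<^bsub>G\<^esub> g)))))"
    proof (rule arg_cong [where f = "hscl K cH"], rule sum.cong [OF refl], rule arg_cong [where f = "hscl K cH"])
      fix k assume k: "k \<in> carrier G"
      show "(\<Sum>l\<in>carrier G. \<Psi> k (\<Psi>' l (\<xi> (inv\<^bsub>G\<^esub> l \<otimes>\<^bsub>G\<^esub> (inv\<^bsub>G\<^esub> k \<otimes>\<^bsub>G\<^esub> g)))))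
          = (\<Sum>m\<in>carrier G. \<Psi> k (\<Psi>' (inv\<^bsub>G\<^esub> k \<otimes>\<^bsub>G\<^esub> m) (\<xi> (inv\<^bsub>G\<^esub> m \<otimes>\<^bsub>G\<^esub> g))))"
        by (rule sum.reindex_bij_witness [of _ "\<lambda>m. inv\<^bsub>G\<^esub> k \<otimes>\<^bsub>G\<^esub> m" "\<lambda>l. k \<otimes>\<^bsub>G\<^esub> l"])
          (use k g in \<open>simp_all add: m_assoc [symmetric] inv_mult_group\<close>)
    qed
    also have "\<dots> = hscl K cH (\<Sum>m\<in>carrier G. hscl K cH (\<Sum>k\<in>carrier G. \<Psi> k (\<Psi>' (inv\<^bsub>G\<^esub> k \<otimes>\<^bsub>G\<^esub> m) (\<xi> (inv\<^bsub>G\<^esub> m \<otimes>\<^bsub>G\<^esub> g)))))"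
      unfolding vs.scale_sum_right by (subst sum.swap) (rule refl)
    also have "\<dots> = iop (conv \<Psi> \<Psi>') \<xi> g"
      using x g by (simp add: iop_apply conv_def pscl_def sum_fun_app)
    finally show ?thesis by simp
  next
    case False
    have "iop \<Psi> (0 :: 'g \<Rightarrow> 'u) = 0" by (rule kg.bops_0 [OF iop_bops [OF e(1)]])
    then show ?thesis using False by (cases "\<xi> \<in> hcar KG") (simp_all add: iop_outside)
  qed
  then show ?thesis by (intro ext)
qed

lemma iop_adjoint:
  assumes e: "equi \<Psi>" "equi \<Psi>'"
    and adj: "\<And>g. g \<in> carrier G \<Longrightarrow> adjoint_pair K (\<Psi> g) (\<Psi>' (inv\<^bsub>G\<^esub> g))"
  shows "adjoint_pair KG (iop \<Psi>) (iop \<Psi>')"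
  unfolding adjoint_pair_def
proof (intro conjI ballI)
  show "iop \<Psi> \<in> bops KG" "iop \<Psi>' \<in> bops KG" using e by simp_all
  fix \<xi> \<eta> assume x: "\<xi> \<in> hcar KG" and y: "\<eta> \<in> hcar KG"
  have P: "\<Psi> k v \<in> hcar K" "\<Psi>' k v \<in> hcar K" if "k \<in> carrier G" "v \<in> hcar K" for k v
    using equiD(1) [OF e(1) that(1)] equiD(1) [OF e(2) that(1)] that(2) by simp_all
  have "hinner KG (iop \<Psi> \<xi>) \<eta> = (\<Sum>g\<in>carrier G. \<Sum>k\<in>carrier G. cH * hinner K (\<Psi> k (\<xi> (inv\<^bsub>G\<^esub> k \<otimes>\<^bsub>G\<^esub> g))) (\<eta> g))"
    unfolding KG_eq fun_hilb_simps using x y P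
    by (intro sum.cong refl) (simp add: iop_apply inner_scale inner_sum KG_D sum_distrib_left)
  also have "\<dots> = (\<Sum>k\<in>carrier G. \<Sum>g\<in>carrier G. cH * hinner K (\<Psi> k (\<xi> (inv\<^bsub>G\<^esub> k \<otimes>\<^bsub>G\<^esub> g))) (\<eta> g))"
    by (rule sum.swap)
  also have "\<dots> = (\<Sum>k\<in>carrier G. \<Sum>g\<in>carrier G. cH * hinner K (\<xi> (inv\<^bsub>G\<^esub> k \<otimes>\<^bsub>G\<^esub> g)) (\<Psi>' (inv\<^bsub>G\<^esub> k) (\<eta> g)))"
    by (intro sum.cong refl arg_cong2 [where f = "(*)"] adjoint_pairD(1) [OF adj] KG_D(1) [OF x] KG_D(1) [OF y])
  also have "\<dots> = (\<Sum>k\<in>carrier G. \<Sum>g\<in>carrier G. cH * hinner K (\<xi> (k \<otimes>\<^bsub>G\<^esub> g)) (\<Psi>' k (\<eta> g)))"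
    by (rule sum.reindex_bij_witness [of _ "\<lambda>k. inv\<^bsub>G\<^esub> k" "\<lambda>k. inv\<^bsub>G\<^esub> k"]) simp_all
  also have "\<dots> = (\<Sum>k\<in>carrier G. \<Sum>g\<in>carrier G. cH * hinner K (\<xi> g) (\<Psi>' k (\<eta> (inv\<^bsub>G\<^esub> k \<otimes>\<^bsub>G\<^esub> g))))"
  proof (rule sum.cong [OF refl])
    fix k assume k: "k \<in> carrier G"
    show "(\<Sum>g\<in>carrier G. cH * hinner K (\<xi> (k \<otimes>\<^bsub>G\<^esub> g)) (\<Psi>' k (\<eta> g))) = (\<Sum>g\<in>carrier G. cH * hinner K (\<xi> g) (\<Psi>' k (\<eta> (inv\<^bsub>G\<^esub> k \<otimes>\<^bsub>G\<^esub> g))))"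
      by (rule sum.reindex_bij_witness [of _ "\<lambda>g. inv\<^bsub>G\<^esub> k \<otimes>\<^bsub>G\<^esub> g" "\<lambda>g. k \<otimes>\<^bsub>G\<^esub> g"])
        (use k in \<open>simp_all add: m_assoc [symmetric]\<close>)
  qed
  also have "\<dots> = (\<Sum>g\<in>carrier G. \<Sum>k\<in>carrier G. cH * hinner K (\<xi> g) (\<Psi>' k (\<eta> (inv\<^bsub>G\<^esub> k \<otimes>\<^bsub>G\<^esub> g))))"
    by (rule sum.swap)
  also have "\<dots> = hinner KG \<xi> (iop \<Psi>' \<eta>)"
    unfolding KG_eq fun_hilb_simps using x y P
    by (intro sum.cong refl) (simp add: iop_apply inner_scale_right inner_sum_right KG_D sum_distrib_left fconj_divide)
  finally show "hinner KG (iop \<Psi> \<xi>) \<eta> = hinner KG \<xi> (iop \<Psi>' \<eta>)" .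
qed

text \<open>The equivariant function supported on \<open>H\<close> with value \<open>v\<close> at
  the unit. An induced operator maps it to g |-> \<Psi> g v, from which \<Psi> is recovered.\<close>

definition delta :: "'u \<Rightarrow> 'g \<Rightarrow> 'u" where
  "delta v g = (if g \<in> H then \<theta> (inv\<^bsub>G\<^esub> g) v else 0)"

lemma mult_mem_H: "g \<in> carrier G \<Longrightarrow> h \<in> H \<Longrightarrow> g \<otimes>\<^bsub>G\<^esub> h \<in> H \<longleftrightarrow> g \<in> H"
proof
  assume g: "g \<in> carrier G" and h: "h \<in> H" and gh: "g \<otimes>\<^bsub>G\<^esub> h \<in> H"
  have "(g \<otimes>\<^bsub>G\<^esub> h) \<otimes>\<^bsub>G\<^esub> inv\<^bsub>G\<^esub> h \<in> H" using gh h by simp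
  then show "g \<in> H" using g h by (simp add: m_assoc)
qed simp

lemma delta_KG [simp]: "v \<in> hcar K \<Longrightarrow> delta v \<in> hcar KG"
proof (rule KG_I)
  fix g h assume v: "v \<in> hcar K" and g: "g \<in> carrier G" and h: "h \<in> H"
  show "delta v (g \<otimes>\<^bsub>G\<^esub> h) = \<theta> (inv\<^bsub>G\<^esub> h) (delta v g)"
    using g h mult_mem_H [OF g h]
    by (simp add: delta_def inv_mult_group theta_mult)
qed (auto simp: delta_def)

lemma iop_delta:
  assumes e: "equi \<Psi>" and v: "v \<in> hcar K" and g: "g \<in> carrier G"
  shows "iop \<Psi> (delta v) g = \<Psi> g v"
  unfolding iop_apply [OF delta_KG [OF v] g]
proof (rule coset_average [OF vs.vector_space_axioms g])
  fix h assume h: "h \<in> H"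
  have a: "inv\<^bsub>G\<^esub> (g \<otimes>\<^bsub>G\<^esub> h) \<otimes>\<^bsub>G\<^esub> g = inv\<^bsub>G\<^esub> h"
    using g h by (simp add: inv_mult_group m_assoc)
  have b: "\<theta> (inv\<^bsub>G\<^esub> h) (\<theta> h w) = w" if "w \<in> hcar K" for w
    using fun_cong [OF theta_mult [of "inv\<^bsub>G\<^esub> h" h], of w] h that by simp
  have pv: "\<Psi> g v \<in> hcar K" using equiD(1) [OF e g] v by simp
  show "\<Psi> (g \<otimes>\<^bsub>G\<^esub> h) (delta v (inv\<^bsub>G\<^esub> (g \<otimes>\<^bsub>G\<^esub> h) \<otimes>\<^bsub>G\<^esub> g)) = \<Psi> g v"
    unfolding a using h by (simp add: delta_def equiD(2) [OF e g] equiD(3) [OF e g h, symmetric] b pv)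
next
  fix k assume k: "k \<in> carrier G" and out: "inv\<^bsub>G\<^esub> g \<otimes>\<^bsub>G\<^esub> k \<notin> H"
  have "inv\<^bsub>G\<^esub> k \<otimes>\<^bsub>G\<^esub> g \<notin> H"
  proof
    assume "inv\<^bsub>G\<^esub> k \<otimes>\<^bsub>G\<^esub> g \<in> H"
    then have "inv\<^bsub>G\<^esub> (inv\<^bsub>G\<^esub> k \<otimes>\<^bsub>G\<^esub> g) \<in> H" by simp
    then show False using out k g by (simp add: inv_mult_group)
  qed
  then show "\<Psi> k (delta v (inv\<^bsub>G\<^esub> k \<otimes>\<^bsub>G\<^esub> g)) = 0"
    using equiD(1) [OF e k] by (simp add: delta_def)
qed

lemma iop_inj:
  assumes "equi \<Psi>" "equi \<Psi>'" "iop \<Psi> = iop \<Psi>'" "g \<in> carrier G"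
  shows "\<Psi> g = \<Psi>' g"
proof (rule bops_eqI)
  show "\<Psi> g v = \<Psi>' g v" if "v \<in> hcar K" for v
    using iop_delta [OF assms(1) that assms(4)] iop_delta [OF assms(2) that assms(4)] assms(3) by simp
qed (use assms equiD(1) in auto)

text \<open>With respect to a transversal \<open>r\<close> of \<open>G / H\<close>, \<open>iop \<Psi>\<close> is the operator matrix with entries
  \<open>\<Psi> (r a r b\<^sup>-\<^sup>1)\<close>.\<close>

definition transversal :: "nat \<Rightarrow> (nat \<Rightarrow> 'g) \<Rightarrow> bool" where
  "transversal q r \<longleftrightarrow> (\<forall>a<q. r a \<in> carrier G) \<and>
     bij_betw (\<lambda>(a, h). r a \<otimes>\<^bsub>G\<^esub> h) ({..<q} \<times> H) (carrier G)"

text \<open>The index \<open>p\<close> encodes the pair (i, a) by p = i q + a, with matrix index i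
  and coset index a.\<close>

definition coset_mat :: "nat \<Rightarrow> (nat \<Rightarrow> 'g) \<Rightarrow> (nat \<Rightarrow> nat \<Rightarrow> 'g \<Rightarrow> 'b) \<Rightarrow> nat \<Rightarrow> nat \<Rightarrow> 'b" where
  "coset_mat q r \<Phi> p s = \<Phi> (p div q) (s div q) (r (p mod q) \<otimes>\<^bsub>G\<^esub> inv\<^bsub>G\<^esub> (r (s mod q)))"

lemma transversal_exists: "\<exists>q r. transversal q r"
proof -
  define rep where "rep g = (SOME k. k \<in> carrier G \<and> inv\<^bsub>G\<^esub> k \<otimes>\<^bsub>G\<^esub> g \<in> H)" for g
  have rep: "rep g \<in> carrier G" "inv\<^bsub>G\<^esub> (rep g) \<otimes>\<^bsub>G\<^esub> g \<in> H" if "g \<in> carrier G" for g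
  proof -
    have "\<exists>k. k \<in> carrier G \<and> inv\<^bsub>G\<^esub> k \<otimes>\<^bsub>G\<^esub> g \<in> H" using that by (intro exI [of _ g]) simp
    then have "rep g \<in> carrier G \<and> inv\<^bsub>G\<^esub> (rep g) \<otimes>\<^bsub>G\<^esub> g \<in> H" unfolding rep_def by (rule someI_ex)
    then show "rep g \<in> carrier G" "inv\<^bsub>G\<^esub> (rep g) \<otimes>\<^bsub>G\<^esub> g \<in> H" by auto
  qed
  \<comment> \<open>The predicate under \<open>SOME\<close> depends only on the coset of
    \<open>g\<close>, so all elements of a coset receive the same representative.\<close>
  have rep_mult: "rep (g \<otimes>\<^bsub>G\<^esub> h) = rep g" if g: "g \<in> carrier G" and h: "h \<in> H" for g h
  proof -
    have "inv\<^bsub>G\<^esub> k \<otimes>\<^bsub>G\<^esub> (g \<otimes>\<^bsub>G\<^esub> h) \<in> H \<longleftrightarrow> inv\<^bsub>G\<^esub> k \<otimes>\<^bsub>G\<^esub> g \<in> H" if k: "k \<in> carrier G" for k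
      using mult_mem_H [of "inv\<^bsub>G\<^esub> k \<otimes>\<^bsub>G\<^esub> g" h] g h k by (simp add: m_assoc)
    then show ?thesis unfolding rep_def by (intro arg_cong [where f = Eps] ext) blast
  qed
  have decomp: "rep g \<otimes>\<^bsub>G\<^esub> (inv\<^bsub>G\<^esub> (rep g) \<otimes>\<^bsub>G\<^esub> g) = g" if "g \<in> carrier G" for g
    using rep [OF that] that by simp
  have idem: "rep (rep g) = rep g" if g: "g \<in> carrier G" for g
    using rep_mult [OF rep(1) [OF g] rep(2) [OF g]] decomp [OF g] by simp
  define R where "R = rep ` carrier G"
  have "finite R" using finite_G by (simp add: R_def)
  then obtain r where r: "bij_betw r {0..<card R} R" using ex_bij_betw_nat_finite by blast
  have rR: "r a \<in> R" if "a < card R" for a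
    using bij_betwE [OF r] that by auto
  have rG: "r a \<in> carrier G" "rep (r a) = r a" if "a < card R" for a
    using rR [OF that] rep(1) idem by (auto simp: R_def)
  have "transversal (card R) r"
    unfolding transversal_def bij_betw_def
  proof (intro conjI allI impI rG inj_onI subset_antisym subsetI)
    fix x y assume x: "x \<in> {..<card R} \<times> H" and y: "y \<in> {..<card R} \<times> H"
      and eq: "(\<lambda>(a, h). r a \<otimes>\<^bsub>G\<^esub> h) x = (\<lambda>(a, h). r a \<otimes>\<^bsub>G\<^esub> h) y"
    obtain a h where [simp]: "x = (a, h)" by (cases x)
    obtain b k where [simp]: "y = (b, k)" by (cases y)
    have ab: "a < card R" "h \<in> H" "b < card R" "k \<in> H" using x y by auto
    have "rep (r a \<otimes>\<^bsub>G\<^esub> h) = rep (r b \<otimes>\<^bsub>G\<^esub> k)" using eq by simp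
    then have rab: "r a = r b" using ab rG by (simp add: rep_mult)
    then have "a = b" using r ab unfolding bij_betw_def inj_on_def by simp
    moreover have "h = k" using eq rab ab rG by simp
    ultimately show "x = y" by simp
  next
    fix g assume "g \<in> (\<lambda>(a, h). r a \<otimes>\<^bsub>G\<^esub> h) ` ({..<card R} \<times> H)"
    then show "g \<in> carrier G" using rG by auto
  next
    fix g assume g: "g \<in> carrier G"
    then have "rep g \<in> R" by (simp add: R_def)
    then obtain a where a: "a < card R" "r a = rep g"
      using r unfolding bij_betw_def by force
    then show "g \<in> (\<lambda>(a, h). r a \<otimes>\<^bsub>G\<^esub> h) ` ({..<card R} \<times> H)"
      using decomp [OF g] rep(2) [OF g] by (intro rev_image_eqI [of "(a, inv\<^bsub>G\<^esub> (rep g) \<otimes>\<^bsub>G\<^esub> g)"]) auto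
  qed
  then show ?thesis by blast
qed

lemma transversal_sum:
  assumes "transversal q r"
  shows "(\<Sum>g\<in>carrier G. F g) = (\<Sum>a<q. \<Sum>h\<in>H. F (r a \<otimes>\<^bsub>G\<^esub> h))"
proof -
  have "(\<Sum>g\<in>carrier G. F g) = (\<Sum>x\<in>{..<q} \<times> H. F ((\<lambda>(a, h). r a \<otimes>\<^bsub>G\<^esub> h) x))"
    using assms unfolding transversal_def by (intro sum.reindex_bij_betw [symmetric]) simp
  also have "\<dots> = (\<Sum>(a, h)\<in>{..<q} \<times> H. F (r a \<otimes>\<^bsub>G\<^esub> h))"
    by (intro sum.cong) auto
  finally show ?thesis by (simp add: sum.cartesian_product)
qed

lemma theta_inv [simp]: "h \<in> H \<Longrightarrow> v \<in> hcar K \<Longrightarrow> \<theta> (inv\<^bsub>G\<^esub> h) (\<theta> h v) = v"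
    "h \<in> H \<Longrightarrow> v \<in> hcar K \<Longrightarrow> \<theta> h (\<theta> (inv\<^bsub>G\<^esub> h) v) = v"
  using fun_cong [OF theta_mult [of "inv\<^bsub>G\<^esub> h" h], of v] fun_cong [OF theta_mult [of h "inv\<^bsub>G\<^esub> h"], of v] by simp_all

lemma theta_hnorm: "h \<in> H \<Longrightarrow> v \<in> hcar K \<Longrightarrow> hnorm K (\<theta> h v) = hnorm K v"
  by (simp add: hnorm_def theta_inner)

text \<open>Unitarity of \<theta> makes the norm of \<xi> g constant on cosets. The resulting factor
  \<open>card H\<close> occurs on both sides of norm comparisons and cancels there.\<close>

lemma hnorm_KG_transversal:
  assumes t: "transversal q r" and x: "\<xi> \<in> hcar KG"
  shows "(hnorm KG \<xi>)\<^sup>2 = card H * (\<Sum>a<q. (hnorm K (\<xi> (r a)))\<^sup>2)"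
proof -
  have "(hnorm KG \<xi>)\<^sup>2 = (\<Sum>a<q. \<Sum>h\<in>H. (hnorm K (\<xi> (r a \<otimes>\<^bsub>G\<^esub> h)))\<^sup>2)"
    unfolding hnorm_KG [OF x] by (rule transversal_sum [OF t])
  also have "\<dots> = (\<Sum>a<q. \<Sum>h\<in>H. (hnorm K (\<xi> (r a)))\<^sup>2)"
  proof (intro sum.cong refl)
    fix a h assume "a \<in> {..<q}" "h \<in> H"
    then show "(hnorm K (\<xi> (r a \<otimes>\<^bsub>G\<^esub> h)))\<^sup>2 = (hnorm K (\<xi> (r a)))\<^sup>2"
      using t KG_D [OF x] by (simp add: transversal_def theta_hnorm)
  qed
  finally show ?thesis by (simp add: sum_distrib_left)
qed

text \<open>Along a coset the equivariance of \<Psi> contributes \<theta> h and that of \<xi>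
  contributes its inverse. Centrality of \<open>H\<close> lets the two meet and cancel, so |H| equal
  terms remain against the factor 1/|H|.\<close>

lemma iop_transversal:
  assumes t: "transversal q r" and e: "equi \<Psi>" and x: "\<xi> \<in> hcar KG" and a: "a < q"
  shows "iop \<Psi> \<xi> (r a) = (\<Sum>b<q. \<Psi> (r a \<otimes>\<^bsub>G\<^esub> inv\<^bsub>G\<^esub> (r b)) (\<xi> (r b)))"
proof -
  have rG: "r b \<in> carrier G" if "b < q" for b using t that by (simp add: transversal_def)
  have "iop \<Psi> \<xi> (r a) = hscl K cH (\<Sum>g\<in>carrier G. \<Psi> (r a \<otimes>\<^bsub>G\<^esub> inv\<^bsub>G\<^esub> g) (\<xi> g))"
    using sum_inv_mult [of "r a" "\<lambda>k l. \<Psi> k (\<xi> l)"] rG a x by (simp add: iop_apply)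
  also have "\<dots> = hscl K cH (\<Sum>b<q. \<Sum>h\<in>H. \<Psi> (r a \<otimes>\<^bsub>G\<^esub> inv\<^bsub>G\<^esub> (r b \<otimes>\<^bsub>G\<^esub> h)) (\<xi> (r b \<otimes>\<^bsub>G\<^esub> h)))"
    unfolding transversal_sum [OF t] ..
  also have "\<dots> = hscl K cH (\<Sum>b<q. \<Sum>h\<in>H. \<Psi> (r a \<otimes>\<^bsub>G\<^esub> inv\<^bsub>G\<^esub> (r b)) (\<xi> (r b)))"
  proof (intro arg_cong [where f = "hscl K cH"] sum.cong refl)
    fix b h assume "b \<in> {..<q}" and h: "h \<in> H"
    then have b: "b < q" by simp
    let ?g = "r a \<otimes>\<^bsub>G\<^esub> inv\<^bsub>G\<^esub> (r b)"
    have g: "?g \<in> carrier G" using rG a b by simp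
    have "r a \<otimes>\<^bsub>G\<^esub> inv\<^bsub>G\<^esub> (r b \<otimes>\<^bsub>G\<^esub> h) = ?g \<otimes>\<^bsub>G\<^esub> inv\<^bsub>G\<^esub> h"
      using rG [OF a] rG [OF b] h H_comm [of "inv\<^bsub>G\<^esub> h" "inv\<^bsub>G\<^esub> (r b)"] by (simp add: inv_mult_group m_assoc)
    then have "\<Psi> (r a \<otimes>\<^bsub>G\<^esub> inv\<^bsub>G\<^esub> (r b \<otimes>\<^bsub>G\<^esub> h)) (\<xi> (r b \<otimes>\<^bsub>G\<^esub> h)) = \<theta> h (\<Psi> ?g (\<theta> (inv\<^bsub>G\<^esub> h) (\<xi> (r b))))"
      using equiD(2) [OF e g, of "inv\<^bsub>G\<^esub> h"] KG_D(3) [OF x rG [OF b] h] h by simp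
    also have "\<dots> = \<Psi> ?g (\<xi> (r b))"
      using equiD(3) [OF e g h] h KG_D(1) [OF x] by simp
    finally show "\<Psi> (r a \<otimes>\<^bsub>G\<^esub> inv\<^bsub>G\<^esub> (r b \<otimes>\<^bsub>G\<^esub> h)) (\<xi> (r b \<otimes>\<^bsub>G\<^esub> h)) = \<Psi> ?g (\<xi> (r b))" .
  qed
  also have "\<dots> = (\<Sum>b<q. (\<Sum>h\<in>H. hscl K cH (\<Psi> (r a \<otimes>\<^bsub>G\<^esub> inv\<^bsub>G\<^esub> (r b)) (\<xi> (r b)))))"
    by (simp only: vs.scale_sum_right)
  also have "\<dots> = (\<Sum>b<q. \<Psi> (r a \<otimes>\<^bsub>G\<^esub> inv\<^bsub>G\<^esub> (r b)) (\<xi> (r b)))"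
    unfolding vs.scale_sum_left [symmetric] using card_H_pos by simp
  finally show ?thesis .
qed

lemma KG_extend:
  assumes t: "transversal q r" and v: "\<And>a. a < q \<Longrightarrow> v a \<in> hcar K"
  shows "\<exists>\<xi>\<in>hcar KG. \<forall>a<q. \<xi> (r a) = v a"
proof -
  define f where "f = (\<lambda>(a, h). r a \<otimes>\<^bsub>G\<^esub> h)"
  have f: "inj_on f ({..<q} \<times> H)" "f ` ({..<q} \<times> H) = carrier G"
    using t unfolding transversal_def f_def bij_betw_def by auto
  have rG: "r b \<in> carrier G" if "b < q" for b using t that by (simp add: transversal_def)
  define i where "i = the_inv_into ({..<q} \<times> H) f"
  have i: "i (r a \<otimes>\<^bsub>G\<^esub> h) = (a, h)" if "a < q" "h \<in> H" for a h
    using the_inv_into_f_f [OF f(1), of "(a, h)"] that by (simp add: i_def f_def)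
  \<comment> \<open>Equivariance forces the value \<theta> (h^-1) (v a) at r a h; the inverse
    \<open>i\<close> of the parametrization reads off a and h.\<close>
  define \<xi> where "\<xi> = (\<lambda>g. if g \<in> carrier G then \<theta> (inv\<^bsub>G\<^esub> (snd (i g))) (v (fst (i g))) else 0)"
  have xi: "\<xi> (r a \<otimes>\<^bsub>G\<^esub> h) = \<theta> (inv\<^bsub>G\<^esub> h) (v a)" if "a < q" "h \<in> H" for a h
    using that rG by (simp add: \<xi>_def i)
  have dec: "\<exists>a h. a < q \<and> h \<in> H \<and> g = r a \<otimes>\<^bsub>G\<^esub> h" if "g \<in> carrier G" for g
    using that unfolding f(2) [symmetric] f_def by auto
  have "\<xi> \<in> hcar KG"
  proof (rule KG_I)
    fix g assume "g \<in> carrier G"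
    then obtain a k where ak: "a < q" "k \<in> H" "g = r a \<otimes>\<^bsub>G\<^esub> k" using dec by blast
    show "\<xi> g \<in> hcar K" using ak v by (simp add: xi)
    fix h assume h: "h \<in> H"
    have "\<xi> (g \<otimes>\<^bsub>G\<^esub> h) = \<theta> (inv\<^bsub>G\<^esub> (k \<otimes>\<^bsub>G\<^esub> h)) (v a)"
      using ak h rG by (simp add: m_assoc xi)
    also have "inv\<^bsub>G\<^esub> (k \<otimes>\<^bsub>G\<^esub> h) = inv\<^bsub>G\<^esub> h \<otimes>\<^bsub>G\<^esub> inv\<^bsub>G\<^esub> k"
      using ak h by (simp add: inv_mult_group)
    also have "\<theta> (inv\<^bsub>G\<^esub> h \<otimes>\<^bsub>G\<^esub> inv\<^bsub>G\<^esub> k) (v a) = \<theta> (inv\<^bsub>G\<^esub> h) (\<xi> g)"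
      using ak h by (simp add: theta_mult xi)
    finally show "\<xi> (g \<otimes>\<^bsub>G\<^esub> h) = \<theta> (inv\<^bsub>G\<^esub> h) (\<xi> g)" .
  qed (simp add: \<xi>_def)
  moreover have "\<xi> (r a) = v a" if "a < q" for a
    using xi [OF that H_closed(1)] rG [OF that] v [OF that] by simp
  ultimately show ?thesis by blast
qed

lemma coset_mat_bops:
  assumes t: "transversal q r" and e: "\<And>i j. i < n \<Longrightarrow> j < n \<Longrightarrow> equi (\<Psi> i j)" and ps: "p < n * q" "s < n * q"
  shows "coset_mat q r \<Psi> p s \<in> bops K"
proof -
  have "q > 0" using ps by (cases q) auto
  then have pq: "p div q < n" "s div q < n" "p mod q < q" "s mod q < q"
    using ps by (auto simp: less_mult_imp_div_less)
  show ?thesis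
    unfolding coset_mat_def by (rule equiD(1) [OF e [OF pq(1,2)]]) (use t pq in \<open>auto simp: transversal_def\<close>)
qed

text \<open>Up to the scalar sqrt |H|, restriction to the transversal is a unitary from the induced
  space onto a q-fold direct sum, and it carries \<open>iop\<close> to \<open>coset_mat\<close>.
  Norms over the induced space thus become matrix norms over the original operators.\<close>

theorem opmat_norm_coset_mat:
  assumes t: "transversal q r" and e: "\<And>i j. i < n \<Longrightarrow> j < n \<Longrightarrow> equi (\<Psi> i j)"
  shows "opmat_norm KG n (\<lambda>i j. iop (\<Psi> i j)) = opmat_norm K (n * q) (coset_mat q r \<Psi>)"
proof -
  let ?M = "coset_mat q r \<Psi>"
  have Mb: "?M p s \<in> bops K" if "p < n * q" "s < n * q" for p s
    using coset_mat_bops [OF t, of n \<Psi> p s] e that by blast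
  have Tb: "iop (\<Psi> i j) \<in> bops KG" if "i < n" "j < n" for i j using e [OF that] by simp
  let ?A = "\<lambda>\<xi>. (\<Sum>i<n. (hnorm KG (\<Sum>j<n. iop (\<Psi> i j) (\<xi> j)))\<^sup>2)" and ?C = "\<lambda>\<xi>. (\<Sum>j<n. (hnorm KG (\<xi> j))\<^sup>2)"
  let ?B = "\<lambda>v. (\<Sum>p<n * q. (hnorm K (\<Sum>s<n * q. ?M p s (v s)))\<^sup>2)" and ?D = "\<lambda>v. (\<Sum>s<n * q. (hnorm K (v s))\<^sup>2)"
  have key: "?A \<xi> = card H * ?B v"
      "?C \<xi> = card H * ?D v"
    if x: "\<And>j. j < n \<Longrightarrow> \<xi> j \<in> hcar KG" and v: "\<And>j a. j < n \<Longrightarrow> a < q \<Longrightarrow> \<xi> j (r a) = v (j * q + a)" for \<xi> v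
  proof -
    show "(\<Sum>j<n. (hnorm KG (\<xi> j))\<^sup>2) = card H * (\<Sum>s<n * q. (hnorm K (v s))\<^sup>2)"
      unfolding sum_lessThan_mult sum_distrib_left [of _ _ "{..<n}"]
      by (intro sum.cong refl) (simp add: hnorm_KG_transversal [OF t x] v)
    have "(\<Sum>i<n. (hnorm KG (\<Sum>j<n. iop (\<Psi> i j) (\<xi> j)))\<^sup>2)
        = (\<Sum>i<n. card H * (\<Sum>a<q. (hnorm K (\<Sum>s<n * q. ?M (i * q + a) s (v s)))\<^sup>2))"
    proof (intro sum.cong refl)
      fix i assume "i \<in> {..<n}"
      then have i: "i < n" by simp
      have car: "(\<Sum>j<n. iop (\<Psi> i j) (\<xi> j)) \<in> hcar KG"
        using x Tb i by (intro kg.car_sum) (simp add: kg.bops_car)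
      have "(\<Sum>j<n. iop (\<Psi> i j) (\<xi> j)) (r a) = (\<Sum>s<n * q. ?M (i * q + a) s (v s))" if a: "a < q" for a
      proof -
        have "(\<Sum>j<n. iop (\<Psi> i j) (\<xi> j)) (r a) = (\<Sum>j<n. \<Sum>b<q. \<Psi> i j (r a \<otimes>\<^bsub>G\<^esub> inv\<^bsub>G\<^esub> (r b)) (\<xi> j (r b)))"
          unfolding sum_fun_app using e i x a by (intro sum.cong refl iop_transversal [OF t]) auto
        also have "\<dots> = (\<Sum>j<n. \<Sum>b<q. ?M (i * q + a) (j * q + b) (v (j * q + b)))"
          using a by (intro sum.cong refl) (simp add: coset_mat_def v)
        finally show ?thesis by (simp only: sum_lessThan_mult)
      qed
      then show "(hnorm KG (\<Sum>j<n. iop (\<Psi> i j) (\<xi> j)))\<^sup>2 = card H * (\<Sum>a<q. (hnorm K (\<Sum>s<n * q. ?M (i * q + a) s (v s)))\<^sup>2)"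
        unfolding hnorm_KG_transversal [OF t car] by simp
    qed
    then show "(\<Sum>i<n. (hnorm KG (\<Sum>j<n. iop (\<Psi> i j) (\<xi> j)))\<^sup>2) = card H * (\<Sum>p<n * q. (hnorm K (\<Sum>s<n * q. ?M p s (v s)))\<^sup>2)"
      by (simp only: sum_lessThan_mult [of "\<lambda>p. (hnorm K (\<Sum>s<n * q. ?M p s (v s)))\<^sup>2"] sum_distrib_left [of _ _ "{..<n}"])
  qed
  have cp: "real (card H) > 0" using card_H_pos by simp
  show ?thesis
  proof (rule antisym)
    show "opmat_norm KG n (\<lambda>i j. iop (\<Psi> i j)) \<le> opmat_norm K (n * q) ?M"
    proof (rule kg.opmat_norm_least [OF Tb])
      show "0 \<le> opmat_norm K (n * q) ?M" by (rule opmat_norm_nonneg [OF Mb])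
      fix \<xi> :: "nat \<Rightarrow> 'g \<Rightarrow> 'u" assume x: "\<And>j. j < n \<Longrightarrow> \<xi> j \<in> hcar KG"
      define v where "v = (\<lambda>s. \<xi> (s div q) (r (s mod q)))"
      have vx: "\<xi> j (r a) = v (j * q + a)" if "a < q" for j a using that by (simp add: v_def)
      have vK: "v s \<in> hcar K" if "s < n * q" for s
        unfolding v_def by (rule KG_D(1) [OF x]) (use that in \<open>simp add: less_mult_imp_div_less\<close>)
      have k: "?A \<xi> = card H * ?B v" "?C \<xi> = card H * ?D v"
        by (rule key; simp add: x vx)+
      have "card H * (\<Sum>p<n * q. (hnorm K (\<Sum>s<n * q. ?M p s (v s)))\<^sup>2) \<le> card H * ((opmat_norm K (n * q) ?M)\<^sup>2 * (\<Sum>s<n * q. (hnorm K (v s))\<^sup>2))"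
        by (intro mult_left_mono opmat_norm_ub Mb vK) auto
      then show "(\<Sum>i<n. (hnorm KG (\<Sum>j<n. iop (\<Psi> i j) (\<xi> j)))\<^sup>2) \<le> (opmat_norm K (n * q) ?M)\<^sup>2 * (\<Sum>j<n. (hnorm KG (\<xi> j))\<^sup>2)"
        unfolding k by (simp add: mult.left_commute)
    qed
    show "opmat_norm K (n * q) ?M \<le> opmat_norm KG n (\<lambda>i j. iop (\<Psi> i j))"
    proof (rule opmat_norm_least [OF Mb])
      show "0 \<le> opmat_norm KG n (\<lambda>i j. iop (\<Psi> i j))" by (rule kg.opmat_norm_nonneg [OF Tb])
      fix v :: "nat \<Rightarrow> 'u" assume v: "\<And>s. s < n * q \<Longrightarrow> v s \<in> hcar K"
      have "\<exists>\<xi>. \<xi> \<in> hcar KG \<and> (\<forall>a<q. \<xi> (r a) = v (j * q + a))" if j: "j < n" for j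
      proof -
        have "j * q + a < n * q" if "a < q" for a
        proof -
          have "j * q + a < Suc j * q" using that by simp
          also have "\<dots> \<le> n * q" using j by (intro mult_right_mono) auto
          finally show ?thesis .
        qed
        then show ?thesis using KG_extend [OF t, of "\<lambda>a. v (j * q + a)"] v by blast
      qed
      then obtain \<xi> where x: "\<And>j. j < n \<Longrightarrow> \<xi> j \<in> hcar KG" "\<And>j a. j < n \<Longrightarrow> a < q \<Longrightarrow> \<xi> j (r a) = v (j * q + a)"
        by metis
      have k: "?A \<xi> = card H * ?B v" "?C \<xi> = card H * ?D v"
        by (rule key; simp add: x)+
      have "(\<Sum>i<n. (hnorm KG (\<Sum>j<n. iop (\<Psi> i j) (\<xi> j)))\<^sup>2) \<le> (opmat_norm KG n (\<lambda>i j. iop (\<Psi> i j)))\<^sup>2 * (\<Sum>j<n. (hnorm KG (\<xi> j))\<^sup>2)"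
        using x(1) by (intro kg.opmat_norm_ub Tb)
      then have "card H * (\<Sum>p<n * q. (hnorm K (\<Sum>s<n * q. ?M p s (v s)))\<^sup>2) \<le> card H * ((opmat_norm KG n (\<lambda>i j. iop (\<Psi> i j)))\<^sup>2 * (\<Sum>s<n * q. (hnorm K (v s))\<^sup>2))"
        unfolding k by (simp add: mult.left_commute)
      then show "(\<Sum>p<n * q. (hnorm K (\<Sum>s<n * q. ?M p s (v s)))\<^sup>2) \<le> (opmat_norm KG n (\<lambda>i j. iop (\<Psi> i j)))\<^sup>2 * (\<Sum>s<n * q. (hnorm K (v s))\<^sup>2)"
        using cp by simp
    qed
  qed
qed

end

subsection \<open>Tensor products of operator matrices\<close>

context prehilbert
begin

text \<open>Each block matrix is a product of two factors, one acting on the inner and one on the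
  outer index; each factor is a direct sum of copies of \<open>T\<close> or of \<open>S\<close> and
  has the same norm. Entries of \<open>S\<close> and \<open>T\<close> need not commute, and the two
  orders correspond to left and right convolution.\<close>

lemma opmat_norm_tensor:
  assumes S: "\<And>i j. i < m \<Longrightarrow> j < m \<Longrightarrow> S i j \<in> bops K" and T: "\<And>i j. i < n \<Longrightarrow> j < n \<Longrightarrow> T i j \<in> bops K"
    and n: "0 < n"
  shows "opmat_norm K (m * n) (\<lambda>p q. T (p mod n) (q mod n) \<circ> S (p div n) (q div n)) \<le> opmat_norm K n T * opmat_norm K m S"
    and "opmat_norm K (m * n) (\<lambda>p q. S (p div n) (q div n) \<circ> T (p mod n) (q mod n)) \<le> opmat_norm K n T * opmat_norm K m S"
proof -
  have nn: "0 \<le> opmat_norm K n T" "0 \<le> opmat_norm K m S"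
    using S T by (auto intro: opmat_norm_nonneg)
  have dv: "p div n < m" "p mod n < n" if "p < m * n" for p
    using that n by (auto simp: less_mult_imp_div_less)
  have ix: "a * n + j < m * n" if "a < m" "j < n" for a j
  proof -
    have "a * n + j < Suc a * n" using that by simp
    also have "\<dots> \<le> m * n" using that by (intro mult_right_mono) auto
    finally show ?thesis .
  qed
  show "opmat_norm K (m * n) (\<lambda>p q. T (p mod n) (q mod n) \<circ> S (p div n) (q div n)) \<le> opmat_norm K n T * opmat_norm K m S"
  proof (rule opmat_norm_least)
    fix v :: "nat \<Rightarrow> 'v" assume v: "\<And>s. s < m * n \<Longrightarrow> v s \<in> hcar K"
    \<comment> \<open>The intermediate vector, after \<open>S\<close> has acted on the outer index
      and before \<open>T\<close> acts on the inner one.\<close>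
    define w where "w = (\<lambda>a j. \<Sum>b<m. S a b (v (b * n + j)))"
    have w: "w a j \<in> hcar K" if "a < m" "j < n" for a j
      unfolding w_def using that S v ix by (intro car_sum) simp
    have "(\<Sum>p<m * n. (hnorm K (\<Sum>s<m * n. (T (p mod n) (s mod n) \<circ> S (p div n) (s div n)) (v s)))\<^sup>2)
      = (\<Sum>a<m. \<Sum>i<n. (hnorm K (\<Sum>j<n. T i j (w a j)))\<^sup>2)"
      unfolding sum_lessThan_mult
    proof (rule sum.cong [OF refl], rule sum.cong [OF refl], rule arg_cong [where f = "\<lambda>x. (hnorm K x)\<^sup>2"])
      fix a i assume "a \<in> {..<m}" "i \<in> {..<n}"
      then have ai: "a < m" "i < n" by auto
      have "(\<Sum>b<m. \<Sum>j<n. T i j (S a b (v (b * n + j)))) = (\<Sum>j<n. \<Sum>b<m. T i j (S a b (v (b * n + j))))"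
        by (rule sum.swap)
      also have "\<dots> = (\<Sum>j<n. T i j (w a j))"
        unfolding w_def using ai S T v ix by (intro sum.cong refl bops_sum [symmetric]) auto
      finally show "(\<Sum>b<m. \<Sum>j<n. (T ((a * n + i) mod n) ((b * n + j) mod n) \<circ> S ((a * n + i) div n) ((b * n + j) div n)) (v (b * n + j)))
          = (\<Sum>j<n. T i j (w a j))"
        using ai by simp
    qed
    also have "\<dots> \<le> (\<Sum>a<m. (opmat_norm K n T)\<^sup>2 * (\<Sum>j<n. (hnorm K (w a j))\<^sup>2))"
      using w T by (intro sum_mono opmat_norm_ub) auto
    also have "\<dots> = (opmat_norm K n T)\<^sup>2 * (\<Sum>j<n. \<Sum>a<m. (hnorm K (\<Sum>b<m. S a b (v (b * n + j))))\<^sup>2)"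
      unfolding sum_distrib_left [symmetric] w_def by (subst sum.swap) simp
    also have "\<dots> \<le> (opmat_norm K n T)\<^sup>2 * (\<Sum>j<n. (opmat_norm K m S)\<^sup>2 * (\<Sum>b<m. (hnorm K (v (b * n + j)))\<^sup>2))"
      using v S ix by (intro mult_left_mono sum_mono opmat_norm_ub) auto
    also have "\<dots> = (opmat_norm K n T * opmat_norm K m S)\<^sup>2 * (\<Sum>s<m * n. (hnorm K (v s))\<^sup>2)"
      unfolding sum_lessThan_mult sum_distrib_left [symmetric] by (subst (2) sum.swap) (simp add: power_mult_distrib)
    finally show "(\<Sum>p<m * n. (hnorm K (\<Sum>s<m * n. (T (p mod n) (s mod n) \<circ> S (p div n) (s div n)) (v s)))\<^sup>2)
        \<le> (opmat_norm K n T * opmat_norm K m S)\<^sup>2 * (\<Sum>s<m * n. (hnorm K (v s))\<^sup>2)" .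
  qed (use nn S T dv in auto)
  show "opmat_norm K (m * n) (\<lambda>p q. S (p div n) (q div n) \<circ> T (p mod n) (q mod n)) \<le> opmat_norm K n T * opmat_norm K m S"
  proof (rule opmat_norm_least)
    fix v :: "nat \<Rightarrow> 'v" assume v: "\<And>s. s < m * n \<Longrightarrow> v s \<in> hcar K"
    define w where "w = (\<lambda>i b. \<Sum>j<n. T i j (v (b * n + j)))"
    have w: "w i b \<in> hcar K" if "b < m" "i < n" for i b
      unfolding w_def using that T v ix by (intro car_sum) simp
    have "(\<Sum>p<m * n. (hnorm K (\<Sum>s<m * n. (S (p div n) (s div n) \<circ> T (p mod n) (s mod n)) (v s)))\<^sup>2)
      = (\<Sum>a<m. \<Sum>i<n. (hnorm K (\<Sum>b<m. S a b (w i b)))\<^sup>2)"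
      unfolding sum_lessThan_mult
    proof (intro sum.cong refl arg_cong [where f = "\<lambda>x. (hnorm K x)\<^sup>2"])
      fix a i b assume "a \<in> {..<m}" "i \<in> {..<n}" "b \<in> {..<m}"
      then have ai: "a < m" "i < n" "b < m" by auto
      have "(\<Sum>j<n. S a b (T i j (v (b * n + j)))) = S a b (w i b)"
        unfolding w_def using ai S T v ix by (intro bops_sum [symmetric]) auto
      then show "(\<Sum>j<n. (S ((a * n + i) div n) ((b * n + j) div n) \<circ> T ((a * n + i) mod n) ((b * n + j) mod n)) (v (b * n + j)))
          = S a b (w i b)"
        using ai by simp
    qed
    also have "\<dots> = (\<Sum>i<n. \<Sum>a<m. (hnorm K (\<Sum>b<m. S a b (w i b)))\<^sup>2)"
      by (rule sum.swap)
    also have "\<dots> \<le> (\<Sum>i<n. (opmat_norm K m S)\<^sup>2 * (\<Sum>b<m. (hnorm K (w i b))\<^sup>2))"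
      using w S by (intro sum_mono opmat_norm_ub) auto
    also have "\<dots> = (opmat_norm K m S)\<^sup>2 * (\<Sum>b<m. \<Sum>i<n. (hnorm K (\<Sum>j<n. T i j (v (b * n + j))))\<^sup>2)"
      unfolding sum_distrib_left [symmetric] w_def by (subst sum.swap) simp
    also have "\<dots> \<le> (opmat_norm K m S)\<^sup>2 * (\<Sum>b<m. (opmat_norm K n T)\<^sup>2 * (\<Sum>j<n. (hnorm K (v (b * n + j)))\<^sup>2))"
      using v T ix by (intro mult_left_mono sum_mono opmat_norm_ub) auto
    also have "\<dots> = (opmat_norm K n T * opmat_norm K m S)\<^sup>2 * (\<Sum>s<m * n. (hnorm K (v s))\<^sup>2)"
      unfolding sum_lessThan_mult sum_distrib_left [symmetric] by (simp add: power_mult_distrib)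
    finally show "(\<Sum>p<m * n. (hnorm K (\<Sum>s<m * n. (S (p div n) (s div n) \<circ> T (p mod n) (s mod n)) (v s)))\<^sup>2)
        \<le> (opmat_norm K n T * opmat_norm K m S)\<^sup>2 * (\<Sum>s<m * n. (hnorm K (v s))\<^sup>2)" .
  qed (use nn S T dv in auto)
qed

end

subsection \<open>The representation of \<open>D\<^sub>G\<close>\<close>

context central_setting
begin

definition DG :: "('g \<Rightarrow> 'x \<Rightarrow> 'x) set" where
  "DG = ind_car G H (D_act X act) D"

definition XG :: "('g \<Rightarrow> 'x) set" where
  "XG = ind_car G H act (ocar X)"

lemma D_act_eq: "D_act X act h d = hop h \<circ> d"
  by (simp add: D_act_def hop_def)

lemma DG_D:
  assumes "\<phi> \<in> DG"
  shows "\<phi> g \<in> D" "g \<notin> carrier G \<Longrightarrow> \<phi> g = 0"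
    "g \<in> carrier G \<Longrightarrow> h \<in> H \<Longrightarrow> \<phi> (g \<otimes>\<^bsub>G\<^esub> h) x = hop (inv\<^bsub>G\<^esub> h) (\<phi> g x)"
  using assms unfolding DG_def ind_car_def D_act_eq by (cases "g \<in> carrier G"; simp)+

lemma DG_I:
  assumes "\<And>g. g \<in> carrier G \<Longrightarrow> \<phi> g \<in> D" "\<And>g. g \<notin> carrier G \<Longrightarrow> \<phi> g = 0"
    "\<And>g h x. g \<in> carrier G \<Longrightarrow> h \<in> H \<Longrightarrow> x \<in> ocar X \<Longrightarrow> \<phi> (g \<otimes>\<^bsub>G\<^esub> h) x = hop (inv\<^bsub>G\<^esub> h) (\<phi> g x)"
  shows "\<phi> \<in> DG"
proof -
  have "\<phi> (g \<otimes>\<^bsub>G\<^esub> h) = hop (inv\<^bsub>G\<^esub> h) \<circ> \<phi> g" if gh: "g \<in> carrier G" "h \<in> H" for g h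
  proof (rule ext)
    fix x show "\<phi> (g \<otimes>\<^bsub>G\<^esub> h) x = (hop (inv\<^bsub>G\<^esub> h) \<circ> \<phi> g) x"
      using assms(1) [of g] assms(1) [of "g \<otimes>\<^bsub>G\<^esub> h"] assms(3) [OF gh, of x] gh
      by (cases "x \<in> ocar X") (simp_all add: D_outside)
  qed
  then show ?thesis unfolding DG_def ind_car_def D_act_eq using assms(1,2) by simp
qed

lemma XG_D:
  assumes "x \<in> XG"
  shows "x g \<in> ocar X" "g \<notin> carrier G \<Longrightarrow> x g = 0"
    "g \<in> carrier G \<Longrightarrow> h \<in> H \<Longrightarrow> x (g \<otimes>\<^bsub>G\<^esub> h) = act (inv\<^bsub>G\<^esub> h) (x g)"
  using assms unfolding XG_def ind_car_def by (cases "g \<in> carrier G"; simp)+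

lemma XG_I:
  assumes "\<And>g. g \<in> carrier G \<Longrightarrow> x g \<in> ocar X" "\<And>g. g \<notin> carrier G \<Longrightarrow> x g = 0"
    "\<And>g h. g \<in> carrier G \<Longrightarrow> h \<in> H \<Longrightarrow> x (g \<otimes>\<^bsub>G\<^esub> h) = act (inv\<^bsub>G\<^esub> h) (x g)"
  shows "x \<in> XG"
  unfolding XG_def ind_car_def using assms by simp

text \<open>In the notation of the paper, \<open>W \<phi> = \<JJ>(\<pi> \<circ> \<phi>)\<close> and \<open>j x = \<JJ>(\<rho> \<circ> x)\<close>.\<close>

definition W :: "('g \<Rightarrow> 'x \<Rightarrow> 'x) \<Rightarrow> ('g \<Rightarrow> 'u) \<Rightarrow> 'g \<Rightarrow> 'u" where
  "W \<phi> = iop (\<lambda>g. \<pi> (\<phi> g))"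

definition j :: "('g \<Rightarrow> 'x) \<Rightarrow> ('g \<Rightarrow> 'u) \<Rightarrow> 'g \<Rightarrow> 'u" where
  "j x = iop (\<lambda>g. \<rho> (x g))"

lemma equi_W [simp]:
  assumes p: "\<phi> \<in> DG"
  shows "equi (\<lambda>g. \<pi> (\<phi> g))"
  unfolding equi_def
proof (intro ballI conjI allI)
  fix g h v assume g: "g \<in> carrier G"
  show "\<pi> (\<phi> g) \<in> bops K" using DG_D(1) [OF p] by simp
  assume h: "h \<in> H"
  have "\<phi> (g \<otimes>\<^bsub>G\<^esub> h) = hop (inv\<^bsub>G\<^esub> h) \<circ> \<phi> g" using DG_D(3) [OF p g h] by (simp add: fun_eq_iff)
  then show "\<pi> (\<phi> (g \<otimes>\<^bsub>G\<^esub> h)) v = \<theta> (inv\<^bsub>G\<^esub> h) (\<pi> (\<phi> g) v)"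
    using pi_hop_comp [of "inv\<^bsub>G\<^esub> h" "\<phi> g"] DG_D(1) [OF p] h by simp
  show "\<theta> h (\<pi> (\<phi> g) v) = \<pi> (\<phi> g) (\<theta> h v)"
    using B_comm_theta [of "\<pi> (\<phi> g)" h v] DG_D(1) [OF p] h by simp
qed

lemma equi_j [simp]:
  assumes x: "x \<in> XG"
  shows "equi (\<lambda>g. \<rho> (x g))"
  unfolding equi_def
proof (intro ballI conjI allI)
  fix g h v assume g: "g \<in> carrier G"
  show "\<rho> (x g) \<in> bops K" using XG_D(1) [OF x] by simp
  assume h: "h \<in> H"
  show "\<rho> (x (g \<otimes>\<^bsub>G\<^esub> h)) v = \<theta> (inv\<^bsub>G\<^esub> h) (\<rho> (x g) v)"
    using XG_D [OF x] g h by (simp add: rho_act(1))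
  show "\<theta> h (\<rho> (x g) v) = \<rho> (x g) (\<theta> h v)"
    using fun_cong [OF rho_act(1) [OF h XG_D(1) [OF x, of g]], of v] fun_cong [OF rho_act(2) [OF h XG_D(1) [OF x, of g]], of v]
    by simp
qed

lemma W_bops [simp]: "\<phi> \<in> DG \<Longrightarrow> W \<phi> \<in> bops KG" and j_bops [simp]: "x \<in> XG \<Longrightarrow> j x \<in> bops KG"
  by (simp_all add: W_def j_def)

lemma star_hop_comp:
  assumes "h \<in> H" "d \<in> D"
  shows "centralizer_star TYPE('u) X (hop h \<circ> d) = hop (inv\<^bsub>G\<^esub> h) \<circ> centralizer_star TYPE('u) X d"
proof -
  have "adjoint_pair K (\<pi> (hop h \<circ> d)) (\<pi> (hop (inv\<^bsub>G\<^esub> h) \<circ> centralizer_star TYPE('u) X d))"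
    using adjoint_comp [OF theta_adjoint [OF assms(1)] D_star(2) [OF assms(2)]] assms D_star(1) [OF assms(2)]
      B_commute [of "\<pi> (centralizer_star TYPE('u) X d)" "\<theta> (inv\<^bsub>G\<^esub> h)"]
    by (simp add: pi_hop_comp)
  then show ?thesis
    using Drep.rep_star_eqI assms D_star(1) [OF assms(2)] unfolding D_alg_simps by simp
qed

lemma DG_alg_simps: "acar (DG_alg TYPE('u) G H X act) = DG" "ascl (DG_alg TYPE('u) G H X act) = pscl (pscl (oscl X))"
    "amul (DG_alg TYPE('u) G H X act) \<phi> \<psi> = on_zero (carrier G) (\<lambda>g. pscl (oscl X) cH
       (\<Sum>k\<in>carrier G. \<phi> k \<circ> \<psi> (inv\<^bsub>G\<^esub> k \<otimes>\<^bsub>G\<^esub> g)))"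
    "astar (DG_alg TYPE('u) G H X act) \<phi> = on_zero (carrier G) (\<lambda>g. centralizer_star TYPE('u) X (\<phi> (inv\<^bsub>G\<^esub> g)))"
  by (simp_all add: DG_alg_def DG_def D_alg_simps)

lemma D_sum_mem [simp]: "(\<And>i. i \<in> I \<Longrightarrow> d i \<in> D) \<Longrightarrow> (\<Sum>i\<in>I. d i) \<in> D"
  by (rule xso.subspace_sum [OF D_subspace])

lemma DG_mul_closed:
  assumes p: "\<phi> \<in> DG" "\<psi> \<in> DG"
  shows "amul (DG_alg TYPE('u) G H X act) \<phi> \<psi> \<in> DG"
proof (rule DG_I)
  have "pscl (oscl X) cH (\<Sum>k\<in>carrier G. \<phi> k \<circ> \<psi> (inv\<^bsub>G\<^esub> k \<otimes>\<^bsub>G\<^esub> g)) \<in> D" for g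
    by (intro D_simps D_sum_mem D_comp DG_D(1) [OF p(1)] DG_D(1) [OF p(2)])
  then show "amul (DG_alg TYPE('u) G H X act) \<phi> \<psi> g \<in> D" if "g \<in> carrier G" for g
    using that by (simp add: DG_alg_simps on_zero_def)
  fix g h x assume g: "g \<in> carrier G" and h: "h \<in> H" and x: "x \<in> ocar X"
  have ih: "hop (inv\<^bsub>G\<^esub> h) \<in> D" using h by simp
  have "\<phi> k (\<psi> (inv\<^bsub>G\<^esub> k \<otimes>\<^bsub>G\<^esub> (g \<otimes>\<^bsub>G\<^esub> h)) x) = hop (inv\<^bsub>G\<^esub> h) (\<phi> k (\<psi> (inv\<^bsub>G\<^esub> k \<otimes>\<^bsub>G\<^esub> g) x))" if k: "k \<in> carrier G" for k
    using DG_D(3) [OF p(2), of "inv\<^bsub>G\<^esub> k \<otimes>\<^bsub>G\<^esub> g" h x] g h k D_commute [OF DG_D(1) [OF p(1)] ih] by (simp add: m_assoc)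
  then show "amul (DG_alg TYPE('u) G H X act) \<phi> \<psi> (g \<otimes>\<^bsub>G\<^esub> h) x = hop (inv\<^bsub>G\<^esub> h) (amul (DG_alg TYPE('u) G H X act) \<phi> \<psi> g x)"
    using g h D_ocar [OF DG_D(1) [OF p(1)]]
    by (simp add: DG_alg_simps on_zero_def pscl_def sum_fun_app D_scale [OF ih] D_sum [OF ih] xs.subspace_sum [OF x_subspace])
qed (simp add: DG_alg_simps on_zero_def)

lemma DG_star_closed:
  assumes p: "\<phi> \<in> DG"
  shows "astar (DG_alg TYPE('u) G H X act) \<phi> \<in> DG"
proof (rule DG_I)
  show "astar (DG_alg TYPE('u) G H X act) \<phi> g \<in> D" if "g \<in> carrier G" for g
    using that D_star(1) [OF DG_D(1) [OF p]] by (simp add: DG_alg_simps on_zero_def)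
  fix g h x assume g: "g \<in> carrier G" and h: "h \<in> H"
  have "inv\<^bsub>G\<^esub> (g \<otimes>\<^bsub>G\<^esub> h) = inv\<^bsub>G\<^esub> g \<otimes>\<^bsub>G\<^esub> inv\<^bsub>G\<^esub> h"
    using g h H_comm [of "inv\<^bsub>G\<^esub> h" "inv\<^bsub>G\<^esub> g"] by (simp add: inv_mult_group)
  then have "\<phi> (inv\<^bsub>G\<^esub> (g \<otimes>\<^bsub>G\<^esub> h)) = hop h \<circ> \<phi> (inv\<^bsub>G\<^esub> g)"
    using DG_D(3) [OF p, of "inv\<^bsub>G\<^esub> g" "inv\<^bsub>G\<^esub> h"] g h by (simp add: fun_eq_iff)
  then show "astar (DG_alg TYPE('u) G H X act) \<phi> (g \<otimes>\<^bsub>G\<^esub> h) x = hop (inv\<^bsub>G\<^esub> h) (astar (DG_alg TYPE('u) G H X act) \<phi> g x)"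
    using g h star_hop_comp [OF h DG_D(1) [OF p]] by (simp add: DG_alg_simps on_zero_def)
qed (simp add: DG_alg_simps on_zero_def)

lemma W_mul:
  assumes p: "\<phi> \<in> DG" "\<psi> \<in> DG"
  shows "W (amul (DG_alg TYPE('u) G H X act) \<phi> \<psi>) = W \<phi> \<circ> W \<psi>"
proof -
  have "\<pi> (amul (DG_alg TYPE('u) G H X act) \<phi> \<psi> g) = conv (\<lambda>g. \<pi> (\<phi> g)) (\<lambda>g. \<pi> (\<psi> g)) g" if g: "g \<in> carrier G" for g
  proof -
    have D: "\<phi> k \<circ> \<psi> (inv\<^bsub>G\<^esub> k \<otimes>\<^bsub>G\<^esub> g) \<in> D" for k by (intro D_comp DG_D(1) [OF p(1)] DG_D(1) [OF p(2)])
    have "\<pi> (\<Sum>k\<in>carrier G. \<phi> k \<circ> \<psi> (inv\<^bsub>G\<^esub> k \<otimes>\<^bsub>G\<^esub> g)) = (\<Sum>k\<in>carrier G. \<pi> (\<phi> k \<circ> \<psi> (inv\<^bsub>G\<^esub> k \<otimes>\<^bsub>G\<^esub> g)))"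
      using Drep.va.lin_on_sum [OF Drep.A_subspace Drep.rep_lin vso.vector_space_axioms, of "carrier G" "\<lambda>k. \<phi> k \<circ> \<psi> (inv\<^bsub>G\<^esub> k \<otimes>\<^bsub>G\<^esub> g)"] D
      unfolding D_alg_simps by simp
    also have "\<dots> = (\<Sum>k\<in>carrier G. \<pi> (\<phi> k) \<circ> \<pi> (\<psi> (inv\<^bsub>G\<^esub> k \<otimes>\<^bsub>G\<^esub> g)))"
      by (intro sum.cong refl pi_comp DG_D(1) [OF p(1)] DG_D(1) [OF p(2)])
    finally show ?thesis
      using g by (simp add: DG_alg_simps on_zero_def conv_def pi_scale D)
  qed
  then have "W (amul (DG_alg TYPE('u) G H X act) \<phi> \<psi>) = iop (conv (\<lambda>g. \<pi> (\<phi> g)) (\<lambda>g. \<pi> (\<psi> g)))"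
    unfolding W_def by (rule iop_cong)
  then show ?thesis using iop_conv [OF equi_W [OF p(1)] equi_W [OF p(2)]] by (simp add: W_def)
qed

lemma W_star:
  assumes p: "\<phi> \<in> DG"
  shows "adjoint_pair KG (W \<phi>) (W (astar (DG_alg TYPE('u) G H X act) \<phi>))"
  unfolding W_def
proof (rule iop_adjoint)
  show "equi (\<lambda>g. \<pi> (astar (DG_alg TYPE('u) G H X act) \<phi> g))" using DG_star_closed [OF p] by simp
  show "adjoint_pair K (\<pi> (\<phi> g)) (\<pi> (astar (DG_alg TYPE('u) G H X act) \<phi> (inv\<^bsub>G\<^esub> g)))" if "g \<in> carrier G" for g
    using that D_star(2) [OF DG_D(1) [OF p]] by (simp add: DG_alg_simps on_zero_def)
qed (use p in simp)

lemma W_delta: "\<phi> \<in> DG \<Longrightarrow> v \<in> hcar K \<Longrightarrow> g \<in> carrier G \<Longrightarrow> W \<phi> (delta v) g = \<pi> (\<phi> g) v"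
  unfolding W_def by (rule iop_delta) simp_all

lemma W_add: "\<phi> \<in> DG \<Longrightarrow> \<psi> \<in> DG \<Longrightarrow> W (\<phi> + \<psi>) = W \<phi> + W \<psi>"
  unfolding W_def iop_add [symmetric] using DG_D(1) by (intro iop_cong) (simp add: pi_add)

lemma W_scale: "\<phi> \<in> DG \<Longrightarrow> W (pscl (pscl (oscl X)) c \<phi>) = pscl (pscl (hscl K)) c (W \<phi>)"
  unfolding W_def iop_scale [symmetric] using DG_D(1)
  by (intro iop_cong) (simp add: pi_scale [symmetric] pscl_def [of "pscl (oscl X)"])

sublocale xdo: rc_vector_space "pscl (pscl (oscl X)) :: 'f \<Rightarrow> ('g \<Rightarrow> 'x \<Rightarrow> 'x) \<Rightarrow> 'g \<Rightarrow> 'x \<Rightarrow> 'x"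
  unfolding rc_vector_space_def by (intro vector_space_pscl X_vs)

lemma DG_subspace: "xdo.subspace DG"
proof (rule xdo.subspaceI)
  fix c \<phi> \<psi> assume p: "\<phi> \<in> DG"
  show "pscl (pscl (oscl X)) c \<phi> \<in> DG"
  proof (rule DG_I)
    show "pscl (pscl (oscl X)) c \<phi> g \<in> D" if "g \<in> carrier G" for g
      using DG_D(1) [OF p] by (simp add: pscl_def [of "pscl (oscl X)"])
  qed (use DG_D [OF p] in \<open>simp_all add: pscl_def D_scale fun_eq_iff\<close>)
  assume q: "\<psi> \<in> DG"
  show "\<phi> + \<psi> \<in> DG"
    by (rule DG_I) (use DG_D [OF p] DG_D [OF q] in \<open>simp_all add: D_add\<close>)
qed (rule DG_I; simp)

text \<open>\<open>E k d\<close> is supported on the coset \<open>k H\<close>; convolution with \<open>dl k\<close> is translation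
  by \<open>k\<close>.\<close>

definition E :: "'g \<Rightarrow> ('x \<Rightarrow> 'x) \<Rightarrow> 'g \<Rightarrow> 'x \<Rightarrow> 'x" where
  "E k d g = (if g \<in> carrier G \<and> inv\<^bsub>G\<^esub> k \<otimes>\<^bsub>G\<^esub> g \<in> H then hop (inv\<^bsub>G\<^esub> (inv\<^bsub>G\<^esub> k \<otimes>\<^bsub>G\<^esub> g)) \<circ> d else 0)"

abbreviation dl :: "'g \<Rightarrow> 'g \<Rightarrow> 'x \<Rightarrow> 'x" where
  "dl k \<equiv> E k (hop \<one>\<^bsub>G\<^esub>)"

lemma E_DG [simp]:
  assumes k: "k \<in> carrier G" and d: "d \<in> D"
  shows "E k d \<in> DG"
proof (rule DG_I)
  show "E k d g \<in> D" if "g \<in> carrier G" for g using d by (simp add: E_def)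
  fix g h x assume g: "g \<in> carrier G" and h: "h \<in> H"
  let ?l = "inv\<^bsub>G\<^esub> k \<otimes>\<^bsub>G\<^esub> g"
  have l: "inv\<^bsub>G\<^esub> k \<otimes>\<^bsub>G\<^esub> (g \<otimes>\<^bsub>G\<^esub> h) = ?l \<otimes>\<^bsub>G\<^esub> h" using g h k by (simp add: m_assoc)
  show "E k d (g \<otimes>\<^bsub>G\<^esub> h) x = hop (inv\<^bsub>G\<^esub> h) (E k d g x)"
  proof (cases "?l \<in> H")
    case True
    have "inv\<^bsub>G\<^esub> (?l \<otimes>\<^bsub>G\<^esub> h) = inv\<^bsub>G\<^esub> h \<otimes>\<^bsub>G\<^esub> inv\<^bsub>G\<^esub> ?l" using g h k True by (simp add: inv_mult_group)
    then show ?thesis using g h k True d hop_comp [of "inv\<^bsub>G\<^esub> h" "inv\<^bsub>G\<^esub> ?l" "d x"] by (simp add: E_def l)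
  next
    case False
    then show ?thesis using g h k mult_mem_H [of ?l h] by (simp add: E_def l)
  qed
qed (simp add: E_def)

lemma E_add: "d \<in> D \<Longrightarrow> d' \<in> D \<Longrightarrow> k \<in> carrier G \<Longrightarrow> E k (pscl (oscl X) c d + d') = pscl (pscl (oscl X)) c (E k d) + E k d'"
  by (auto simp: E_def fun_eq_iff pscl_def D_add [OF hop_D] D_scale [OF hop_D])

text \<open>An element of \<open>H\<close> can be moved from the value into the base point. This
  reduces all functions supported on one coset to combinations of the \<open>dl\<close>.\<close>

lemma E_hop:
  assumes k: "k \<in> carrier G" and h: "h \<in> H"
  shows "E k (hop h) = dl (k \<otimes>\<^bsub>G\<^esub> h)"
proof (rule ext)
  fix g
  show "E k (hop h) g = dl (k \<otimes>\<^bsub>G\<^esub> h) g"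
  proof (cases "g \<in> carrier G")
    case g: True
    let ?l = "inv\<^bsub>G\<^esub> k \<otimes>\<^bsub>G\<^esub> g"
    have l: "inv\<^bsub>G\<^esub> (k \<otimes>\<^bsub>G\<^esub> h) \<otimes>\<^bsub>G\<^esub> g = ?l \<otimes>\<^bsub>G\<^esub> inv\<^bsub>G\<^esub> h"
      using g h k H_comm [of "inv\<^bsub>G\<^esub> h" "?l"] by (simp add: inv_mult_group m_assoc)
    have m: "?l \<otimes>\<^bsub>G\<^esub> inv\<^bsub>G\<^esub> h \<in> H \<longleftrightarrow> ?l \<in> H" using g h k by (intro mult_mem_H) simp_all
    have "hop (inv\<^bsub>G\<^esub> ?l) (hop h x) = hop (inv\<^bsub>G\<^esub> (?l \<otimes>\<^bsub>G\<^esub> inv\<^bsub>G\<^esub> h)) (hop \<one>\<^bsub>G\<^esub> x)" if "?l \<in> H" for x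
    proof -
      have "inv\<^bsub>G\<^esub> (?l \<otimes>\<^bsub>G\<^esub> inv\<^bsub>G\<^esub> h) = inv\<^bsub>G\<^esub> ?l \<otimes>\<^bsub>G\<^esub> h"
        using that h H_comm [of h "inv\<^bsub>G\<^esub> ?l"] g k by (simp add: inv_mult_group [of ?l "inv\<^bsub>G\<^esub> h"])
      then show ?thesis
        using that h hop_comp [of "inv\<^bsub>G\<^esub> ?l" h x] by (cases "x \<in> ocar X") (simp_all add: hop_apply)
    qed
    then show ?thesis by (auto simp: E_def l m fun_eq_iff)
  qed (simp add: E_def)
qed

lemma mem_H_inv: "g \<in> carrier G \<Longrightarrow> k \<in> carrier G \<Longrightarrow> inv\<^bsub>G\<^esub> g \<otimes>\<^bsub>G\<^esub> k \<notin> H \<Longrightarrow> inv\<^bsub>G\<^esub> k \<otimes>\<^bsub>G\<^esub> g \<notin> H"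
  using H_closed(2) [of "inv\<^bsub>G\<^esub> k \<otimes>\<^bsub>G\<^esub> g"] by (auto simp: inv_mult_group)

text \<open>\<open>E k (\<phi> k)\<close> is \<phi> cut down to the coset of \<open>k\<close>, so
  the sum counts every coset |H| times.\<close>

lemma DG_decompose:
  assumes p: "\<phi> \<in> DG"
  shows "\<phi> = pscl (pscl (oscl X)) cH (\<Sum>k\<in>carrier G. E k (\<phi> k))"
proof (rule ext)
  fix g
  show "\<phi> g = pscl (pscl (oscl X)) cH (\<Sum>k\<in>carrier G. E k (\<phi> k)) g"
  proof (cases "g \<in> carrier G")
    case g: True
    have "pscl (oscl X) cH (\<Sum>k\<in>carrier G. E k (\<phi> k) g) = \<phi> g"
    proof (rule coset_average [OF xso.vector_space_axioms g])
      show "E k (\<phi> k) g = 0" if "k \<in> carrier G" "inv\<^bsub>G\<^esub> g \<otimes>\<^bsub>G\<^esub> k \<notin> H" for k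
        using mem_H_inv [OF g that] by (simp add: E_def)
      fix h assume h: "h \<in> H"
      have a: "inv\<^bsub>G\<^esub> (g \<otimes>\<^bsub>G\<^esub> h) \<otimes>\<^bsub>G\<^esub> g = inv\<^bsub>G\<^esub> h"
        using g h by (simp add: inv_mult_group m_assoc)
      have "hop h (hop (inv\<^bsub>G\<^esub> h) y) = y" if "y \<in> ocar X" for y
        using hop_comp [of h "inv\<^bsub>G\<^esub> h" y] h that by (simp add: hop_apply)
      then show "E (g \<otimes>\<^bsub>G\<^esub> h) (\<phi> (g \<otimes>\<^bsub>G\<^esub> h)) g = \<phi> g"
        using g h DG_D(3) [OF p g h] D_ocar [OF DG_D(1) [OF p]] by (simp add: E_def a fun_eq_iff)
    qed
    then show ?thesis by (simp add: pscl_def [of "pscl (oscl X)"] sum_fun_app)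
  qed (simp add: DG_D(2) [OF p] E_def pscl_def sum_fun_app fun_eq_iff)
qed

text \<open>The source of finite dimension for \<open>D_G\<close>, and later the reason why the
  convolution operators are exactly the span of the translations.\<close>

lemma DG_span: "DG = xdo.span (dl ` carrier G)"
proof
  show "xdo.span (dl ` carrier G) \<subseteq> DG"
    by (rule xdo.span_minimal [OF _ DG_subspace]) auto
  have E: "E k d \<in> xdo.span (dl ` carrier G)" if k: "k \<in> carrier G" and "d \<in> D" for k d
    using that(2)
  proof (rule D_induct)
    have "E k 0 = 0" using k by (auto simp: E_def fun_eq_iff)
    then show "E k 0 \<in> xdo.span (dl ` carrier G)" by (simp only: xdo.span_zero)
    fix c h d assume h: "h \<in> H" and d: "d \<in> D" and IH: "E k d \<in> xdo.span (dl ` carrier G)"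
    show "E k (pscl (oscl X) c (hop h) + d) \<in> xdo.span (dl ` carrier G)"
      unfolding E_add [OF hop_D [OF h] d k] E_hop [OF k h]
      using h k by (intro xdo.span_add xdo.span_scale IH xdo.span_base) simp
  qed
  show "DG \<subseteq> xdo.span (dl ` carrier G)"
  proof
    fix \<phi> assume p: "\<phi> \<in> DG"
    show "\<phi> \<in> xdo.span (dl ` carrier G)"
      by (subst DG_decompose [OF p]) (intro xdo.span_scale xdo.span_sum E DG_D(1) [OF p])
  qed
qed

sublocale DGrep: star_rep KG "DG_alg TYPE('u) G H X act" W
proof (rule star_rep.intro [OF prehilbert_KG], rule star_rep_axioms.intro, unfold DG_alg_simps(1,2))
  show "vector_space (pscl (pscl (oscl X)) :: 'f \<Rightarrow> ('g \<Rightarrow> 'x \<Rightarrow> 'x) \<Rightarrow> 'g \<Rightarrow> 'x \<Rightarrow> 'x)"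
    by (rule xdo.vector_space_axioms)
  show "xdo.subspace DG" by (rule DG_subspace)
  show "\<exists>S. finite S \<and> DG \<subseteq> xdo.span S" using finite_G DG_span by blast
  show "lin_on (pscl (pscl (oscl X))) DG (pscl (hscl KG)) (bops KG) W"
    by (simp add: lin_on_def W_add W_scale)
  fix \<phi> assume p: "\<phi> \<in> DG"
  show "astar (DG_alg TYPE('u) G H X act) \<phi> \<in> DG" by (rule DG_star_closed [OF p])
  show "adjoint_pair KG (W \<phi>) (W (astar (DG_alg TYPE('u) G H X act) \<phi>))" by (rule W_star [OF p])
  show "\<phi> = 0" if W0: "W \<phi> = 0"
  proof (rule ext)
    fix g show "\<phi> g = 0 g"
    proof (cases "g \<in> carrier G")
      case g: True
      have "\<pi> (\<phi> g) v = 0" if "v \<in> hcar K" for v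
        using W_delta [OF p that g] W0 by simp
      then have "\<pi> (\<phi> g) = 0" using DG_D(1) [OF p] by (intro bops_eqI) simp_all
      then show ?thesis using Drep.rep_inj [of "\<phi> g"] DG_D(1) [OF p] unfolding D_alg_simps by simp
    qed (simp add: DG_D(2) [OF p])
  qed
  fix \<psi> assume q: "\<psi> \<in> DG"
  show "amul (DG_alg TYPE('u) G H X act) \<phi> \<psi> \<in> DG" by (rule DG_mul_closed [OF p q])
  show "W (amul (DG_alg TYPE('u) G H X act) \<phi> \<psi>) = W \<phi> \<circ> W \<psi>" by (rule W_mul [OF p q])
qed

end

subsection \<open>Test vectors\<close>

context central_setting
begin

abbreviation XO where
  "XO \<equiv> ind_opspace G H X act K \<theta> \<rho>"

lemma XO_simps [simp]: "ocar XO = XG" "oscl XO = pscl (oscl X)"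
    "omnorm XO n A = opmat_norm KG n (\<lambda>i k. j (A i k))"
  by (simp_all add: ind_opspace_def XG_def KG_def j_def iop_def)

lemma XG_subspace: "xso.subspace XG"
proof (rule xso.subspaceI)
  fix c x y assume x: "x \<in> XG"
  have al: "act h (y + z) = act h y + act h z" if "h \<in> H" "y \<in> ocar X" "z \<in> ocar X" for h y z
    using act_lin [OF that(1)] that unfolding lin_on_def by blast
  have as: "act h (oscl X c y) = oscl X c (act h y)" if "h \<in> H" "y \<in> ocar X" for h y c
    using act_lin [OF that(1)] that unfolding lin_on_def by blast
  show "pscl (oscl X) c x \<in> XG"
    by (rule XG_I) (use XG_D [OF x] as in \<open>simp_all add: pscl_def\<close>)
  show "x + y \<in> XG" if y: "y \<in> XG"
    by (rule XG_I) (use XG_D [OF x] XG_D [OF y] al in simp_all)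
next
  show "0 \<in> XG"
  proof (rule XG_I)
    fix g h assume "g \<in> carrier G" "h \<in> H"
    then show "0 (g \<otimes>\<^bsub>G\<^esub> h) = act (inv\<^bsub>G\<^esub> h) (0 g)"
      using xs.lin_on_zero [OF X_subspace act_lin X_vs, of "inv\<^bsub>G\<^esub> h"] by simp
  qed simp_all
qed

lemma j_inj: "inj_on j XG"
proof (rule inj_onI)
  fix x y assume x: "x \<in> XG" and y: "y \<in> XG" and eq: "j x = j y"
  show "x = y"
  proof (rule ext)
    fix g show "x g = y g"
    proof (cases "g \<in> carrier G")
      case True
      then have "\<rho> (x g) = \<rho> (y g)"
        using iop_inj [OF equi_j [OF x] equi_j [OF y]] eq by (simp add: j_def)
      then show ?thesis using XG_D(1) [OF x] XG_D(1) [OF y] by (intro isom_eqI)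
    qed (simp add: XG_D(2) [OF x] XG_D(2) [OF y])
  qed
qed

sublocale jx: comp_isom KG XO j
proof (intro comp_isom.intro comp_isom_axioms.intro prehilbert_KG)
  show "vector_space (oscl XO)" by (simp add: xso.vector_space_axioms)
  show "module.subspace (oscl XO) (ocar XO)" using XG_subspace by simp
  have "j (x + y) = j x + j y" if "x \<in> XG" "y \<in> XG" for x y
    unfolding j_def iop_add [symmetric] using XG_D(1) that by (intro iop_cong) (simp add: isom_add)
  moreover have "j (pscl (oscl X) c x) = pscl (pscl (hscl K)) c (j x)" if "x \<in> XG" for x c
    unfolding j_def iop_scale [symmetric] using XG_D(1) that
    by (intro iop_cong) (simp add: isom_scale [symmetric] pscl_def [of "oscl X"])
  ultimately show "complete_isometry XO KG j"
    by (simp add: complete_isometry_def lin_on_def j_inj)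
qed

text \<open>The embedding of \<open>X\<close> as the functions supported on \<open>H\<close>. Under
  \<open>j\<close> such a function acts as \<rho> x at every point of \<open>G\<close>.\<close>

definition xd :: "'x \<Rightarrow> 'g \<Rightarrow> 'x" where
  "xd x g = (if g \<in> H then act (inv\<^bsub>G\<^esub> g) x else 0)"

lemma xd_XG [simp]:
  assumes x: "x \<in> ocar X"
  shows "xd x \<in> XG"
proof (rule XG_I)
  fix g h assume g: "g \<in> carrier G" and h: "h \<in> H"
  have "act (inv\<^bsub>G\<^esub> h) 0 = 0" using xs.lin_on_zero [OF X_subspace act_lin X_vs, of "inv\<^bsub>G\<^esub> h"] h by simp
  then show "xd x (g \<otimes>\<^bsub>G\<^esub> h) = act (inv\<^bsub>G\<^esub> h) (xd x g)"
    using x g h mult_mem_H [OF g h] by (simp add: xd_def inv_mult_group act_mult)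
qed (use x in \<open>auto simp: xd_def\<close>)

lemma j_xd:
  assumes x: "x \<in> ocar X" and xi: "\<xi> \<in> hcar KG" and g: "g \<in> carrier G"
  shows "j (xd x) \<xi> g = \<rho> x (\<xi> g)"
  unfolding j_def iop_apply [OF xi g]
proof (rule coset_average [OF vs.vector_space_axioms one_closed])
  show "\<rho> (xd x k) (\<xi> (inv\<^bsub>G\<^esub> k \<otimes>\<^bsub>G\<^esub> g)) = 0" if "k \<in> carrier G" "inv\<^bsub>G\<^esub> \<one>\<^bsub>G\<^esub> \<otimes>\<^bsub>G\<^esub> k \<notin> H" for k
    using that by (simp add: xd_def)
  fix h assume h: "h \<in> H"
  have "\<xi> (inv\<^bsub>G\<^esub> h \<otimes>\<^bsub>G\<^esub> g) = \<theta> h (\<xi> g)"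
    using KG_D(3) [OF xi g, of "inv\<^bsub>G\<^esub> h"] h H_comm [of "inv\<^bsub>G\<^esub> h" g] g by simp
  then show "\<rho> (xd x (\<one>\<^bsub>G\<^esub> \<otimes>\<^bsub>G\<^esub> h)) (\<xi> (inv\<^bsub>G\<^esub> (\<one>\<^bsub>G\<^esub> \<otimes>\<^bsub>G\<^esub> h) \<otimes>\<^bsub>G\<^esub> g)) = \<rho> x (\<xi> g)"
    using h x KG_D(1) [OF xi] by (simp add: xd_def rho_act(2))
qed

text \<open>\<rho> x acts pointwise and commutes with all values of \<pi>. Hence the same test
  functions serve left and right convolution.\<close>

lemma j_xd_commute:
  assumes x: "x \<in> ocar X" and p: "\<phi> \<in> DG"
  shows "W \<phi> \<circ> j (xd x) = j (xd x) \<circ> W \<phi>"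
proof (rule DGrep.bops_eqI)
  fix \<xi> assume xi: "\<xi> \<in> hcar KG"
  have jxi: "j (xd x) \<xi> \<in> hcar KG" and Wxi: "W \<phi> \<xi> \<in> hcar KG" using x p xi by simp_all
  show "(W \<phi> \<circ> j (xd x)) \<xi> = (j (xd x) \<circ> W \<phi>) \<xi>"
  proof (rule ext)
    fix g show "(W \<phi> \<circ> j (xd x)) \<xi> g = (j (xd x) \<circ> W \<phi>) \<xi> g"
    proof (cases "g \<in> carrier G")
      case g: True
      have pb: "\<pi> (\<phi> k) \<in> B" for k using DG_D(1) [OF p] by simp
      have "(j (xd x) \<circ> W \<phi>) \<xi> g = \<rho> x (hscl K cH (\<Sum>k\<in>carrier G. \<pi> (\<phi> k) (\<xi> (inv\<^bsub>G\<^esub> k \<otimes>\<^bsub>G\<^esub> g))))"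
        using j_xd [OF x Wxi g] iop_apply [OF xi g] by (simp add: W_def)
      also have "\<dots> = hscl K cH (\<Sum>k\<in>carrier G. \<pi> (\<phi> k) (\<rho> x (\<xi> (inv\<^bsub>G\<^esub> k \<otimes>\<^bsub>G\<^esub> g))))"
        using x pb by (simp add: bops_scale bops_sum B_car B_rho')
      also have "\<dots> = hscl K cH (\<Sum>k\<in>carrier G. \<pi> (\<phi> k) (j (xd x) \<xi> (inv\<^bsub>G\<^esub> k \<otimes>\<^bsub>G\<^esub> g)))"
        using g by (intro arg_cong [where f = "hscl K cH"] sum.cong refl) (simp add: j_xd [OF x xi])
      also have "\<dots> = (W \<phi> \<circ> j (xd x)) \<xi> g"
        using iop_apply [OF jxi g] by (simp add: W_def)
      finally show ?thesis by simp
    qed (use KG_D(2) in \<open>simp add: W_def j_def iop_outside\<close>)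
  qed
qed (use x p in simp_all)

lemma j_xd_delta:
  assumes x: "x \<in> ocar X" and v: "v \<in> hcar K"
  shows "j (xd x) (delta v) = delta (\<rho> x v)"
proof (rule ext)
  fix g show "j (xd x) (delta v) g = delta (\<rho> x v) g"
  proof (cases "g \<in> carrier G")
    case True
    then show ?thesis
      using j_xd [OF x delta_KG [OF v] True] B_rho' [of "\<theta> (inv\<^bsub>G\<^esub> g)" x v] x by (simp add: delta_def)
  qed (auto simp: j_def iop_outside delta_def)
qed

text \<open>Keeps the test functions in the unit ball of \<open>X_G\<close>: pointwise action by
  \<rho> x cannot have larger norm than \<rho> x.\<close>

lemma opn_j_xd:
  assumes x: "x \<in> ocar X"
  shows "opn KG (j (xd x)) \<le> opn K (\<rho> x)"
proof (rule DGrep.opn_least)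
  show o: "0 \<le> opn K (\<rho> x)" using x by (simp add: opn_nonneg)
  fix \<xi> assume xi: "\<xi> \<in> hcar KG"
  have car: "j (xd x) \<xi> \<in> hcar KG" using x xi by simp
  show "hnorm KG (j (xd x) \<xi>) \<le> opn K (\<rho> x) * hnorm KG \<xi>"
  proof (rule power2_le_imp_le)
    have "(hnorm KG (j (xd x) \<xi>))\<^sup>2 \<le> (\<Sum>g\<in>carrier G. (opn K (\<rho> x) * hnorm K (\<xi> g))\<^sup>2)"
      unfolding hnorm_KG [OF car]
      using j_xd [OF x xi] opn_ub [OF isom_bops [OF x] KG_D(1) [OF xi]]
      by (intro sum_mono power_mono) simp_all
    then show "(hnorm KG (j (xd x) \<xi>))\<^sup>2 \<le> (opn K (\<rho> x) * hnorm KG \<xi>)\<^sup>2"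
      by (simp add: power_mult_distrib hnorm_KG [OF xi] sum_distrib_left)
  qed (use o in simp)
qed

text \<open>\<open>top_eigenvector\<close> only provides \<zeta>^2 f = s^2 f. Positivity of \<zeta>
  excludes the eigenvalue - s and so allows the square root to be taken.\<close>

lemma D_top_eigenvector:
  assumes z: "\<zeta> \<in> D" "\<zeta> \<noteq> 0" and sa: "adjoint_pair K (\<pi> \<zeta>) (\<pi> \<zeta>)"
    and pos: "\<And>v. v \<in> hcar K \<Longrightarrow> \<exists>r\<ge>0. hinner K (\<pi> \<zeta> v) v = of_real r"
  shows "\<exists>g\<in>D. g \<noteq> 0 \<and> \<zeta> \<circ> g = pscl (oscl X) (of_real (opn K (\<pi> \<zeta>))) g"
proof -
  let ?s = "opn K (\<pi> \<zeta>)"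
  have pz: "\<pi> \<zeta> \<in> bops K" using z by simp
  have "\<pi> \<zeta> \<noteq> 0" using Drep.rep_inj [of \<zeta>] z unfolding D_alg_simps by blast
  then have s: "?s > 0" using opn_nonneg [OF pz] opn_eq_0 [OF pz] by linarith
  have star: "centralizer_star TYPE('u) X \<zeta> = \<zeta>"
    using Drep.rep_star_eqI [of \<zeta> \<zeta>] z sa unfolding D_alg_simps by simp
  obtain f where f: "f \<in> D" "f \<noteq> 0" "\<zeta> \<circ> \<zeta> \<circ> f = pscl (oscl X) (of_real (?s\<^sup>2)) f"
    using Drep.top_eigenvector [of \<zeta>] z s unfolding D_alg_simps star by blast
  \<comment> \<open>(\<zeta> - s)(\<zeta> + s) f = 0, so (\<zeta> + s) f is an eigenvector for
    \<open>s\<close> unless it is 0.\<close>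
  define g where "g = (\<zeta> \<circ> f) + pscl (oscl X) (of_real ?s) f"
  have gD: "g \<in> D" using z f(1) by (simp add: g_def)
  have zzf: "\<zeta> (\<zeta> (f x)) = oscl X (of_real (?s\<^sup>2)) (f x)" for x
    using fun_cong [OF f(3), of x] by (simp add: pscl_def)
  have "\<zeta> \<circ> g = pscl (oscl X) (of_real ?s) g"
    using z f(1) by (simp add: g_def fun_eq_iff pscl_def D_add D_scale zzf xs.scale_right_distrib power2_eq_square add.commute)
  moreover have "g \<noteq> 0"
  proof
    \<comment> \<open>Then \<zeta> u = - s u for every u in the range of \<pi> f, which is
      compatible with <\<zeta> u, u> \<ge> 0 only for u = 0.\<close>
    assume g0: "g = 0"
    have "\<pi> g = (\<pi> \<zeta> \<circ> \<pi> f) + pscl (hscl K) (of_real ?s) (\<pi> f)"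
      using z f(1) by (simp add: g_def pi_add pi_comp pi_scale)
    then have pg: "(\<pi> \<zeta> \<circ> \<pi> f) + pscl (hscl K) (of_real ?s) (\<pi> f) = 0"
      unfolding g0 Drep.rep_0 by (rule sym)
    have eq: "\<pi> \<zeta> (\<pi> f v) + hscl K (of_real ?s) (\<pi> f v) = 0" for v
      using fun_cong [OF pg, of v] by (simp add: pscl_def)
    have "\<pi> f v = 0" if v: "v \<in> hcar K" for v
    proof -
      let ?u = "\<pi> f v"
      have u: "?u \<in> hcar K" "\<pi> \<zeta> ?u \<in> hcar K" using f(1) z by simp_all
      obtain r where r: "r \<ge> 0" "hinner K (\<pi> \<zeta> ?u) ?u = of_real r" using pos u(1) by blast
      have "0 = hinner K (\<pi> \<zeta> ?u + hscl K (of_real ?s) ?u) ?u" using eq [of v] u by simp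
      also have "\<dots> = of_real (r + ?s * (hnorm K ?u)\<^sup>2)"
        using u r by (simp add: inner_add inner_scale inner_self)
      finally have "r + ?s * (hnorm K ?u)\<^sup>2 = 0" by (metis of_real_eq_0_iff)
      then have "(hnorm K ?u)\<^sup>2 = 0"
        using r(1) s by (simp add: add_nonneg_eq_0_iff)
      then show ?thesis using u by (simp add: hnorm_eq_0)
    qed
    then have "\<pi> f = 0" using f(1) by (intro bops_eqI) simp_all
    then show False using Drep.rep_inj [of f] f(1,2) unfolding D_alg_simps by blast
  qed
  ultimately show ?thesis using gD by blast
qed

text \<open>\<open>f\<close> is a column of an eigenvector of \<open>\<phi>\<^sup>* \<phi>\<close> for the top eigenvalue \<open>N\<^sup>2\<close>, and
  \<open>\<zeta> = \<Sum> f\<^sub>i(g)\<^sup>* f\<^sub>i(g)\<close>. The element \<open>x\<close> is chosen such that \<open>\<rho> x\<close> almost attains its norm at a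
  vector \<open>v'\<close> in the top eigenspace of \<open>\<zeta>\<close>.\<close>

lemma test_element:
  assumes p: "\<phi> \<in> mats n DG" and c: "0 \<le> c" "c < opmat_norm KG n (\<lambda>i k. W (\<phi> i k))"
  shows "\<exists>x\<in>ocar X. opn K (\<rho> x) = 1 \<and> c < opmat_norm KG n (\<lambda>i k. W (\<phi> i k) \<circ> j (xd x))"
proof -
  interpret hs: prehilbert "hsum n KG" by (rule DGrep.prehilbert_hsum)
  let ?P = "\<lambda>M. opmat KG n (\<lambda>i k. W (M i k))"
  interpret m: star_rep "hsum n KG" "mat_alg n (DG_alg TYPE('u) G H X act)" ?P by (rule DGrep.star_rep_mat)
  define N where "N = opmat_norm KG n (\<lambda>i k. W (\<phi> i k))"
  have macar: "acar (mat_alg n (DG_alg TYPE('u) G H X act)) = mats n DG" "ascl (mat_alg n (DG_alg TYPE('u) G H X act)) = pscl (pscl (pscl (pscl (oscl X))))"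
    by (simp_all add: mat_alg_def DG_alg_simps)
  note pij = matsD(1) [OF p]
  have N: "N = opn (hsum n KG) (?P \<phi>)"
    unfolding N_def by (rule DGrep.opmat_norm_eq_opn) (use pij in simp)
  have N0: "N > 0" using c by (simp add: N_def)
  let ?Q = "amul (mat_alg n (DG_alg TYPE('u) G H X act)) (astar (mat_alg n (DG_alg TYPE('u) G H X act)) \<phi>) \<phi>"
  have pm: "\<phi> \<in> acar (mat_alg n (DG_alg TYPE('u) G H X act))" using p macar by simp
  have Qm: "?Q \<in> acar (mat_alg n (DG_alg TYPE('u) G H X act))" using pm by (intro m.A_mul m.A_star)
  obtain f where f: "f \<in> mats n DG" "f \<noteq> 0" "amul (mat_alg n (DG_alg TYPE('u) G H X act)) ?Q f = ascl (mat_alg n (DG_alg TYPE('u) G H X act)) (of_real (N\<^sup>2)) f"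
    using m.top_eigenvector [OF pm] N0 unfolding N macar(1) by blast
  have fm: "f \<in> acar (mat_alg n (DG_alg TYPE('u) G H X act))" using f(1) macar by simp
  note fij = matsD(1) [OF f(1)]
  have "\<exists>a<n. \<exists>b<n. f a b \<noteq> 0"
  proof (rule ccontr)
    assume *: "\<not> (\<exists>a<n. \<exists>b<n. f a b \<noteq> 0)"
    have "f a b = 0" for a b
      using * matsD(2) [OF f(1), of a b] by (cases "a < n \<and> b < n") auto
    then have "f = 0" by (intro ext) simp
    then show False using f(2) by contradiction
  qed
  \<comment> \<open>Column \<open>b\<close> of the eigenvector is nonzero, and every column
    satisfies the same eigenvalue equation.\<close>
  then obtain a b where ab: "a < n" "b < n" "f a b \<noteq> 0" by metis
  have fb: "f i b \<in> DG" if "i < n" for i using fij that ab by simp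
  \<comment> \<open>Feeding \<open>delta v\<close> into slot \<open>b\<close> produces
    \<open>kk v\<close>, the column \<open>b\<close> of \<open>f\<close> applied to
    \<open>delta v\<close>; its values are the vectors \<pi> (f i b g) v.\<close>
  define \<Delta> where "\<Delta> = (\<lambda>v k. if k = b then delta v else 0)"
  have Dl: "\<Delta> v \<in> hcar (hsum n KG)" if "v \<in> hcar K" for v
    using that ab by (intro DGrep.hsum_carI) (auto simp: \<Delta>_def)
  define kk where "kk = (\<lambda>v. ?P f (\<Delta> v))"
  have kk_car: "kk v \<in> hcar (hsum n KG)" if "v \<in> hcar K" for v
    using Dl [OF that] m.rep_bops [OF fm] hs.bops_car by (simp add: kk_def)
  have kk_i: "kk v i = W (f i b) (delta v)" if v: "v \<in> hcar K" and i: "i < n" for v i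
  proof -
    have "kk v i = (\<Sum>k<n. W (f i k) (\<Delta> v k))"
      using i by (simp add: kk_def DGrep.opmat_apply [OF Dl [OF v]])
    also have "\<dots> = (\<Sum>k<n. if k = b then W (f i b) (delta v) else 0)"
      using i by (intro sum.cong refl) (auto simp: \<Delta>_def intro!: DGrep.bops_0 W_bops fij)
    finally show ?thesis using ab by simp
  qed
  define I where "I = {..<n} \<times> carrier G"
  define d where "d = (\<lambda>y. f (fst y) b (snd y))"
  have dD: "d y \<in> D" if "y \<in> I" for y using that fb DG_D(1) by (auto simp: d_def I_def)
  let ?st = "centralizer_star TYPE('u) X"
  \<comment> \<open>Built so that <\<zeta> v, v> = |kk v|^2: the size of the eigenvectors
    \<open>kk v\<close> is thereby governed by an element of \<open>D\<close>.\<close>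
  define \<zeta> where "\<zeta> = (\<Sum>y\<in>I. ?st (d y) \<circ> d y)"
  have zD: "\<zeta> \<in> D" unfolding \<zeta>_def using dD D_star(1) by (intro D_sum_mem D_comp) auto
  have pz: "\<pi> \<zeta> = (\<Sum>y\<in>I. \<pi> (?st (d y)) \<circ> \<pi> (d y))"
  proof -
    have "\<pi> \<zeta> = (\<Sum>y\<in>I. \<pi> (?st (d y) \<circ> d y))"
      unfolding \<zeta>_def using dD D_star(1)
      by (intro Drep.va.lin_on_sum [OF Drep.A_subspace Drep.rep_lin vso.vector_space_axioms, unfolded D_alg_simps] D_comp) auto
    then show ?thesis using dD D_star(1) by (simp add: pi_comp)
  qed
  have zsa: "adjoint_pair K (\<pi> \<zeta>) (\<pi> \<zeta>)"
    unfolding pz using dD D_star(2) by (intro adjoint_sum adjoint_comp adjoint_sym [OF D_star(2)] D_star(2)) auto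
  have zin: "hinner K (\<pi> \<zeta> v) v = of_real ((hnorm (hsum n KG) (kk v))\<^sup>2)" if v: "v \<in> hcar K" for v
  proof -
    have "hinner K (\<pi> \<zeta> v) v = (\<Sum>y\<in>I. hinner K (\<pi> (?st (d y)) (\<pi> (d y) v)) v)"
      unfolding pz sum_fun_app using v dD D_star(1) by (subst inner_sum) auto
    also have "\<dots> = (\<Sum>y\<in>I. of_real ((hnorm K (\<pi> (d y) v))\<^sup>2))"
    proof (rule sum.cong [OF refl])
      fix y assume y: "y \<in> I"
      have u: "\<pi> (d y) v \<in> hcar K" using dD [OF y] by simp
      show "hinner K (\<pi> (?st (d y)) (\<pi> (d y) v)) v = of_real ((hnorm K (\<pi> (d y) v))\<^sup>2)"
        using adjoint_pairD(1) [OF adjoint_sym [OF D_star(2) [OF dD [OF y]]] u v] u by (simp add: inner_self)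
    qed
    also have "\<dots> = of_real (\<Sum>i<n. \<Sum>g\<in>carrier G. (hnorm K (\<pi> (f i b g) v))\<^sup>2)"
      unfolding of_real_sum sum.cartesian_product I_def d_def by (intro sum.cong refl) auto
    also have "(\<Sum>i<n. \<Sum>g\<in>carrier G. (hnorm K (\<pi> (f i b g) v))\<^sup>2) = (hnorm (hsum n KG) (kk v))\<^sup>2"
      using DGrep.hsum_carD(1) [OF kk_car [OF v]]
      by (subst DGrep.hnorm_hsum_sq) (simp_all add: hnorm_KG kk_i [OF v] W_delta [OF fb v])
    finally show ?thesis .
  qed
  have z0: "\<zeta> \<noteq> 0"
  proof
    assume "\<zeta> = 0"
    then have "\<pi> \<zeta> = 0" using Drep.rep_0 by simp
    then have k0: "kk v = 0" if "v \<in> hcar K" for v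
    proof -
      have "of_real ((hnorm (hsum n KG) (kk v))\<^sup>2) = (0 :: 'f)" using zin [OF that] that \<open>\<pi> \<zeta> = 0\<close> by simp
      then have "hnorm (hsum n KG) (kk v) = 0" unfolding of_real_eq_0_iff by simp
      then show ?thesis using hs.hnorm_eq_0 kk_car [OF that] by blast
    qed
    have "W (f a b) (delta v) = 0" if "v \<in> hcar K" for v
      using kk_i [OF that ab(1)] k0 [OF that] by simp
    then have p0: "\<pi> (f a b g) v = 0" if "v \<in> hcar K" "g \<in> carrier G" for v g
      using W_delta [OF fb [OF ab(1)] that] that by simp
    have "f a b g = 0" for g
    proof (cases "g \<in> carrier G")
      case True
      have fg: "f a b g \<in> D" by (rule DG_D(1) [OF fb [OF ab(1)]])
      have "\<pi> (f a b g) = 0" using p0 [OF _ True] fg by (intro bops_eqI) simp_all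
      then show ?thesis using Drep.rep_inj [of "f a b g"] fg unfolding D_alg_simps by blast
    qed (rule DG_D(2) [OF fb [OF ab(1)]])
    then show False using ab(3) by (simp add: fun_eq_iff)
  qed
  define z where "z = opn K (\<pi> \<zeta>)"
  have z_pos: "z > 0"
    using z0 Drep.rep_inj [of \<zeta>] zD opn_eq_0 [of "\<pi> \<zeta>"] opn_nonneg [of "\<pi> \<zeta>"] unfolding D_alg_simps z_def
    by fastforce
  obtain g where g: "g \<in> D" "g \<noteq> 0" "\<zeta> \<circ> g = pscl (oscl X) (of_real z) g"
    using D_top_eigenvector [OF zD z0 zsa] zin unfolding z_def by (metis zero_le_power2)
  define s where "s = opn K (\<pi> g)"
  have "\<pi> g \<noteq> 0" using Drep.rep_inj [of g] g(1,2) unfolding D_alg_simps by blast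
  then have s: "s > 0" using opn_nonneg [of "\<pi> g"] opn_eq_0 [of "\<pi> g"] g(1) by (simp add: s_def order_less_le)
  let ?p = "?st g \<circ> g"
  have pD: "?p \<in> D" using g(1) D_star(1) by simp
  \<comment> \<open>\<open>g\<close> is not known to be a multiple of a projection. A top
    eigenvector of g* g supplies elements of \<open>X\<close> on which g* g acts as the scalar s^2,
    its norm.\<close>
  obtain g' where g': "g' \<in> D" "g' \<noteq> 0" "?p \<circ> g' = pscl (oscl X) (of_real (s\<^sup>2)) g'"
    using Drep.top_eigenvector [of g] g(1) s unfolding D_alg_simps s_def by blast
  obtain x0 where x0: "x0 \<in> ocar X" "g' x0 \<noteq> 0"
    using g'(1,2) D_outside by (metis ext zero_fun_apply)
  define x1 where "x1 = g' x0"
  have x1: "x1 \<in> ocar X" "x1 \<noteq> 0" using x0 g'(1) by (simp_all add: x1_def)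
  have "\<rho> x1 \<noteq> 0" using isom_eqI [of x1 0] x1 by auto
  then have n1: "opn K (\<rho> x1) > 0"
    using opn_nonneg [of "\<rho> x1"] opn_eq_0 [of "\<rho> x1"] x1 by (simp add: order_less_le)
  define x where "x = oscl X (of_real (1 / opn K (\<rho> x1))) x1"
  have x: "x \<in> ocar X" using x1 by (simp add: x_def)
  have nx: "opn K (\<rho> x) = 1"
    using n1 x1 by (simp add: x_def isom_scale opn_scale norm_divide)
  have "?p x1 = oscl X (of_real (s\<^sup>2)) x1"
    using fun_cong [OF g'(3), of x0] by (simp add: x1_def pscl_def)
  then have px: "?p x = oscl X (of_real (s\<^sup>2)) x"
    using D_scale [OF pD x1(1)] by (simp only: x_def xs.scale_left_commute)
  \<comment> \<open>Possible since \<rho> x has norm 1 and c < N; the point of the ratio is that N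
    |\<rho> x v| > c.\<close>
  obtain v where v: "v \<in> hcar K" "hnorm K v \<le> 1" "c / N < hnorm K (\<rho> x v)"
    using opn_approx [of "\<rho> x" "c / N"] x nx c N0 by (auto simp: N_def)
  \<comment> \<open>With this \<open>w\<close>, v' = s^-2 g g* v lies in the range of
    \<open>g\<close>, hence in the z-eigenspace of \<zeta>. As g* g / s^2 is a contraction fixing
    \<open>x\<close>, v' has norm at most 1 and \<rho> x v' = \<rho> x v.\<close>
  define w where "w = hscl K (of_real (1 / s\<^sup>2)) (\<pi> (?st g) v)"
  have w: "w \<in> hcar K" using D_star(1) [OF g(1)] by (simp add: w_def)
  define v' where "v' = \<pi> g w"
  have v': "v' \<in> hcar K" using g(1) by (simp add: v'_def)
  have v'_eq: "v' = hscl K (of_real (1 / s\<^sup>2)) (\<pi> ?p v)"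
    using D_star(1) [OF g(1)] g(1) B_commute' [of "\<pi> g" "\<pi> (?st g)"]
    by (simp add: v'_def w_def bops_scale pi_comp)
  have "opn K (\<pi> ?p) = s\<^sup>2"
    using opn_cstar(1) [OF D_star(2) [OF g(1)]] D_star(1) [OF g(1)] g(1) by (simp add: pi_comp s_def)
  then have "hnorm K (\<pi> ?p v) \<le> s\<^sup>2 * hnorm K v"
    using opn_ub [of "\<pi> ?p" v] pD v(1) by simp
  also have "\<dots> \<le> s\<^sup>2 * 1" using v(2) by (intro mult_left_mono) auto
  finally have v'1: "hnorm K v' \<le> 1"
    using pD s by (simp add: v'_eq hnorm_scale norm_divide norm_power divide_le_eq)
  have "\<rho> x (\<pi> ?p v) = hscl K (of_real (s\<^sup>2)) (\<rho> x v)"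
    using fun_cong [OF rho_D' [OF pD x], of v] fun_cong [OF isom_scale [OF x, of "of_real (s\<^sup>2)"], of v]
    unfolding px by (simp add: pscl_def)
  then have rv: "\<rho> x v' = \<rho> x v"
    using x pD v(1) s by (simp add: v'_eq bops_scale)
  have pzg: "\<pi> \<zeta> \<circ> \<pi> g = pscl (hscl K) (of_real z) (\<pi> g)"
    unfolding pi_comp [OF zD g(1), symmetric] g(3) by (rule pi_scale [OF g(1)])
  have zv: "\<pi> \<zeta> v' = hscl K (of_real z) v'"
    using fun_cong [OF pzg, of w] by (simp add: v'_def pscl_def)
  have zr: "\<pi> \<zeta> (\<rho> x v') = hscl K (of_real z) (\<rho> x v')"
    using B_rho' [of "\<pi> \<zeta>" x v'] zD x v' by (simp add: zv bops_scale)
  have kn: "(hnorm (hsum n KG) (kk u))\<^sup>2 = z * (hnorm K u)\<^sup>2" if u: "u \<in> hcar K" and e: "\<pi> \<zeta> u = hscl K (of_real z) u" for u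
  proof -
    have "of_real ((hnorm (hsum n KG) (kk u))\<^sup>2) = (of_real (z * (hnorm K u)\<^sup>2) :: 'f)"
      using zin [OF u] u unfolding e by (simp add: inner_scale inner_self)
    then show ?thesis by (simp only: of_real_eq_iff)
  qed
  \<comment> \<open>|\<phi> k|^2 = <\<phi>* \<phi> k, k>, and k = \<open>kk u\<close> inherits the
    eigenvalue N^2 from \<open>f\<close>.\<close>
  have top: "(hnorm (hsum n KG) (?P \<phi> (kk u)))\<^sup>2 = N\<^sup>2 * (hnorm (hsum n KG) (kk u))\<^sup>2" if u: "u \<in> hcar K" for u
  proof -
    let ?k = "kk u"
    have Pk: "?P \<phi> ?k \<in> hcar (hsum n KG)" using m.rep_bops [OF pm] kk_car [OF u] hs.bops_car by blast
    have "?P ?Q ?k = ?P (amul (mat_alg n (DG_alg TYPE('u) G H X act)) ?Q f) (\<Delta> u)"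
      using fun_cong [OF m.rep_mul [OF Qm fm], of "\<Delta> u"] by (simp add: kk_def)
    also have "\<dots> = hscl (hsum n KG) (of_real (N\<^sup>2)) ?k"
      unfolding f(3) using fun_cong [OF m.rep_scale [OF fm, of "of_real (N\<^sup>2)"], of "\<Delta> u"]
      by (simp only: pscl_def [of "hscl (hsum n KG)"] kk_def)
    finally have Qk: "?P ?Q ?k = hscl (hsum n KG) (of_real (N\<^sup>2)) ?k" .
    have "of_real ((hnorm (hsum n KG) (?P \<phi> ?k))\<^sup>2) = hinner (hsum n KG) (?P \<phi> ?k) (?P \<phi> ?k)"
      using hs.inner_self [OF Pk] by simp
    also have "\<dots> = hinner (hsum n KG) (?P (astar (mat_alg n (DG_alg TYPE('u) G H X act)) \<phi>) (?P \<phi> ?k)) ?k"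
      using hs.adjoint_pairD(1) [OF hs.adjoint_sym [OF m.rep_star [OF pm]] Pk kk_car [OF u]] by simp
    also have "?P (astar (mat_alg n (DG_alg TYPE('u) G H X act)) \<phi>) (?P \<phi> ?k) = ?P ?Q ?k"
      using fun_cong [OF m.rep_mul [OF m.A_star [OF pm] pm], of ?k] by simp
    also have "hinner (hsum n KG) (?P ?Q ?k) ?k = of_real (N\<^sup>2 * (hnorm (hsum n KG) ?k)\<^sup>2)"
      unfolding Qk hs.inner_scale [OF kk_car [OF u] kk_car [OF u]] hs.inner_self [OF kk_car [OF u]] by simp
    finally show ?thesis by (simp only: of_real_eq_iff)
  qed
  define M where "M = opmat_norm KG n (\<lambda>i k. W (\<phi> i k) \<circ> j (xd x))"
  have Mb: "W (\<phi> i k) \<circ> j (xd x) \<in> bops KG" if "i < n" "k < n" for i k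
    using pij [OF that] x by (intro DGrep.comp_bops) simp_all
  have M0: "0 \<le> M" unfolding M_def by (rule DGrep.opmat_norm_nonneg [OF Mb])
  \<comment> \<open>\<open>j (xd x)\<close> commutes with \<open>W (f i b)\<close> and maps
    \<open>delta v'\<close> to \<open>delta (\<rho> x v')\<close>, so it moves inside
    \<open>kk\<close>.\<close>
  have jk: "j (xd x) (kk v' i) = kk (\<rho> x v') i" if i: "i < n" for i
    using fun_cong [OF j_xd_commute [OF x fb [OF i]], of "delta v'"] x v' kk_i [OF v' i] kk_i [of "\<rho> x v'" i] i
    by (simp add: j_xd_delta)
  have rk: "\<rho> x v' \<in> hcar K" using x by simp
  have "(\<Sum>i<n. (hnorm KG (\<Sum>k<n. (W (\<phi> i k) \<circ> j (xd x)) (kk v' k)))\<^sup>2) \<le> M\<^sup>2 * (\<Sum>k<n. (hnorm KG (kk v' k))\<^sup>2)"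
    unfolding M_def using DGrep.hsum_carD(1) [OF kk_car [OF v']] by (intro DGrep.opmat_norm_ub Mb)
  moreover have "(\<Sum>i<n. (hnorm KG (\<Sum>k<n. (W (\<phi> i k) \<circ> j (xd x)) (kk v' k)))\<^sup>2) = (hnorm (hsum n KG) (?P \<phi> (kk (\<rho> x v'))))\<^sup>2"
  proof -
    have "(\<Sum>k<n. W (\<phi> i k) (kk (\<rho> x v') k)) \<in> hcar KG" if "i < n" for i
      using that pij DGrep.hsum_carD(1) [OF kk_car [OF rk]] by (intro DGrep.car_sum) simp
    then show ?thesis
      unfolding DGrep.opmat_apply [OF kk_car [OF rk]] by (subst DGrep.hnorm_hsum_sq) (simp_all add: jk)
  qed
  moreover have "(\<Sum>k<n. (hnorm KG (kk v' k))\<^sup>2) = (hnorm (hsum n KG) (kk v'))\<^sup>2"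
    using DGrep.hsum_carD(1) [OF kk_car [OF v']] by (subst DGrep.hnorm_hsum_sq) simp_all
  \<comment> \<open>On the z-eigenspace \<open>kk\<close> multiplies norms by sqrt z. The factor z
    cancels and leaves N |\<rho> x v| \<le> M.\<close>
  ultimately have "N\<^sup>2 * (z * (hnorm K (\<rho> x v))\<^sup>2) \<le> M\<^sup>2 * (z * (hnorm K v')\<^sup>2)"
    using top [OF rk] kn [OF v' zv] kn [OF rk zr] by (simp add: rv)
  also have "\<dots> \<le> M\<^sup>2 * (z * 1)"
    using v'1 z_pos by (intro mult_left_mono power_le_one) auto
  finally have "(N * hnorm K (\<rho> x v))\<^sup>2 \<le> M\<^sup>2"
    using z_pos by (simp add: power_mult_distrib mult.left_commute)
  then have "N * hnorm K (\<rho> x v) \<le> M" using M0 by (rule power2_le_imp_le)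
  moreover have "c < N * hnorm K (\<rho> x v)" using v(3) N0 by (simp add: field_simps)
  ultimately show ?thesis using x nx unfolding M_def by (intro bexI [of _ x]) auto
qed

end

subsection \<open>Convolution operators on \<open>X\<^sub>G\<close>\<close>

text \<open>Lets the right and the left translation algebra be compared through \<open>D_G\<close>
  instead of directly.\<close>

lemma (in star_rep) star_iso_factor:
  assumes B: "star_iso A B \<Phi>" and C: "star_iso A C \<Psi>"
  shows "star_iso B C (\<Psi> \<circ> inv_into (acar A) \<Phi>)"
proof -
  let ?i = "inv_into (acar A) \<Phi>"
  have bij: "bij_betw \<Phi> (acar A) (acar B)" "bij_betw \<Psi> (acar A) (acar C)"
    using B C by (simp_all add: star_iso_def)
  have i: "?i (\<Phi> x) = x" if "x \<in> acar A" for x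
    using bij_betw_inv_into_left [OF bij(1) that] .
  have ex: "\<exists>x\<in>acar A. b = \<Phi> x" if "b \<in> acar B" for b
    using bij(1) that by (auto simp: bij_betw_def)
  have PB: "\<Phi> x + \<Phi> y = \<Phi> (x + y)" "ascl B c (\<Phi> x) = \<Phi> (ascl A c x)"
      "amul B (\<Phi> x) (\<Phi> y) = \<Phi> (amul A x y)" "astar B (\<Phi> x) = \<Phi> (astar A x)"
    if "x \<in> acar A" "y \<in> acar A" for x y c
    using B that by (simp_all add: star_iso_def lin_on_def)
  have PC: "\<Psi> x + \<Psi> y = \<Psi> (x + y)" "ascl C c (\<Psi> x) = \<Psi> (ascl A c x)" "\<Psi> x \<in> acar C"
      "amul C (\<Psi> x) (\<Psi> y) = \<Psi> (amul A x y)" "astar C (\<Psi> x) = \<Psi> (astar A x)"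
    if "x \<in> acar A" "y \<in> acar A" for x y c
    using C that by (simp_all add: star_iso_def lin_on_def)
  have cl: "x + y \<in> acar A" "ascl A c x \<in> acar A" "amul A x y \<in> acar A" "astar A x \<in> acar A"
    if "x \<in> acar A" "y \<in> acar A" for x y c
    using that A_mul A_star by simp_all
  show ?thesis
    unfolding star_iso_def lin_on_def
  proof (intro conjI ballI allI)
    show "bij_betw (\<Psi> \<circ> ?i) (acar B) (acar C)"
      by (rule bij_betw_trans [OF bij_betw_inv_into [OF bij(1)] bij(2)])
    fix b assume "b \<in> acar B"
    then obtain x where x: "x \<in> acar A" "b = \<Phi> x" using ex by blast
    show "(\<Psi> \<circ> ?i) b \<in> acar C" using x PC(3) by (simp add: i)
    show "(\<Psi> \<circ> ?i) (astar B b) = astar C ((\<Psi> \<circ> ?i) b)" using x PB(4) PC(5) cl by (simp add: i)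
    show "(\<Psi> \<circ> ?i) (ascl B c b) = ascl C c ((\<Psi> \<circ> ?i) b)" for c using x PB(2) PC(2) cl by (simp add: i)
    fix b' assume "b' \<in> acar B"
    then obtain y where y: "y \<in> acar A" "b' = \<Phi> y" using ex by blast
    show "(\<Psi> \<circ> ?i) (b + b') = (\<Psi> \<circ> ?i) b + (\<Psi> \<circ> ?i) b'" using x y PB(1) PC(1) cl by (simp add: i)
    show "(\<Psi> \<circ> ?i) (amul B b b') = amul C ((\<Psi> \<circ> ?i) b) ((\<Psi> \<circ> ?i) b')"
      using x y PB(3) PC(4) cl by (simp add: i)
  qed
qed

context central_setting
begin

sublocale xgo: rc_vector_space "pscl (pscl (oscl X)) :: 'f \<Rightarrow> (('g \<Rightarrow> 'x) \<Rightarrow> 'g \<Rightarrow> 'x) \<Rightarrow> ('g \<Rightarrow> 'x) \<Rightarrow> 'g \<Rightarrow> 'x"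
  unfolding rc_vector_space_def by (intro vector_space_pscl X_vs)

text \<open>\<open>t k g\<close> is \<open>k\<^sup>-\<^sup>1 g\<close> for the left and \<open>g k\<^sup>-\<^sup>1\<close> for the right convolution.\<close>

definition mop :: "('g \<Rightarrow> 'g \<Rightarrow> 'g) \<Rightarrow> ('g \<Rightarrow> 'x \<Rightarrow> 'x) \<Rightarrow> ('g \<Rightarrow> 'x) \<Rightarrow> 'g \<Rightarrow> 'x" where
  "mop t \<phi> = on_zero XG (\<lambda>x. on_zero (carrier G) (\<lambda>g. oscl X cH (\<Sum>k\<in>carrier G. \<phi> k (x (t k g)))))"

definition lsh :: "'g \<Rightarrow> 'g \<Rightarrow> 'g" where "lsh k g = inv\<^bsub>G\<^esub> k \<otimes>\<^bsub>G\<^esub> g"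
definition rsh :: "'g \<Rightarrow> 'g \<Rightarrow> 'g" where "rsh k g = g \<otimes>\<^bsub>G\<^esub> inv\<^bsub>G\<^esub> k"

text \<open>What both index shifts share: compatibility with \<open>H\<close> in either variable.
  This is where centrality of \<open>H\<close> enters the convolution operators on
  \<open>X_G\<close>.\<close>

definition shift :: "('g \<Rightarrow> 'g \<Rightarrow> 'g) \<Rightarrow> bool" where
  "shift t \<longleftrightarrow> (\<forall>k\<in>carrier G. \<forall>g\<in>carrier G. t k g \<in> carrier G \<and>
     (\<forall>h\<in>H. t k (g \<otimes>\<^bsub>G\<^esub> h) = t k g \<otimes>\<^bsub>G\<^esub> h \<and> t (k \<otimes>\<^bsub>G\<^esub> h) g = t k g \<otimes>\<^bsub>G\<^esub> inv\<^bsub>G\<^esub> h))"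

lemma shift_lsh: "shift lsh"
  unfolding shift_def lsh_def
proof (intro ballI conjI)
  fix k g h assume k: "k \<in> carrier G" and g: "g \<in> carrier G" and h: "h \<in> H"
  show "inv\<^bsub>G\<^esub> (k \<otimes>\<^bsub>G\<^esub> h) \<otimes>\<^bsub>G\<^esub> g = inv\<^bsub>G\<^esub> k \<otimes>\<^bsub>G\<^esub> g \<otimes>\<^bsub>G\<^esub> inv\<^bsub>G\<^esub> h"
    using k g h H_comm [of "inv\<^bsub>G\<^esub> h" "inv\<^bsub>G\<^esub> k \<otimes>\<^bsub>G\<^esub> g"] by (simp add: inv_mult_group m_assoc)
qed (simp_all add: m_assoc)

lemma shift_rsh: "shift rsh"
  unfolding shift_def rsh_def
proof (intro ballI conjI)
  fix k g h assume k: "k \<in> carrier G" and g: "g \<in> carrier G" and h: "h \<in> H"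
  show "g \<otimes>\<^bsub>G\<^esub> h \<otimes>\<^bsub>G\<^esub> inv\<^bsub>G\<^esub> k = g \<otimes>\<^bsub>G\<^esub> inv\<^bsub>G\<^esub> k \<otimes>\<^bsub>G\<^esub> h"
    using k g h H_comm [of h "inv\<^bsub>G\<^esub> k"] by (simp add: m_assoc)
  show "g \<otimes>\<^bsub>G\<^esub> inv\<^bsub>G\<^esub> (k \<otimes>\<^bsub>G\<^esub> h) = g \<otimes>\<^bsub>G\<^esub> inv\<^bsub>G\<^esub> k \<otimes>\<^bsub>G\<^esub> inv\<^bsub>G\<^esub> h"
    using k g h H_comm [of "inv\<^bsub>G\<^esub> h" "inv\<^bsub>G\<^esub> k"] by (simp add: inv_mult_group m_assoc)
qed simp

lemma shiftD:
  assumes "shift t" "k \<in> carrier G" "g \<in> carrier G"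
  shows "t k g \<in> carrier G" "h \<in> H \<Longrightarrow> t k (g \<otimes>\<^bsub>G\<^esub> h) = t k g \<otimes>\<^bsub>G\<^esub> h"
    "h \<in> H \<Longrightarrow> t (k \<otimes>\<^bsub>G\<^esub> h) g = t k g \<otimes>\<^bsub>G\<^esub> inv\<^bsub>G\<^esub> h"
  using assms unfolding shift_def by blast+

lemma mop_outside: "x \<notin> XG \<Longrightarrow> mop t \<phi> x = 0"
  by (simp add: mop_def on_zero_def)

lemma mop_apply: "x \<in> XG \<Longrightarrow> g \<in> carrier G \<Longrightarrow> mop t \<phi> x g = oscl X cH (\<Sum>k\<in>carrier G. \<phi> k (x (t k g)))"
  by (simp add: mop_def on_zero_def)

lemma mop_add: "mop t (\<phi> + \<psi>) = mop t \<phi> + mop t \<psi>"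
  by (auto simp: mop_def on_zero_def fun_eq_iff sum.distrib xs.scale_right_distrib)

lemma mop_scale: "mop t (pscl (pscl (oscl X)) c \<phi>) = pscl (pscl (oscl X)) c (mop t \<phi>)"
  by (auto simp: mop_def on_zero_def fun_eq_iff pscl_def xs.scale_sum_right mult.commute)

lemma mop_XG:
  assumes t: "shift t" and p: "\<phi> \<in> DG" and x: "x \<in> XG"
  shows "mop t \<phi> x \<in> XG"
proof (rule XG_I)
  have vals: "\<phi> k (x l) \<in> ocar X" for k l
    using D_ocar [OF DG_D(1) [OF p]] XG_D(1) [OF x] by blast
  show "mop t \<phi> x g \<in> ocar X" if "g \<in> carrier G" for g
    unfolding mop_apply [OF x that] by (intro ocar_simps xs.subspace_sum [OF x_subspace] vals)
  show "mop t \<phi> x g = 0" if "g \<notin> carrier G" for g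
    using that x by (simp add: mop_def on_zero_def)
  fix g h assume g: "g \<in> carrier G" and h: "h \<in> H"
  have ih: "hop (inv\<^bsub>G\<^esub> h) \<in> D" using h by simp
  have s: "(\<Sum>k\<in>carrier G. \<phi> k (x (t k g))) \<in> ocar X" by (intro xs.subspace_sum [OF x_subspace] vals)
  have "\<phi> k (x (t k (g \<otimes>\<^bsub>G\<^esub> h))) = hop (inv\<^bsub>G\<^esub> h) (\<phi> k (x (t k g)))" if k: "k \<in> carrier G" for k
  proof -
    have "x (t k (g \<otimes>\<^bsub>G\<^esub> h)) = hop (inv\<^bsub>G\<^esub> h) (x (t k g))"
      using shiftD [OF t k g] XG_D [OF x] h by (simp add: hop_apply)
    then show ?thesis using D_commute [OF DG_D(1) [OF p] ih] by simp
  qed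
  then have "mop t \<phi> x (g \<otimes>\<^bsub>G\<^esub> h) = oscl X cH (\<Sum>k\<in>carrier G. hop (inv\<^bsub>G\<^esub> h) (\<phi> k (x (t k g))))"
    using g h x by (simp add: mop_apply)
  also have "\<dots> = hop (inv\<^bsub>G\<^esub> h) (mop t \<phi> x g)"
    unfolding mop_apply [OF x g] using vals s by (simp add: D_scale [OF ih] D_sum [OF ih])
  also have "\<dots> = act (inv\<^bsub>G\<^esub> h) (mop t \<phi> x g)"
    unfolding mop_apply [OF x g] using s by (intro hop_apply) simp
  finally show "mop t \<phi> x (g \<otimes>\<^bsub>G\<^esub> h) = act (inv\<^bsub>G\<^esub> h) (mop t \<phi> x g)" .
qed

lemma rho_mop:
  assumes p: "\<phi> \<in> DG" and x: "x \<in> XG" and g: "g \<in> carrier G"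
  shows "\<rho> (mop t \<phi> x g) = pscl (hscl K) cH (\<Sum>k\<in>carrier G. \<rho> (\<phi> k (x (t k g))))"
proof -
  have vals: "\<phi> k (x l) \<in> ocar X" for k l
    using D_ocar [OF DG_D(1) [OF p]] XG_D(1) [OF x] by blast
  then show ?thesis
    unfolding mop_apply [OF x g] by (simp add: isom_scale isom_sum xs.subspace_sum [OF x_subspace])
qed

lemma j_mop_lsh:
  assumes p: "\<phi> \<in> DG" and x: "x \<in> XG"
  shows "j (mop lsh \<phi> x) = W \<phi> \<circ> j x"
proof -
  have "\<rho> (mop lsh \<phi> x g) = conv (\<lambda>g. \<pi> (\<phi> g)) (\<lambda>g. \<rho> (x g)) g" if g: "g \<in> carrier G" for g
    unfolding rho_mop [OF p x g] conv_def lsh_def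
    by (simp only: rho_D [OF DG_D(1) [OF p] XG_D(1) [OF x]])
  then have "j (mop lsh \<phi> x) = iop (conv (\<lambda>g. \<pi> (\<phi> g)) (\<lambda>g. \<rho> (x g)))"
    unfolding j_def by (rule iop_cong)
  then show ?thesis using iop_conv [OF equi_W [OF p] equi_j [OF x]] by (simp add: W_def j_def)
qed

text \<open>Elements of \<open>D\<close> act through \<pi> also from the right of \<rho> x. After
  the substitution k -> g k^-1 the sum is a convolution with \<phi> as second factor.\<close>

lemma j_mop_rsh:
  assumes p: "\<phi> \<in> DG" and x: "x \<in> XG"
  shows "j (mop rsh \<phi> x) = j x \<circ> W \<phi>"
proof -
  have "\<rho> (mop rsh \<phi> x g) = conv (\<lambda>g. \<rho> (x g)) (\<lambda>g. \<pi> (\<phi> g)) g" if g: "g \<in> carrier G" for g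
    unfolding rho_mop [OF p x g] conv_def rsh_def sum_inv_mult [OF g, of "\<lambda>k l. \<rho> (x k) \<circ> \<pi> (\<phi> l)"]
    by (simp only: rho_D' [OF DG_D(1) [OF p] XG_D(1) [OF x]])
  then have "j (mop rsh \<phi> x) = iop (conv (\<lambda>g. \<rho> (x g)) (\<lambda>g. \<pi> (\<phi> g)))"
    unfolding j_def by (rule iop_cong)
  then show ?thesis using iop_conv [OF equi_j [OF x] equi_W [OF p]] by (simp add: W_def j_def)
qed

lemma mop_dl:
  assumes t: "shift t" and k: "k \<in> carrier G"
  shows "mop t (dl k) = on_zero XG (\<lambda>x. on_zero (carrier G) (\<lambda>g. x (t k g)))"
proof (intro ext)
  fix x g
  show "mop t (dl k) x g = on_zero XG (\<lambda>x. on_zero (carrier G) (\<lambda>g. x (t k g))) x g"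
  proof (cases "x \<in> XG \<and> g \<in> carrier G")
    case True
    then have x: "x \<in> XG" and g: "g \<in> carrier G" by auto
    have "oscl X cH (\<Sum>l\<in>carrier G. dl k l (x (t l g))) = x (t k g)"
    proof (rule coset_average [OF xs.vector_space_axioms k])
      fix h assume h: "h \<in> H"
      have a: "inv\<^bsub>G\<^esub> k \<otimes>\<^bsub>G\<^esub> (k \<otimes>\<^bsub>G\<^esub> h) = h" using k h by (simp add: m_assoc [symmetric])
      show "dl k (k \<otimes>\<^bsub>G\<^esub> h) (x (t (k \<otimes>\<^bsub>G\<^esub> h) g)) = x (t k g)"
        using k h shiftD [OF t k g] XG_D [OF x] by (simp add: E_def a hop_apply)
    qed (simp add: E_def)
    then show ?thesis using x g by (simp add: mop_apply on_zero_def)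
  qed (auto simp: mop_def on_zero_def)
qed

lemma ltrans_mop: "g \<in> carrier G \<Longrightarrow> ltrans G H X act g = mop lsh (dl g)"
  by (simp add: mop_dl shift_lsh ltrans_def XG_def lsh_def)

text \<open>The inverse appears because \<open>rsh\<close> shifts by k^-1 while the right
  translation shifts by g itself.\<close>

lemma rtrans_mop: "g \<in> carrier G \<Longrightarrow> rtrans G H X act g = mop rsh (dl (inv\<^bsub>G\<^esub> g))"
  by (simp add: mop_dl shift_rsh rtrans_def XG_def rsh_def)

lemma star_dl:
  assumes k: "k \<in> carrier G"
  shows "astar (DG_alg TYPE('u) G H X act) (dl k) = dl (inv\<^bsub>G\<^esub> k)"
proof (rule ext)
  fix g
  show "astar (DG_alg TYPE('u) G H X act) (dl k) g = dl (inv\<^bsub>G\<^esub> k) g"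
  proof (cases "g \<in> carrier G")
    case g: True
    have one: "hop \<one>\<^bsub>G\<^esub> \<in> D" using H_closed(1) by simp
    have s0: "centralizer_star TYPE('u) X 0 = 0"
      using Drep.va.subspace_0 [OF Drep.A_subspace] Drep.rep_star_eqI [of 0 0] adjoint_0 unfolding D_alg_simps by simp
    have s1: "centralizer_star TYPE('u) X (hop h \<circ> hop \<one>\<^bsub>G\<^esub>) = hop (inv\<^bsub>G\<^esub> h) \<circ> hop \<one>\<^bsub>G\<^esub>" if "h \<in> H" for h
      using star_hop_comp [OF that one] star_hop [OF H_closed(1)] by simp
    let ?l = "inv\<^bsub>G\<^esub> k \<otimes>\<^bsub>G\<^esub> inv\<^bsub>G\<^esub> g"
    have l: "inv\<^bsub>G\<^esub> ?l = g \<otimes>\<^bsub>G\<^esub> k" using g k by (simp add: inv_mult_group)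
    \<comment> \<open>A product g k lying in \<open>H\<close> is central, and cancelling
      \<open>k\<close> in k (g k) = (g k) k gives g k = k g. This makes the support condition
      symmetric under inversion.\<close>
    have gk: "g \<otimes>\<^bsub>G\<^esub> k = k \<otimes>\<^bsub>G\<^esub> g" if "g \<otimes>\<^bsub>G\<^esub> k \<in> H"
    proof -
      have "k \<otimes>\<^bsub>G\<^esub> (g \<otimes>\<^bsub>G\<^esub> k) = (g \<otimes>\<^bsub>G\<^esub> k) \<otimes>\<^bsub>G\<^esub> k" using H_comm [OF that k] by simp
      then have "(k \<otimes>\<^bsub>G\<^esub> g) \<otimes>\<^bsub>G\<^esub> k = (g \<otimes>\<^bsub>G\<^esub> k) \<otimes>\<^bsub>G\<^esub> k" using g k by (simp add: m_assoc)
      then show ?thesis using g k by simp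
    qed
    have gk': "k \<otimes>\<^bsub>G\<^esub> g = g \<otimes>\<^bsub>G\<^esub> k" if "k \<otimes>\<^bsub>G\<^esub> g \<in> H"
    proof -
      have "(k \<otimes>\<^bsub>G\<^esub> g) \<otimes>\<^bsub>G\<^esub> k = k \<otimes>\<^bsub>G\<^esub> (k \<otimes>\<^bsub>G\<^esub> g)" using H_comm [OF that k] by simp
      then have "k \<otimes>\<^bsub>G\<^esub> (g \<otimes>\<^bsub>G\<^esub> k) = k \<otimes>\<^bsub>G\<^esub> (k \<otimes>\<^bsub>G\<^esub> g)" using g k by (simp add: m_assoc)
      then show ?thesis using g k by simp
    qed
    have m: "?l \<in> H \<longleftrightarrow> k \<otimes>\<^bsub>G\<^esub> g \<in> H"
    proof
      assume "?l \<in> H"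
      then have "g \<otimes>\<^bsub>G\<^esub> k \<in> H" using H_closed(2) [of ?l] l by simp
      then show "k \<otimes>\<^bsub>G\<^esub> g \<in> H" using gk by simp
    next
      assume "k \<otimes>\<^bsub>G\<^esub> g \<in> H"
      then have "inv\<^bsub>G\<^esub> (g \<otimes>\<^bsub>G\<^esub> k) \<in> H" using gk' H_closed(2) [of "k \<otimes>\<^bsub>G\<^esub> g"] by simp
      then show "?l \<in> H" using g k by (simp add: inv_mult_group)
    qed
    show ?thesis
    proof (cases "?l \<in> H")
      case True
      then have kg: "k \<otimes>\<^bsub>G\<^esub> g \<in> H" and gH: "g \<otimes>\<^bsub>G\<^esub> k \<in> H" and e: "g \<otimes>\<^bsub>G\<^esub> k = k \<otimes>\<^bsub>G\<^esub> g"
        using m gk' by auto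
      show ?thesis
        using g k True kg gH s1 [of "k \<otimes>\<^bsub>G\<^esub> g"] by (simp add: DG_alg_simps on_zero_def E_def l e)
    next
      case False
      then show ?thesis using g k m s0 by (simp add: DG_alg_simps on_zero_def E_def)
    qed
  qed (simp add: DG_alg_simps on_zero_def E_def)
qed

lemma mop_0: "mop t 0 = 0"
  by (simp add: mop_def on_zero_def fun_eq_iff)

text \<open>Treats left and right convolution at once: \<open>cmp\<close> composes with
  \<open>W \<phi>\<close> on the side that corresponds to the shift \<open>t\<close>.\<close>

context
  fixes t and cmp :: "(('g \<Rightarrow> 'u) \<Rightarrow> 'g \<Rightarrow> 'u) \<Rightarrow> (('g \<Rightarrow> 'u) \<Rightarrow> 'g \<Rightarrow> 'u) \<Rightarrow> ('g \<Rightarrow> 'u) \<Rightarrow> 'g \<Rightarrow> 'u"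
  assumes side: "t = lsh \<and> cmp = (\<circ>) \<or> t = rsh \<and> cmp = (\<lambda>S T. T \<circ> S)"
begin

lemma side_shift: "shift t"
  using side shift_lsh shift_rsh by blast

lemma j_mop: "\<phi> \<in> DG \<Longrightarrow> x \<in> XG \<Longrightarrow> j (mop t \<phi> x) = cmp (W \<phi>) (j x)"
  using side j_mop_lsh j_mop_rsh by auto

lemma cmp_bops: "S \<in> bops KG \<Longrightarrow> T \<in> bops KG \<Longrightarrow> cmp S T \<in> bops KG"
  using side DGrep.comp_bops by auto

lemma cmp_add: 
  assumes "S \<in> bops KG" "T \<in> bops KG" "T' \<in> bops KG"
  shows "cmp S (T + T') = cmp S T + cmp S T'"
proof (rule DGrep.bops_eqI)
  fix v assume "v \<in> hcar KG"
  then show "cmp S (T + T') v = (cmp S T + cmp S T') v"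
    using side assms by (auto simp: DGrep.bops_add DGrep.bops_car)
qed (use assms in \<open>simp_all add: cmp_bops DGrep.add_bops\<close>)

lemma cmp_scale: 
  assumes "S \<in> bops KG" "T \<in> bops KG"
  shows "cmp S (pscl (hscl KG) c T) = pscl (hscl KG) c (cmp S T)"
proof (rule DGrep.bops_eqI)
  fix v assume "v \<in> hcar KG"
  then show "cmp S (pscl (hscl KG) c T) v = pscl (hscl KG) c (cmp S T) v"
    using side assms by (auto simp: pscl_def [of "hscl KG"] DGrep.bops_scale DGrep.bops_car simp del: KG_scl)
qed (use assms in \<open>simp_all add: cmp_bops DGrep.scale_bops del: KG_scl\<close>)

lemma mop_lin:
  assumes p: "\<phi> \<in> DG"
  shows "lin_on (pscl (oscl X)) XG (pscl (oscl X)) XG (mop t \<phi>)"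
  unfolding lin_on_def
proof (intro conjI ballI allI)
  note M = mop_XG [OF side_shift p]
  fix x assume x: "x \<in> XG"
  show "mop t \<phi> x \<in> XG" by (rule M [OF x])
  show "mop t \<phi> (pscl (oscl X) c x) = pscl (oscl X) c (mop t \<phi> x)" for c
  proof (rule jx.isom_eqI, unfold XO_simps(1,2))
    have "j (pscl (oscl X) c x) = pscl (hscl KG) c (j x)"
      using jx.isom_scale [of x c] x by simp
    moreover have "j (pscl (oscl X) c (mop t \<phi> x)) = pscl (hscl KG) c (j (mop t \<phi> x))"
      using jx.isom_scale [of "mop t \<phi> x" c] M [OF x] by simp
    ultimately show "j (mop t \<phi> (pscl (oscl X) c x)) = j (pscl (oscl X) c (mop t \<phi> x))"
      using p x xso.subspace_scale [OF XG_subspace] cmp_scale [OF W_bops [OF p] j_bops [OF x]] by (simp add: j_mop)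
  qed (use x M xso.subspace_scale [OF XG_subspace] in simp_all)
  fix y assume y: "y \<in> XG"
  show "mop t \<phi> (x + y) = mop t \<phi> x + mop t \<phi> y"
  proof (rule jx.isom_eqI, unfold XO_simps(1,2))
    have "j (x + y) = j x + j y" "j (mop t \<phi> x + mop t \<phi> y) = j (mop t \<phi> x) + j (mop t \<phi> y)"
      using jx.isom_add x y M by simp_all
    then show "j (mop t \<phi> (x + y)) = j (mop t \<phi> x + mop t \<phi> y)"
      using p x y xso.subspace_add [OF XG_subspace] cmp_add [OF W_bops [OF p] j_bops [OF x] j_bops [OF y]] by (simp add: j_mop)
  qed (use x y M xso.subspace_add [OF XG_subspace] in simp_all)
qed

text \<open>Applying the convolution to \<open>xd y\<close> and then its image under
  \<open>j\<close> to \<open>delta v\<close> recovers every vector \<rho> (\<phi> g y) v.\<close>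

lemma mop_inj:
  assumes p: "\<phi> \<in> DG" "\<psi> \<in> DG" and eq: "mop t \<phi> = mop t \<psi>"
  shows "\<phi> = \<psi>"
proof (intro ext)
  fix g y
  show "\<phi> g y = \<psi> g y"
  proof (cases "g \<in> carrier G \<and> y \<in> ocar X")
    case True
    then have g: "g \<in> carrier G" and y: "y \<in> ocar X" by auto
    have e: "W \<phi>' \<circ> j (xd y) = j (mop t \<phi>' (xd y))" if "\<phi>' \<in> DG" for \<phi>'
      using side j_mop [OF that xd_XG [OF y]] j_xd_commute [OF y that] by auto
    have d: "\<rho> (\<phi>' g y) v = (W \<phi>' \<circ> j (xd y)) (delta v) g" if "\<phi>' \<in> DG" "v \<in> hcar K" for \<phi>' v
      using that y g W_delta [OF that(1) _ g, of "\<rho> y v"] by (simp add: j_xd_delta rho_D [OF DG_D(1) [OF that(1)] y])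
    have "\<rho> (\<phi> g y) = \<rho> (\<psi> g y)"
    proof (rule bops_eqI)
      show "\<rho> (\<phi> g y) v = \<rho> (\<psi> g y) v" if "v \<in> hcar K" for v
        unfolding d [OF p(1) that] d [OF p(2) that] e [OF p(1)] e [OF p(2)] eq ..
    qed (use y D_ocar DG_D(1) p in simp_all)
    then show ?thesis using y D_ocar DG_D(1) p by (intro isom_eqI) simp_all
  next
    case False
    have z: "\<phi>' g y = 0" if "\<phi>' \<in> DG" for \<phi>'
      using False DG_D(2) [OF that, of g] D_outside [OF DG_D(1) [OF that]] by (cases "g \<in> carrier G") auto
    show ?thesis unfolding z [OF p(1)] z [OF p(2)] ..
  qed
qed

section \<open>Operator norms and completely bounded norms of convolution operators\<close>

lemma amplify_norm:
  assumes n: "0 < n" and p: "\<forall>i<n. \<forall>k<n. \<phi> i k \<in> DG" and x: "x \<in> mats m XG"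
  shows "omnorm XO (m * n) (amplify n m (\<lambda>i k. mop t (\<phi> i k)) x) =
    opmat_norm KG (m * n) (\<lambda>p q. cmp (W (\<phi> (p mod n) (q mod n))) (j (x (p div n) (q div n))))"
  unfolding XO_simps(3)
proof (rule DGrep.opmat_norm_cong)
  fix r s assume "r < m * n" "s < m * n"
  then have "r div n < m" "s div n < m" "r mod n < n" "s mod n < n"
    using n by (auto simp: less_mult_imp_div_less)
  then show "j (amplify n m (\<lambda>i k. mop t (\<phi> i k)) x r s) = cmp (W (\<phi> (r mod n) (s mod n))) (j (x (r div n) (s div n)))"
    using \<open>r < m * n\<close> \<open>s < m * n\<close> matsD(1) [OF x] p by (simp add: amplify_def j_mop)
qed

lemma amplify_le:
  assumes n: "0 < n" and p: "\<forall>i<n. \<forall>k<n. \<phi> i k \<in> DG" and x: "x \<in> mats m XG"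
  shows "omnorm XO (m * n) (amplify n m (\<lambda>i k. mop t (\<phi> i k)) x)
    \<le> opmat_norm KG n (\<lambda>i k. W (\<phi> i k)) * omnorm XO m x"
  unfolding amplify_norm [OF n p x] unfolding XO_simps(3)
  using side DGrep.opmat_norm_tensor [of m "\<lambda>i k. j (x i k)" n "\<lambda>i k. W (\<phi> i k)"] n p matsD(1) [OF x] by auto

lemma cb_values_le:
  assumes n: "0 < n" and p: "\<forall>i<n. \<forall>k<n. \<phi> i k \<in> DG"
    and r: "r \<in> cb_values XO n (\<lambda>i k. mop t (\<phi> i k))"
  shows "r \<le> opmat_norm KG n (\<lambda>i k. W (\<phi> i k))"
proof -
  obtain m x where x: "m > 0" "x \<in> mats m XG" "omnorm XO m x \<le> 1"
      "r = omnorm XO (m * n) (amplify n m (\<lambda>i k. mop t (\<phi> i k)) x)"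
    using r unfolding cb_values_def XO_simps(1) by blast
  have "0 \<le> opmat_norm KG n (\<lambda>i k. W (\<phi> i k))" using p by (intro DGrep.opmat_norm_nonneg) simp
  then have "opmat_norm KG n (\<lambda>i k. W (\<phi> i k)) * omnorm XO m x \<le> opmat_norm KG n (\<lambda>i k. W (\<phi> i k)) * 1"
    using x(3) by (intro mult_left_mono)
  then show ?thesis using amplify_le [OF n p x(2)] unfolding x(4) by simp
qed

text \<open>Test matrices of size m = 1 suffice for the lower bound: amplification at
  \<open>mat1 (xd x)\<close> composes every entry with \<open>j (xd x)\<close>, and commutation
  makes the result independent of the side.\<close>

lemma xd_cb_value:
  assumes n: "0 < n" and p: "\<forall>i<n. \<forall>k<n. \<phi> i k \<in> DG" and x: "x \<in> ocar X" "opn K (\<rho> x) \<le> 1"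
  shows "opmat_norm KG n (\<lambda>i k. W (\<phi> i k) \<circ> j (xd x)) \<in> cb_values XO n (\<lambda>i k. mop t (\<phi> i k))"
proof -
  have m: "mat1 (xd x) \<in> mats 1 XG"
    using x xso.subspace_0 [OF XG_subspace] by (intro jx.mat1_mats) simp_all
  have le: "omnorm XO 1 (mat1 (xd x)) \<le> 1"
    using jx.isom_norm_1 [of "xd x"] opn_j_xd [OF x(1)] x by simp
  have "opmat_norm KG n (\<lambda>i k. W (\<phi> i k) \<circ> j (xd x)) = omnorm XO (1 * n) (amplify n 1 (\<lambda>i k. mop t (\<phi> i k)) (mat1 (xd x)))"
    unfolding amplify_norm [OF n p m]
  proof (simp only: mult_1, rule DGrep.opmat_norm_cong)
    fix i k assume ik: "i < n" "k < n"
    have "cmp (W (\<phi> i k)) (j (xd x)) = W (\<phi> i k) \<circ> j (xd x)"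
      using side j_xd_commute [OF x(1), of "\<phi> i k"] p ik by auto
    then show "W (\<phi> i k) \<circ> j (xd x) = cmp (W (\<phi> (i mod n) (k mod n))) (j (mat1 (xd x) (i div n) (k div n)))"
      using ik by (simp add: mat1_def)
  qed
  then show ?thesis
    unfolding cb_values_def XO_simps(1) using m le zero_less_one by blast
qed

text \<open>The upper bound is the block matrix estimate \<open>opmat_norm_tensor\<close>; a smaller
  bound would contradict \<open>test_element\<close>.\<close>

lemma cb_mnorm_mop:
  assumes n: "0 < n" and p: "\<phi> \<in> mats n DG"
  shows "cb_mnorm XO n (\<lambda>i k. mop t (\<phi> i k)) = opmat_norm KG n (\<lambda>i k. W (\<phi> i k))"
  unfolding cb_mnorm_def
proof (rule cSup_eq)
  fix r assume "r \<in> cb_values XO n (\<lambda>i k. mop t (\<phi> i k))"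
  then show "r \<le> opmat_norm KG n (\<lambda>i k. W (\<phi> i k))"
    using cb_values_le [OF n] matsD(1) [OF p] by blast
next
  fix c assume c: "\<And>r. r \<in> cb_values XO n (\<lambda>i k. mop t (\<phi> i k)) \<Longrightarrow> r \<le> c"
  have le: "opmat_norm KG n (\<lambda>i k. W (\<phi> i k) \<circ> j (xd x)) \<le> c" if "x \<in> ocar X" "opn K (\<rho> x) \<le> 1" for x
    by (rule c, rule xd_cb_value [OF n]) (use that matsD(1) [OF p] in blast)+
  \<comment> \<open>The value at x = 0 shows that \<open>c\<close> is nonnegative, as
    \<open>test_element\<close> requires.\<close>
  have "W (\<phi> i k) \<circ> j (xd 0) \<in> bops KG" if "i < n" "k < n" for i k
    using matsD(1) [OF p that] by (intro DGrep.comp_bops) simp_all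
  then have "0 \<le> opmat_norm KG n (\<lambda>i k. W (\<phi> i k) \<circ> j (xd 0))" by (rule DGrep.opmat_norm_nonneg)
  then have c0: "0 \<le> c" using le [of 0] by simp
  show "opmat_norm KG n (\<lambda>i k. W (\<phi> i k)) \<le> c"
  proof (rule ccontr)
    assume "\<not> opmat_norm KG n (\<lambda>i k. W (\<phi> i k)) \<le> c"
    then have "c < opmat_norm KG n (\<lambda>i k. W (\<phi> i k))" by simp
    then obtain x where "x \<in> ocar X" "opn K (\<rho> x) = 1" "c < opmat_norm KG n (\<lambda>i k. W (\<phi> i k) \<circ> j (xd x))"
      using test_element [OF p c0] by blast
    then show False using le [of x] by simp
  qed
qed

text \<open>The test elements at matrix level 1 already attain the completely bounded norm up to any
  margin, so the norm inherited from bounded operators on \<open>X_G\<close> is the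
  \<open>C*\<close>-norm as well.\<close>

lemma op_norm_mop:
  assumes p: "\<phi> \<in> DG"
  shows "op_norm XO (mop t \<phi>) = opn KG (W \<phi>)"
proof -
  note M = mop_XG [OF side_shift p]
  have n1: "omnorm XO 1 (mat1 x) = opn KG (j x)" if "x \<in> XG" for x
    using jx.isom_norm_1 [of x] that by simp
  have val: "omnorm XO 1 (mat1 (mop t \<phi> x)) = opn KG (cmp (W \<phi>) (j x))" if "x \<in> XG" for x
    unfolding n1 [OF M [OF that]] j_mop [OF p that] ..
  show ?thesis
    unfolding op_norm_def XO_simps(1)
  proof (rule cSup_eq)
    fix r assume "r \<in> {omnorm XO 1 (mat1 (mop t \<phi> x)) | x. x \<in> XG \<and> omnorm XO 1 (mat1 x) \<le> 1}"
    then obtain x where x: "x \<in> XG" "omnorm XO 1 (mat1 x) \<le> 1" and r: "r = omnorm XO 1 (mat1 (mop t \<phi> x))"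
      by blast
    have "r \<le> opn KG (W \<phi>) * opn KG (j x)"
      using side DGrep.opn_comp [OF W_bops [OF p] j_bops [OF x(1)]] DGrep.opn_comp [OF j_bops [OF x(1)] W_bops [OF p]]
      unfolding r val [OF x(1)] by (auto simp: mult.commute)
    also have "\<dots> \<le> opn KG (W \<phi>) * 1"
      using x n1 [OF x(1)] p by (intro mult_left_mono DGrep.opn_nonneg) simp_all
    finally show "r \<le> opn KG (W \<phi>)" by simp
  next
    fix c assume c: "\<And>r. r \<in> {omnorm XO 1 (mat1 (mop t \<phi> x)) | x. x \<in> XG \<and> omnorm XO 1 (mat1 x) \<le> 1} \<Longrightarrow> r \<le> c"
    have le: "opn KG (W \<phi> \<circ> j (xd x)) \<le> c" if x: "x \<in> ocar X" "opn K (\<rho> x) \<le> 1" for x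
    proof (rule c, rule CollectI, intro exI conjI)
      show "opn KG (W \<phi> \<circ> j (xd x)) = omnorm XO 1 (mat1 (mop t \<phi> (xd x)))"
        using side j_xd_commute [OF x(1) p] unfolding val [OF xd_XG [OF x(1)]] by auto
      show "omnorm XO 1 (mat1 (xd x)) \<le> 1"
        unfolding n1 [OF xd_XG [OF x(1)]] using opn_j_xd [OF x(1)] x(2) by simp
    qed (use x in simp)
    have b: "W \<phi> \<circ> j (xd x) \<in> bops KG" if "x \<in> ocar X" for x
      using p that by (intro DGrep.comp_bops) simp_all
    have c0: "0 \<le> c" using le [of 0] DGrep.opn_nonneg [OF b [of 0]] by simp
    have m: "mat1 \<phi> \<in> mats 1 DG" by (rule jx.mat1_mats [OF xdo.subspace_0 [OF DG_subspace] p])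
    show "opn KG (W \<phi>) \<le> c"
    proof (rule ccontr)
      assume "\<not> opn KG (W \<phi>) \<le> c"
      then have "c < opmat_norm KG 1 (\<lambda>i k. W (mat1 \<phi> i k))"
        using DGrep.opmat_norm_1 [of "\<lambda>i k. W (mat1 \<phi> i k)"] p by (simp add: mat1_def)
      then obtain x where x: "x \<in> ocar X" "opn K (\<rho> x) = 1" "c < opmat_norm KG 1 (\<lambda>i k. W (mat1 \<phi> i k) \<circ> j (xd x))"
        using test_element [OF m c0] by blast
      then have "c < opn KG (W \<phi> \<circ> j (xd x))"
        using DGrep.opmat_norm_1 [of "\<lambda>i k. W (mat1 \<phi> i k) \<circ> j (xd x)"] b [OF x(1)] by (simp add: mat1_def)
      then show False using le [OF x(1)] x(2) by simp
    qed
  qed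
qed

lemma mop_CB:
  assumes p: "\<phi> \<in> DG"
  shows "mop t \<phi> \<in> CB XO"
  unfolding CB_def XO_simps(1,2)
proof (intro CollectI conjI allI impI)
  have "mat1 (mop t \<phi>) = (\<lambda>i k. mop t (mat1 \<phi> i k))"
    using mop_0 by (auto simp: mat1_def mtrunc_def fun_eq_iff)
  then have "r \<le> opmat_norm KG 1 (\<lambda>i k. W (mat1 \<phi> i k))" if "r \<in> cb_values XO 1 (mat1 (mop t \<phi>))" for r
    using cb_values_le [of 1 "mat1 \<phi>" r] that p by (simp add: mat1_def)
  then show "bdd_above (cb_values XO 1 (mat1 (mop t \<phi>)))" by (rule bdd_aboveI)
qed (simp_all add: mop_lin p mop_outside)

end

lemma mop_lsh_mul:
  assumes p: "\<phi> \<in> DG" "\<psi> \<in> DG"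
  shows "mop lsh (amul (DG_alg TYPE('u) G H X act) \<phi> \<psi>) = mop lsh \<phi> \<circ> mop lsh \<psi>"
proof (rule ext)
  fix x
  note M = mop_XG [OF shift_lsh]
  have pq: "amul (DG_alg TYPE('u) G H X act) \<phi> \<psi> \<in> DG" by (rule DG_mul_closed [OF p])
  show "mop lsh (amul (DG_alg TYPE('u) G H X act) \<phi> \<psi>) x = (mop lsh \<phi> \<circ> mop lsh \<psi>) x"
  proof (cases "x \<in> XG")
    case x: True
    have "j (mop lsh (amul (DG_alg TYPE('u) G H X act) \<phi> \<psi>) x) = j (mop lsh \<phi> (mop lsh \<psi> x))"
      by (simp only: j_mop_lsh p pq x M W_mul o_assoc)
    then show ?thesis using j_inj M p pq x by (auto dest: inj_onD)
  next
    case False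
    have "mop lsh \<phi> 0 = 0"
      using xso.lin_on_zero [OF XG_subspace mop_lin [of lsh "(\<circ>)"] xso.vector_space_axioms] p by simp
    then show ?thesis using False by (simp add: mop_outside)
  qed
qed

lemma mop_rsh_mul:
  assumes p: "\<phi> \<in> DG" "\<psi> \<in> DG"
  shows "mop rsh (amul (DG_alg TYPE('u) G H X act) \<phi> \<psi>) = mop rsh \<psi> \<circ> mop rsh \<phi>"
proof (rule ext)
  fix x
  note M = mop_XG [OF shift_rsh]
  have pq: "amul (DG_alg TYPE('u) G H X act) \<phi> \<psi> \<in> DG" by (rule DG_mul_closed [OF p])
  show "mop rsh (amul (DG_alg TYPE('u) G H X act) \<phi> \<psi>) x = (mop rsh \<psi> \<circ> mop rsh \<phi>) x"
  proof (cases "x \<in> XG")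
    case x: True
    have "j (mop rsh (amul (DG_alg TYPE('u) G H X act) \<phi> \<psi>) x) = j (mop rsh \<psi> (mop rsh \<phi> x))"
      by (simp only: j_mop_rsh p pq x M W_mul o_assoc)
    then show ?thesis using j_inj M p pq x by (auto dest: inj_onD)
  next
    case False
    have "mop rsh \<psi> 0 = 0"
      using xso.lin_on_zero [OF XG_subspace mop_lin [of rsh "\<lambda>S T. T \<circ> S"] xso.vector_space_axioms] p by simp
    then show ?thesis using False by (simp add: mop_outside)
  qed
qed

text \<open>The operators \<open>P g\<close> are the translations, and \<open>\<tau>\<close> is the identity for the left and the
  inversion for the right translations.\<close>

lemma translation_algebra:
  assumes t: "t = lsh \<or> t = rsh"
    and mul: "\<And>\<phi> \<psi>. \<phi> \<in> DG \<Longrightarrow> \<psi> \<in> DG \<Longrightarrow>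
      mop t (amul (DG_alg TYPE('u) G H X act) \<phi> \<psi>) = ml (mop t \<phi>) (mop t \<psi>)"
    and P: "\<And>g. g \<in> carrier G \<Longrightarrow> P g = mop t (dl (\<tau> g))"
    and \<tau>: "\<And>g. g \<in> carrier G \<Longrightarrow> \<tau> g \<in> carrier G \<and> \<tau> (\<tau> g) = g \<and> \<tau> (inv\<^bsub>G\<^esub> g) = inv\<^bsub>G\<^esub> (\<tau> g)"
  shows "\<exists>s. natural_involution G X P s \<and> (\<forall>A.
    A = \<lparr>acar = trans_span G X P, ascl = pscl (pscl (oscl X)), amul = ml, astar = s\<rparr> \<longrightarrow>
    acar A \<subseteq> CB XO \<and> cstar_algebra A (op_norm XO) \<and> star_iso (DG_alg TYPE('u) G H X act) A (mop t))"
proof -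
  let ?DG = "DG_alg TYPE('u) G H X act"
  obtain cmp :: "(('g \<Rightarrow> 'u) \<Rightarrow> 'g \<Rightarrow> 'u) \<Rightarrow> (('g \<Rightarrow> 'u) \<Rightarrow> 'g \<Rightarrow> 'u) \<Rightarrow> ('g \<Rightarrow> 'u) \<Rightarrow> 'g \<Rightarrow> 'u"
    where side: "t = lsh \<and> cmp = (\<circ>) \<or> t = rsh \<and> cmp = (\<lambda>S T. T \<circ> S)"
    using t by blast
  note inj = mop_inj [of t cmp, OF side]
  have hom: "module_hom (pscl (pscl (oscl X))) (pscl (pscl (oscl X))) (mop t)"
    by (intro module_hom.intro module_hom_axioms.intro xdo.module_axioms xgo.module_axioms) (simp_all add: mop_add mop_scale)
  have "P ` carrier G = mop t ` dl ` carrier G"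
  proof (intro subset_antisym subsetI)
    show "T \<in> mop t ` dl ` carrier G" if "T \<in> P ` carrier G" for T
      using that \<tau> P by auto
    show "T \<in> P ` carrier G" if T: "T \<in> mop t ` dl ` carrier G" for T
    proof -
      obtain g where g: "g \<in> carrier G" "T = mop t (dl g)" using T by blast
      then have "T = P (\<tau> g)" using P [of "\<tau> g"] \<tau> [of g] by simp
      then show ?thesis using g \<tau> by blast
    qed
  qed
  then have span: "trans_span G X P = mop t ` DG"
    unfolding trans_span_def DG_span using module_hom.span_image [OF hom, of "dl ` carrier G"] by simp
  define i where "i = inv_into DG (mop t)"
  have i [simp]: "i (mop t \<phi>) = \<phi>" if "\<phi> \<in> DG" for \<phi>
    unfolding i_def using inj that by (intro inv_into_f_f inj_onI) auto
  \<comment> \<open>The translations may be linearly dependent. Transporting the star of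
    \<open>D_G\<close> along the injective map \<open>mop t\<close> settles
    well-definedness.\<close>
  define s where "s T = mop t (astar ?DG (i T))" for T
  note st = DG_star_closed and sta = DGrep.rep_star [unfolded DG_alg_simps(1)]
  have star_add: "astar ?DG (\<phi> + \<psi>) = astar ?DG \<phi> + astar ?DG \<psi>" if "\<phi> \<in> DG" "\<psi> \<in> DG" for \<phi> \<psi>
    using cstar_algebra.star_add [OF DGrep.cstar_algebra_of_rep [OF refl], of \<phi> \<psi>] that unfolding DG_alg_simps(1,2) by simp
  have star_scale: "astar ?DG (pscl (pscl (oscl X)) c \<phi>) = pscl (pscl (oscl X)) (fconj c) (astar ?DG \<phi>)" if "\<phi> \<in> DG" for c \<phi>
    using cstar_algebra.star_scale [OF DGrep.cstar_algebra_of_rep [OF refl], of \<phi> c] that unfolding DG_alg_simps(1,2) by simp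
  have cl: "\<phi> + \<psi> \<in> DG" "pscl (pscl (oscl X)) c \<phi> \<in> DG" "amul ?DG \<phi> \<psi> \<in> DG" if "\<phi> \<in> DG" "\<psi> \<in> DG" for c \<phi> \<psi>
    using that xdo.subspace_add [OF DG_subspace] xdo.subspace_scale [OF DG_subspace] DG_mul_closed by blast+
  have "natural_involution G X P s"
    unfolding natural_involution_def span ball_simps(9)
  proof (intro conjI ballI allI)
    fix \<phi> assume p: "\<phi> \<in> DG"
    show "s (pscl (pscl (oscl X)) c (mop t \<phi>)) = pscl (pscl (oscl X)) (fconj c) (s (mop t \<phi>))" for c
      using p cl by (simp add: s_def mop_scale [symmetric] star_scale)
    fix \<psi> assume q: "\<psi> \<in> DG"
    show "s (mop t \<phi> + mop t \<psi>) = s (mop t \<phi>) + s (mop t \<psi>)"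
      using p q cl by (simp add: s_def mop_add [symmetric] star_add)
  next
    fix g assume g: "g \<in> carrier G"
    have "hop \<one>\<^bsub>G\<^esub> \<in> D" using H_closed(1) by simp
    then show "s (P g) = P (inv\<^bsub>G\<^esub> g)"
      using g \<tau> [OF g] by (simp add: P s_def star_dl)
  qed
  moreover have "acar A \<subseteq> CB XO \<and> cstar_algebra A (op_norm XO) \<and> star_iso ?DG A (mop t)"
    if A: "A = \<lparr>acar = trans_span G X P, ascl = pscl (pscl (oscl X)), amul = ml, astar = s\<rparr>" for A
  proof (intro conjI)
    have As: "acar A = mop t ` DG" "ascl A = pscl (pscl (oscl X))" "amul A = ml" "astar A = s"
      by (simp_all add: A span)
    show "acar A \<subseteq> CB XO" unfolding As(1) using mop_CB [OF side] by blast
    \<comment> \<open>\<open>X_G\<close> is not a Hilbert space, so the translation algebra is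
      represented on \<open>KG\<close> instead, through the inverse of \<open>mop t\<close>.\<close>
    interpret a: star_rep KG A "W \<circ> i"
    proof (rule star_rep.intro [OF prehilbert_KG], rule star_rep_axioms.intro, unfold As)
      show "vector_space (pscl (pscl (oscl X)) :: 'f \<Rightarrow> (('g \<Rightarrow> 'x) \<Rightarrow> 'g \<Rightarrow> 'x) \<Rightarrow> ('g \<Rightarrow> 'x) \<Rightarrow> 'g \<Rightarrow> 'x)"
        by (rule xgo.vector_space_axioms)
      show "xgo.subspace (mop t ` DG)" by (rule module_hom.subspace_image [OF hom DG_subspace])
      show "\<exists>S. finite S \<and> mop t ` DG \<subseteq> xgo.span S"
        using finite_G span unfolding trans_span_def by (intro exI [of _ "P ` carrier G"]) simp
      have "(W \<circ> i) (mop t \<phi> + mop t \<psi>) = (W \<circ> i) (mop t \<phi>) + (W \<circ> i) (mop t \<psi>)" if "\<phi> \<in> DG" "\<psi> \<in> DG" for \<phi> \<psi>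
        using that cl by (simp add: mop_add [symmetric] W_add)
      moreover have "(W \<circ> i) (pscl (pscl (oscl X)) c (mop t \<phi>)) = pscl (pscl (hscl K)) c ((W \<circ> i) (mop t \<phi>))" if "\<phi> \<in> DG" for c \<phi>
        using that cl by (simp add: mop_scale [symmetric] W_scale)
      ultimately show "lin_on (pscl (pscl (oscl X))) (mop t ` DG) (pscl (hscl KG)) (bops KG) (W \<circ> i)"
        unfolding lin_on_def ball_simps(9) by (simp add: W_bops)
      fix S assume "S \<in> mop t ` DG"
      then obtain \<phi> where p: "\<phi> \<in> DG" "S = mop t \<phi>" by blast
      show "s S \<in> mop t ` DG" using p st by (simp add: s_def)
      show "S = 0" if "(W \<circ> i) S = 0"
        using DGrep.rep_inj [of \<phi>] that p mop_0 by (simp add: DG_alg_simps)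
      show "adjoint_pair KG ((W \<circ> i) S) ((W \<circ> i) (s S))" using p st sta by (simp add: s_def)
      fix T assume "T \<in> mop t ` DG"
      then obtain \<psi> where q: "\<psi> \<in> DG" "T = mop t \<psi>" by blast
      show "ml S T \<in> mop t ` DG" unfolding p(2) q(2) mul [OF p(1) q(1), symmetric] using cl(3) p q by blast
      show "(W \<circ> i) (ml S T) = (W \<circ> i) S \<circ> (W \<circ> i) T"
        unfolding p(2) q(2) mul [OF p(1) q(1), symmetric] using cl(3) p q by (simp add: W_mul)
    qed
    show "cstar_algebra A (op_norm XO)"
      by (rule a.cstar_algebra_of_rep) (auto simp: As(1) op_norm_mop [OF side])
    show "star_iso ?DG A (mop t)"
      unfolding star_iso_def As DG_alg_simps(1,2) lin_on_def bij_betw_def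
      using inj mul st by (auto simp: mop_add mop_scale s_def intro: inj_onI)
  qed
  ultimately show ?thesis by blast
qed

end

text \<open>Passing to coset matrices turns the given norm of \<open>D_G\<close> into a matrix norm
  over \<open>D\<close>. The complete isometry of the representation of \<open>D\<close> identifies
  it with the canonical \<open>C*\<close>-matrix norm, which \<pi> computes too; the same passage
  backwards ends at \<open>W\<close>.\<close>

lemma (in central_setting) DG_norm_eq:
  fixes KD :: "('f, 'd::ab_group_add) hilb"
  assumes rep: "central_rep G H (D_opspace TYPE('u) H X act) (D_act X act) KD \<theta>D \<rho>D"
    and n: "0 < n" and p: "\<phi> \<in> mats n DG"
  shows "omnorm (ind_opspace G H (D_opspace TYPE('u) H X act) (D_act X act) KD \<theta>D \<rho>D) n \<phi> =
    opmat_norm KG n (\<lambda>i k. W (\<phi> i k))"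
proof -
  let ?X = "D_opspace TYPE('u) H X act"
  interpret d: unitary_setting KD G H \<theta>D
    using rep hilbert_space_prehilbert G_group G_finite H_central
    by (intro unitary_setting.intro unitary_setting_axioms.intro) (auto simp: central_rep_def)
  have X: "ocar ?X = D" "omnorm ?X = cstar_mnorm (D_alg TYPE('u) H X act)"
    by (simp_all add: D_opspace_def D_alg_simps)
  have isom: "complete_isometry ?X KD \<rho>D" using rep by (simp add: central_rep_def)
  have rb: "\<rho>D d \<in> bops KD" if "d \<in> D" for d
    using isom that unfolding complete_isometry_def lin_on_def X by blast
  have act: "\<rho>D (D_act X act h d) v = \<theta>D h (\<rho>D d v)" "\<rho>D (D_act X act h d) v = \<rho>D d (\<theta>D h v)"
    if "h \<in> H" "d \<in> D" for h d v
  proof -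
    have *: "\<rho>D (D_act X act h d) = \<theta>D h \<circ> \<rho>D d \<and> \<rho>D (D_act X act h d) = \<rho>D d \<circ> \<theta>D h"
      using rep that unfolding central_rep_def X by blast
    show "\<rho>D (D_act X act h d) v = \<theta>D h (\<rho>D d v)" using fun_cong [OF conjunct1 [OF *], of v] by simp
    show "\<rho>D (D_act X act h d) v = \<rho>D d (\<theta>D h v)" using fun_cong [OF conjunct2 [OF *], of v] by simp
  qed
  note pij = matsD(1) [OF p]
  have equi: "d.equi (\<lambda>g. \<rho>D (\<phi> i k g))" if "i < n" "k < n" for i k
    unfolding d.equi_def
  proof (intro ballI conjI allI)
    fix g h v assume g: "g \<in> carrier G"
    have D: "\<phi> i k g \<in> D" using DG_D(1) [OF pij [OF that]] .
    show "\<rho>D (\<phi> i k g) \<in> bops KD" by (rule rb [OF D])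
    assume h: "h \<in> H"
    have "\<phi> i k (g \<otimes>\<^bsub>G\<^esub> h) = D_act X act (inv\<^bsub>G\<^esub> h) (\<phi> i k g)"
      using DG_D(3) [OF pij [OF that] g h] by (simp add: D_act_eq fun_eq_iff)
    then show "\<rho>D (\<phi> i k (g \<otimes>\<^bsub>G\<^esub> h)) v = \<theta>D (inv\<^bsub>G\<^esub> h) (\<rho>D (\<phi> i k g) v)"
      using act(1) [OF _ D] h by simp
    show "\<theta>D h (\<rho>D (\<phi> i k g) v) = \<rho>D (\<phi> i k g) (\<theta>D h v)"
      using act [OF h D] by simp
  qed
  obtain q r where t: "transversal q r" using transversal_exists by blast
  \<comment> \<open>The norms of matrices over \<open>D\<close> are specified for positive size, so
    the number of cosets has to be positive.\<close>
  have q: "q > 0"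
  proof (rule ccontr)
    assume "\<not> q > 0"
    then have "carrier G = {}" using t unfolding transversal_def bij_betw_def by simp
    then show False using one_closed by blast
  qed
  \<comment> \<open>\<open>coset_mat\<close> is defined at all indices, whereas a matrix over
    \<open>D\<close> must be 0 outside its range.\<close>
  let ?M = "mtrunc (n * q) (coset_mat q r \<phi>)"
  have M: "?M \<in> mats (n * q) D"
  proof (rule mtrunc_mats)
    fix a b assume "a < n * q" "b < n * q"
    then have "a div q < n" "b div q < n" by (simp_all add: less_mult_imp_div_less)
    then show "coset_mat q r \<phi> a b \<in> D" unfolding coset_mat_def by (intro DG_D(1) [OF pij])
  qed
  have nq: "0 < n * q" using n q by simp
  have "omnorm (ind_opspace G H ?X (D_act X act) KD \<theta>D \<rho>D) n \<phi> = opmat_norm d.KG n (\<lambda>i k. d.iop (\<lambda>g. \<rho>D (\<phi> i k g)))"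
    by (simp add: ind_opspace_def d.KG_def d.iop_def)
  also have "\<dots> = opmat_norm KD (n * q) (coset_mat q r (\<lambda>i k g. \<rho>D (\<phi> i k g)))"
    by (rule d.opmat_norm_coset_mat [OF t equi])
  also have "\<dots> = opmat_norm KD (n * q) (\<lambda>a b. \<rho>D (?M a b))"
    by (rule d.opmat_norm_cong) (simp add: coset_mat_def)
  also have "\<dots> = cstar_mnorm (D_alg TYPE('u) H X act) (n * q) ?M"
    using isom nq M unfolding complete_isometry_def X by blast
  also have "\<dots> = opmat_norm K (n * q) (\<lambda>a b. \<pi> (?M a b))"
    using M unfolding D_alg_simps(1) [symmetric] by (rule Drep.cstar_mnorm_eq)
  also have "\<dots> = opmat_norm K (n * q) (coset_mat q r (\<lambda>i k g. \<pi> (\<phi> i k g)))"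
    by (rule opmat_norm_cong) (simp add: coset_mat_def)
  also have "\<dots> = opmat_norm KG n (\<lambda>i k. W (\<phi> i k))"
    unfolding W_def by (rule opmat_norm_coset_mat [OF t equi_W [OF pij], symmetric])
  finally show ?thesis .
qed

theorem theorem6p2:
  fixes G :: "('g, 'z) monoid_scheme" and H :: "'g set"
    and X :: "('f::rc_field, 'x::ab_group_add) opspace" and act :: "'g \<Rightarrow> 'x \<Rightarrow> 'x"
    and K :: "('f, 'u::ab_group_add) hilb" and \<theta> :: "'g \<Rightarrow> 'u \<Rightarrow> 'u" and \<rho> :: "'x \<Rightarrow> 'u \<Rightarrow> 'u"
    and K\<^sub>D :: "('f, 'd::ab_group_add) hilb" and \<theta>\<^sub>D :: "'g \<Rightarrow> 'd \<Rightarrow> 'd"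
    and \<rho>\<^sub>D :: "('x \<Rightarrow> 'x) \<Rightarrow> 'd \<Rightarrow> 'd"
  assumes "group G" and "finite (carrier G)" and "central_subgroup H G"
    and "vector_space (oscl X)" and "module.subspace (oscl X) (ocar X)"
    and "modular_action G H X act"
    and "central_rep G H X act K \<theta> \<rho>"
    and "faithful_action G H X act"
    and "central_rep G H (D_opspace TYPE('u) H X act) (D_act X act) K\<^sub>D \<theta>\<^sub>D \<rho>\<^sub>D"
  defines "XG \<equiv> ind_opspace G H X act K \<theta> \<rho>"
    and "DG \<equiv> DG_alg TYPE('u) G H X act"
    and "DG_norm \<equiv> omnorm (ind_opspace G H (D_opspace TYPE('u) H X act) (D_act X act) K\<^sub>D \<theta>\<^sub>D \<rho>\<^sub>D)"
  shows "\<exists>sl sr.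
    natural_involution G X (ltrans G H X act) sl \<and>
    natural_involution G X (rtrans G H X act) sr \<and>
    (let Gl = Gl_alg G H X act sl; Gr = Gr_alg G H X act sr in
      acar Gl \<subseteq> CB XG \<and> acar Gr \<subseteq> CB XG \<and>
      cstar_algebra Gl (op_norm XG) \<and>
      (\<exists>\<Phi>. star_iso DG Gl \<Phi> \<and> completely_isometric (acar DG) DG_norm (cb_mnorm XG) \<Phi>) \<and>
      cstar_algebra Gr (op_norm XG) \<and>
      (\<exists>\<Phi>. star_iso DG Gr \<Phi>) \<and>
      (\<exists>\<Phi>. star_iso Gr Gl \<Phi> \<and>
            completely_isometric (acar Gr) (cb_mnorm XG) (cb_mnorm XG) \<Phi>))"
proof -
  interpret s: central_setting G H X act K \<theta> \<rho>
    using assms(1-7) by (rule central_setting.intro)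
  let ?L = "s.mop s.lsh" and ?R = "s.mop s.rsh"
  obtain sl where sl: "natural_involution G X (ltrans G H X act) sl"
    and Gl: "acar (Gl_alg G H X act sl) \<subseteq> CB XG" "cstar_algebra (Gl_alg G H X act sl) (op_norm XG)"
      "star_iso DG (Gl_alg G H X act sl) ?L"
    using s.translation_algebra [of s.lsh "(\<circ>)" "ltrans G H X act" "\<lambda>g. g"] s.mop_lsh_mul s.ltrans_mop
    unfolding XG_def DG_def Gl_alg_def by auto
  obtain sr where sr: "natural_involution G X (rtrans G H X act) sr"
    and Gr: "acar (Gr_alg G H X act sr) \<subseteq> CB XG" "cstar_algebra (Gr_alg G H X act sr) (op_norm XG)"
      "star_iso DG (Gr_alg G H X act sr) ?R"
    using s.translation_algebra [of s.rsh "\<lambda>S T. T \<circ> S" "rtrans G H X act" "\<lambda>g. inv\<^bsub>G\<^esub> g"] s.mop_rsh_mul s.rtrans_mop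
    unfolding XG_def DG_def Gr_alg_def by auto
  have acar: "acar DG = s.DG" by (simp add: DG_def s.DG_alg_simps)
  have L: "cb_mnorm XG n (\<lambda>i k. ?L (\<phi> i k)) = opmat_norm s.KG n (\<lambda>i k. s.W (\<phi> i k))"
    and R: "cb_mnorm XG n (\<lambda>i k. ?R (\<phi> i k)) = opmat_norm s.KG n (\<lambda>i k. s.W (\<phi> i k))"
    if "0 < n" "\<phi> \<in> mats n s.DG" for n \<phi>
    using that s.cb_mnorm_mop [of s.lsh "(\<circ>)"] s.cb_mnorm_mop [of s.rsh "\<lambda>S T. T \<circ> S"] by (simp_all add: XG_def)
  have "completely_isometric (acar DG) DG_norm (cb_mnorm XG) ?L"
    unfolding completely_isometric_def acar DG_norm_def using L s.DG_norm_eq [OF assms(9)] by simp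
  moreover have "star_iso (Gr_alg G H X act sr) (Gl_alg G H X act sl) (?L \<circ> inv_into (acar DG) ?R)"
    using s.DGrep.star_iso_factor Gl(3) Gr(3) unfolding DG_def by blast
  moreover have "completely_isometric (acar (Gr_alg G H X act sr)) (cb_mnorm XG) (cb_mnorm XG) (?L \<circ> inv_into (acar DG) ?R)"
    unfolding completely_isometric_def
  proof (intro allI impI ballI)
    \<comment> \<open>Pulled back entrywise to a matrix over \<open>D_G\<close>, both sides become
      the norm of the matrix of operators \<open>W\<close>.\<close>
    fix n A assume n: "0 < n" and A: "A \<in> mats n (acar (Gr_alg G H X act sr))"
    let ?\<phi> = "\<lambda>i k. inv_into (acar DG) ?R (A i k)"
    have bij: "bij_betw ?R s.DG (acar (Gr_alg G H X act sr))"
      using Gr(3) by (simp add: star_iso_def acar)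
    have Z: "0 \<in> s.DG" by (rule s.xdo.subspace_0 [OF s.DG_subspace])
    \<comment> \<open>The entries of \<open>A\<close> outside the index range are 0 and have to be
      pulled back to 0.\<close>
    have i0: "inv_into s.DG ?R 0 = 0"
      using bij_betw_inv_into_left [OF bij Z] by (simp add: s.mop_0)
    have phi: "?\<phi> \<in> mats n s.DG"
    proof (rule matsI)
      show "?\<phi> i k \<in> s.DG" if "i < n" "k < n" for i k
        using bij_betw_apply [OF bij_betw_inv_into [OF bij] matsD(1) [OF A that]] by (simp add: acar)
      show "?\<phi> i k = 0" if "\<not> (i < n \<and> k < n)" for i k
        using matsD(2) [OF A that] by (simp add: acar i0)
    qed
    have "?R (?\<phi> i k) = A i k" for i k
    proof (cases "i < n \<and> k < n")
      case True
      then show ?thesis using bij_betw_inv_into_right [OF bij matsD(1) [OF A]] by (simp add: acar)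
    next
      case False
      then show ?thesis using matsD(2) [OF A False] by (simp add: acar i0 s.mop_0)
    qed
    then have "cb_mnorm XG n A = opmat_norm s.KG n (\<lambda>i k. s.W (?\<phi> i k))"
      using R [OF n phi] by simp
    then show "cb_mnorm XG n (\<lambda>i k. (?L \<circ> inv_into (acar DG) ?R) (A i k)) = cb_mnorm XG n A"
      using L [OF n phi] by simp
  qed
  ultimately show ?thesis
    using sl sr Gl Gr unfolding Let_def by blast
qed

end
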